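(* Let $M\in D^T_{v=0}$ be a regular holonomic $D_{R|k}$-module with variation zero and let $\mathcal M^\bullet$ be the complex of $k$-vector spaces associated to its $n$-hypercube. Then there is an isomorphism of complexes $$\mathcal M^\bullet\cong[\check C_{\mathfrak m}(M)]^\bullet_{\mathbf 1}.$$ In particular, $[H^p_{\mathfrak m}(M)]_{\mathbf 1}\cong H_p(\mathcal M^\bullet)$ for all $p$.
   Context: Let $k$ be a field, $R=k[x_1,\dots,x_n]$, $\mathfrak m=(x_1,\dots,x_n)$, and $D_{R|k}$ the ring of $k$-linear differential operators of $R$. Let $\varepsilon_1,\dots,\varepsilon_n$ be the natural basis of $\mathbb Z^n$ and $\mathbf 1=(1,\dots,1)$. For $\alpha\in\{0,1\}^n$ put $|\alpha|=\sum\alpha_i$, $\mathbf x^\alpha=\prod x_i^{\alpha_i}$, $\mathfrak p_\alpha=\langle x_i\mid\alpha_i\neq0\rangle$. Modules with variation zero: $D^T_{v=0}$ (with $T=\{x_1\cdots x_n=0\}$) is the category of regular holonomic $D_{R|k}$-modules $M$ having an increasing filtration $0=F_{-1}\subseteq F_0\subseteq\cdots\subseteq F_n=M$ by submodules with $F_j/F_{j-1}\cong\bigoplus_{|\alpha|=j}(H^{|\alpha|}_{\mathfrak p_\alpha}(R))^{m_\alpha}$ for integers $m_\alpha\ge0$. These modules are $\mathbb Z^n$-graded (they are the straight modules shifted by $\mathbf 1$). In positive characteristic, modules with variation zero are defined by the existence of such a filtration. Hypercube: let $E_\alpha={}^*E_R(R/\mathfrak p_\alpha)(\mathbf 1)\cong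 R[1/\mathbf x^{\mathbf 1}]/\sum_{\alpha_i=1}R[1/\mathbf x^{\mathbf 1-\varepsilon_i}]$ (shifted $\mathbb Z^n$-graded injective hull), with natural epimorphisms $E_\alpha\to E_{\alpha+\varepsilon_i}$ when $\alpha_i=0$. The $n$-hypercube of $M$ consists of the $k$-vector spaces $[M]_\alpha:=\mathrm{Hom}_{D_{R|k}}(M,E_\alpha)$, $\alpha\in\{0,1\}^n$, and the canonical maps $u_{\alpha,i}:[M]_\alpha\to[M]_{\alpha+\varepsilon_i}$ (for $\alpha_i=0$) induced by $E_\alpha\to E_{\alpha+\varepsilon_i}$. (In positive characteristic one uses degree-preserving $R$-linear maps $M\to E_\alpha$ instead.) Equivalently, $[M]_\alpha\cong(M_{-\alpha})^*$, the $k$-dual of the degree $-\alpha$ part of $M$, with $u_{\alpha,i}$ dual to multiplication by $x_i$, $M_{-\alpha-\varepsilon_i}\to M_{-\alpha}$. The functor $[\,\cdot\,]_\alpha$ is contravariant and exact. For $\alpha_i\neq 0$, $\mathrm{sign}(i,\alpha)=(-1)^{r-1}$ if $\alpha_i$ is the $r$-th component of $\alpha$ different from zero. The complex $\mathcal M^\bullet$ is $$0\leftarrow[M]_{\mathbf 1}\leftarrow\bigoplus_{|\alpha|=n-1}[M]_\alpha\leftarrow\cdots\leftarrow\bigoplus_{|\alpha|=n-p}[M]_\alpha\leftarrow\cdots\leftarrow[M]_{\mathbf 0}\leftarrow0,$$ with $\bigoplus_{|\alpha|=n-p}[M]_\alpha$ in homological degree $p$, the map $[M]_\alpha\to[M]_{\alpha+\varepsilon_i}$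 being $\mathrm{sign}(i,\alpha+\varepsilon_i)\,u_{\alpha,i}$. The complex $[\check C_{\mathfrak m}(M)]^\bullet_{\mathbf 1}$ is obtained by applying $[\,\cdot\,]_{\mathbf 1}$ to the Čech complex $0\to M\to\bigoplus_{|\alpha|=1}M_{\mathbf x^\alpha}\to\cdots\to\bigoplus_{|\alpha|=p}M_{\mathbf x^\alpha}\to\cdots\to M_{\mathbf x^{\mathbf 1}}\to0$, where $M_{\mathbf x^\alpha}\to M_{\mathbf x^{\alpha+\varepsilon_i}}$ is $\mathrm{sign}(i,\alpha+\varepsilon_i)$ times the localization map; $\bigoplus_{|\alpha|=p}[M_{\mathbf x^\alpha}]_{\mathbf 1}$ is placed in homological degree $p$. *)

theory Defs
  imports
    "HOL-Algebra.Algebraic_Closure_Type"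
    "HOL-Library.Poly_Mapping"
    "HOL-Library.FuncSet"
    "HOL-Library.Cardinality"
begin

section \<open>Left modules over a not necessarily commutative ring\<close>

text \<open>
  The library locale \<^locale>\<open>module\<close> requires a commutative ring of scalars, which rules out rings
  of differential operators. Only the record is reused; its fields \<open>mult\<close> and \<open>one\<close> play no role
  for modules and are left unspecified.
\<close>

locale left_module = R?: ring R + M?: abelian_group M
  for R :: "('a, 'c) ring_scheme" and M :: "('a, 'b) module" (structure) +
  assumes smult_closed:
      "\<lbrakk>a \<in> carrier R; x \<in> carrier M\<rbrakk> \<Longrightarrow> a \<odot>\<^bsub>M\<^esub> x \<in> carrier M"
    and smult_l_distr:
      "\<lbrakk>a \<in> carrier R; b \<in> carrier R; x \<in> carrier M\<rbrakk> \<Longrightarrow>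
         (a \<oplus>\<^bsub>R\<^esub> b) \<odot>\<^bsub>M\<^esub> x = a \<odot>\<^bsub>M\<^esub> x \<oplus>\<^bsub>M\<^esub> b \<odot>\<^bsub>M\<^esub> x"
    and smult_r_distr:
      "\<lbrakk>a \<in> carrier R; x \<in> carrier M; y \<in> carrier M\<rbrakk> \<Longrightarrow>
         a \<odot>\<^bsub>M\<^esub> (x \<oplus>\<^bsub>M\<^esub> y) = a \<odot>\<^bsub>M\<^esub> x \<oplus>\<^bsub>M\<^esub> a \<odot>\<^bsub>M\<^esub> y"
    and smult_assoc:
      "\<lbrakk>a \<in> carrier R; b \<in> carrier R; x \<in> carrier M\<rbrakk> \<Longrightarrow>
         (a \<otimes>\<^bsub>R\<^esub> b) \<odot>\<^bsub>M\<^esub> x = a \<odot>\<^bsub>M\<^esub> (b \<odot>\<^bsub>M\<^esub> x)"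
    and smult_one:
      "x \<in> carrier M \<Longrightarrow> \<one>\<^bsub>R\<^esub> \<odot>\<^bsub>M\<^esub> x = x"

definition mk_module ::
    "'b set \<Rightarrow> 'b \<Rightarrow> ('b \<Rightarrow> 'b \<Rightarrow> 'b) \<Rightarrow> ('a \<Rightarrow> 'b \<Rightarrow> 'b) \<Rightarrow> ('a, 'b) module" where
  "mk_module C z pl sm =
     \<lparr>carrier = C, monoid.mult = undefined, one = undefined, ring.zero = z, add = pl, module.smult = sm\<rparr>"

definition mod_hom ::
    "('a, 'c) ring_scheme \<Rightarrow> ('a, 'b) module \<Rightarrow> ('a, 'e) module \<Rightarrow> ('b \<Rightarrow> 'e) set" where
  "mod_hom A M N = {f \<in> carrier M \<rightarrow> carrier N.
     (\<forall>x\<in>carrier M. \<forall>y\<in>carrier M. f (x \<oplus>\<^bsub>M\<^esub> y) = f x \<oplus>\<^bsub>N\<^esub> f y) \<and>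
     (\<forall>a\<in>carrier A. \<forall>x\<in>carrier M. f (a \<odot>\<^bsub>M\<^esub> x) = a \<odot>\<^bsub>N\<^esub> f x)}"

definition mod_iso ::
    "('a, 'c) ring_scheme \<Rightarrow> ('a, 'b) module \<Rightarrow> ('a, 'e) module \<Rightarrow> ('b \<Rightarrow> 'e) set" where
  "mod_iso A M N = {f \<in> mod_hom A M N. bij_betw f (carrier M) (carrier N)}"

definition isomorphic_mod ::
    "('a, 'c) ring_scheme \<Rightarrow> ('a, 'b) module \<Rightarrow> ('a, 'e) module \<Rightarrow> bool" where
  "isomorphic_mod A M N \<longleftrightarrow> mod_iso A M N \<noteq> {}"

definition quot_mod :: "('a, 'b) module \<Rightarrow> 'b set \<Rightarrow> ('a, 'b set) module" where
  "quot_mod M N = mk_module (a_rcosets\<^bsub>M\<^esub> N) N (set_add M)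
     (\<lambda>a C. \<Union>x\<in>C. N +>\<^bsub>M\<^esub> (a \<odot>\<^bsub>M\<^esub> x))"

text \<open>Used for finite index sets only, where it is the direct sum.\<close>

definition dsum :: "'i set \<Rightarrow> ('i \<Rightarrow> ('a, 'b) module) \<Rightarrow> ('a, 'i \<Rightarrow> 'b) module" where
  "dsum I M = mk_module (\<Pi>\<^sub>E i\<in>I. carrier (M i)) (\<lambda>i\<in>I. \<zero>\<^bsub>M i\<^esub>)
     (\<lambda>f g. \<lambda>i\<in>I. f i \<oplus>\<^bsub>M i\<^esub> g i) (\<lambda>a f. \<lambda>i\<in>I. a \<odot>\<^bsub>M i\<^esub> f i)"

definition restrict_scalars :: "('c \<Rightarrow> 'a) \<Rightarrow> ('a, 'b) module \<Rightarrow> ('c, 'b) module" where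
  "restrict_scalars h M = mk_module (carrier M) \<zero>\<^bsub>M\<^esub> (add M) (\<lambda>c x. h c \<odot>\<^bsub>M\<^esub> x)"


section \<open>Complexes\<close>

text \<open>
  Homological convention: \<open>d p\<close> maps degree \<open>p + 1\<close> to degree \<open>p\<close>.
  In the cochain version used for cohomology, \<open>d p\<close> maps degree \<open>p\<close> to degree \<open>p + 1\<close>.
  Both kinds of complexes vanish in negative degrees.
\<close>

definition chain_complex ::
    "('a, 'c) ring_scheme \<Rightarrow> (nat \<Rightarrow> ('a, 'b) module) \<Rightarrow> (nat \<Rightarrow> 'b \<Rightarrow> 'b) \<Rightarrow> bool" where
  "chain_complex A V d \<longleftrightarrow>
     (\<forall>p. left_module A (V p) \<and> d p \<in> mod_hom A (V (Suc p)) (V p) \<and>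
        (\<forall>x\<in>carrier (V (Suc (Suc p))). d p (d (Suc p) x) = \<zero>\<^bsub>V p\<^esub>))"

definition isomorphic_complexes ::
    "('a, 'c) ring_scheme \<Rightarrow> (nat \<Rightarrow> ('a, 'b) module) \<Rightarrow> (nat \<Rightarrow> 'b \<Rightarrow> 'b) \<Rightarrow>
     (nat \<Rightarrow> ('a, 'e) module) \<Rightarrow> (nat \<Rightarrow> 'e \<Rightarrow> 'e) \<Rightarrow> bool" where
  "isomorphic_complexes A V d W e \<longleftrightarrow>
     chain_complex A V d \<and> chain_complex A W e \<and>
     (\<exists>\<phi>. \<forall>p. \<phi> p \<in> mod_iso A (V p) (W p) \<and>
        (\<forall>x\<in>carrier (V (Suc p)). \<phi> p (d p x) = e p (\<phi> (Suc p) x)))"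

definition homology_mod ::
    "(nat \<Rightarrow> ('a, 'b) module) \<Rightarrow> (nat \<Rightarrow> 'b \<Rightarrow> 'b) \<Rightarrow> nat \<Rightarrow> ('a, 'b set) module" where
  "homology_mod V d p = quot_mod
     ((V p)\<lparr>carrier := (case p of 0 \<Rightarrow> carrier (V 0) | Suc q \<Rightarrow> a_kernel (V p) (V q) (d q))\<rparr>)
     (d p ` carrier (V (Suc p)))"

definition cohomology_mod ::
    "(nat \<Rightarrow> ('a, 'b) module) \<Rightarrow> (nat \<Rightarrow> 'b \<Rightarrow> 'b) \<Rightarrow> nat \<Rightarrow> ('a, 'b set) module" where
  "cohomology_mod C d p = quot_mod
     ((C p)\<lparr>carrier := a_kernel (C p) (C (Suc p)) (d p)\<rparr>)
     (case p of 0 \<Rightarrow> {\<zero>\<^bsub>C 0\<^esub>} | Suc q \<Rightarrow> d q ` carrier (C q))"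


section \<open>The polynomial ring and its differential operators\<close>

text \<open>
  The variables are indexed by a finite linearly ordered type \<open>'n\<close>, so that \<open>n\<close> is \<open>CARD('n)\<close>.
  An element \<open>\<alpha>\<close> of \<open>{0,1}\<^sup>n\<close> is encoded by its support, a set of type \<open>'n set\<close>: thus
  \<open>\<bar>\<alpha>\<bar>\<close> is \<open>card \<alpha>\<close>, \<open>\<alpha> + \<epsilon>\<^sub>i\<close> for \<open>\<alpha>\<^sub>i = 0\<close> is \<open>insert i \<alpha>\<close>, the vector \<open>\<zero>\<close> is the empty set
  and the vector \<open>\<one>\<close> is \<open>UNIV\<close>.
\<close>

type_synonym ('k, 'n) mpoly = "('n \<Rightarrow>\<^sub>0 nat) \<Rightarrow>\<^sub>0 'k"

type_synonym ('k, 'n) poly_op = "('k, 'n) mpoly \<Rightarrow> ('k, 'n) mpoly"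

type_synonym ('k, 'n, 'm) dmodule = "(('k, 'n) poly_op, 'm) module"

definition const_poly :: "'k::field \<Rightarrow> ('k, 'n::{finite,linorder}) mpoly" where
  "const_poly c = Poly_Mapping.single 0 c"

definition var_poly :: "'n::{finite,linorder} \<Rightarrow> ('k::field, 'n) mpoly" where
  "var_poly i = Poly_Mapping.single (Poly_Mapping.single i 1) 1"

definition xmon :: "'n::{finite,linorder} set \<Rightarrow> ('k::field, 'n) mpoly" where
  "xmon \<alpha> = (\<Prod>i\<in>\<alpha>. var_poly i)"

definition k_linear :: "('k::field, 'n::{finite,linorder}) poly_op \<Rightarrow> bool" where
  "k_linear P \<longleftrightarrow> (\<forall>f g. P (f + g) = P f + P g) \<and> (\<forall>c f. P (const_poly c * f) = const_poly c * P f)"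

definition op_comm ::
    "('k::field, 'n::{finite,linorder}) poly_op \<Rightarrow> ('k, 'n) mpoly \<Rightarrow> ('k, 'n) poly_op" where
  "op_comm P r = (\<lambda>f. P (r * f) - r * P f)"

text \<open>Grothendieck's definition of the differential operators of order at most \<open>j\<close>.\<close>

primrec diff_ops :: "nat \<Rightarrow> ('k::field, 'n::{finite,linorder}) poly_op set" where
  "diff_ops 0 = {P. k_linear P \<and> (\<forall>r. op_comm P r = (\<lambda>_. 0))}"
| "diff_ops (Suc j) = {P. k_linear P \<and> (\<forall>r. op_comm P r \<in> diff_ops j)}"

definition D_ring :: "('k::field, 'n::{finite,linorder}) poly_op ring" where
  "D_ring = \<lparr>carrier = (\<Union>j. diff_ops j), monoid.mult = (\<circ>), one = id,
             ring.zero = (\<lambda>_. 0), add = (\<lambda>P Q f. P f + Q f)\<rparr>"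

definition R_mod :: "('k::field, 'n::{finite,linorder}, ('k, 'n) mpoly) dmodule" where
  "R_mod = mk_module UNIV 0 (+) (\<lambda>P f. P f)"

text \<open>The polynomial \<open>r\<close> acts on a \<open>D\<close>-module through the multiplication operator \<open>(*) r\<close>.\<close>

definition as_R_mod :: "('k::field, 'n::{finite,linorder}, 'm) dmodule \<Rightarrow> (('k, 'n) mpoly, 'm) module"
  where "as_R_mod M = restrict_scalars (\<lambda>r. (*) r) M"


section \<open>Localization of \<open>D\<close>-modules\<close>

definition powers :: "'a::monoid_mult \<Rightarrow> 'a set" where
  "powers s = range (\<lambda>k. s ^ k)"

definition frac_rel ::
    "('k::field, 'n::{finite,linorder}, 'm) dmodule \<Rightarrow> ('k, 'n) mpoly set \<Rightarrow>
     (('m \<times> ('k, 'n) mpoly) \<times> ('m \<times> ('k, 'n) mpoly)) set" where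
  "frac_rel M S = {((m, t), (m', t')). m \<in> carrier M \<and> m' \<in> carrier M \<and> t \<in> S \<and> t' \<in> S \<and>
     (\<exists>u\<in>S. (*) (u * t') \<odot>\<^bsub>M\<^esub> m = (*) (u * t) \<odot>\<^bsub>M\<^esub> m')}"

definition frac ::
    "('k::field, 'n::{finite,linorder}, 'm) dmodule \<Rightarrow> ('k, 'n) mpoly set \<Rightarrow>
     'm \<Rightarrow> ('k, 'n) mpoly \<Rightarrow> ('m \<times> ('k, 'n) mpoly) set" where
  "frac M S m t = frac_rel M S `` {(m, t)}"

text \<open>
  The action of a differential operator \<open>P\<close> on fractions is the one of the Ore localization:
  for \<open>t \<in> S\<close> there are \<open>u \<in> S\<close> and a differential operator \<open>Q\<close> with \<open>Q \<circ> t = u \<circ> P\<close>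
  (for instance \<open>u = t\<^sup>N\<^sup>+\<^sup>1\<close> if \<open>P\<close> has order at most \<open>N\<close>), whence \<open>P (m/t) = (Q m)/u\<close>. For a
  derivation \<open>P\<close> one can take \<open>u = t\<^sup>2\<close> and \<open>Q = t P - P(t)\<close>: the quotient rule.
\<close>

definition loc_mod ::
    "('k::field, 'n::{finite,linorder}, 'm) dmodule \<Rightarrow> ('k, 'n) mpoly set \<Rightarrow>
     ('k, 'n, ('m \<times> ('k, 'n) mpoly) set) dmodule" where
  "loc_mod M S = mk_module
     ((carrier M \<times> S) // frac_rel M S)
     (frac M S \<zero>\<^bsub>M\<^esub> 1)
     (\<lambda>A B. \<Union>(m, t)\<in>A. \<Union>(m', t')\<in>B. frac M S ((*) t' \<odot>\<^bsub>M\<^esub> m \<oplus>\<^bsub>M\<^esub> (*) t \<odot>\<^bsub>M\<^esub> m') (t * t'))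
     (\<lambda>P A. \<Union>{frac M S (Q \<odot>\<^bsub>M\<^esub> m) u | Q m t u.
        (m, t) \<in> A \<and> Q \<in> carrier D_ring \<and> u \<in> S \<and> Q \<circ> (*) t = (*) u \<circ> P})"

text \<open>
  The natural map \<open>S\<^sup>-\<^sup>1 M \<rightarrow> S'\<^sup>-\<^sup>1 M\<close>, available when every element of \<open>S\<close> divides one of \<open>S'\<close>.
\<close>

definition loc_map ::
    "('k::field, 'n::{finite,linorder}, 'm) dmodule \<Rightarrow> ('k, 'n) mpoly set \<Rightarrow> ('k, 'n) mpoly set \<Rightarrow>
     ('m \<times> ('k, 'n) mpoly) set \<Rightarrow> ('m \<times> ('k, 'n) mpoly) set" where
  "loc_map M S S' A = \<Union>{frac M S' ((*) w \<odot>\<^bsub>M\<^esub> m) (w * t) | w m t. (m, t) \<in> A \<and> w * t \<in> S'}"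


section \<open>Cech complexes and local cohomology\<close>

text \<open>\<open>i\<close> is the \<open>r\<close>-th element of \<open>\<alpha>\<close> with \<open>r - 1\<close> the exponent below.\<close>

definition cube_sign :: "'n::{finite,linorder} \<Rightarrow> 'n set \<Rightarrow> 'a::ring_1" where
  "cube_sign i \<alpha> = (- 1) ^ card {j \<in> \<alpha>. j < i}"

text \<open>
  The Cech complex of \<open>M\<close> with respect to the generators \<open>x\<^sub>i\<close>, \<open>i \<in> \<alpha>\<close>, of \<open>\<pp>\<^sub>\<alpha>\<close>, and its
  cohomology \<open>H\<^sup>p(M)\<close> with support in \<open>\<pp>\<^sub>\<alpha>\<close>. The case \<open>\<alpha> = UNIV\<close> is that of \<open>\<mm>\<close>.
\<close>

definition cech_idx :: "'n::{finite,linorder} set \<Rightarrow> nat \<Rightarrow> 'n set set" where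
  "cech_idx \<alpha> p = {\<beta>. \<beta> \<subseteq> \<alpha> \<and> card \<beta> = p}"

definition loc_at :: "('k::field, 'n::{finite,linorder}, 'm) dmodule \<Rightarrow> 'n set \<Rightarrow>
     ('k, 'n, ('m \<times> ('k, 'n) mpoly) set) dmodule" where
  "loc_at M \<beta> = loc_mod M (powers (xmon \<beta>))"

definition cech_mod :: "('k::field, 'n::{finite,linorder}, 'm) dmodule \<Rightarrow> 'n set \<Rightarrow> nat \<Rightarrow>
     ('k, 'n, 'n set \<Rightarrow> ('m \<times> ('k, 'n) mpoly) set) dmodule" where
  "cech_mod M \<alpha> p = dsum (cech_idx \<alpha> p) (loc_at M)"

definition cech_diff :: "('k::field, 'n::{finite,linorder}, 'm) dmodule \<Rightarrow> 'n set \<Rightarrow> nat \<Rightarrow>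
     ('n set \<Rightarrow> ('m \<times> ('k, 'n) mpoly) set) \<Rightarrow> ('n set \<Rightarrow> ('m \<times> ('k, 'n) mpoly) set)" where
  "cech_diff M \<alpha> p f = (\<lambda>\<gamma>\<in>cech_idx \<alpha> (Suc p).
     \<Oplus>\<^bsub>loc_at M \<gamma>\<^esub>i\<in>\<gamma>. (*) (cube_sign i \<gamma>) \<odot>\<^bsub>loc_at M \<gamma>\<^esub>
        loc_map M (powers (xmon (\<gamma> - {i}))) (powers (xmon \<gamma>)) (f (\<gamma> - {i})))"

definition local_coh :: "('k::field, 'n::{finite,linorder}, 'm) dmodule \<Rightarrow> 'n set \<Rightarrow> nat \<Rightarrow>
     ('k, 'n, ('n set \<Rightarrow> ('m \<times> ('k, 'n) mpoly) set) set) dmodule" where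
  "local_coh M \<alpha> p = cohomology_mod (cech_mod M \<alpha>) (cech_diff M \<alpha>) p"


section \<open>Modules with variation zero\<close>

text \<open>
  The modules \<open>H\<^sup>\<bar>\<^sup>\<alpha>\<^sup>\<bar>(R)\<close> with support in \<open>\<pp>\<^sub>\<alpha>\<close> are regular holonomic in characteristic zero, and
  regular holonomic modules are closed under extensions; hence the filtration already forces \<open>M\<close>
  to be regular holonomic, and no separate hypothesis is made. In positive characteristic the
  filtration is the definition.
\<close>

definition variation_zero :: "('k::field, 'n::{finite,linorder}, 'm) dmodule \<Rightarrow> bool" where
  "variation_zero M \<longleftrightarrow> left_module D_ring M \<and>
     (\<exists>(F :: int \<Rightarrow> 'm set) (m :: 'n set \<Rightarrow> nat).
        F (- 1) = {\<zero>\<^bsub>M\<^esub>} \<and> F (int CARD('n)) = carrier M \<and>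
        (\<forall>j\<in>{0..int CARD('n)}. submodule (F j) D_ring M \<and> F (j - 1) \<subseteq> F j \<and>
           isomorphic_mod D_ring
             (quot_mod (M\<lparr>carrier := F j\<rparr>) (F (j - 1)))
             (dsum {(\<alpha>, t). int (card \<alpha>) = j \<and> t < m \<alpha>}
                (\<lambda>(\<alpha>, t). local_coh (R_mod :: ('k, 'n, ('k, 'n) mpoly) dmodule) \<alpha> (card \<alpha>)))))"


section \<open>The hypercube\<close>

text \<open>
  \<open>E\<^sub>\<alpha>\<close> is the quotient of \<open>R[1/x\<^sup>\<one>]\<close> by the sum of the images of \<open>R[1/x\<^sup>\<one>\<^sup>-\<^sup>\<epsilon>\<^sub>i]\<close>, \<open>i \<in> \<alpha>\<close>.
  The second definition is the natural epimorphism from \<open>E\<^sub>\<alpha>\<close> to \<open>E\<^sub>\<beta>\<close> for \<open>\<alpha> \<subseteq> \<beta>\<close>, applied to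
  cosets.
\<close>

type_synonym ('k, 'n) laurent = "(('k, 'n) mpoly \<times> ('k, 'n) mpoly) set"

definition E_sub :: "'n::{finite,linorder} set \<Rightarrow> ('k::field, 'n) laurent set" where
  "E_sub \<alpha> = {\<Oplus>\<^bsub>loc_at R_mod UNIV\<^esub>i\<in>\<alpha>. g i | g.
     \<forall>i\<in>\<alpha>. g i \<in> loc_map R_mod (powers (xmon (UNIV - {i}))) (powers (xmon UNIV)) `
                    carrier (loc_at R_mod (UNIV - {i}))}"

definition E_mod :: "'n::{finite,linorder} set \<Rightarrow> ('k::field, 'n, ('k, 'n) laurent set) dmodule" where
  "E_mod \<alpha> = quot_mod (loc_at R_mod UNIV) (E_sub \<alpha>)"

definition E_epi :: "'n::{finite,linorder} set \<Rightarrow> ('k::field, 'n) laurent set \<Rightarrow> ('k, 'n) laurent set"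
  where "E_epi \<beta> C = E_sub \<beta> <+>\<^bsub>loc_at R_mod UNIV\<^esub> C"

text \<open>
  The \<open>\<int>\<^sup>n\<close>-grading of a \<open>D\<close>-module, in arbitrary characteristic. The differential operator
  \<open>x\<^sub>i\<^sup>t \<partial>\<^sub>i\<^sup>t / t!\<close> maps the monomial \<open>x\<^sup>a\<close> to \<open>(a\<^sub>i choose t) x\<^sup>a\<close>; the degree \<open>b\<close> part consists of
  the elements on which it acts as the scalar \<open>b\<^sub>i choose t\<close> for all \<open>i\<close> and \<open>t\<close>. On Laurent
  polynomials, hence on every \<open>E\<^sub>\<alpha>\<close>, this is the usual grading; on a module with variation zero
  it is the grading of the corresponding straight module shifted by \<open>\<one>\<close>.
\<close>

definition euler_op :: "'n::{finite,linorder} \<Rightarrow> nat \<Rightarrow> ('k::field, 'n) poly_op" where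
  "euler_op i t = Poly_Mapping.mapp (\<lambda>a c. of_nat (Poly_Mapping.lookup a i choose t) * c)"

text \<open>The binomial coefficient of an integer; the division is exact.\<close>

definition int_binom :: "int \<Rightarrow> nat \<Rightarrow> int" where
  "int_binom a t = (\<Prod>j<t. a - int j) div fact t"

definition deg_part ::
    "('k::field, 'n::{finite,linorder}, 'm) dmodule \<Rightarrow> ('n \<Rightarrow> int) \<Rightarrow> 'm set" where
  "deg_part M b = {m \<in> carrier M. \<forall>i t.
     euler_op i t \<odot>\<^bsub>M\<^esub> m = (*) (const_poly (of_int (int_binom (b i) t))) \<odot>\<^bsub>M\<^esub> m}"

definition graded_R_hom ::
    "('k::field, 'n::{finite,linorder}, 'm) dmodule \<Rightarrow> ('k, 'n, 'e) dmodule \<Rightarrow> ('m \<Rightarrow> 'e) set" where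
  "graded_R_hom M N = {f \<in> mod_hom ring_of_type_algebra (as_R_mod M) (as_R_mod N).
     \<forall>b. f ` deg_part M b \<subseteq> deg_part N b}"

text \<open>
  The \<open>k\<close>-vector space \<open>[M]\<^sub>\<alpha>\<close>. Its elements are taken extensional, so that equality of functions
  is equality on \<open>carrier M\<close>.
\<close>

definition cube_vs :: "('k::field, 'n::{finite,linorder}, 'm) dmodule \<Rightarrow> 'n set \<Rightarrow>
     ('k, 'm \<Rightarrow> ('k, 'n) laurent set) module" where
  "cube_vs M \<alpha> = mk_module
     (extensional (carrier M) \<inter>
        (if CHAR('k) = 0 then mod_hom D_ring M (E_mod \<alpha>) else graded_R_hom M (E_mod \<alpha>)))
     (\<lambda>m\<in>carrier M. \<zero>\<^bsub>E_mod \<alpha>\<^esub>)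
     (\<lambda>f g. \<lambda>m\<in>carrier M. f m \<oplus>\<^bsub>E_mod \<alpha>\<^esub> g m)
     (\<lambda>c f. \<lambda>m\<in>carrier M. (*) (const_poly c) \<odot>\<^bsub>E_mod \<alpha>\<^esub> f m)"

text \<open>The map \<open>u\<^bsub>\<alpha>,i\<^esub>\<close> and the action of \<open>[\<cdot>]\<^sub>\<alpha>\<close> on a morphism \<open>\<phi>\<close> with source \<open>M\<close>.\<close>

definition cube_map :: "('k::field, 'n::{finite,linorder}, 'm) dmodule \<Rightarrow> 'n set \<Rightarrow> 'n \<Rightarrow>
     ('m \<Rightarrow> ('k, 'n) laurent set) \<Rightarrow> ('m \<Rightarrow> ('k, 'n) laurent set)" where
  "cube_map M \<alpha> i f = compose (carrier M) (E_epi (insert i \<alpha>)) f"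

definition cube_functor_map :: "('k::field, 'n::{finite,linorder}, 'm) dmodule \<Rightarrow> ('m \<Rightarrow> 'm') \<Rightarrow>
     ('m' \<Rightarrow> ('k, 'n) laurent set) \<Rightarrow> ('m \<Rightarrow> ('k, 'n) laurent set)" where
  "cube_functor_map M \<phi> g = compose (carrier M) g \<phi>"


section \<open>The two complexes\<close>

definition cube_idx :: "nat \<Rightarrow> 'n::{finite,linorder} set set" where
  "cube_idx p = {\<alpha>. card \<alpha> + p = CARD('n)}"

definition cube_cplx :: "('k::field, 'n::{finite,linorder}, 'm) dmodule \<Rightarrow> nat \<Rightarrow>
     ('k, 'n set \<Rightarrow> 'm \<Rightarrow> ('k, 'n) laurent set) module" where
  "cube_cplx M p = dsum (cube_idx p) (cube_vs M)"

definition cube_diff :: "('k::field, 'n::{finite,linorder}, 'm) dmodule \<Rightarrow> nat \<Rightarrow>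
     ('n set \<Rightarrow> 'm \<Rightarrow> ('k, 'n) laurent set) \<Rightarrow> ('n set \<Rightarrow> 'm \<Rightarrow> ('k, 'n) laurent set)" where
  "cube_diff M p f = (\<lambda>\<gamma>\<in>cube_idx p.
     \<Oplus>\<^bsub>cube_vs M \<gamma>\<^esub>i\<in>\<gamma>. cube_sign i \<gamma> \<odot>\<^bsub>cube_vs M \<gamma>\<^esub> cube_map M (\<gamma> - {i}) i (f (\<gamma> - {i})))"

definition cech_cube_cplx :: "('k::field, 'n::{finite,linorder}, 'm) dmodule \<Rightarrow> nat \<Rightarrow>
     ('k, ('n set \<Rightarrow> ('m \<times> ('k, 'n) mpoly) set) \<Rightarrow> ('k, 'n) laurent set) module" where
  "cech_cube_cplx M p = cube_vs (cech_mod M UNIV p) UNIV"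

definition cech_cube_diff :: "('k::field, 'n::{finite,linorder}, 'm) dmodule \<Rightarrow> nat \<Rightarrow>
     (('n set \<Rightarrow> ('m \<times> ('k, 'n) mpoly) set) \<Rightarrow> ('k, 'n) laurent set) \<Rightarrow>
     (('n set \<Rightarrow> ('m \<times> ('k, 'n) mpoly) set) \<Rightarrow> ('k, 'n) laurent set)" where
  "cech_cube_diff M p = cube_functor_map (cech_mod M UNIV p) (cech_diff M UNIV p)"

end

theory Submission
  imports Defs
begin

text \<open>
  Everything is reduced to duality on weight spaces, a weight being a common eigenvalue \<open>b\<close> of the Euler
  operators, as for the monomial \<open>x\<^sup>b\<close>. The module \<open>E\<^sub>\<alpha>\<close> has as a basis the Laurent monomials with exponents
  that are negative on \<open>\<alpha>\<close>. Let \<open>\<beta>\<close> be the complement of \<open>\<alpha>\<close>. A graded homomorphism \<open>f : M \<rightarrow> E\<^sub>\<alpha>\<close> is known as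
  soon as the coefficients of \<open>f(m)\<close> at the exponents \<open>-\<one> + L\<beta>\<close>, \<open>L \<ge> 0\<close>, are known, and any
  compatible family of functionals occurs (\<open>graded_determined\<close>, \<open>compatible_graded\<close>). The coefficient at \<open>-\<one> + L\<beta>\<close>
  depends only on the fraction \<open>m / x\<^sup>L\<^sup>\<beta>\<close>. Thus \<open>[M]\<^sub>\<alpha>\<close> is the space of functionals on the part of weight \<open>-\<one>\<close> of the
  localization \<open>M[1/x\<^sup>\<beta>]\<close>. For empty \<open>\<beta>\<close> this says that \<open>[N]\<^sub>\<one>\<close> is dual to the part of weight \<open>-\<one>\<close> of \<open>N\<close>, by taking
  residues. Hence \<open>[M]\<^sub>\<alpha>\<close> and \<open>[M[1/x\<^sup>\<beta>]]\<^sub>\<one>\<close> agree. The maps of the hypercube are dual to the localization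
  maps (\<open>pairing_res\<close>), and the signs in the two complexes, which count predecessors of \<open>i\<close> in a subset and in its
  complement, differ by a coboundary (\<open>twist_remove\<close>). This gives the isomorphism of complexes.

  For homology, functionals on the part of weight \<open>-\<one>\<close> extend from submodules (\<open>functional_extend\<close>). Therefore
  cycles of the dual complex restrict to all functionals on cocycles that vanish on coboundaries, and
  those that restrict to zero are boundaries.

  It remains to see that modules with variation zero have enough weight vectors (\<open>level_extension\<close>). This is clear for
  the graded pieces of the filtration, sums of modules \<open>H\<^sup>\<bar>\<^sup>\<alpha>\<^sup>\<bar>(R)\<close> with support in \<open>\<pp>\<^sub>\<alpha>\<close>, whose weights are negative
  exactly on \<open>\<alpha>\<close>. It passes to extensions because the sets \<open>\<alpha>\<close> grow along the filtration. The same bookkeeping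
  shows that \<open>\<partial>\<^sub>i\<close> kills the weight spaces with \<open>b\<^sub>i = 0\<close>. In characteristic zero, where \<open>[M]\<^sub>\<alpha>\<close> is defined by
  \<open>D\<close>-linear maps, this implies that graded \<open>R\<close>-linear maps into \<open>E\<^sub>\<alpha>\<close> are \<open>D\<close>-linear (\<open>graded_R_hom_D_linear\<close>), so that
  one description serves all characteristics.
\<close>

section \<open>Left modules\<close>

lemma mk_module_simps [simp]:
  "carrier (mk_module C z pl sm) = C" "\<zero>\<^bsub>mk_module C z pl sm\<^esub> = z"
  "x \<oplus>\<^bsub>mk_module C z pl sm\<^esub> y = pl x y" "a \<odot>\<^bsub>mk_module C z pl sm\<^esub> x = sm a x"
  by (simp_all add: mk_module_def)

text \<open>
  Additive inverses come for free: they are multiples by the scalar \<open>-1\<close>.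
\<close>

lemma left_moduleI:
  assumes "ring A"
    and "\<And>x y. \<lbrakk>x \<in> carrier M; y \<in> carrier M\<rbrakk> \<Longrightarrow> x \<oplus>\<^bsub>M\<^esub> y \<in> carrier M"
    and "\<zero>\<^bsub>M\<^esub> \<in> carrier M"
    and "\<And>x y z. \<lbrakk>x \<in> carrier M; y \<in> carrier M; z \<in> carrier M\<rbrakk> \<Longrightarrow>
           (x \<oplus>\<^bsub>M\<^esub> y) \<oplus>\<^bsub>M\<^esub> z = x \<oplus>\<^bsub>M\<^esub> (y \<oplus>\<^bsub>M\<^esub> z)"
    and "\<And>x y. \<lbrakk>x \<in> carrier M; y \<in> carrier M\<rbrakk> \<Longrightarrow> x \<oplus>\<^bsub>M\<^esub> y = y \<oplus>\<^bsub>M\<^esub> x"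
    and "\<And>x. x \<in> carrier M \<Longrightarrow> \<zero>\<^bsub>M\<^esub> \<oplus>\<^bsub>M\<^esub> x = x"
    and zs: "\<And>x. x \<in> carrier M \<Longrightarrow> \<zero>\<^bsub>A\<^esub> \<odot>\<^bsub>M\<^esub> x = \<zero>\<^bsub>M\<^esub>"
    and sc: "\<And>a x. \<lbrakk>a \<in> carrier A; x \<in> carrier M\<rbrakk> \<Longrightarrow> a \<odot>\<^bsub>M\<^esub> x \<in> carrier M"
    and ld: "\<And>a b x. \<lbrakk>a \<in> carrier A; b \<in> carrier A; x \<in> carrier M\<rbrakk> \<Longrightarrow>
           (a \<oplus>\<^bsub>A\<^esub> b) \<odot>\<^bsub>M\<^esub> x = a \<odot>\<^bsub>M\<^esub> x \<oplus>\<^bsub>M\<^esub> b \<odot>\<^bsub>M\<^esub> x"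
    and "\<And>a x y. \<lbrakk>a \<in> carrier A; x \<in> carrier M; y \<in> carrier M\<rbrakk> \<Longrightarrow>
           a \<odot>\<^bsub>M\<^esub> (x \<oplus>\<^bsub>M\<^esub> y) = a \<odot>\<^bsub>M\<^esub> x \<oplus>\<^bsub>M\<^esub> a \<odot>\<^bsub>M\<^esub> y"
    and "\<And>a b x. \<lbrakk>a \<in> carrier A; b \<in> carrier A; x \<in> carrier M\<rbrakk> \<Longrightarrow>
           (a \<otimes>\<^bsub>A\<^esub> b) \<odot>\<^bsub>M\<^esub> x = a \<odot>\<^bsub>M\<^esub> (b \<odot>\<^bsub>M\<^esub> x)"
    and one: "\<And>x. x \<in> carrier M \<Longrightarrow> \<one>\<^bsub>A\<^esub> \<odot>\<^bsub>M\<^esub> x = x"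
  shows "left_module A M"
proof -
  interpret A: ring A by fact
  have "\<exists>y\<in>carrier M. y \<oplus>\<^bsub>M\<^esub> x = \<zero>\<^bsub>M\<^esub>" if "x \<in> carrier M" for x
  proof (rule bexI[of _ "(\<ominus>\<^bsub>A\<^esub> \<one>\<^bsub>A\<^esub>) \<odot>\<^bsub>M\<^esub> x"])
    have "(\<ominus>\<^bsub>A\<^esub> \<one>\<^bsub>A\<^esub>) \<odot>\<^bsub>M\<^esub> x \<oplus>\<^bsub>M\<^esub> x = (\<ominus>\<^bsub>A\<^esub> \<one>\<^bsub>A\<^esub> \<oplus>\<^bsub>A\<^esub> \<one>\<^bsub>A\<^esub>) \<odot>\<^bsub>M\<^esub> x"
      using that one ld by simp
    also have "\<dots> = \<zero>\<^bsub>M\<^esub>" using that zs by (simp add: A.l_neg)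
    finally show "(\<ominus>\<^bsub>A\<^esub> \<one>\<^bsub>A\<^esub>) \<odot>\<^bsub>M\<^esub> x \<oplus>\<^bsub>M\<^esub> x = \<zero>\<^bsub>M\<^esub>" .
    show "(\<ominus>\<^bsub>A\<^esub> \<one>\<^bsub>A\<^esub>) \<odot>\<^bsub>M\<^esub> x \<in> carrier M" using that sc by simp
  qed
  then have "abelian_group M" using assms by (intro abelian_groupI) auto
  then show ?thesis
    by (intro left_module.intro left_module_axioms.intro) (use assms in auto)
qed

context left_module begin

lemma smult_zero [simp]: "a \<in> carrier R \<Longrightarrow> a \<odot> \<zero> = \<zero>"
  by (metis M.add.l_cancel_one' M.r_zero M.zero_closed smult_closed smult_r_distr)

lemma zero_smult [simp]: "x \<in> carrier M \<Longrightarrow> \<zero>\<^bsub>R\<^esub> \<odot> x = \<zero>"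
  by (metis M.add.l_cancel_one' R.r_zero R.zero_closed smult_closed smult_l_distr)

lemma minus_one_smult: "x \<in> carrier M \<Longrightarrow> (\<ominus>\<^bsub>R\<^esub> \<one>\<^bsub>R\<^esub>) \<odot> x = \<ominus> x"
  by (metis M.minus_equality R.add.inv_closed R.l_neg R.one_closed smult_closed smult_l_distr smult_one zero_smult)

lemma smult_minus: "a \<in> carrier R \<Longrightarrow> x \<in> carrier M \<Longrightarrow> a \<odot> (\<ominus> x) = \<ominus> (a \<odot> x)"
  by (metis M.add.inv_closed M.l_neg M.minus_equality smult_closed smult_r_distr smult_zero)

lemma smult_diff: "a \<in> carrier R \<Longrightarrow> x \<in> carrier M \<Longrightarrow> y \<in> carrier M \<Longrightarrow>
    a \<odot> (x \<ominus> y) = a \<odot> x \<ominus> a \<odot> y"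
  by (simp add: M.minus_eq smult_r_distr smult_minus)

lemma submodule_by_closure:
  assumes "U \<subseteq> carrier M" "\<zero> \<in> U" "\<And>x y. x \<in> U \<Longrightarrow> y \<in> U \<Longrightarrow> x \<oplus> y \<in> U"
    and "\<And>a x. a \<in> carrier R \<Longrightarrow> x \<in> U \<Longrightarrow> a \<odot> x \<in> U"
  shows "submodule U R M"
proof -
  have "\<ominus> x \<in> U" if "x \<in> U" for x
    using assms(1) assms(4)[OF _ that, of "\<ominus>\<^bsub>R\<^esub> \<one>\<^bsub>R\<^esub>"] minus_one_smult that by auto
  then show ?thesis
    by (intro submodule.intro subgroup.intro submodule_axioms.intro)
      (use assms in \<open>auto simp flip: a_inv_def\<close>)
qed

end

lemma submodule_closure:
  assumes "submodule U A M"
  shows submodule_subset: "U \<subseteq> carrier M"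
    and submodule_zero: "\<zero>\<^bsub>M\<^esub> \<in> U"
    and submodule_add: "x \<in> U \<Longrightarrow> y \<in> U \<Longrightarrow> x \<oplus>\<^bsub>M\<^esub> y \<in> U"
    and submodule_smult: "a \<in> carrier A \<Longrightarrow> x \<in> U \<Longrightarrow> a \<odot>\<^bsub>M\<^esub> x \<in> U"
proof -
  interpret submodule U A M by fact
  show "U \<subseteq> carrier M" using subset by simp
  show "\<zero>\<^bsub>M\<^esub> \<in> U" using one_closed by simp
  show "x \<in> U \<Longrightarrow> y \<in> U \<Longrightarrow> x \<oplus>\<^bsub>M\<^esub> y \<in> U" using m_closed by simp
  show "a \<in> carrier A \<Longrightarrow> x \<in> U \<Longrightarrow> a \<odot>\<^bsub>M\<^esub> x \<in> U" by simp
qed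

lemma (in left_module) left_module_submodule:
  assumes "submodule U R M"
  shows "left_module R (M\<lparr>carrier := U\<rparr>)"
  using submodule_subset[OF assms] submodule_closure[OF assms]
  by (intro left_moduleI)
    (auto simp: subset_iff M.a_assoc R.ring_axioms smult_assoc smult_l_distr smult_r_distr smult_one intro: M.a_comm)

lemma (in abelian_group) diff_eq_zero_iff:
  "x \<in> carrier G \<Longrightarrow> y \<in> carrier G \<Longrightarrow> x \<ominus> y = \<zero> \<longleftrightarrow> x = y"
  by (metis a_minus_def add.inv_solve_right' l_zero r_neg zero_closed)

subsection \<open>Homomorphisms\<close>

lemma mod_homI:
  assumes "\<And>x. x \<in> carrier M \<Longrightarrow> f x \<in> carrier N"
    and "\<And>x y. x \<in> carrier M \<Longrightarrow> y \<in> carrier M \<Longrightarrow> f (x \<oplus>\<^bsub>M\<^esub> y) = f x \<oplus>\<^bsub>N\<^esub> f y"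
    and "\<And>a x. a \<in> carrier A \<Longrightarrow> x \<in> carrier M \<Longrightarrow> f (a \<odot>\<^bsub>M\<^esub> x) = a \<odot>\<^bsub>N\<^esub> f x"
  shows "f \<in> mod_hom A M N"
  using assms by (auto simp: mod_hom_def)

lemma mod_homD:
  assumes "f \<in> mod_hom A M N"
  shows "x \<in> carrier M \<Longrightarrow> f x \<in> carrier N"
    and "x \<in> carrier M \<Longrightarrow> y \<in> carrier M \<Longrightarrow> f (x \<oplus>\<^bsub>M\<^esub> y) = f x \<oplus>\<^bsub>N\<^esub> f y"
    and "a \<in> carrier A \<Longrightarrow> x \<in> carrier M \<Longrightarrow> f (a \<odot>\<^bsub>M\<^esub> x) = a \<odot>\<^bsub>N\<^esub> f x"
  using assms by (auto simp: mod_hom_def)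

lemma mod_hom_zero:
  assumes "left_module A M" "left_module A N" "f \<in> mod_hom A M N"
  shows "f \<zero>\<^bsub>M\<^esub> = \<zero>\<^bsub>N\<^esub>"
proof -
  interpret M: left_module A M by fact
  interpret N: left_module A N by fact
  have "f (\<zero>\<^bsub>A\<^esub> \<odot>\<^bsub>M\<^esub> \<zero>\<^bsub>M\<^esub>) = \<zero>\<^bsub>A\<^esub> \<odot>\<^bsub>N\<^esub> f \<zero>\<^bsub>M\<^esub>" by (rule mod_homD(3)[OF assms(3)]) auto
  then show ?thesis using mod_homD(1)[OF assms(3), of "\<zero>\<^bsub>M\<^esub>"] by simp
qed

lemma mod_hom_minus:
  assumes "left_module A M" "left_module A N" "f \<in> mod_hom A M N" "x \<in> carrier M"
  shows "f (\<ominus>\<^bsub>M\<^esub> x) = \<ominus>\<^bsub>N\<^esub> f x"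
proof -
  interpret M: left_module A M by fact
  interpret N: left_module A N by fact
  have "f ((\<ominus>\<^bsub>A\<^esub> \<one>\<^bsub>A\<^esub>) \<odot>\<^bsub>M\<^esub> x) = (\<ominus>\<^bsub>A\<^esub> \<one>\<^bsub>A\<^esub>) \<odot>\<^bsub>N\<^esub> f x"
    by (rule mod_homD(3)[OF assms(3)]) (use assms in auto)
  then show ?thesis using mod_homD(1)[OF assms(3)] assms(4) M.minus_one_smult N.minus_one_smult by simp
qed

lemma mod_hom_diff:
  assumes "left_module A M" "left_module A N" "f \<in> mod_hom A M N" "x \<in> carrier M" "y \<in> carrier M"
  shows "f (x \<ominus>\<^bsub>M\<^esub> y) = f x \<ominus>\<^bsub>N\<^esub> f y"
proof -
  interpret M: left_module A M by fact
  interpret N: left_module A N by fact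
  show ?thesis using mod_homD(2)[OF assms(3)] assms(4,5) mod_hom_minus[OF assms(1-3)]
    by (simp add: M.M.minus_eq N.M.minus_eq)
qed

lemma mod_hom_finsum:
  assumes "left_module A M" "left_module A N" "f \<in> mod_hom A M N" "finite I" "g \<in> I \<rightarrow> carrier M"
  shows "f (finsum M g I) = finsum N (\<lambda>i. f (g i)) I"
proof -
  interpret M: left_module A M by fact
  interpret N: left_module A N by fact
  show ?thesis using assms(4,5)
  proof (induction I)
    case empty
    then show ?case by (simp add: mod_hom_zero[OF assms(1-3)])
  next
    case (insert i I)
    moreover have "(\<lambda>i. f (g i)) \<in> I \<rightarrow> carrier N" "f (g i) \<in> carrier N"
      using insert mod_homD(1)[OF assms(3)] by (auto simp: Pi_iff)
    ultimately show ?case by (simp add: mod_homD(2)[OF assms(3)])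
  qed
qed

lemma mod_hom_compose:
  "f \<in> mod_hom A M N \<Longrightarrow> g \<in> mod_hom A N K \<Longrightarrow> (\<lambda>x. g (f x)) \<in> mod_hom A M K"
  by (auto simp: mod_hom_def Pi_iff)

lemma (in left_module) smult_finsum:
  assumes "a \<in> carrier R" "finite I" "g \<in> I \<rightarrow> carrier M"
  shows "a \<odot> finsum M g I = finsum M (\<lambda>i. a \<odot> g i) I"
  using assms(2,3)
proof (induction I)
  case empty
  then show ?case using assms by simp
next
  case (insert i I)
  moreover have "(\<lambda>i. a \<odot> g i) \<in> I \<rightarrow> carrier M" "a \<odot> g i \<in> carrier M" "g \<in> I \<rightarrow> carrier M"
    using insert smult_closed assms by (auto simp: Pi_iff)
  ultimately show ?case using assms by (simp add: smult_r_distr)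
qed

lemma (in abelian_group) additive_finsum:
  fixes \<phi> :: "_ \<Rightarrow> 'c::cancel_comm_monoid_add"
  assumes "\<And>x y. x \<in> carrier G \<Longrightarrow> y \<in> carrier G \<Longrightarrow> \<phi> (x \<oplus> y) = \<phi> x + \<phi> y"
    and "finite I" "g \<in> I \<rightarrow> carrier G"
  shows "\<phi> (finsum G g I) = (\<Sum>i\<in>I. \<phi> (g i))"
proof -
  have "\<phi> (\<zero> \<oplus> \<zero>) = \<phi> \<zero> + \<phi> \<zero>" using assms(1) by blast
  then have "\<phi> \<zero> = 0" by simp
  with assms(2,3) show ?thesis
    by (induction I) (auto simp: assms(1) Pi_iff)
qed

lemma mod_hom_kernel_submodule:
  assumes "left_module A M" "left_module A N" "f \<in> mod_hom A M N"
  shows "submodule {x \<in> carrier M. f x = \<zero>\<^bsub>N\<^esub>} A M"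
proof -
  interpret M: left_module A M by fact
  interpret N: left_module A N by fact
  show ?thesis
    by (rule M.submodule_by_closure)
      (auto simp: mod_homD[OF assms(3)] mod_hom_zero[OF assms] M.smult_closed)
qed

lemma mod_hom_image_submodule:
  assumes "left_module A M" "left_module A N" "f \<in> mod_hom A M N"
  shows "submodule (f ` carrier M) A N"
proof -
  interpret M: left_module A M by fact
  interpret N: left_module A N by fact
  show ?thesis
  proof (rule N.submodule_by_closure)
    show "f ` carrier M \<subseteq> carrier N" by (auto simp: mod_homD[OF assms(3)])
    show "\<zero>\<^bsub>N\<^esub> \<in> f ` carrier M" using mod_hom_zero[OF assms] by (metis M.M.zero_closed image_eqI)
  next
    fix x y assume "x \<in> f ` carrier M" "y \<in> f ` carrier M"
    then show "x \<oplus>\<^bsub>N\<^esub> y \<in> f ` carrier M"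
      by clarsimp (metis M.M.a_closed image_eqI mod_homD(2)[OF assms(3)])
  next
    fix a x assume "a \<in> carrier A" "x \<in> f ` carrier M"
    then show "a \<odot>\<^bsub>N\<^esub> x \<in> f ` carrier M"
      by clarsimp (metis M.smult_closed image_eqI mod_homD(3)[OF assms(3)])
  qed
qed

subsection \<open>Quotients and direct sums\<close>

context left_module begin

lemma coset_eq_iff:
  assumes "submodule U R M" "x \<in> carrier M" "y \<in> carrier M"
  shows "U +> x = U +> y \<longleftrightarrow> x \<ominus> y \<in> U"
proof -
  interpret abelian_subgroup U M
    using assms(1) submodule.axioms(1) by (intro abelian_subgroupI3 additive_subgroup.intro) (auto intro: abelian_group_axioms)
  have "U +> x = U +> y \<longleftrightarrow> x \<in> U +> y"
    using assms a_repr_independence' a_repr_independenceD by (metis a_rcos_self)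
  also have "\<dots> \<longleftrightarrow> x \<ominus> y \<in> U"
    using assms a_rcos_module[of y x] by (simp add: M.minus_eq)
  finally show ?thesis .
qed

lemma quot_mod_carrier: "carrier (quot_mod M U) = (\<lambda>x. U +> x) ` carrier M"
  by (auto simp: quot_mod_def A_RCOSETS_def')

lemma quot_mod_zero:
  assumes "submodule U R M" shows "\<zero>\<^bsub>quot_mod M U\<^esub> = U +> \<zero>"
  using a_coset_add_zero[OF submodule_subset[OF assms]] by (simp add: quot_mod_def)

lemma quot_mod_add:
  assumes "submodule U R M" "x \<in> carrier M" "y \<in> carrier M"
  shows "(U +> x) \<oplus>\<^bsub>quot_mod M U\<^esub> (U +> y) = U +> (x \<oplus> y)"
proof -
  interpret abelian_subgroup U M
    using assms(1) submodule.axioms(1) by (intro abelian_subgroupI3 additive_subgroup.intro) (auto intro: abelian_group_axioms)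
  show ?thesis using assms by (simp add: quot_mod_def a_rcos_sum)
qed

lemma coset_self: "submodule U R M \<Longrightarrow> x \<in> carrier M \<Longrightarrow> x \<in> U +> x"
  using submodule_zero[of U R M] M.l_zero[of x] unfolding a_r_coset_def' by (auto intro!: bexI[of _ \<zero>])

lemma coset_mem_iff:
  assumes "submodule U R M" "x \<in> carrier M"
  shows "y \<in> U +> x \<longleftrightarrow> y \<in> carrier M \<and> U +> y = U +> x"
proof
  assume y: "y \<in> U +> x"
  then obtain u where u: "u \<in> U" "y = u \<oplus> x" by (auto simp: a_r_coset_def')
  have uc: "u \<in> carrier M" using u submodule_subset[OF assms(1)] by auto
  have "y \<ominus> x = u" using u uc assms by (simp add: M.minus_eq M.a_assoc M.r_neg)
  then show "y \<in> carrier M \<and> U +> y = U +> x" using coset_eq_iff assms u uc by auto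
next
  assume "y \<in> carrier M \<and> U +> y = U +> x"
  then show "y \<in> U +> x" using coset_self[OF assms(1)] by metis
qed

lemma quot_mod_smult:
  assumes "submodule U R M" "a \<in> carrier R" "x \<in> carrier M"
  shows "a \<odot>\<^bsub>quot_mod M U\<^esub> (U +> x) = U +> (a \<odot> x)"
proof -
  have "U +> (a \<odot> y) = U +> (a \<odot> x)" if "y \<in> U +> x" for y
  proof -
    have y: "y \<in> carrier M" "y \<ominus> x \<in> U"
      using that coset_mem_iff[OF assms(1,3), of y] coset_eq_iff[OF assms(1) _ assms(3), of y] by blast+
    then have "a \<odot> y \<ominus> a \<odot> x \<in> U"
      using smult_diff[OF assms(2) y(1) assms(3)] submodule_smult[OF assms(1,2)] by metis
    then show ?thesis using coset_eq_iff assms y by (simp add: smult_closed)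
  qed
  then have "(\<Union>y\<in>U +> x. U +> (a \<odot> y)) = (\<Union>y\<in>U +> x. U +> (a \<odot> x))"
    by (intro SUP_cong refl) blast
  then show ?thesis using coset_self[OF assms(1,3)] by (auto simp add: quot_mod_def simp del: UN_simps)
qed

lemma left_module_quot:
  assumes "submodule U R M" shows "left_module R (quot_mod M U)"
  by (rule left_moduleI)
    (auto simp: quot_mod_carrier quot_mod_zero quot_mod_add quot_mod_smult assms R.ring_axioms
      smult_closed smult_l_distr smult_r_distr smult_assoc smult_one M.a_ac)

lemma coset_hom:
  assumes "submodule U R M" shows "(\<lambda>x. U +> x) \<in> mod_hom R M (quot_mod M U)"
  by (rule mod_homI) (auto simp: quot_mod_carrier quot_mod_add quot_mod_smult assms)

lemma coset_zero_iff:
  assumes "submodule U R M" "x \<in> carrier M"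
  shows "U +> x = \<zero>\<^bsub>quot_mod M U\<^esub> \<longleftrightarrow> x \<in> U"
proof -
  have "\<ominus> \<zero> = \<zero>" by (rule M.minus_equality) auto
  then have "x \<ominus> \<zero> = x" using assms(2) by (simp only: M.minus_eq M.r_zero)
  then show ?thesis
    using coset_eq_iff[OF assms M.zero_closed] by (simp only: quot_mod_zero[OF assms(1)])
qed

end

lemma dsum_simps:
  "carrier (dsum I M) = (\<Pi>\<^sub>E i\<in>I. carrier (M i))" "\<zero>\<^bsub>dsum I M\<^esub> = (\<lambda>i\<in>I. \<zero>\<^bsub>M i\<^esub>)"
  "f \<oplus>\<^bsub>dsum I M\<^esub> g = (\<lambda>i\<in>I. f i \<oplus>\<^bsub>M i\<^esub> g i)"
  "a \<odot>\<^bsub>dsum I M\<^esub> f = (\<lambda>i\<in>I. a \<odot>\<^bsub>M i\<^esub> f i)"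
  by (simp_all add: dsum_def)

lemma left_module_dsum:
  assumes "ring A" and M: "\<And>i. i \<in> I \<Longrightarrow> left_module A (M i)"
  shows "left_module A (dsum I M)"
proof -
  have ab: "abelian_group (M i)" if "i \<in> I" for i by (rule left_module.axioms(2)[OF M[OF that]])
  have am: "abelian_monoid (M i)" if "i \<in> I" for i by (rule abelian_group.axioms(1)[OF ab[OF that]])
  note [simp] = left_module.smult_closed[OF M] abelian_monoid.a_closed[OF am] abelian_monoid.zero_closed[OF am]
    PiE_mem[where S=I and T="\<lambda>i. carrier (M i)"] dsum_simps restrict_PiE_iff
  show ?thesis
  proof (rule left_moduleI)
    fix f g h assume f: "f \<in> carrier (dsum I M)"
    have ext: "(\<lambda>i\<in>I. f i) = f" using f PiE_restrict by auto
    show "\<zero>\<^bsub>dsum I M\<^esub> \<oplus>\<^bsub>dsum I M\<^esub> f = f"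
      using f by (subst ext[symmetric], unfold dsum_simps, intro restrict_ext) (simp add: abelian_monoid.l_zero[OF am])
    show "\<one>\<^bsub>A\<^esub> \<odot>\<^bsub>dsum I M\<^esub> f = f"
      using f by (subst ext[symmetric], unfold dsum_simps, intro restrict_ext) (simp add: left_module.smult_one[OF M])
    show "\<zero>\<^bsub>A\<^esub> \<odot>\<^bsub>dsum I M\<^esub> f = \<zero>\<^bsub>dsum I M\<^esub>"
      using f by (simp, intro restrict_ext) (simp add: left_module.zero_smult[OF M])
    assume g: "g \<in> carrier (dsum I M)"
    show "f \<oplus>\<^bsub>dsum I M\<^esub> g \<in> carrier (dsum I M)" using f g by simp
    show "f \<oplus>\<^bsub>dsum I M\<^esub> g = g \<oplus>\<^bsub>dsum I M\<^esub> f"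
      using f g by (simp, intro restrict_ext) (simp add: abelian_monoid.a_comm[OF am])
    assume h: "h \<in> carrier (dsum I M)"
    show "f \<oplus>\<^bsub>dsum I M\<^esub> g \<oplus>\<^bsub>dsum I M\<^esub> h = f \<oplus>\<^bsub>dsum I M\<^esub> (g \<oplus>\<^bsub>dsum I M\<^esub> h)"
      using f g h by (simp, intro restrict_ext) (simp add: abelian_monoid.a_assoc[OF am])
  next
    fix a b f g assume a: "a \<in> carrier A" and f: "f \<in> carrier (dsum I M)"
    show "a \<odot>\<^bsub>dsum I M\<^esub> f \<in> carrier (dsum I M)" using a f by simp
    {
      assume b: "b \<in> carrier A"
      show "(a \<oplus>\<^bsub>A\<^esub> b) \<odot>\<^bsub>dsum I M\<^esub> f = a \<odot>\<^bsub>dsum I M\<^esub> f \<oplus>\<^bsub>dsum I M\<^esub> b \<odot>\<^bsub>dsum I M\<^esub> f"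
        using a b f by (simp, intro restrict_ext) (simp add: left_module.smult_l_distr[OF M])
      show "(a \<otimes>\<^bsub>A\<^esub> b) \<odot>\<^bsub>dsum I M\<^esub> f = a \<odot>\<^bsub>dsum I M\<^esub> (b \<odot>\<^bsub>dsum I M\<^esub> f)"
        using a b f by (simp, intro restrict_ext) (simp add: left_module.smult_assoc[OF M])
    next
      assume g: "g \<in> carrier (dsum I M)"
      show "a \<odot>\<^bsub>dsum I M\<^esub> (f \<oplus>\<^bsub>dsum I M\<^esub> g) = a \<odot>\<^bsub>dsum I M\<^esub> f \<oplus>\<^bsub>dsum I M\<^esub> a \<odot>\<^bsub>dsum I M\<^esub> g"
        using a f g by (simp, intro restrict_ext) (simp add: left_module.smult_r_distr[OF M])
    }
  qed (simp_all add: \<open>ring A\<close>)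
qed

lemma dsum_component_hom:
  "i \<in> I \<Longrightarrow> (\<lambda>f. f i) \<in> mod_hom A (dsum I M) (M i)"
  by (rule mod_homI) (auto simp: dsum_simps)

lemma first_isomorphism:
  assumes M: "left_module A M" and N: "left_module A N" and f: "f \<in> mod_hom A M N"
    and surj: "f ` carrier M = carrier N"
  shows "isomorphic_mod A N (quot_mod M {x \<in> carrier M. f x = \<zero>\<^bsub>N\<^esub>})"
proof -
  interpret M: left_module A M by fact
  interpret N: left_module A N by fact
  define U where "U = {x \<in> carrier M. f x = \<zero>\<^bsub>N\<^esub>}"
  have U: "submodule U A M" unfolding U_def by (rule mod_hom_kernel_submodule[OF M N f])
  have eq: "U +>\<^bsub>M\<^esub> x = U +>\<^bsub>M\<^esub> y \<longleftrightarrow> f x = f y" if "x \<in> carrier M" "y \<in> carrier M" for x y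
  proof -
    have "U +>\<^bsub>M\<^esub> x = U +>\<^bsub>M\<^esub> y \<longleftrightarrow> f x \<ominus>\<^bsub>N\<^esub> f y = \<zero>\<^bsub>N\<^esub>"
      using that M.coset_eq_iff[OF U that] mod_hom_diff[OF M N f that] by (simp add: U_def)
    then show ?thesis using that mod_homD(1)[OF f] N.M.diff_eq_zero_iff by simp
  qed
  define h where "h = inv_into (carrier M) f"
  have h: "h y \<in> carrier M" "f (h y) = y" if "y \<in> carrier N" for y
    using that surj by (auto simp: h_def inv_into_into f_inv_into_f)
  have "(\<lambda>y. U +>\<^bsub>M\<^esub> h y) \<in> mod_hom A N (quot_mod M U)"
  proof (rule mod_homI)
    fix x y assume "x \<in> carrier N" "y \<in> carrier N"
    then show "U +>\<^bsub>M\<^esub> h (x \<oplus>\<^bsub>N\<^esub> y) = (U +>\<^bsub>M\<^esub> h x) \<oplus>\<^bsub>quot_mod M U\<^esub> (U +>\<^bsub>M\<^esub> h y)"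
      using h by (simp add: M.quot_mod_add[OF U] eq mod_homD(2)[OF f])
  next
    fix a x assume "a \<in> carrier A" "x \<in> carrier N"
    then show "U +>\<^bsub>M\<^esub> h (a \<odot>\<^bsub>N\<^esub> x) = a \<odot>\<^bsub>quot_mod M U\<^esub> (U +>\<^bsub>M\<^esub> h x)"
      using h by (simp add: M.quot_mod_smult[OF U] eq mod_homD(3)[OF f] M.smult_closed N.smult_closed)
  qed (auto simp: M.quot_mod_carrier h)
  moreover have "bij_betw (\<lambda>y. U +>\<^bsub>M\<^esub> h y) (carrier N) (carrier (quot_mod M U))"
  proof (rule bij_betwI')
    fix x y assume "x \<in> carrier N" "y \<in> carrier N"
    then show "(U +>\<^bsub>M\<^esub> h x = U +>\<^bsub>M\<^esub> h y) = (x = y)" using h eq by simp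
  next
    fix C assume "C \<in> carrier (quot_mod M U)"
    then obtain x where x: "x \<in> carrier M" "C = U +>\<^bsub>M\<^esub> x" by (auto simp: M.quot_mod_carrier)
    then show "\<exists>y\<in>carrier N. C = U +>\<^bsub>M\<^esub> h y"
      using eq h mod_homD(1)[OF f] by (intro bexI[of _ "f x"]) auto
  qed (auto simp: M.quot_mod_carrier h)
  ultimately show ?thesis by (auto simp: isomorphic_mod_def mod_iso_def U_def)
qed

section \<open>Polynomials and differential operators\<close>

type_synonym 'n expo = "'n \<Rightarrow>\<^sub>0 nat"

abbreviation "lk \<equiv> Poly_Mapping.lookup"
abbreviation "mono_poly a \<equiv> Poly_Mapping.single a 1"
abbreviation "unit_exp i \<equiv> Poly_Mapping.single i (Suc 0)"

lemma lookup_single_times: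
  fixes f :: "('k::field, 'n::{finite,linorder}) mpoly"
  shows "lk (Poly_Mapping.single a c * f) b = (if \<forall>i. lk a i \<le> lk b i then c * lk f (b - a) else 0)"
proof -
  have "lk (Poly_Mapping.single a c * f) b = c * (\<Sum>q. lk f q when b = a + q)"
    unfolding lookup_mult lookup_single when_mult by simp
  also have "(\<Sum>q. lk f q when b = a + q) = (if \<forall>i. lk a i \<le> lk b i then lk f (b - a) else 0)"
  proof (cases "\<forall>i. lk a i \<le> lk b i")
    case True
    then have "b = a + q \<longleftrightarrow> q = b - a" for q
      by (auto simp: poly_mapping_eq_iff lookup_add lookup_minus fun_eq_iff le_add_diff_inverse)
    then show ?thesis using True by simp
  next
    case False
    then have "b \<noteq> a + q" for q by (metis le_add1 lookup_add)
    then have "(\<lambda>q. lk f q when b = a + q) = (\<lambda>_. 0)" by simp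
    from arg_cong[OF this, of Sum_any] show ?thesis unfolding if_not_P[OF False] by simp
  qed
  finally show ?thesis by simp
qed

lemma unit_exp_le_iff: "(\<forall>j. lk (unit_exp i) j \<le> lk b j) \<longleftrightarrow> 0 < lk b i"
  by (auto simp: lookup_single when_def Suc_le_eq)

lemma lookup_var_times:
  "lk (var_poly i * f) b = (if 0 < lk b i then lk f (b - unit_exp i) else 0)"
  unfolding var_poly_def One_nat_def using lookup_single_times[of "unit_exp i" 1 f b] unit_exp_le_iff[of i b] by simp

lemma lookup_const_times: "lk (const_poly c * f) b = c * lk f b"
  by (simp add: const_poly_def lookup_single_times)

lemma const_poly_simps:
  "const_poly 0 = 0" "const_poly 1 = 1" "const_poly (a + b) = const_poly a + const_poly b"
  "const_poly (a * b) = const_poly a * const_poly b" "const_poly (- a) = - const_poly a"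
  "const_poly (a - b) = const_poly a - const_poly b"
  by (simp_all add: const_poly_def single_add mult_single single_uminus single_diff)

lemma mpoly_induct [case_names single add]:
  fixes f :: "('k::field, 'n::{finite,linorder}) mpoly"
  assumes s: "\<And>a c. P (Poly_Mapping.single a c)" and add: "\<And>f g. P f \<Longrightarrow> P g \<Longrightarrow> P (f + g)"
  shows "P f"
proof (induction f rule: update_induct)
  case const
  show ?case using s[of 0 0] by simp
next
  case (update f a b)
  have "Poly_Mapping.update a b f = f + Poly_Mapping.single a b"
    using update by (intro poly_mapping_eqI) (auto simp: lookup_update lookup_add lookup_single when_def in_keys_iff)
  then show ?case using update s add by simp
qed

definition total_deg :: "'n::finite expo \<Rightarrow> nat" where "total_deg a = (\<Sum>i\<in>UNIV. lk a i)"

lemma total_deg_add: "total_deg (a + b) = total_deg a + total_deg b"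
  by (simp add: total_deg_def lookup_add sum.distrib)

lemma total_deg_unit [simp]: "total_deg (unit_exp i) = 1"
  by (simp add: total_deg_def lookup_single when_def)

lemma exp_induct [case_names zero Suc]:
  fixes a :: "'n::finite expo"
  assumes z: "P 0" and s: "\<And>a i. P a \<Longrightarrow> P (a + unit_exp i)"
  shows "P a"
proof (induction "total_deg a" arbitrary: a)
  case 0
  then have "a = 0" by (intro poly_mapping_eqI) (simp add: total_deg_def)
  then show ?case using z by simp
next
  case (Suc d)
  then obtain i where i: "lk a i \<noteq> 0" unfolding total_deg_def by (metis Zero_not_Suc sum.neutral)
  have a: "a = (a - unit_exp i) + unit_exp i"
    using i by (intro poly_mapping_eqI) (auto simp: lookup_add lookup_minus lookup_single when_def)
  then have "total_deg a = total_deg (a - unit_exp i) + 1" by (metis total_deg_add total_deg_unit)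
  with Suc have "P (a - unit_exp i)" by simp
  then show ?case using s a by metis
qed

lemma single_Suc_exp: "Poly_Mapping.single (a + unit_exp i) c = var_poly i * Poly_Mapping.single a c"
  by (simp add: var_poly_def mult_single add.commute)

lemma mpoly_ring_induct [case_names const var add mult]:
  fixes f :: "('k::field, 'n::{finite,linorder}) mpoly"
  assumes "\<And>c. P (const_poly c)" "\<And>i. P (var_poly i)"
    and "\<And>f g. P f \<Longrightarrow> P g \<Longrightarrow> P (f + g)" "\<And>f g. P f \<Longrightarrow> P g \<Longrightarrow> P (f * g)"
  shows "P f"
proof (induction f rule: mpoly_induct)
  case (single a c)
  show ?case
    by (induction a rule: exp_induct) (use assms(1)[of c] assms in \<open>auto simp: single_Suc_exp const_poly_def\<close>)
qed (fact assms(3))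

subsection \<open>Operators of bounded order\<close>

declare diff_ops.simps [simp del]

lemma k_linearD:
  assumes "k_linear P"
  shows "P (f + g) = P f + P g" "P (const_poly c * f) = const_poly c * P f" "P 0 = 0" "P (- f) = - P f" "P (f - g) = P f - P g"
proof -
  show add: "P (f + g) = P f + P g" and sc: "P (const_poly c * f) = const_poly c * P f" for f g c
    using assms by (auto simp: k_linear_def)
  show "P 0 = 0" using sc[of 0 0] by (simp add: const_poly_simps)
  show neg: "P (- f) = - P f" for f using sc[of "-1" f] by (simp add: const_poly_simps)
  show "P (f - g) = P f - P g" using add[of f "- g"] neg by simp
qed

lemma k_linear_ops:
  assumes "k_linear P" "k_linear Q"
  shows "k_linear (\<lambda>f. P f + Q f)" "k_linear (\<lambda>f. r * P f)" "k_linear (\<lambda>f. P (r * f))" "k_linear (\<lambda>f. P (Q f))"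
    "k_linear (op_comm P r)" "k_linear (\<lambda>f. 0)" "k_linear ((*) r)"
  using assms by (auto simp: k_linear_def op_comm_def distrib_left right_diff_distrib mult.left_commute[of r "const_poly _"])

lemma diff_ops_k_linear: "P \<in> diff_ops j \<Longrightarrow> k_linear P"
  by (cases j) (auto simp: diff_ops.simps)

lemma diff_ops_zero: "(\<lambda>f. 0) \<in> diff_ops j"
  by (induction j) (auto simp: k_linear_def op_comm_def diff_ops.simps)

lemma diff_ops_Suc: "(diff_ops j :: ('k::field, 'n::{finite,linorder}) poly_op set) \<subseteq> diff_ops (Suc j)"
proof (induction j)
  case 0
  have "op_comm P r = (\<lambda>f. 0)" if "P \<in> diff_ops 0" for P :: "('k, 'n) poly_op" and r
    using that by (auto simp: diff_ops.simps)
  then show ?case using diff_ops_zero[of 0] diff_ops_k_linear by (auto simp: diff_ops.simps(2))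
next
  case (Suc j)
  then show ?case by (auto simp: diff_ops.simps(2))
qed

lemma diff_ops_mono: "i \<le> j \<Longrightarrow> diff_ops i \<subseteq> diff_ops j"
  using lift_Suc_mono_le[of diff_ops, OF diff_ops_Suc] by blast

lemma diff_ops_add: "P \<in> diff_ops j \<Longrightarrow> Q \<in> diff_ops j \<Longrightarrow> (\<lambda>f. P f + Q f) \<in> diff_ops j"
proof (induction j arbitrary: P Q)
  case 0
  then show ?case by (auto simp: diff_ops.simps k_linear_ops op_comm_def fun_eq_iff algebra_simps)
next
  case (Suc j)
  have "op_comm (\<lambda>f. P f + Q f) r = (\<lambda>f. op_comm P r f + op_comm Q r f)" for r
    by (auto simp: op_comm_def algebra_simps)
  with Suc show ?case by (auto simp: k_linear_ops diff_ops.simps(2))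
qed

lemma diff_ops_comp:
  "P \<in> diff_ops i \<Longrightarrow> Q \<in> diff_ops j \<Longrightarrow> (\<lambda>f. P (Q f)) \<in> diff_ops (i + j)"
proof (induction "i + j" arbitrary: i j P Q)
  case 0
  then show ?case by (auto simp: diff_ops.simps k_linear_ops op_comm_def fun_eq_iff algebra_simps)
next
  case (Suc n)
  have kl: "k_linear P" "k_linear Q" using Suc.prems diff_ops_k_linear by auto
  have "op_comm (\<lambda>f. P (Q f)) r \<in> diff_ops n" for r
  proof -
    have eq: "op_comm (\<lambda>f. P (Q f)) r = (\<lambda>f. P (op_comm Q r f) + op_comm P r (Q f))"
      by (auto simp: op_comm_def k_linearD[OF kl(1)])
    have "(\<lambda>f. P (op_comm Q r f)) \<in> diff_ops n"
    proof (cases j)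
      case 0
      then have "op_comm Q r = (\<lambda>f. 0)" using Suc.prems by (auto simp: diff_ops.simps)
      then show ?thesis using diff_ops_zero k_linearD(3)[OF kl(1)] by simp
    next
      case j: (Suc j')
      then have "op_comm Q r \<in> diff_ops j'" "n = i + j'" using Suc by (auto simp: diff_ops.simps)
      then show ?thesis using Suc.hyps(1)[OF _ Suc.prems(1)] by auto
    qed
    moreover have "(\<lambda>f. op_comm P r (Q f)) \<in> diff_ops n"
    proof (cases i)
      case 0
      then have "op_comm P r = (\<lambda>f. 0)" using Suc.prems by (auto simp: diff_ops.simps)
      then show ?thesis using diff_ops_zero by simp
    next
      case i: (Suc i')
      then have "op_comm P r \<in> diff_ops i'" "n = i' + j" using Suc by (auto simp: diff_ops.simps)
      then show ?thesis using Suc.hyps(1)[OF _ _ Suc.prems(2)] by auto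
    qed
    ultimately show ?thesis unfolding eq by (rule diff_ops_add)
  qed
  then show ?case unfolding Suc.hyps(2)[symmetric] using kl by (simp add: k_linear_ops diff_ops.simps)
qed

lemma diff_ops_mult: "(*) r \<in> diff_ops 0"
  by (auto simp: k_linear_def op_comm_def algebra_simps diff_ops.simps)

lemma times_one_fun: "(*) (1 :: 'a::comm_semiring_1) = (\<lambda>f. f)"
  by auto

lemma diff_ops_id: "(\<lambda>f. f) \<in> diff_ops 0"
  using diff_ops_mult[of 1] by (simp add: times_one_fun)

lemma diff_ops_0D: "P \<in> diff_ops 0 \<Longrightarrow> P (r * f) = r * P f"
  by (auto simp: op_comm_def fun_eq_iff diff_ops.simps)

lemma diff_ops_SucD: "P \<in> diff_ops (Suc j) \<Longrightarrow> op_comm P r \<in> diff_ops j"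
  by (simp add: diff_ops.simps)

lemma diff_ops_lmult: "P \<in> diff_ops j \<Longrightarrow> (\<lambda>f. r * P f) \<in> diff_ops j"
  using diff_ops_comp[OF diff_ops_mult] by simp

lemma diff_ops_rmult: "P \<in> diff_ops j \<Longrightarrow> (\<lambda>f. P (r * f)) \<in> diff_ops j"
  using diff_ops_comp[OF _ diff_ops_mult] by simp

text \<open>\<open>[P, \<cdot>]\<close> is a derivation, so it is controlled by its values on the variables.\<close>

lemma diff_ops_by_vars:
  assumes P: "k_linear P" and v: "\<And>i. op_comm P (var_poly i) \<in> diff_ops j"
  shows "P \<in> diff_ops (Suc j)"
proof -
  have "op_comm P r \<in> diff_ops j" for r
  proof (induction r rule: mpoly_ring_induct)
    case (const c)
    have "op_comm P (const_poly c) = (\<lambda>f. 0)" by (auto simp: op_comm_def k_linearD[OF P])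
    then show ?case using diff_ops_zero by simp
  next
    case (add r s)
    have "op_comm P (r + s) = (\<lambda>f. op_comm P r f + op_comm P s f)"
      by (auto simp: op_comm_def k_linearD[OF P] algebra_simps)
    then show ?case using add diff_ops_add by simp
  next
    case (mult r s)
    have "op_comm P (r * s) = (\<lambda>f. op_comm P r (s * f) + r * op_comm P s f)"
      by (auto simp: op_comm_def k_linearD[OF P] algebra_simps)
    moreover have "\<dots> \<in> diff_ops j"
      by (rule diff_ops_add[OF diff_ops_rmult[OF mult(1)] diff_ops_lmult[OF mult(2)]])
    ultimately show ?case by simp
  qed (fact v)
  then show ?thesis using P by (simp add: diff_ops.simps)
qed

subsection \<open>The ring of differential operators\<close>

lemma D_ring_simps:
  "carrier D_ring = (\<Union>j. diff_ops j)" "P \<otimes>\<^bsub>D_ring\<^esub> Q = (\<lambda>f. P (Q f))" "\<one>\<^bsub>D_ring\<^esub> = (\<lambda>f. f)"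
  "\<zero>\<^bsub>D_ring\<^esub> = (\<lambda>_. 0)" "P \<oplus>\<^bsub>D_ring\<^esub> Q = (\<lambda>f. P f + Q f)"
  by (auto simp: D_ring_def)

abbreviation D_ops :: "('k::field, 'n::{finite,linorder}) poly_op set" where
  "D_ops \<equiv> carrier D_ring"

lemma D_ops_k_linear: "P \<in> D_ops \<Longrightarrow> k_linear P"
  by (auto simp: D_ring_simps diff_ops_k_linear)

context
  fixes P Q :: "('k::field, 'n::{finite,linorder}) poly_op" and r :: "('k, 'n) mpoly"
begin

lemma D_ops_mult: "(*) r \<in> D_ops"
  using diff_ops_mult by (auto simp: D_ring_simps)

lemma D_ops_id: "(\<lambda>f. f) \<in> (D_ops :: ('k, 'n) poly_op set)"
  using diff_ops_id by (auto simp: D_ring_simps)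

lemma D_ops_zero: "(\<lambda>f. 0) \<in> (D_ops :: ('k, 'n) poly_op set)"
  using diff_ops_zero by (auto simp: D_ring_simps)

lemma D_ops_comp: "P \<in> D_ops \<Longrightarrow> Q \<in> D_ops \<Longrightarrow> (\<lambda>f. P (Q f)) \<in> D_ops"
  using diff_ops_comp by (fastforce simp: D_ring_simps)

lemma D_ops_add: "P \<in> D_ops \<Longrightarrow> Q \<in> D_ops \<Longrightarrow> (\<lambda>f. P f + Q f) \<in> D_ops"
proof -
  assume "P \<in> D_ops" "Q \<in> D_ops"
  then obtain i j where "P \<in> diff_ops i" "Q \<in> diff_ops j" by (auto simp: D_ring_simps)
  then have "P \<in> diff_ops (max i j)" "Q \<in> diff_ops (max i j)"
    using diff_ops_mono[of i "max i j"] diff_ops_mono[of j "max i j"] by auto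
  then show ?thesis using diff_ops_add by (auto simp: D_ring_simps)
qed

lemma D_ops_lmult: "P \<in> D_ops \<Longrightarrow> (\<lambda>f. r * P f) \<in> D_ops"
  using diff_ops_lmult by (fastforce simp: D_ring_simps)

lemma D_ops_rmult: "P \<in> D_ops \<Longrightarrow> (\<lambda>f. P (r * f)) \<in> D_ops"
  using diff_ops_rmult by (fastforce simp: D_ring_simps)

end

lemma D_ops_diff: "P \<in> D_ops \<Longrightarrow> Q \<in> D_ops \<Longrightarrow> (\<lambda>f. P f - Q f) \<in> D_ops"
  using D_ops_add[OF _ D_ops_lmult[of Q "-1"]] by simp

lemma ring_D_ring: "ring (D_ring :: ('k::field, 'n::{finite,linorder}) poly_op ring)"
proof (rule ringI)
  show "abelian_group (D_ring :: ('k, 'n) poly_op ring)"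
  proof (rule abelian_groupI)
    fix P :: "('k, 'n) poly_op" assume "P \<in> D_ops"
    then show "\<exists>Q\<in>D_ops. Q \<oplus>\<^bsub>D_ring\<^esub> P = \<zero>\<^bsub>D_ring\<^esub>"
      by (intro bexI[of _ "\<lambda>f. -1 * P f"]) (use D_ops_lmult[of P "-1"] in \<open>auto simp: D_ring_simps(2-)\<close>)
  qed (auto simp: D_ring_simps(2-) D_ops_add D_ops_zero algebra_simps)
  show "Group.monoid (D_ring :: ('k, 'n) poly_op ring)"
    by (rule monoidI) (auto simp: D_ring_simps(2-) D_ops_comp D_ops_id)
qed (auto simp: D_ring_simps(2-) k_linearD(1)[OF D_ops_k_linear])

text \<open>
  An Ore condition. Commuting with \<open>t\<close> lowers the order of \<open>P\<close>, so by induction on the order a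
  high power of \<open>t\<close> on the left of \<open>P\<close> yields any prescribed power on the right of another operator.
\<close>

lemma ore_left:
  fixes P :: "('k::field, 'n::{finite,linorder}) poly_op"
  shows "P \<in> diff_ops j \<Longrightarrow> \<exists>Q\<in>D_ops. \<forall>f. t ^ (j + N) * P f = Q (t ^ N * f)"
proof (induction j arbitrary: P N)
  case 0
  then show ?case by (intro bexI[of _ P]) (auto simp: D_ring_simps diff_ops_0D)
next
  case (Suc j)
  note sP = Suc.prems and IH = Suc.IH
  show ?case
  proof (induction N)
    case 0
    show ?case using sP by (intro bexI[of _ "\<lambda>f. t ^ Suc j * P f"] D_ops_lmult) (auto simp: D_ring_simps)
  next
    case (Suc N)
    then obtain Q where Q: "Q \<in> D_ops" "\<And>f. t ^ (Suc j + N) * P f = Q (t ^ N * f)" by blast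
    then obtain Q' where Q': "Q' \<in> D_ops" "\<And>f. t ^ (j + Suc N) * op_comm P t f = Q' (t ^ Suc N * f)"
      using IH[OF diff_ops_SucD[OF sP], of "Suc N" t] by blast
    have "t ^ (Suc j + Suc N) * P f = Q (t ^ Suc N * f) - Q' (t ^ Suc N * f)" for f
    proof -
      have "t ^ (Suc j + Suc N) * P f = t ^ (Suc j + N) * (t * P f)" by (simp add: algebra_simps)
      also have "\<dots> = t ^ (Suc j + N) * P (t * f) - t ^ (j + Suc N) * op_comm P t f"
        by (simp add: op_comm_def algebra_simps)
      finally show ?thesis unfolding Q Q' by (simp add: algebra_simps)
    qed
    then show ?case using Q Q' D_ops_diff by (intro bexI[of _ "\<lambda>f. Q f - Q' f"]) auto
  qed
qed

text \<open>
  If \<open>P\<close> kills the multiples of \<open>r\<close>, then so do its commutators with polynomials. By induction on the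
  order these vanish, so that \<open>P\<close> is \<open>R\<close>-linear and \<open>r P(f) = P(r f) = 0\<close>.
\<close>

lemma D_ops_right_cancel:
  fixes P :: "('k::field, 'n::{finite,linorder}) poly_op"
  assumes r: "\<And>f. r * f = 0 \<Longrightarrow> f = 0"
  shows "P \<in> diff_ops j \<Longrightarrow> (\<And>f. P (r * f) = 0) \<Longrightarrow> P f = 0"
proof (induction j arbitrary: P f)
  case 0
  then have "r * P f = 0" by (metis diff_ops_0D)
  then show ?case by (rule r)
next
  case (Suc j)
  have "op_comm P s f = 0" for s f
  proof (rule Suc.IH[of "op_comm P s"])
    show "op_comm P s \<in> diff_ops j" using Suc diff_ops_SucD by blast
    show "op_comm P s (r * g) = 0" for g
      using Suc.prems(2)[of "s * g"] Suc.prems(2)[of g] by (simp add: op_comm_def mult.left_commute)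
  qed
  then have c: "P (s * f) = s * P f" for s f by (simp add: op_comm_def)
  then have "r * P f = 0" using Suc by metis
  then show ?case by (rule r)
qed

lemma D_ops_right_cancel_eq:
  assumes "\<And>f. r * f = 0 \<Longrightarrow> f = 0" "P \<in> D_ops" "Q \<in> D_ops" "\<And>f. P (r * f) = Q (r * f)"
  shows "P = Q"
proof
  fix f
  obtain j where j: "(\<lambda>f. P f - Q f) \<in> diff_ops j" using D_ops_diff[OF assms(2,3)] by (auto simp: D_ring_simps)
  have "P f - Q f = 0"
  proof (rule D_ops_right_cancel[of r "\<lambda>f. P f - Q f", OF _ j])
    show "g = 0" if "r * g = 0" for g using assms(1) that .
  qed (simp add: assms(4))
  then show "P f = Q f" by simp
qed

subsection \<open>Euler operators and partial derivatives\<close>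

lemma lookup_euler_op: "lk (euler_op i t f) a = of_nat (lk a i choose t) * lk f a"
  by (auto simp: euler_op_def lookup_mapp when_def in_keys_iff)

lemma k_linear_euler_op: "k_linear (euler_op i t)"
  by (auto simp: k_linear_def intro!: poly_mapping_eqI simp: lookup_euler_op lookup_add lookup_const_times distrib_left mult.left_commute)

lemma euler_op_0: "euler_op i 0 = (\<lambda>f. f)"
  by (intro ext poly_mapping_eqI) (simp add: lookup_euler_op)

lemma euler_op_var:
  "euler_op i (Suc t) (var_poly i * f) = var_poly i * euler_op i (Suc t) f + var_poly i * euler_op i t f"
proof (rule poly_mapping_eqI)
  fix a
  show "lk (euler_op i (Suc t) (var_poly i * f)) a =
    lk (var_poly i * euler_op i (Suc t) f + var_poly i * euler_op i t f) a"
    by (cases "lk a i") (simp_all add: lookup_euler_op lookup_var_times lookup_add lookup_minus distrib_right)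
qed

lemma euler_op_other_var: "j \<noteq> i \<Longrightarrow> euler_op i t (var_poly j * f) = var_poly j * euler_op i t f"
  by (intro poly_mapping_eqI) (simp add: lookup_euler_op lookup_var_times lookup_minus lookup_single)

lemma euler_op_D: "(euler_op i t :: ('k::field, 'n::{finite,linorder}) poly_op) \<in> D_ops"
proof -
  have "(euler_op i t :: ('k, 'n) poly_op) \<in> diff_ops t"
  proof (induction t)
    case 0
    show ?case using diff_ops_id by (simp add: euler_op_0)
  next
    case (Suc t)
    show ?case
    proof (rule diff_ops_by_vars[OF k_linear_euler_op])
      fix j
      let ?E = "\<lambda>t. euler_op i t :: ('k, 'n) poly_op"
      show "op_comm (?E (Suc t)) (var_poly j) \<in> diff_ops t"
      proof (cases "j = i")
        case True
        have "op_comm (?E (Suc t)) (var_poly i) = (\<lambda>f. var_poly i * euler_op i t f)"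
          by (auto simp: op_comm_def euler_op_var)
        then show ?thesis using diff_ops_lmult[OF Suc] True by simp
      next
        case False
        then have "op_comm (?E (Suc t)) (var_poly j) = (\<lambda>f. 0)"
          by (auto simp: op_comm_def euler_op_other_var)
        then show ?thesis using diff_ops_zero by metis
      qed
    qed
  qed
  then show ?thesis by (auto simp: D_ring_simps)
qed

definition partial :: "'n::{finite,linorder} \<Rightarrow> ('k::field, 'n) poly_op" where
  "partial i f = Abs_poly_mapping (\<lambda>a. of_nat (Suc (lk a i)) * lk f (a + unit_exp i))"

lemma lookup_partial: "lk (partial i f) a = of_nat (Suc (lk a i)) * lk f (a + unit_exp i)"
proof -
  have "{a. of_nat (Suc (lk a i)) * lk f (a + unit_exp i) \<noteq> 0} \<subseteq> (\<lambda>a. a - unit_exp i) ` Poly_Mapping.keys f"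
  proof
    fix a assume "a \<in> {a. of_nat (Suc (lk a i)) * lk f (a + unit_exp i) \<noteq> 0}"
    then show "a \<in> (\<lambda>a. a - unit_exp i) ` Poly_Mapping.keys f"
      by (intro image_eqI[of _ _ "a + unit_exp i"]) (auto simp: in_keys_iff)
  qed
  then have "finite {a. of_nat (Suc (lk a i)) * lk f (a + unit_exp i) \<noteq> 0}"
    by (rule finite_subset) simp
  then show ?thesis by (simp add: partial_def)
qed

lemma k_linear_partial: "k_linear (partial i)"
  by (auto simp: k_linear_def intro!: poly_mapping_eqI simp: lookup_partial lookup_add lookup_const_times distrib_left mult.left_commute)

lemma partial_var: "partial i (var_poly i * f) = var_poly i * partial i f + f"
proof (rule poly_mapping_eqI)
  fix a
  have "lk a i \<noteq> 0 \<Longrightarrow> a - unit_exp i + unit_exp i = a"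
    by (intro poly_mapping_eqI) (auto simp: lookup_add lookup_minus lookup_single when_def)
  then show "lk (partial i (var_poly i * f)) a = lk (var_poly i * partial i f + f) a"
    by (cases "lk a i") (simp_all add: lookup_partial lookup_var_times lookup_add lookup_minus distrib_right)
qed

lemma partial_other_var:
  assumes "j \<noteq> i" shows "partial i (var_poly j * f) = var_poly j * partial i f"
proof (rule poly_mapping_eqI)
  fix a
  have "lk a j \<noteq> 0 \<Longrightarrow> a + unit_exp i - unit_exp j = a - unit_exp j + unit_exp i"
    using assms by (intro poly_mapping_eqI) (auto simp: lookup_add lookup_minus lookup_single when_def)
  then show "lk (partial i (var_poly j * f)) a = lk (var_poly j * partial i f) a"
    using assms by (simp add: lookup_partial lookup_var_times lookup_add lookup_minus lookup_single)
qed

lemma var_partial: "var_poly i * partial i f = euler_op i 1 f"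
proof (rule poly_mapping_eqI)
  fix a
  have "lk a i \<noteq> 0 \<Longrightarrow> a - unit_exp i + unit_exp i = a"
    by (intro poly_mapping_eqI) (auto simp: lookup_add lookup_minus lookup_single when_def)
  then show "lk (var_poly i * partial i f) a = lk (euler_op i 1 f) a"
    by (cases "lk a i") (simp_all add: lookup_partial lookup_var_times lookup_euler_op lookup_minus)
qed

lemma partial_diff_ops: "(partial i :: ('k::field, 'n::{finite,linorder}) poly_op) \<in> diff_ops 1"
proof -
  have "op_comm (partial i :: ('k, 'n) poly_op) (var_poly j) \<in> diff_ops 0" for j
  proof -
    have "op_comm (partial i :: ('k, 'n) poly_op) (var_poly j) = (if j = i then (\<lambda>f. f) else (\<lambda>f. 0))"
      by (auto simp: op_comm_def partial_var partial_other_var)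
    then show ?thesis using diff_ops_id diff_ops_zero by (cases "j = i") simp_all
  qed
  then show ?thesis using diff_ops_by_vars[OF k_linear_partial, of i 0] by (metis One_nat_def)
qed

lemma partial_D: "partial i \<in> D_ops"
  using partial_diff_ops by (auto simp only: D_ring_simps)

lemma partial_mono: "partial i (mono_poly a) = const_poly (of_nat (lk a i)) * mono_poly (a - unit_exp i)"
proof (cases "lk a i")
  case 0
  then have "b + unit_exp i \<noteq> a" for b by (auto simp: poly_mapping_eq_iff lookup_add fun_eq_iff lookup_single when_def intro!: exI[of _ i])
  then show ?thesis using 0 by (intro poly_mapping_eqI) (auto simp: lookup_partial lookup_single when_def const_poly_simps)
next
  case (Suc m)
  then have "a = (a - unit_exp i) + unit_exp i"
    by (intro poly_mapping_eqI) (auto simp: lookup_add lookup_minus lookup_single when_def)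
  then have "a = b + unit_exp i \<longleftrightarrow> b = a - unit_exp i" for b by (metis add_diff_cancel_right')
  then show ?thesis using Suc
    by (intro poly_mapping_eqI) (auto simp: lookup_partial lookup_single when_def const_poly_def mult_single lookup_minus)
qed

text \<open>
  The commutator of \<open>P\<close> with a variable has smaller order and kills the monomials of degree less than
  \<open>j\<close>. By induction it is zero, so \<open>P\<close> is \<open>R\<close>-linear and vanishes because \<open>P(1) = 0\<close>.
\<close>

lemma diff_ops_zero_on_monomials:
  fixes P :: "('k::field, 'n::{finite,linorder}) poly_op"
  shows "P \<in> diff_ops j \<Longrightarrow> (\<And>a. total_deg a \<le> j \<Longrightarrow> P (mono_poly a) = 0) \<Longrightarrow> P f = 0"
proof (induction j arbitrary: P f)
  case 0
  then have "P (f * 1) = f * P 1" using diff_ops_0D by blast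
  moreover have "P 1 = 0" using 0(2)[of 0] by (simp add: total_deg_def)
  ultimately show ?case by simp
next
  case (Suc j)
  have kl: "k_linear P" using Suc diff_ops_k_linear by blast
  have "op_comm P (var_poly i) f = 0" for i f
  proof (rule Suc.IH[of "op_comm P (var_poly i)"])
    show "op_comm P (var_poly i) \<in> diff_ops j" using Suc diff_ops_SucD by blast
    show "op_comm P (var_poly i) (mono_poly a) = 0" if "total_deg a \<le> j" for a
      using that Suc.prems(2)[of a] Suc.prems(2)[of "a + unit_exp i"]
      by (simp add: op_comm_def total_deg_add single_Suc_exp)
  qed
  then have "op_comm P (var_poly i) = (\<lambda>f. 0)" for i by auto
  then have c: "P (var_poly i * f) = var_poly i * P f" for i f by (simp add: op_comm_def fun_eq_iff)
  have P1: "P 1 = 0" using Suc.prems(2)[of 0] by (simp add: total_deg_def)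
  have s: "P (Poly_Mapping.single a c) = 0" for a c
  proof (induction a rule: exp_induct)
    case zero
    have "P (const_poly c * 1) = const_poly c * P 1" by (rule k_linearD[OF kl])
    then show ?case using P1 by (simp add: const_poly_def)
  qed (simp add: single_Suc_exp c)
  show ?case by (induction f rule: mpoly_induct) (auto simp: s k_linearD[OF kl])
qed

text \<open>
  The composition \<open>\<partial>\<^sup>a\<close> of partial derivatives maps \<open>x\<^sup>a\<close> to a constant, which is not zero in characteristic
  zero, and kills all other monomials of degree at most \<open>\<bar>a\<bar>\<close>. With polynomial multiples of these
  operators \<open>P\<close> is matched on the monomials whose degree is at most its order, and these determine it.
\<close>

lemma D_ops_induct_char_0 [consumes 2, case_names mult partial add comp]:
  fixes P :: "('k::field, 'n::{finite,linorder}) poly_op"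
  assumes ch: "CHAR('k) = 0" and "P \<in> D_ops"
    and m: "\<And>r. S ((*) r)" and d: "\<And>i. S (partial i)"
    and ad: "\<And>P Q. P \<in> D_ops \<Longrightarrow> Q \<in> D_ops \<Longrightarrow> S P \<Longrightarrow> S Q \<Longrightarrow> S (\<lambda>f. P f + Q f)"
    and co: "\<And>P Q. P \<in> D_ops \<Longrightarrow> Q \<in> D_ops \<Longrightarrow> S P \<Longrightarrow> S Q \<Longrightarrow> S (\<lambda>f. P (Q f))"
  shows "S P"
proof -
  obtain j where j: "P \<in> diff_ops j" using assms(2) by (auto simp: D_ring_simps)
  have Dj: "Q \<in> D_ops" if "Q \<in> diff_ops i" for Q :: "('k, 'n) poly_op" and i using that by (auto simp: D_ring_simps)
  \<comment> \<open>\<open>T\<close> is the composition of partial derivatives belonging to \<open>a\<close>.\<close>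
  have T: "\<exists>T. T \<in> diff_ops (total_deg a) \<and> S T \<and> (\<exists>c. c \<noteq> 0 \<and> T (mono_poly a) = const_poly c) \<and>
          (\<forall>b. total_deg b \<le> total_deg a \<and> b \<noteq> a \<longrightarrow> T (mono_poly b) = 0)" for a :: "'n expo"
  proof (induction a rule: exp_induct)
    case zero
    have "b = 0" if "total_deg b = 0" for b :: "'n expo"
      using that by (intro poly_mapping_eqI) (simp add: total_deg_def)
    then show ?case using m[of 1] diff_ops_id
      by (intro exI[of _ "\<lambda>f. f"]) (auto simp: times_one_fun total_deg_def const_poly_simps intro!: exI[of _ 1])
  next
    case (Suc a i)
    then obtain T c where T: "T \<in> diff_ops (total_deg a)" "S T" "c \<noteq> 0" "T (mono_poly a) = const_poly c"
      "\<And>b. total_deg b \<le> total_deg a \<Longrightarrow> b \<noteq> a \<Longrightarrow> T (mono_poly b) = 0" by blast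
    have kl: "k_linear T" using T diff_ops_k_linear by blast
    show ?case
    proof (intro exI[of _ "\<lambda>f. T (partial i f)"] conjI)
      show "(\<lambda>f. T (partial i f)) \<in> diff_ops (total_deg (a + unit_exp i))"
        using diff_ops_comp[OF T(1) partial_diff_ops] by (simp add: total_deg_add)
      show "S (\<lambda>f. T (partial i f))" using co[OF Dj[OF T(1)] partial_D T(2) d] .
      have "of_nat (Suc (lk a i)) \<noteq> (0 :: 'k)" using ch by (simp add: of_nat_eq_0_iff_char_dvd del: of_nat_Suc)
      then show "\<exists>c. c \<noteq> 0 \<and> T (partial i (mono_poly (a + unit_exp i))) = const_poly c"
        using T by (intro exI[of _ "of_nat (Suc (lk a i)) * c"])
          (auto simp: partial_mono k_linearD[OF kl] lookup_add const_poly_simps simp del: of_nat_Suc)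
      show "\<forall>b. total_deg b \<le> total_deg (a + unit_exp i) \<and> b \<noteq> a + unit_exp i \<longrightarrow> T (partial i (mono_poly b)) = 0"
      proof (intro allI impI)
        fix b assume b: "total_deg b \<le> total_deg (a + unit_exp i) \<and> b \<noteq> a + unit_exp i"
        show "T (partial i (mono_poly b)) = 0"
        proof (cases "lk b i")
          case 0
          then show ?thesis by (simp add: partial_mono const_poly_simps k_linearD[OF kl])
        next
          case (Suc l)
          then have e: "b = (b - unit_exp i) + unit_exp i"
            by (intro poly_mapping_eqI) (auto simp: lookup_add lookup_minus lookup_single when_def)
          then have "total_deg b = total_deg (b - unit_exp i) + 1" by (metis total_deg_add total_deg_unit)
          then have "T (mono_poly (b - unit_exp i)) = 0" using b e T(5) by (auto simp: total_deg_add)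
          then show ?thesis by (simp add: partial_mono k_linearD[OF kl])
        qed
      qed
    qed
  qed
  \<comment> \<open>The monomials are added by increasing degree, so that a correction at \<open>a\<close> does not disturb the earlier ones.\<close>
  have agree: "\<exists>Q. Q \<in> diff_ops j \<and> S Q \<and> (\<forall>a\<in>A. Q (mono_poly a) = P (mono_poly a))"
    if "finite A" "\<forall>a\<in>A. total_deg a \<le> j" for A :: "'n expo set"
    using that
  proof (induction A rule: finite_ranking_induct[where f = total_deg])
    case empty
    then show ?case using m[of 0] diff_ops_mult[of 0] diff_ops_mono[of 0 j] by blast
  next
    case (insert a A)
    show ?case
    proof (cases "a \<in> A")
      case True
      then show ?thesis using insert by (simp add: insert_absorb)
    next
      case False
      from insert obtain Q where Q: "Q \<in> diff_ops j" "S Q" "\<forall>a\<in>A. Q (mono_poly a) = P (mono_poly a)" by auto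
      from T[of a] obtain T c where T: "T \<in> diff_ops (total_deg a)" "S T" "c \<noteq> 0" "T (mono_poly a) = const_poly c"
        "\<And>b. total_deg b \<le> total_deg a \<Longrightarrow> b \<noteq> a \<Longrightarrow> T (mono_poly b) = 0" by blast
      define r where "r = const_poly (inverse c) * (P (mono_poly a) - Q (mono_poly a))"
      have Tj: "T \<in> diff_ops j" using T(1) insert.prems diff_ops_mono[of "total_deg a" j] by auto
      have "const_poly c * const_poly (inverse c) = (1 :: ('k, 'n) mpoly)"
        using T(3) by (simp flip: const_poly_simps)
      moreover have "r * const_poly c = (const_poly c * const_poly (inverse c)) * (P (mono_poly a) - Q (mono_poly a))"
        by (simp only: r_def ac_simps)
      ultimately have rc: "r * const_poly c = P (mono_poly a) - Q (mono_poly a)" by simp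
      show ?thesis
      proof (intro exI[of _ "\<lambda>f. Q f + r * T f"] conjI ballI)
        show "(\<lambda>f. Q f + r * T f) \<in> diff_ops j" using Q Tj by (intro diff_ops_add diff_ops_lmult)
        show "S (\<lambda>f. Q f + r * T f)"
          using Q T Tj Dj by (intro ad co[of "(*) r" T] m D_ops_lmult D_ops_mult) auto
        fix b assume b: "b \<in> insert a A"
        show "Q (mono_poly b) + r * T (mono_poly b) = P (mono_poly b)"
        proof (cases "b = a")
          case True
          then show ?thesis using T(4) rc by simp
        next
          case False
          then have "b \<in> A" using b by simp
          then show ?thesis using Q(3) T(5)[OF insert.hyps(2) False] by simp
        qed
      qed
    qed
  qed
  have fin: "finite {a :: 'n expo. total_deg a \<le> j}"
  proof (rule finite_subset)
    show "{a :: 'n expo. total_deg a \<le> j} \<subseteq> Abs_poly_mapping ` (UNIV \<rightarrow>\<^sub>E {..j})"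
    proof
      fix a :: "'n expo" assume "a \<in> {a. total_deg a \<le> j}"
      then have "lk a i \<le> j" for i
        using member_le_sum[of i UNIV "lk a"] by (auto simp: total_deg_def)
      then show "a \<in> Abs_poly_mapping ` (UNIV \<rightarrow>\<^sub>E {..j})"
        by (intro image_eqI[of _ _ "lk a"]) (auto simp: lookup_inverse)
    qed
  qed (auto intro!: finite_imageI finite_PiE)
  obtain Q where Q: "Q \<in> diff_ops j" "S Q" "\<forall>a\<in>{a. total_deg a \<le> j}. Q (mono_poly a) = P (mono_poly a)"
    using agree[OF fin] by auto
  have "(\<lambda>f. P f + -1 * Q f) \<in> diff_ops j" using j Q by (intro diff_ops_add diff_ops_lmult)
  then have "P f + -1 * Q f = 0" for f
    by (rule diff_ops_zero_on_monomials) (use Q(3) in auto)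
  then have "P = Q" by (auto simp: fun_eq_iff)
  then show ?thesis using Q by simp
qed

section \<open>Weights\<close>

subsection \<open>Binomial coefficients of integers\<close>

lemma int_binom_0 [simp]: "int_binom a 0 = 1"
  by (simp add: int_binom_def)

lemma int_binom_Suc: "int_binom (a + 1) (Suc t) = int_binom a t + int_binom a (Suc t)"
  using gbinomial_int_Suc_Suc[of a t, unfolded gbinomial_prod_rev atLeast0LessThan]
  by (simp only: int_binom_def)

lemma int_binom_nat: "int_binom (int n) t = int (n choose t)"
  using int_binomial[of n t, unfolded gbinomial_prod_rev atLeast0LessThan]
  by (simp only: int_binom_def)

lemma int_binom_1 [simp]: "int_binom a (Suc 0) = a"
  by (simp add: int_binom_def)

text \<open>
  Distinct integers are separated by binomial coefficients modulo every prime: by Pascal's rule the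
  set of pairs that are not separated is invariant under translation, and \<open>0\<close> is separated from
  \<open>d > 0\<close> by \<open>d choose d = 1\<close>.
\<close>

lemma int_binom_separates:
  assumes "a \<noteq> b"
  shows "\<exists>t. of_int (int_binom a t) \<noteq> (of_int (int_binom b t) :: 'k::field)"
proof (rule ccontr)
  assume "\<not> ?thesis"
  then have eq: "of_int (int_binom a t) = (of_int (int_binom b t) :: 'k)" for t by blast
  define Z where "Z c \<longleftrightarrow> (\<forall>t. of_int (int_binom (a + c) t) = (of_int (int_binom (b + c) t) :: 'k))" for c
  have Z0: "Z 0" using eq by (simp add: Z_def)
  have up: "Z (c + 1)" if "Z c" for c
    unfolding Z_def
  proof
    fix t
    show "of_int (int_binom (a + (c + 1)) t) = (of_int (int_binom (b + (c + 1)) t) :: 'k)"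
      using that int_binom_Suc[of "a + c"] int_binom_Suc[of "b + c"] unfolding Z_def
      by (cases t) (auto simp: add.assoc)
  qed
  have down: "Z (c - 1)" if "Z c" for c
    unfolding Z_def
  proof
    fix t
    show "of_int (int_binom (a + (c - 1)) t) = (of_int (int_binom (b + (c - 1)) t) :: 'k)"
    proof (induction t)
      case (Suc t)
      have "of_int (int_binom (a + c) (Suc t)) = (of_int (int_binom (b + c) (Suc t)) :: 'k)"
        using that by (auto simp: Z_def)
      then show ?case using Suc int_binom_Suc[of "a + (c - 1)" t] int_binom_Suc[of "b + (c - 1)" t] by simp
    qed simp
  qed
  have Z: "Z c" for c
    using Z0 by (induction c rule: int_induct[where k = 0]) (auto intro: up down)
  have ne: "\<not> (\<forall>t. of_int (int_binom 0 t) = (of_int (int_binom (int d) t) :: 'k))" if "d > 0" for d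
  proof -
    have "int_binom 0 d = 0" "int_binom (int d) d = 1"
      using int_binom_nat[of 0 d] int_binom_nat[of d d] that by auto
    then show ?thesis by (intro notI) (metis of_int_0 of_int_1 zero_neq_one)
  qed
  show False
  proof (cases "a < b")
    case True
    then show False using Z[of "- a"] ne[of "nat (b - a)"] by (simp add: Z_def)
  next
    case False
    with assms have "b < a" by simp
    then show False using Z[of "- b"] ne[of "nat (a - b)"] by (simp add: Z_def)
  qed
qed

subsection \<open>Modules over the ring of differential operators\<close>

locale D_module = left_module D_ring M
  for M :: "('k::field, 'n::{finite,linorder}, 'm) dmodule" (structure)
begin

lemma op_add: "P \<in> D_ops \<Longrightarrow> Q \<in> D_ops \<Longrightarrow> x \<in> carrier M \<Longrightarrow> (\<lambda>f. P f + Q f) \<odot> x = P \<odot> x \<oplus> Q \<odot> x"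
  using smult_l_distr[of P Q x] by (simp add: D_ring_simps(5))

lemma op_comp: "P \<in> D_ops \<Longrightarrow> Q \<in> D_ops \<Longrightarrow> x \<in> carrier M \<Longrightarrow> (\<lambda>f. P (Q f)) \<odot> x = P \<odot> (Q \<odot> x)"
  using smult_assoc[of P Q x] by (simp add: D_ring_simps(2))

lemma op_id [simp]: "x \<in> carrier M \<Longrightarrow> (\<lambda>f. f) \<odot> x = x"
  using smult_one[of x] by (simp add: D_ring_simps(3))

lemma op_zero [simp]: "x \<in> carrier M \<Longrightarrow> (\<lambda>f. 0) \<odot> x = \<zero>"
  using zero_smult[of x] by (simp add: D_ring_simps(4))

lemma rmul_closed [simp]: "x \<in> carrier M \<Longrightarrow> (*) r \<odot> x \<in> carrier M"
  by (simp add: smult_closed D_ops_mult)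

lemma rmul_rmul: "x \<in> carrier M \<Longrightarrow> (*) r \<odot> ((*) s \<odot> x) = (*) (r * s) \<odot> x"
  using op_comp[OF D_ops_mult D_ops_mult, of x r s] by (simp add: mult.assoc[symmetric])

lemma rmul_one [simp]: "x \<in> carrier M \<Longrightarrow> (*) 1 \<odot> x = x"
  unfolding times_one_fun by simp

lemma rmul_zero [simp]: "x \<in> carrier M \<Longrightarrow> (*) 0 \<odot> x = \<zero>"
  using op_zero[of x] by (simp add: fun_eq_iff[of "(*) 0" "\<lambda>f. 0", THEN iffD2])

lemma rmul_add: "x \<in> carrier M \<Longrightarrow> (*) (r + s) \<odot> x = (*) r \<odot> x \<oplus> (*) s \<odot> x"
  using op_add[OF D_ops_mult D_ops_mult, of x r s] by (simp add: distrib_right[symmetric])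

lemma rmul_commute: "x \<in> carrier M \<Longrightarrow> (*) r \<odot> ((*) s \<odot> x) = (*) s \<odot> ((*) r \<odot> x)"
  by (simp add: rmul_rmul mult.commute)

lemma op_const: "P \<in> D_ops \<Longrightarrow> x \<in> carrier M \<Longrightarrow> P \<odot> ((*) (const_poly c) \<odot> x) = (*) (const_poly c) \<odot> (P \<odot> x)"
  using op_comp[OF _ D_ops_mult, of P x "const_poly c"] op_comp[OF D_ops_mult, of P x "const_poly c"]
  by (simp add: k_linearD(2)[OF D_ops_k_linear])

lemma op_comm:
  assumes "P \<in> D_ops" "Q \<in> D_ops" "P' \<in> D_ops" "Q' \<in> D_ops" "\<And>f. P (Q f) = P' (Q' f)" "x \<in> carrier M"
  shows "P \<odot> (Q \<odot> x) = P' \<odot> (Q' \<odot> x)"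
  using op_comp[OF assms(1,2,6)] op_comp[OF assms(3,4,6)] assms(5) by simp

end

lemma D_moduleI: "left_module D_ring M \<Longrightarrow> D_module M"
  by (simp add: D_module_def)

subsection \<open>The algebra generated by the Euler operators\<close>

text \<open>
  Such an operator acts on every weight space as a scalar, so it comes with a function on weights,
  its symbol.
\<close>

inductive eu :: "('k::field, 'n::{finite,linorder}) poly_op \<Rightarrow> (('n \<Rightarrow> int) \<Rightarrow> 'k) \<Rightarrow> bool" where
  const: "eu ((*) (const_poly c)) (\<lambda>_. c)"
| euler: "eu (euler_op i t) (\<lambda>b. of_int (int_binom (b i) t))"
| add: "eu P \<phi> \<Longrightarrow> eu Q \<psi> \<Longrightarrow> eu (\<lambda>f. P f + Q f) (\<lambda>b. \<phi> b + \<psi> b)"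
| comp: "eu P \<phi> \<Longrightarrow> eu Q \<psi> \<Longrightarrow> eu (\<lambda>f. P (Q f)) (\<lambda>b. \<phi> b * \<psi> b)"

lemma eu_D: "eu P \<phi> \<Longrightarrow> P \<in> D_ops"
  by (induction rule: eu.induct) (auto intro: D_ops_mult euler_op_D D_ops_add D_ops_comp)

lemma eu_scale: "eu P \<phi> \<Longrightarrow> eu (\<lambda>f. const_poly c * P f) (\<lambda>b. c * \<phi> b)"
  using eu.comp[OF eu.const] .

lemma eu_diff: "eu P \<phi> \<Longrightarrow> eu Q \<psi> \<Longrightarrow> eu (\<lambda>f. P f - Q f) (\<lambda>b. \<phi> b - \<psi> b)"
  using eu.add[OF _ eu_scale[of Q \<psi> "-1"]] by (simp add: const_poly_simps)

lemma eu_id: "eu (\<lambda>f. f) (\<lambda>_. 1)"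
  using eu.const[of 1] by (simp add: const_poly_simps times_one_fun)

definition wsub :: "('n \<Rightarrow> int) \<Rightarrow> 'n expo \<Rightarrow> 'n \<Rightarrow> int" where "wsub b a = (\<lambda>i. b i - int (lk a i))"
definition wadd :: "('n \<Rightarrow> int) \<Rightarrow> 'n expo \<Rightarrow> 'n \<Rightarrow> int" where "wadd b a = (\<lambda>i. b i + int (lk a i))"

lemma wadd_wsub [simp]: "wadd (wsub b a) a = b" "wsub (wadd b a) a = b" "wsub b 0 = b" "wadd b 0 = b"
  by (simp_all add: wadd_def wsub_def)

lemma wadd_add: "wadd b (a + a') = wadd (wadd b a) a'" "wsub b (a + a') = wsub (wsub b a) a'"
  by (auto simp: wadd_def wsub_def lookup_add)

text \<open>
  Moving \<open>x\<^sub>i\<close> across the algebra translates the symbols by a unit vector. The translate of \<open>b\<^sub>i choose t\<close>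
  by \<open>-1\<close> is, by Pascal's rule, again a combination of such functions.
\<close>

lemma eu_shift_var:
  "eu P \<phi> \<Longrightarrow> \<exists>P'. eu P' (\<lambda>b. \<phi> (wsub b (unit_exp i))) \<and> (\<forall>f. var_poly i * P f = P' (var_poly i * f))"
proof (induction rule: eu.induct)
  case (const c)
  show ?case by (intro exI[of _ "(*) (const_poly c)"]) (auto intro: eu.const simp: mult.left_commute)
next
  case (euler j t)
  show ?case
  proof (cases "j = i")
    case False
    then have "(\<lambda>b :: 'a \<Rightarrow> int. of_int (int_binom (wsub b (unit_exp i) j) t)) = (\<lambda>b. of_int (int_binom (b j) t) :: 'b)"
      by (simp add: wsub_def lookup_single)
    then show ?thesis using False eu.euler[of j t] by (intro exI[of _ "euler_op j t"]) (auto simp: euler_op_other_var)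
  next
    case True
    have "\<exists>P'. eu P' (\<lambda>b. of_int (int_binom (wsub b (unit_exp i) i) t)) \<and>
        (\<forall>f :: ('b, 'a) mpoly. var_poly i * euler_op i t f = P' (var_poly i * f))"
    proof (induction t)
      case 0
      show ?case using eu_id by (intro exI[of _ "\<lambda>f. f"]) (auto simp: euler_op_0)
    next
      case (Suc t)
      then obtain P' where P': "eu P' (\<lambda>b. of_int (int_binom (wsub b (unit_exp i) i) t))"
        "\<And>f :: ('b, 'a) mpoly. var_poly i * euler_op i t f = P' (var_poly i * f)" by blast
      have "of_int (int_binom (b i) (Suc t)) - of_int (int_binom (wsub b (unit_exp i) i) t) =
          (of_int (int_binom (wsub b (unit_exp i) i) (Suc t)) :: 'b)" for b :: "'a \<Rightarrow> int"
        using int_binom_Suc[of "b i - 1" t] by (simp add: wsub_def lookup_single)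
      then show ?case using eu_diff[OF eu.euler[of i "Suc t"] P'(1)]
        by (intro exI[of _ "\<lambda>f. euler_op i (Suc t) f - P' f"]) (auto simp: euler_op_var P'(2)[symmetric])
    qed
    then show ?thesis using True by simp
  qed
next
  case (add P \<phi> Q \<psi>)
  then obtain P' Q' where "eu P' (\<lambda>b. \<phi> (wsub b (unit_exp i)))" "eu Q' (\<lambda>b. \<psi> (wsub b (unit_exp i)))"
    "\<And>f. var_poly i * P f = P' (var_poly i * f)" "\<And>f. var_poly i * Q f = Q' (var_poly i * f)" by metis
  then show ?case by (intro exI[of _ "\<lambda>f. P' f + Q' f"]) (auto intro: eu.add simp: distrib_left)
next
  case (comp P \<phi> Q \<psi>)
  then obtain P' Q' where "eu P' (\<lambda>b. \<phi> (wsub b (unit_exp i)))" "eu Q' (\<lambda>b. \<psi> (wsub b (unit_exp i)))"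
    "\<And>f. var_poly i * P f = P' (var_poly i * f)" "\<And>f. var_poly i * Q f = Q' (var_poly i * f)" by metis
  then show ?case by (intro exI[of _ "\<lambda>f. P' (Q' f)"]) (auto intro: eu.comp)
qed

lemma wsub_commute: "wsub (wsub b (unit_exp i)) a = wsub (wsub b a) (unit_exp i)"
  by (simp add: wsub_def algebra_simps)

lemma eu_shift:
  "eu P \<phi> \<Longrightarrow> \<exists>P'. eu P' (\<lambda>b. \<phi> (wsub b a)) \<and> (\<forall>f. mono_poly a * P f = P' (mono_poly a * f))"
proof (induction a rule: exp_induct)
  case zero
  then show ?case by (intro exI[of _ P]) (simp add: single_one)
next
  case (Suc a i)
  then obtain P' where P': "eu P' (\<lambda>b. \<phi> (wsub b a))" "\<And>f. mono_poly a * P f = P' (mono_poly a * f)" by blast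
  from eu_shift_var[OF P'(1), of i] obtain P'' where
    "eu P'' (\<lambda>b. \<phi> (wsub (wsub b (unit_exp i)) a))" "\<And>f. var_poly i * P' f = P'' (var_poly i * f)" by blast
  then show ?case using P'
    by (intro exI[of _ P'']) (auto simp: single_Suc_exp mult.assoc wadd_add(2)[of _ a "unit_exp i"] wsub_commute)
qed

lemma eu_unshift_var:
  "eu P \<phi> \<Longrightarrow> \<exists>P'. eu P' (\<lambda>b. \<phi> (wadd b (unit_exp i))) \<and> (\<forall>f. P (var_poly i * f) = var_poly i * P' f)"
proof (induction rule: eu.induct)
  case (const c)
  show ?case by (intro exI[of _ "(*) (const_poly c)"]) (auto intro: eu.const simp: mult.left_commute)
next
  case (euler j t)
  show ?case
  proof (cases "j = i")
    case False
    then have "(\<lambda>b :: 'a \<Rightarrow> int. of_int (int_binom (wadd b (unit_exp i) j) t)) = (\<lambda>b. of_int (int_binom (b j) t) :: 'b)"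
      by (simp add: wadd_def lookup_single)
    then show ?thesis using False eu.euler[of j t] by (intro exI[of _ "euler_op j t"]) (auto simp: euler_op_other_var)
  next
    case True
    show ?thesis
    proof (cases t)
      case 0
      then show ?thesis using eu_id by (intro exI[of _ "\<lambda>f. f"]) (auto simp: euler_op_0)
    next
      case (Suc s)
      have e: "of_int (int_binom (wadd b (unit_exp i) i) (Suc s)) =
          of_int (int_binom (b i) (Suc s)) + (of_int (int_binom (b i) s) :: 'b)" for b :: "'a \<Rightarrow> int"
        using int_binom_Suc[of "b i" s] by (simp add: wadd_def lookup_single add.commute)
      then show ?thesis using eu.add[OF eu.euler[of i "Suc s"] eu.euler[of i s]] True Suc
        by (intro exI[of _ "\<lambda>f. euler_op i (Suc s) f + euler_op i s f"]) (auto simp: e euler_op_var distrib_left)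
    qed
  qed
next
  case (add P \<phi> Q \<psi>)
  then obtain P' Q' where "eu P' (\<lambda>b. \<phi> (wadd b (unit_exp i)))" "eu Q' (\<lambda>b. \<psi> (wadd b (unit_exp i)))"
    "\<And>f. P (var_poly i * f) = var_poly i * P' f" "\<And>f. Q (var_poly i * f) = var_poly i * Q' f" by metis
  then show ?case by (intro exI[of _ "\<lambda>f. P' f + Q' f"]) (auto intro: eu.add simp: distrib_left)
next
  case (comp P \<phi> Q \<psi>)
  then obtain P' Q' where "eu P' (\<lambda>b. \<phi> (wadd b (unit_exp i)))" "eu Q' (\<lambda>b. \<psi> (wadd b (unit_exp i)))"
    "\<And>f. P (var_poly i * f) = var_poly i * P' f" "\<And>f. Q (var_poly i * f) = var_poly i * Q' f" by metis
  then show ?case by (intro exI[of _ "\<lambda>f. P' (Q' f)"]) (auto intro: eu.comp)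
qed

text \<open>
  Interpolation: every weight \<open>w \<noteq> b\<close> contributes a factor whose symbol is \<open>0\<close> at \<open>w\<close> and \<open>1\<close> at \<open>b\<close>.
\<close>

lemma eu_projection:
  assumes "finite B"
  shows "\<exists>e \<phi>. eu e \<phi> \<and> \<phi> b = (1 :: 'k::field) \<and> (\<forall>w\<in>B. w \<noteq> b \<longrightarrow> \<phi> w = 0)"
  using assms
proof (induction B)
  case empty
  show ?case using eu_id by (intro exI conjI) auto
next
  case (insert w B)
  then obtain e \<phi> where e: "eu e \<phi>" "\<phi> b = (1 :: 'k)" "\<forall>w\<in>B. w \<noteq> b \<longrightarrow> \<phi> w = 0" by blast
  show ?case
  proof (cases "w = b")
    case True
    then show ?thesis using e by blast
  next
    case False
    then obtain i where "w i \<noteq> b i" by (auto simp: fun_eq_iff)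
    then obtain t where t: "of_int (int_binom (w i) t) \<noteq> (of_int (int_binom (b i) t) :: 'k)"
      using int_binom_separates by blast
    define c :: 'k where "c = of_int (int_binom (w i) t)"
    define d :: 'k where "d = inverse (of_int (int_binom (b i) t) - c)"
    have "eu (\<lambda>f. const_poly d * (euler_op i t (e f) - const_poly c * e f)) (\<lambda>v. d * (of_int (int_binom (v i) t) * \<phi> v - c * \<phi> v))"
      by (intro eu_scale eu_diff eu.comp[OF eu.euler] e(1))
    moreover have "of_int (int_binom (b i) t) - c \<noteq> 0" using t by (simp add: c_def)
    ultimately show ?thesis using e
      by (intro exI[of _ "\<lambda>f. const_poly d * (euler_op i t (e f) - const_poly c * e f)"]
            exI[of _ "\<lambda>v. d * (of_int (int_binom (v i) t) * \<phi> v - c * \<phi> v)"]) (auto simp: d_def c_def)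
  qed
qed

subsection \<open>Weight vectors and finite spectra\<close>

text \<open>
  Instead of as a finite sum of weight vectors with weights in \<open>B\<close>, an element is described by the
  operators that kill it. This is visibly inherited by submodules, quotients and sums.
\<close>

definition spec :: "('k::field, 'n::{finite,linorder}, 'm) dmodule \<Rightarrow> ('n \<Rightarrow> int) set \<Rightarrow> 'm \<Rightarrow> bool" where
  "spec M B x \<longleftrightarrow> x \<in> carrier M \<and> (\<forall>P \<phi>. eu P \<phi> \<and> (\<forall>b\<in>B. \<phi> b = 0) \<longrightarrow> P \<odot>\<^bsub>M\<^esub> x = \<zero>\<^bsub>M\<^esub>)"

definition weight_module :: "('k::field, 'n::{finite,linorder}, 'm) dmodule \<Rightarrow> bool" where
  "weight_module M \<longleftrightarrow> left_module D_ring M \<and> (\<forall>x\<in>carrier M. \<exists>B. finite B \<and> spec M B x)"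

lemma specD: "spec M B x \<Longrightarrow> eu P \<phi> \<Longrightarrow> (\<And>b. b \<in> B \<Longrightarrow> \<phi> b = 0) \<Longrightarrow> P \<odot>\<^bsub>M\<^esub> x = \<zero>\<^bsub>M\<^esub>"
  by (auto simp: spec_def)

lemma spec_carrier: "spec M B x \<Longrightarrow> x \<in> carrier M"
  by (simp add: spec_def)

lemma spec_mono: "spec M B x \<Longrightarrow> B \<subseteq> B' \<Longrightarrow> spec M B' x"
  unfolding spec_def by (meson subsetD)

lemma deg_part_carrier: "m \<in> deg_part M b \<Longrightarrow> m \<in> carrier M"
  by (simp add: deg_part_def)

context D_module begin

lemma eu_closed: "eu P \<phi> \<Longrightarrow> x \<in> carrier M \<Longrightarrow> P \<odot> x \<in> carrier M"
  using eu_D smult_closed by blast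

lemma eu_weight:
  assumes m: "m \<in> deg_part M b"
  shows "eu P \<phi> \<Longrightarrow> P \<odot> m = (*) (const_poly (\<phi> b)) \<odot> m"
proof (induction rule: eu.induct)
  case (euler i t)
  then show ?case using m by (simp add: deg_part_def)
next
  case (add P \<phi> Q \<psi>)
  then show ?case using deg_part_carrier[OF m] by (simp add: op_add eu_D const_poly_simps rmul_add)
next
  case (comp P \<phi> Q \<psi>)
  then show ?case using deg_part_carrier[OF m]
    by (simp add: op_comp eu_D op_const rmul_rmul const_poly_simps(4)
      mult.commute[of "const_poly (\<phi> b)" "const_poly (\<psi> b)"])
qed simp

lemma deg_part_iff:
  "m \<in> deg_part M b \<longleftrightarrow> m \<in> carrier M \<and> (\<forall>P \<phi>. eu P \<phi> \<longrightarrow> P \<odot> m = (*) (const_poly (\<phi> b)) \<odot> m)"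
proof
  assume m: "m \<in> deg_part M b"
  then show "m \<in> carrier M \<and> (\<forall>P \<phi>. eu P \<phi> \<longrightarrow> P \<odot> m = (*) (const_poly (\<phi> b)) \<odot> m)"
    using eu_weight[OF m] deg_part_carrier[OF m] by auto
next
  assume r: "m \<in> carrier M \<and> (\<forall>P \<phi>. eu P \<phi> \<longrightarrow> P \<odot> m = (*) (const_poly (\<phi> b)) \<odot> m)"
  then show "m \<in> deg_part M b"
    unfolding deg_part_def using eu.euler by (intro CollectI conjI allI) fast+
qed

text \<open>
  The constant \<open>\<phi> b\<close> is subtracted from \<open>P\<close>, which turns the eigenvalue equation into a vanishing condition.
\<close>

lemma deg_partI:
  assumes "m \<in> carrier M" "\<And>P \<phi>. eu P \<phi> \<Longrightarrow> \<phi> b = 0 \<Longrightarrow> P \<odot> m = \<zero>"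
  shows "m \<in> deg_part M b"
  unfolding deg_part_iff
proof (intro conjI allI impI)
  fix P and \<phi> :: "('n \<Rightarrow> int) \<Rightarrow> 'k" assume P: "eu P \<phi>"
  have "eu (\<lambda>f. P f + const_poly (- \<phi> b) * f) (\<lambda>v. \<phi> v + - \<phi> b)" by (intro eu.add P eu.const)
  then have "(\<lambda>f. P f + const_poly (- \<phi> b) * f) \<odot> m = \<zero>" using assms(2) by fastforce
  then have "P \<odot> m \<oplus> (*) (const_poly (- \<phi> b)) \<odot> m = \<zero>" using op_add[OF eu_D[OF P] D_ops_mult assms(1)] by simp
  moreover have "(*) (const_poly (\<phi> b)) \<odot> m \<oplus> (*) (const_poly (- \<phi> b)) \<odot> m = \<zero>"
    using assms(1) rmul_add[symmetric, of m "const_poly (\<phi> b)" "const_poly (- \<phi> b)"] by (simp add: const_poly_simps)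
  ultimately show "P \<odot> m = (*) (const_poly (\<phi> b)) \<odot> m"
    using assms(1) eu_closed[OF P assms(1)] by (metis M.add.right_cancel rmul_closed)
qed fact

lemma deg_part_add: "x \<in> deg_part M b \<Longrightarrow> y \<in> deg_part M b \<Longrightarrow> x \<oplus> y \<in> deg_part M b"
  by (simp add: deg_part_def smult_r_distr euler_op_D D_ops_mult)

lemma deg_part_zero: "\<zero> \<in> deg_part M b"
  by (simp add: deg_part_def euler_op_D D_ops_mult)

lemma spec_weight: "m \<in> deg_part M b \<Longrightarrow> spec M {b} m"
  using deg_part_carrier[of m M b] by (auto simp: spec_def eu_weight const_poly_simps)

lemma spec_add: "spec M B x \<Longrightarrow> spec M B' y \<Longrightarrow> spec M (B \<union> B') (x \<oplus> y)"
  unfolding spec_def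
proof (intro conjI allI impI)
  assume x: "x \<in> carrier M \<and> (\<forall>P \<phi>. eu P \<phi> \<and> (\<forall>b\<in>B. \<phi> b = 0) \<longrightarrow> P \<odot> x = \<zero>)"
    and y: "y \<in> carrier M \<and> (\<forall>P \<phi>. eu P \<phi> \<and> (\<forall>b\<in>B'. \<phi> b = 0) \<longrightarrow> P \<odot> y = \<zero>)"
  then show "x \<oplus> y \<in> carrier M" by simp
  fix P and \<phi> :: "('n \<Rightarrow> int) \<Rightarrow> 'k" assume P: "eu P \<phi> \<and> (\<forall>b\<in>B \<union> B'. \<phi> b = 0)"
  then have "P \<odot> x = \<zero>" "P \<odot> y = \<zero>" using x y by (meson UnI1 UnI2)+
  then show "P \<odot> (x \<oplus> y) = \<zero>" using P x y smult_r_distr[of P x y] eu_D by auto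
qed

lemma spec_zero: "spec M {} \<zero>"
  by (auto simp: spec_def eu_D)

lemma spec_empty: "spec M {} x \<Longrightarrow> x = \<zero>"
  using specD[OF _ eu_id] op_id spec_carrier by fastforce

lemma projection_weight:
  assumes "spec M B x" "eu e \<phi>" "\<And>w. w \<in> B \<Longrightarrow> w \<noteq> b \<Longrightarrow> \<phi> w = 0"
  shows "e \<odot> x \<in> deg_part M b"
proof (rule deg_partI)
  have x: "x \<in> carrier M" by (rule spec_carrier[OF assms(1)])
  then show "e \<odot> x \<in> carrier M" using eu_closed[OF assms(2)] by simp
  fix P and \<psi> :: "('n \<Rightarrow> int) \<Rightarrow> 'k" assume P: "eu P \<psi>" "\<psi> b = 0"
  have "(\<lambda>f. P (e f)) \<odot> x = \<zero>"
    by (rule specD[OF assms(1) eu.comp[OF P(1) assms(2)]]) (use P assms(3) in auto)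
  then show "P \<odot> (e \<odot> x) = \<zero>" using op_comp[OF eu_D[OF P(1)] eu_D[OF assms(2)] x] by simp
qed

text \<open>
  The projection onto the weight \<open>b\<close> splits off the component of this weight; the remainder has its
  spectrum in the smaller set. This is the decomposition into weight vectors, in the form in which it is used.
\<close>

lemma spec_induct [consumes 2, case_names zero weight add]:
  assumes "finite B" "spec M B x" and Q0: "Q \<zero>"
    and Qw: "\<And>b m. b \<in> B \<Longrightarrow> m \<in> deg_part M b \<Longrightarrow> Q m"
    and Qa: "\<And>y z. y \<in> carrier M \<Longrightarrow> z \<in> carrier M \<Longrightarrow> Q y \<Longrightarrow> Q z \<Longrightarrow> Q (y \<oplus> z)"
  shows "Q x"
  using assms(1,2) Qw
proof (induction B arbitrary: x)
  case empty
  then show ?case using spec_empty Q0 by blast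
next
  case (insert b B)
  obtain e and \<phi> :: "_ \<Rightarrow> 'k" where e: "eu e \<phi>" "\<phi> b = 1" "\<forall>w\<in>B. w \<noteq> b \<longrightarrow> \<phi> w = 0"
    using eu_projection[OF insert(1)] by blast
  have x: "x \<in> carrier M" by (rule spec_carrier[OF insert(4)])
  have e': "eu (\<lambda>f. f - e f) (\<lambda>v. 1 - \<phi> v)" by (rule eu_diff[OF eu_id e(1)])
  have "e \<odot> x \<in> deg_part M b" using projection_weight[OF insert(4) e(1)] e(3) by blast
  then have 1: "Q (e \<odot> x)" using insert.prems(2) by blast
  have "spec M B ((\<lambda>f. f - e f) \<odot> x)"
    unfolding spec_def
  proof (intro conjI allI impI)
    show "(\<lambda>f. f - e f) \<odot> x \<in> carrier M" using eu_closed[OF e' x] .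
    fix P and \<psi> :: "('n \<Rightarrow> int) \<Rightarrow> 'k" assume P: "eu P \<psi> \<and> (\<forall>b\<in>B. \<psi> b = 0)"
    have "(\<lambda>f. P (f - e f)) \<odot> x = \<zero>"
      by (rule specD[OF insert(4) eu.comp[OF _ e', of P \<psi>]]) (use P e in auto)
    then show "P \<odot> ((\<lambda>f. f - e f) \<odot> x) = \<zero>" using op_comp[OF _ eu_D[OF e'] x, of P] P eu_D[of P \<psi>] by simp
  qed
  then have 2: "Q ((\<lambda>f. f - e f) \<odot> x)" using insert by blast
  have "e \<odot> x \<oplus> (\<lambda>f. f - e f) \<odot> x = x"
    using op_add[OF eu_D[OF e(1)] eu_D[OF e'] x] x by simp
  then show ?case using Qa[OF _ _ 1 2] eu_closed[OF e(1) x] eu_closed[OF e' x] by simp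
qed

lemma var_weight:
  assumes "m \<in> deg_part M b" shows "(*) (var_poly i) \<odot> m \<in> deg_part M (wadd b (unit_exp i))"
proof (rule deg_partI)
  have m: "m \<in> carrier M" by (rule deg_part_carrier[OF assms])
  then show "(*) (var_poly i) \<odot> m \<in> carrier M" by simp
  fix P and \<phi> :: "('n \<Rightarrow> int) \<Rightarrow> 'k" assume P: "eu P \<phi>" "\<phi> (wadd b (unit_exp i)) = 0"
  then obtain P' where P': "eu P' (\<lambda>b. \<phi> (wadd b (unit_exp i)))" "\<And>f. P (var_poly i * f) = var_poly i * P' f"
    using eu_unshift_var by blast
  have "P \<odot> ((*) (var_poly i) \<odot> m) = (*) (var_poly i) \<odot> (P' \<odot> m)"
    by (rule op_comm) (use P P' m in \<open>auto intro: eu_D D_ops_mult\<close>)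
  also have "P' \<odot> m = \<zero>" using eu_weight[OF assms P'(1)] P(2) m by (simp add: const_poly_simps)
  finally show "P \<odot> ((*) (var_poly i) \<odot> m) = \<zero>" by (simp add: D_ops_mult)
qed

lemma mono_weight:
  "m \<in> deg_part M b \<Longrightarrow> (*) (mono_poly a) \<odot> m \<in> deg_part M (wadd b a)"
proof (induction a rule: exp_induct)
  case zero
  then show ?case using deg_part_carrier[OF zero] by (simp add: single_one)
next
  case (Suc a i)
  then have "(*) (var_poly i) \<odot> ((*) (mono_poly a) \<odot> m) \<in> deg_part M (wadd (wadd b a) (unit_exp i))"
    using var_weight by blast
  then show ?case using deg_part_carrier[OF Suc(2)] by (simp add: rmul_rmul single_Suc_exp wadd_add)
qed

text \<open>
  Used for fractions, whose spectrum is found after multiplication by the denominator.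
\<close>

lemma mono_spec_cancel:
  assumes inj: "\<And>y. y \<in> carrier M \<Longrightarrow> (*) (mono_poly a) \<odot> y = \<zero> \<Longrightarrow> y = \<zero>"
    and x: "x \<in> carrier M" "spec M ((\<lambda>b. wadd b a) ` B) ((*) (mono_poly a) \<odot> x)"
  shows "spec M B x"
  unfolding spec_def
proof (intro conjI allI impI)
  fix P and \<phi> :: "('n \<Rightarrow> int) \<Rightarrow> 'k" assume P: "eu P \<phi> \<and> (\<forall>b\<in>B. \<phi> b = 0)"
  then obtain P' where P': "eu P' (\<lambda>b. \<phi> (wsub b a))" "\<And>f. mono_poly a * P f = P' (mono_poly a * f)"
    using eu_shift by blast
  have "(*) (mono_poly a) \<odot> (P \<odot> x) = P' \<odot> ((*) (mono_poly a) \<odot> x)"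
    by (rule op_comm) (use P P' x in \<open>auto intro: eu_D D_ops_mult\<close>)
  also have "\<dots> = \<zero>" by (rule specD[OF x(2) P'(1)]) (use P in auto)
  finally show "P \<odot> x = \<zero>" using inj[OF eu_closed] P x by blast
qed (fact x)

text \<open>
  In positive characteristic the Euler operators of higher order are not polynomials in those of order one.
  Their eigenvalues on \<open>\<partial>\<^sub>i m\<close> are found by induction on \<open>t\<close>, from a commutation rule of the same form as
  Pascal's rule for the eigenvalues.
\<close>

lemma partial_weight:
  assumes m: "m \<in> deg_part M b" shows "partial i \<odot> m \<in> deg_part M (wsub b (unit_exp i))"
proof -
  have mc: "m \<in> carrier M" by (rule deg_part_carrier[OF m])
  then have pc: "partial i \<odot> m \<in> carrier M" by (simp add: smult_closed partial_D)
  have "euler_op j t \<odot> (partial i \<odot> m) = (*) (const_poly (of_int (int_binom (wsub b (unit_exp i) j) t))) \<odot> (partial i \<odot> m)" for j t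
  proof (cases "j = i")
    case False
    have "euler_op j t (partial i f) = partial i (euler_op j t f)" for f :: "('k, 'n) mpoly"
      using False by (intro poly_mapping_eqI) (simp add: lookup_euler_op lookup_partial lookup_add lookup_single mult.left_commute)
    then have "euler_op j t \<odot> (partial i \<odot> m) = partial i \<odot> (euler_op j t \<odot> m)"
      by (intro op_comm) (auto simp: euler_op_D partial_D mc)
    also have "\<dots> = (*) (const_poly (of_int (int_binom (b j) t))) \<odot> (partial i \<odot> m)"
      using m mc by (simp add: deg_part_def op_const partial_D)
    finally show ?thesis using False by (simp add: wsub_def lookup_single)
  next
    case True
    have "euler_op i t \<odot> (partial i \<odot> m) = (*) (const_poly (of_int (int_binom (b i - 1) t))) \<odot> (partial i \<odot> m)" for t
    proof (induction t)
      case 0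
      show ?case using pc by (simp add: euler_op_0 const_poly_simps)
    next
      case (Suc t)
      have "euler_op i (Suc t) (partial i f) + euler_op i t (partial i f) = partial i (euler_op i (Suc t) f)" for f :: "('k, 'n) mpoly"
        by (intro poly_mapping_eqI) (simp add: lookup_euler_op lookup_partial lookup_add distrib_right distrib_left mult.left_commute add_ac)
      then have "(\<lambda>f. euler_op i (Suc t) (partial i f) + euler_op i t (partial i f)) \<odot> m = (\<lambda>f. partial i (euler_op i (Suc t) f)) \<odot> m"
        by presburger
      moreover have "(\<lambda>f. euler_op i (Suc t) (partial i f) + euler_op i t (partial i f)) \<odot> m =
          euler_op i (Suc t) \<odot> (partial i \<odot> m) \<oplus> euler_op i t \<odot> (partial i \<odot> m)"
        using op_add[OF D_ops_comp[OF euler_op_D partial_D] D_ops_comp[OF euler_op_D partial_D] mc]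
        by (simp add: op_comp euler_op_D partial_D mc)
      moreover have "(\<lambda>f. partial i (euler_op i (Suc t) f)) \<odot> m = (*) (const_poly (of_int (int_binom (b i) (Suc t)))) \<odot> (partial i \<odot> m)"
        using m mc by (simp add: op_comp euler_op_D partial_D deg_part_def op_const)
      moreover have "(*) (const_poly (of_int (int_binom (b i) (Suc t)))) \<odot> (partial i \<odot> m) =
          (*) (const_poly (of_int (int_binom (b i - 1) (Suc t)))) \<odot> (partial i \<odot> m)
          \<oplus> (*) (const_poly (of_int (int_binom (b i - 1) t))) \<odot> (partial i \<odot> m)"
        using int_binom_Suc[of "b i - 1" t] pc by (simp add: rmul_add[symmetric] const_poly_simps add.commute)
      ultimately have "euler_op i (Suc t) \<odot> (partial i \<odot> m) \<oplus> (*) (const_poly (of_int (int_binom (b i - 1) t))) \<odot> (partial i \<odot> m)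
          = (*) (const_poly (of_int (int_binom (b i - 1) (Suc t)))) \<odot> (partial i \<odot> m)
          \<oplus> (*) (const_poly (of_int (int_binom (b i - 1) t))) \<odot> (partial i \<odot> m)" using Suc by simp
      then show ?case using pc by (simp add: M.add.right_cancel smult_closed euler_op_D)
    qed
    then show ?thesis using True by (simp add: wsub_def)
  qed
  then show ?thesis using pc by (simp add: deg_part_def)
qed

lemma mod_hom_weight:
  assumes "f \<in> mod_hom D_ring M N" "m \<in> deg_part M b" shows "f m \<in> deg_part N b"
  using assms mod_homD[OF assms(1)] by (auto simp: deg_part_def euler_op_D D_ops_mult) (metis D_ops_mult euler_op_D)

lemma mod_hom_spec:
  assumes "left_module D_ring N" "f \<in> mod_hom D_ring M N" "spec M B x" shows "spec N B (f x)"
  unfolding spec_def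
proof (intro conjI allI impI)
  have x: "x \<in> carrier M" by (rule spec_carrier[OF assms(3)])
  then show "f x \<in> carrier N" using mod_homD[OF assms(2)] by simp
  fix P and \<phi> :: "('n \<Rightarrow> int) \<Rightarrow> 'k" assume P: "eu P \<phi> \<and> (\<forall>b\<in>B. \<phi> b = 0)"
  then have "f (P \<odot> x) = P \<odot>\<^bsub>N\<^esub> f x" using mod_homD(3)[OF assms(2) eu_D x] by blast
  moreover have "P \<odot> x = \<zero>" using specD[OF assms(3)] P by blast
  ultimately show "P \<odot>\<^bsub>N\<^esub> f x = \<zero>\<^bsub>N\<^esub>" using mod_hom_zero[OF left_module_axioms assms(1,2)] by simp
qed

end

lemma weight_moduleD: "weight_module M \<Longrightarrow> D_module M"
  by (simp add: weight_module_def D_module_def)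

text \<open>
  The projection onto the weight \<open>b\<close> belongs to the Euler algebra: it maps \<open>x\<close> to a weight vector, commutes
  with \<open>f\<close> and fixes \<open>f x\<close>. The lift is a multiple of \<open>x\<close>, so it stays in every submodule that contains \<open>x\<close>.
\<close>

lemma weight_lift:
  fixes M :: "('k::field, 'n::{finite,linorder}, 'm) dmodule"
  assumes M: "weight_module M" and N: "D_module N" and f: "f \<in> mod_hom D_ring M N"
    and x: "x \<in> carrier M" "f x \<in> deg_part N b"
  shows "\<exists>m\<in>deg_part M b. f m = f x \<and> (\<exists>P\<in>D_ops. m = P \<odot>\<^bsub>M\<^esub> x)"
proof -
  interpret M: D_module M using M by (rule weight_moduleD)
  interpret N: D_module N by fact
  obtain B where B: "finite B" "spec M B x" using M x by (auto simp: weight_module_def)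
  obtain e and \<phi> :: "_ \<Rightarrow> 'k" where e: "eu e \<phi>" "\<phi> b = 1" "\<forall>w\<in>B. w \<noteq> b \<longrightarrow> \<phi> w = 0"
    using eu_projection[OF B(1)] by blast
  have "f (e \<odot>\<^bsub>M\<^esub> x) = e \<odot>\<^bsub>N\<^esub> f x" using mod_homD(3)[OF f eu_D[OF e(1)] x(1)] .
  also have "\<dots> = f x" using N.eu_weight[OF x(2) e(1)] e(2) mod_homD(1)[OF f x(1)] by (simp add: const_poly_simps)
  finally show ?thesis using M.projection_weight[OF B(2) e(1)] e(3) eu_D[OF e(1)] by (intro bexI[of _ "e \<odot>\<^bsub>M\<^esub> x"]) auto
qed

lemma weight_module_image:
  assumes M: "weight_module M" and N: "left_module D_ring N" and f: "f \<in> mod_hom D_ring M N"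
    and "f ` carrier M = carrier N"
  shows "weight_module N"
proof -
  interpret M: D_module M using M by (rule weight_moduleD)
  show ?thesis unfolding weight_module_def
  proof (intro conjI ballI N)
    fix y assume "y \<in> carrier N"
    then obtain x where x: "x \<in> carrier M" "y = f x" using assms(4) by blast
    then obtain B where "finite B" "spec M B x" using M by (auto simp: weight_module_def)
    then show "\<exists>B. finite B \<and> spec N B y" using M.mod_hom_spec[OF N f] x(2) by auto
  qed
qed

lemma deg_part_restrict: "A \<subseteq> carrier M \<Longrightarrow> deg_part (M\<lparr>carrier := A\<rparr>) b = A \<inter> deg_part M b"
  by (auto simp: deg_part_def)

lemma spec_restrict: "A \<subseteq> carrier M \<Longrightarrow> spec (M\<lparr>carrier := A\<rparr>) B x \<longleftrightarrow> x \<in> A \<and> spec M B x"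
  by (auto simp: spec_def)

lemma weight_module_submodule:
  assumes "weight_module M" "submodule A D_ring M"
  shows "weight_module (M\<lparr>carrier := A\<rparr>)"
proof -
  interpret D_module M using assms weight_moduleD by blast
  show ?thesis using assms left_module_submodule[OF assms(2)] submodule_subset[OF assms(2)]
    by (auto simp: weight_module_def spec_restrict)
qed

lemma weight_module_quot:
  assumes "weight_module M" "submodule A D_ring M"
  shows "weight_module (quot_mod M A)"
proof -
  interpret D_module M using assms weight_moduleD by blast
  show ?thesis
    by (rule weight_module_image[OF assms(1) left_module_quot[OF assms(2)] coset_hom[OF assms(2)]])
      (simp add: quot_mod_carrier)
qed

lemma deg_part_dsum:
  "f \<in> deg_part (dsum I M) b \<longleftrightarrow> f \<in> carrier (dsum I M) \<and> (\<forall>i\<in>I. f i \<in> deg_part (M i) b)"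
  by (auto simp: deg_part_def dsum_simps restrict_def fun_eq_iff dest: PiE_mem)

lemma spec_dsum:
  "f \<in> carrier (dsum I M) \<Longrightarrow> (\<And>i. i \<in> I \<Longrightarrow> spec (M i) B (f i)) \<Longrightarrow> spec (dsum I M) B f"
  by (auto simp: spec_def dsum_simps restrict_def fun_eq_iff)

lemma weight_module_dsum:
  assumes "finite I" and M: "\<And>i. i \<in> I \<Longrightarrow> weight_module (M i)"
  shows "weight_module (dsum I M)"
  unfolding weight_module_def
proof (intro conjI ballI)
  show "left_module D_ring (dsum I M)"
    by (rule left_module_dsum[OF ring_D_ring]) (use M in \<open>auto simp: weight_module_def\<close>)
  fix f assume f: "f \<in> carrier (dsum I M)"
  have "\<forall>i\<in>I. \<exists>B. finite B \<and> spec (M i) B (f i)"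
    using M f by (auto simp: weight_module_def dsum_simps)
  then obtain B where B: "\<And>i. i \<in> I \<Longrightarrow> finite (B i) \<and> spec (M i) (B i) (f i)" by metis
  have "spec (dsum I M) (\<Union>i\<in>I. B i) f" 
  proof (rule spec_dsum[OF f])
    fix i assume "i \<in> I"
    then show "spec (M i) (\<Union>i\<in>I. B i) (f i)" using B[of i] by (auto intro: spec_mono[of "M i" "B i"])
  qed
  then show "\<exists>B. finite B \<and> spec (dsum I M) B f" using B assms(1) by (intro exI[of _ "\<Union>i\<in>I. B i"]) auto
qed

section \<open>Localization\<close>

text \<open>
  The operations on fractions are unions over all representatives. They are computed by exhibiting one
  representative and checking that all others give the same class.
\<close>

lemma UN_const_eq: "x \<in> A \<Longrightarrow> (\<And>y. y \<in> A \<Longrightarrow> g y = c) \<Longrightarrow> (\<Union>y\<in>A. g y) = c"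
  by auto

lemma Union_const_eq: "x \<in> A \<Longrightarrow> (\<And>y. y \<in> A \<Longrightarrow> y = c) \<Longrightarrow> \<Union>A = c"
  by auto

lemma nzd_power:
  assumes "\<And>f. s * f = 0 \<Longrightarrow> f = (0 :: 'a::comm_ring_1)"
  shows "s ^ L * f = 0 \<Longrightarrow> f = 0"
  by (induction L) (auto simp: mult.assoc dest!: assms)

text \<open>
  The module may have \<open>s\<close>-torsion; only on polynomials is \<open>s\<close> assumed to be a nonzerodivisor, which is what
  makes the action of differential operators on fractions well defined.
\<close>

locale localization = D_module M
  for M :: "('k::field, 'n::{finite,linorder}, 'm) dmodule" (structure) +
  fixes s :: "('k, 'n) mpoly"
  assumes nzd: "\<And>f. s * f = 0 \<Longrightarrow> f = 0"
begin

abbreviation "N \<equiv> loc_mod M (powers s)"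

definition fr :: "'m \<Rightarrow> nat \<Rightarrow> ('m \<times> ('k, 'n) mpoly) set" where
  "fr m L = Defs.frac M (powers s) m (s ^ L)"

lemma powers_iff: "t \<in> powers s \<longleftrightarrow> (\<exists>L. t = s ^ L)"
  by (auto simp: powers_def)

lemma bex_powers: "(\<exists>u\<in>powers s. P u) \<longleftrightarrow> (\<exists>K. P (s ^ K))"
  by (auto simp: powers_def)

lemma power_mem [simp]: "s ^ L \<in> powers s"
  by (auto simp: powers_def)

lemma frac_rel_iff:
  "((m, s ^ L), (m', s ^ L')) \<in> frac_rel M (powers s) \<longleftrightarrow> m \<in> carrier M \<and> m' \<in> carrier M \<and>
     (\<exists>K. (*) (s ^ (K + L')) \<odot> m = (*) (s ^ (K + L)) \<odot> m')"
  by (simp add: frac_rel_def bex_powers power_add)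

lemma frac_equiv: "equiv (carrier M \<times> powers s) (frac_rel M (powers s))"
proof (rule equivI)
  show "frac_rel M (powers s) \<subseteq> (carrier M \<times> powers s) \<times> (carrier M \<times> powers s)"
    by (auto simp: frac_rel_def)
  show "refl_on (carrier M \<times> powers s) (frac_rel M (powers s))"
    by (auto simp: refl_on_def powers_iff frac_rel_iff)
  show "sym (frac_rel M (powers s))"
    unfolding frac_rel_def by (auto intro!: symI) metis
  show "trans (frac_rel M (powers s))"
  proof (rule transI)
    fix x y z assume xy: "(x, y) \<in> frac_rel M (powers s)" and yz: "(y, z) \<in> frac_rel M (powers s)"
    then obtain m L m' L' m'' L'' where e: "x = (m, s ^ L)" "y = (m', s ^ L')" "z = (m'', s ^ L'')"
      by (auto simp: frac_rel_def powers_iff)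
    from xy yz obtain J K where JK: "(*) (s ^ (J + L')) \<odot> m = (*) (s ^ (J + L)) \<odot> m'"
        "(*) (s ^ (K + L'')) \<odot> m' = (*) (s ^ (K + L')) \<odot> m''"
      and c: "m \<in> carrier M" "m' \<in> carrier M" "m'' \<in> carrier M"
      unfolding e frac_rel_iff by blast
    have "(*) (s ^ ((J + K + L') + L'')) \<odot> m = (*) (s ^ (K + L'')) \<odot> ((*) (s ^ (J + L')) \<odot> m)"
      using c by (simp add: rmul_rmul power_add[symmetric] add_ac)
    also have "\<dots> = (*) (s ^ (J + L)) \<odot> ((*) (s ^ (K + L'')) \<odot> m')"
      unfolding JK(1) by (rule rmul_commute[OF c(2)])
    also have "\<dots> = (*) (s ^ ((J + K + L') + L)) \<odot> m''"
      unfolding JK(2) using c by (simp add: rmul_rmul power_add[symmetric] add_ac)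
    finally show "(x, z) \<in> frac_rel M (powers s)" unfolding e frac_rel_iff using c by blast
  qed
qed

lemma fr_eq_iff:
  assumes "m \<in> carrier M" "m' \<in> carrier M"
  shows "fr m L = fr m' L' \<longleftrightarrow> (\<exists>K. (*) (s ^ (K + L')) \<odot> m = (*) (s ^ (K + L)) \<odot> m')"
  unfolding fr_def frac_def using eq_equiv_class_iff[OF frac_equiv] assms frac_rel_iff powers_iff
  by (metis (no_types, lifting) SigmaI)

lemma fr_mem:
  assumes "m \<in> carrier M"
  shows "(m', t) \<in> fr m L \<longleftrightarrow> m' \<in> carrier M \<and> (\<exists>L'. t = s ^ L' \<and> fr m' L' = fr m L)"
proof -
  have 1: "(m', t) \<in> fr m L \<longleftrightarrow> ((m, s ^ L), (m', t)) \<in> frac_rel M (powers s)" by (simp add: fr_def frac_def)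
  have 2: "((m, s ^ L), (m', t)) \<in> frac_rel M (powers s) \<Longrightarrow> m' \<in> carrier M \<and> (\<exists>L'. t = s ^ L')"
    by (auto simp: frac_rel_def powers_iff)
  have 3: "((m, s ^ L), (m', s ^ L')) \<in> frac_rel M (powers s) \<longleftrightarrow> m' \<in> carrier M \<and> fr m' L' = fr m L" for L'
    using fr_eq_iff[OF assms, of m' L L'] assms frac_rel_iff by metis
  show ?thesis unfolding 1 using 2 3 by metis
qed

lemma fr_self: "m \<in> carrier M \<Longrightarrow> (m, s ^ L) \<in> fr m L"
  by (auto simp: fr_mem)

lemma fr_expand: "m \<in> carrier M \<Longrightarrow> fr ((*) (s ^ K) \<odot> m) (L + K) = fr m L"
  by (subst fr_eq_iff) (auto simp: rmul_rmul power_add[symmetric] add_ac intro!: exI[of _ 0])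

lemma loc_carrier: "carrier N = {fr m L | m L. m \<in> carrier M}"
  unfolding loc_mod_def quotient_def fr_def frac_def powers_def mk_module_simps by blast

lemma fr_carrier [simp]: "m \<in> carrier M \<Longrightarrow> fr m L \<in> carrier N"
  by (auto simp: loc_carrier)

lemma loc_zero: "\<zero>\<^bsub>N\<^esub> = fr \<zero> 0"
  by (simp add: loc_mod_def fr_def)

lemma loc_add:
  assumes m: "m \<in> carrier M" "m' \<in> carrier M"
  shows "fr m L \<oplus>\<^bsub>N\<^esub> fr m' L' = fr ((*) (s ^ L') \<odot> m \<oplus> (*) (s ^ L) \<odot> m') (L + L')"
proof -
  have "fr ((*) (s ^ L1') \<odot> m1 \<oplus> (*) (s ^ L1) \<odot> m1') (L1 + L1') = fr ((*) (s ^ L') \<odot> m \<oplus> (*) (s ^ L) \<odot> m') (L + L')"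
    if c: "m1 \<in> carrier M" "m1' \<in> carrier M" and e: "fr m1 L1 = fr m L" "fr m1' L1' = fr m' L'" for m1 L1 m1' L1'
  proof -
    obtain J K where J: "(*) (s ^ (J + L)) \<odot> m1 = (*) (s ^ (J + L1)) \<odot> m"
      and K: "(*) (s ^ (K + L')) \<odot> m1' = (*) (s ^ (K + L1')) \<odot> m'"
      using e c m by (auto simp: fr_eq_iff)
    have "(*) (s ^ (J + K + (L + L'))) \<odot> ((*) (s ^ L1') \<odot> m1 \<oplus> (*) (s ^ L1) \<odot> m1') =
        (*) (s ^ (K + L' + L1')) \<odot> ((*) (s ^ (J + L)) \<odot> m1) \<oplus> (*) (s ^ (J + L + L1)) \<odot> ((*) (s ^ (K + L')) \<odot> m1')"
      using c by (simp add: smult_r_distr D_ops_mult rmul_rmul power_add[symmetric] add_ac)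
    also have "\<dots> = (*) (s ^ (J + K + (L1 + L1'))) \<odot> ((*) (s ^ L') \<odot> m \<oplus> (*) (s ^ L) \<odot> m')"
      unfolding J K using m by (simp add: smult_r_distr D_ops_mult rmul_rmul power_add[symmetric] add_ac)
    finally show ?thesis using c m by (subst fr_eq_iff) auto
  qed
  note * = this
  define C where "C = fr ((*) (s ^ L') \<odot> m \<oplus> (*) (s ^ L) \<odot> m') (L + L')"
  have inner: "(\<Union>(m1', t')\<in>fr m' L'. Defs.frac M (powers s) ((*) t' \<odot> m1 \<oplus> (*) (s ^ L1) \<odot> m1') (s ^ L1 * t')) = C"
    if m1: "m1 \<in> carrier M" "fr m1 L1 = fr m L" for m1 L1
  proof (rule UN_const_eq[OF fr_self[OF m(2)]])
    fix y assume "y \<in> fr m' L'"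
    then obtain m1' L1' where y: "y = (m1', s ^ L1')" "m1' \<in> carrier M" "fr m1' L1' = fr m' L'"
      using fr_mem[OF m(2)] by (cases y) auto
    show "(case y of (m1', t') \<Rightarrow> Defs.frac M (powers s) ((*) t' \<odot> m1 \<oplus> (*) (s ^ L1) \<odot> m1') (s ^ L1 * t')) = C"
      unfolding y(1) prod.case power_add[symmetric] fr_def[symmetric] C_def using *[OF m1(1) y(2) m1(2) y(3)] .
  qed
  have "(\<Union>(m1, t)\<in>fr m L. \<Union>(m1', t')\<in>fr m' L'. Defs.frac M (powers s) ((*) t' \<odot> m1 \<oplus> (*) t \<odot> m1') (t * t')) = C"
  proof (rule UN_const_eq[OF fr_self[OF m(1)]])
    fix y assume "y \<in> fr m L"
    then obtain m1 L1 where y: "y = (m1, s ^ L1)" "m1 \<in> carrier M" "fr m1 L1 = fr m L"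
      using fr_mem[OF m(1)] by (cases y) auto
    show "(case y of (m1, t) \<Rightarrow> \<Union>(m1', t')\<in>fr m' L'. Defs.frac M (powers s) ((*) t' \<odot> m1 \<oplus> (*) t \<odot> m1') (t * t')) = C"
      unfolding y(1) prod.case by (rule inner[OF y(2,3)])
  qed
  then show ?thesis by (simp add: loc_mod_def C_def)
qed

lemma loc_add_same:
  assumes "m \<in> carrier M" "m' \<in> carrier M"
  shows "fr m L \<oplus>\<^bsub>N\<^esub> fr m' L = fr (m \<oplus> m') L"
proof -
  have "fr m L \<oplus>\<^bsub>N\<^esub> fr m' L = fr ((*) (s ^ L) \<odot> (m \<oplus> m')) (L + L)"
    using assms by (simp add: loc_add smult_r_distr D_ops_mult)
  then show ?thesis using assms by (simp add: fr_expand)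
qed

lemma ore_exists:
  assumes "P \<in> D_ops" shows "\<exists>Q K. Q \<in> D_ops \<and> (\<forall>f. Q (s ^ L * f) = s ^ K * P f)"
proof -
  obtain j where "P \<in> diff_ops j" using assms by (auto simp: D_ring_simps)
  from ore_left[OF this, of s L] show ?thesis by metis
qed

lemma nzd_pow: "s ^ L * f = 0 \<Longrightarrow> f = 0"
  using nzd_power[OF nzd] .

text \<open>
  The value of an operator on a fraction does not depend on the Ore data. Two choices are compared
  after moving their operators to the right of a common denominator; there they agree because no
  nonzero operator kills a nonzero ideal.
\<close>

lemma loc_op_unique:
  assumes P: "P \<in> D_ops" and Q: "Q \<in> D_ops" "\<And>f. Q (s ^ L * f) = s ^ K * P f"
    and Q': "Q' \<in> D_ops" "\<And>f. Q' (s ^ L' * f) = s ^ K' * P f"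
    and m: "m \<in> carrier M" "m' \<in> carrier M" "fr m L = fr m' L'"
  shows "fr (Q \<odot> m) K = fr (Q' \<odot> m') K'"
proof -
  obtain J where J: "(*) (s ^ (J + L')) \<odot> m = (*) (s ^ (J + L)) \<odot> m'" using m by (auto simp: fr_eq_iff)
  obtain A V where A: "A \<in> D_ops" "\<And>f. A (s ^ (J + L') * f) = s ^ V * Q f" using ore_exists[OF Q(1)] by blast
  obtain B W where B: "B \<in> D_ops" "\<And>f. B (s ^ (J + L) * f) = s ^ W * Q' f" using ore_exists[OF Q'(1)] by blast
  have "(\<lambda>f. s ^ (W + K') * A f) = (\<lambda>f. s ^ (V + K) * B f)"
  proof (rule D_ops_right_cancel_eq[where r = "s ^ (J + L + L')"])
    fix f
    have "s ^ (W + K') * A (s ^ (J + L + L') * f) = s ^ (W + K') * A (s ^ (J + L') * (s ^ L * f))"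
      by (simp add: power_add mult_ac)
    also have "\<dots> = s ^ (W + K') * (s ^ V * (s ^ K * P f))" by (simp only: A Q)
    also have "\<dots> = s ^ (V + K) * (s ^ W * (s ^ K' * P f))" by (simp add: power_add mult_ac)
    also have "\<dots> = s ^ (V + K) * B (s ^ (J + L) * (s ^ L' * f))" by (simp only: B Q')
    also have "\<dots> = s ^ (V + K) * B (s ^ (J + L + L') * f)" by (simp add: power_add mult_ac)
    finally show "s ^ (W + K') * A (s ^ (J + L + L') * f) = s ^ (V + K) * B (s ^ (J + L + L') * f)" .
  qed (use A B D_ops_lmult nzd_pow in blast)+
  then have eq: "(\<lambda>f. s ^ (W + K') * A f) \<odot> x = (\<lambda>f. s ^ (V + K) * B f) \<odot> x" for x by simp
  have c: "Q \<odot> m \<in> carrier M" "Q' \<odot> m' \<in> carrier M" using Q Q' m smult_closed by auto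
  have "(*) (s ^ (V + W + K')) \<odot> (Q \<odot> m) = (\<lambda>f. s ^ (W + K') * A f) \<odot> ((*) (s ^ (J + L')) \<odot> m)"
  proof -
    have "(\<lambda>f. s ^ (W + K') * A (s ^ (J + L') * f)) = (\<lambda>f. s ^ (V + W + K') * Q f)"
      unfolding A by (auto simp: power_add mult_ac)
    then show ?thesis
      using op_comp[OF D_ops_lmult[OF A(1)] D_ops_mult m(1), of "s ^ (W + K')" "s ^ (J + L')"]
        op_comp[OF D_ops_mult Q(1) m(1), of "s ^ (V + W + K')"] by simp
  qed
  also have "\<dots> = (\<lambda>f. s ^ (V + K) * B f) \<odot> ((*) (s ^ (J + L)) \<odot> m')" unfolding J eq ..
  also have "\<dots> = (*) (s ^ (V + W + K)) \<odot> (Q' \<odot> m')"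
  proof -
    have "(\<lambda>f. s ^ (V + K) * B (s ^ (J + L) * f)) = (\<lambda>f. s ^ (V + W + K) * Q' f)"
      unfolding B by (auto simp: power_add mult_ac)
    then show ?thesis
      using op_comp[OF D_ops_lmult[OF B(1)] D_ops_mult m(2), of "s ^ (V + K)" "s ^ (J + L)"]
        op_comp[OF D_ops_mult Q'(1) m(2), of "s ^ (V + W + K)"] by simp
  qed
  finally show ?thesis using c by (subst fr_eq_iff) auto
qed

lemma loc_op:
  assumes P: "P \<in> D_ops" and Q: "Q \<in> D_ops" "\<And>f. Q (s ^ L * f) = s ^ K * P f" and m: "m \<in> carrier M"
  shows "P \<odot>\<^bsub>N\<^esub> fr m L = fr (Q \<odot> m) K"
  unfolding loc_mod_def mk_module_simps
proof (rule Union_const_eq)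
  show "fr (Q \<odot> m) K \<in> {Defs.frac M (powers s) (Q \<odot> m') u | Q m' t u.
        (m', t) \<in> fr m L \<and> Q \<in> carrier D_ring \<and> u \<in> powers s \<and> Q \<circ> (*) t = (*) u \<circ> P}"
    unfolding fr_def[of "Q \<odot> m"] using Q fr_self[OF m]
    by (intro CollectI exI[of _ Q] exI[of _ m] exI[of _ "s ^ L"] exI[of _ "s ^ K"]) (auto simp: powers_iff)
next
  fix y assume "y \<in> {Defs.frac M (powers s) (Q \<odot> m') u | Q m' t u.
        (m', t) \<in> fr m L \<and> Q \<in> carrier D_ring \<and> u \<in> powers s \<and> Q \<circ> (*) t = (*) u \<circ> P}"
  then obtain Q' m' t K' where y0: "y = fr (Q' \<odot> m') K'" "Q' \<in> D_ops" "(m', t) \<in> fr m L" "Q' \<circ> (*) t = (*) (s ^ K') \<circ> P"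
    by (auto simp only: powers_iff fr_def mem_Collect_eq)
  then obtain L' where y: "y = fr (Q' \<odot> m') K'" "Q' \<in> D_ops" "m' \<in> carrier M" "fr m' L' = fr m L"
    "Q' \<circ> (*) (s ^ L') = (*) (s ^ K') \<circ> P"
    using fr_mem[OF m] by metis
  have "Q' (s ^ L' * f) = s ^ K' * P f" for f using fun_cong[OF y(5), of f] by simp
  then show "y = fr (Q \<odot> m) K"
    unfolding y(1) using loc_op_unique[OF P y(2) _ Q y(3) m y(4)] by blast
qed

lemma loc_cases3:
  assumes "x \<in> carrier N" "y \<in> carrier N" "z \<in> carrier N"
  obtains m m' m'' L where "m \<in> carrier M" "m' \<in> carrier M" "m'' \<in> carrier M" "x = fr m L" "y = fr m' L" "z = fr m'' L"
proof -
  obtain m L m' L' m'' L'' where *: "m \<in> carrier M" "m' \<in> carrier M" "m'' \<in> carrier M"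
    "x = fr m L" "y = fr m' L'" "z = fr m'' L''" using assms by (auto simp: loc_carrier)
  then have e: "x = fr ((*) (s ^ (L' + L'')) \<odot> m) (L + L' + L'')" "y = fr ((*) (s ^ (L + L'')) \<odot> m') (L + L' + L'')"
    "z = fr ((*) (s ^ (L + L')) \<odot> m'') (L + L' + L'')"
    using fr_expand[of m "L' + L''" L] fr_expand[of m' "L + L''" L'] fr_expand[of m'' "L + L'" L'']
    by (auto simp: add_ac)
  show thesis by (rule that[OF _ _ _ e]) (use * in auto)
qed

lemma loc_cases:
  assumes "x \<in> carrier N" obtains m L where "m \<in> carrier M" "x = fr m L"
  using assms by (auto simp: loc_carrier)

lemma left_module_loc: "left_module D_ring N"
proof (rule left_moduleI)
  fix x y z assume x: "x \<in> carrier N" and y: "y \<in> carrier N" and z: "z \<in> carrier N"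
  show "x \<oplus>\<^bsub>N\<^esub> y \<in> carrier N" using loc_cases3[OF x y x] by (metis M.a_closed fr_carrier loc_add_same)
  show "x \<oplus>\<^bsub>N\<^esub> y = y \<oplus>\<^bsub>N\<^esub> x" using loc_cases3[OF x y x] by (metis M.a_comm loc_add_same)
  show "x \<oplus>\<^bsub>N\<^esub> y \<oplus>\<^bsub>N\<^esub> z = x \<oplus>\<^bsub>N\<^esub> (y \<oplus>\<^bsub>N\<^esub> z)"
  proof -
    obtain m m' m'' L where "m \<in> carrier M" "m' \<in> carrier M" "m'' \<in> carrier M" "x = fr m L" "y = fr m' L" "z = fr m'' L"
      using loc_cases3[OF x y z] .
    then show ?thesis by (simp add: loc_add_same M.a_assoc)
  qed
next
  show "\<zero>\<^bsub>N\<^esub> \<in> carrier N" by (simp add: loc_zero)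
next
  fix x assume "x \<in> carrier N"
  then obtain m L where x: "m \<in> carrier M" "x = fr m L" by (rule loc_cases)
  have "\<zero>\<^bsub>N\<^esub> = fr \<zero> L" unfolding loc_zero by (subst fr_eq_iff) (auto simp: D_ops_mult)
  then show "\<zero>\<^bsub>N\<^esub> \<oplus>\<^bsub>N\<^esub> x = x" using x by (simp add: loc_add_same)
  have "(\<lambda>f. 0) \<odot>\<^bsub>N\<^esub> fr m L = fr ((\<lambda>f. 0) \<odot> m) L" by (rule loc_op) (use x D_ops_zero in auto)
  then show "\<zero>\<^bsub>D_ring\<^esub> \<odot>\<^bsub>N\<^esub> x = \<zero>\<^bsub>N\<^esub>" using x \<open>\<zero>\<^bsub>N\<^esub> = fr \<zero> L\<close> by (simp add: D_ring_simps(4))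
  have "(\<lambda>f. f) \<odot>\<^bsub>N\<^esub> fr m L = fr ((\<lambda>f. f) \<odot> m) L" by (rule loc_op) (use x D_ops_id in auto)
  then show "\<one>\<^bsub>D_ring\<^esub> \<odot>\<^bsub>N\<^esub> x = x" using x by (simp add: D_ring_simps(3))
next
  fix P :: "('k, 'n) poly_op" and x assume P: "P \<in> D_ops" and x': "x \<in> carrier N"
  obtain m L where x: "m \<in> carrier M" "x = fr m L" using loc_cases[OF x'] .
  obtain Q K where Q: "Q \<in> D_ops" "\<And>f. Q (s ^ L * f) = s ^ K * P f" using ore_exists[OF P] by blast
  have Px: "P \<odot>\<^bsub>N\<^esub> x = fr (Q \<odot> m) K" unfolding x by (rule loc_op[OF P Q x(1)])
  show "P \<odot>\<^bsub>N\<^esub> x \<in> carrier N" unfolding Px using Q x smult_closed by simp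
  {
    fix P' :: "('k, 'n) poly_op" assume P': "P' \<in> D_ops"
    obtain Q' K' where Q': "Q' \<in> D_ops" "\<And>f. Q' (s ^ L * f) = s ^ K' * P' f" using ore_exists[OF P'] by blast
    have a: "P \<odot>\<^bsub>N\<^esub> x = fr ((*) (s ^ K') \<odot> (Q \<odot> m)) (K + K')" unfolding Px using fr_expand Q x smult_closed by simp
    have b: "P' \<odot>\<^bsub>N\<^esub> x = fr ((*) (s ^ K) \<odot> (Q' \<odot> m)) (K + K')"
      unfolding x loc_op[OF P' Q' x(1)] using fr_expand[of "Q' \<odot> m" K K'] Q' x smult_closed by (simp add: add.commute)
    have "(\<lambda>f. P f + P' f) \<odot>\<^bsub>N\<^esub> x = fr ((\<lambda>f. s ^ K' * Q f + s ^ K * Q' f) \<odot> m) (K + K')"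
      unfolding x
    proof (rule loc_op[OF D_ops_add[OF P P'] D_ops_add[OF D_ops_lmult[OF Q(1)] D_ops_lmult[OF Q'(1)]] _ x(1)])
      fix f
      show "s ^ K' * Q (s ^ L * f) + s ^ K * Q' (s ^ L * f) = s ^ (K + K') * (P f + P' f)"
        unfolding Q(2) Q'(2) by (simp add: power_add algebra_simps)
    qed
    also have "(\<lambda>f. s ^ K' * Q f + s ^ K * Q' f) \<odot> m = (*) (s ^ K') \<odot> (Q \<odot> m) \<oplus> (*) (s ^ K) \<odot> (Q' \<odot> m)"
      using x Q Q' by (simp add: op_add D_ops_lmult op_comp[OF D_ops_mult, symmetric])
    finally show "(P \<oplus>\<^bsub>D_ring\<^esub> P') \<odot>\<^bsub>N\<^esub> x = P \<odot>\<^bsub>N\<^esub> x \<oplus>\<^bsub>N\<^esub> P' \<odot>\<^bsub>N\<^esub> x"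
      unfolding a b D_ring_simps using Q Q' x smult_closed by (simp add: loc_add_same)
    obtain Q2 K2 where Q2: "Q2 \<in> D_ops" "\<And>f. Q2 (s ^ K' * f) = s ^ K2 * P f" using ore_exists[OF P] by blast
    have "P \<odot>\<^bsub>N\<^esub> (P' \<odot>\<^bsub>N\<^esub> x) = fr (Q2 \<odot> (Q' \<odot> m)) K2"
      unfolding x loc_op[OF P' Q' x(1)] by (rule loc_op[OF P Q2]) (use Q' x smult_closed in auto)
    moreover have "(\<lambda>f. P (P' f)) \<odot>\<^bsub>N\<^esub> x = fr ((\<lambda>f. Q2 (Q' f)) \<odot> m) K2"
      unfolding x by (rule loc_op[OF D_ops_comp[OF P P'] D_ops_comp[OF Q2(1) Q'(1)] _ x(1)]) (simp add: Q' Q2)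
    ultimately show "(P \<otimes>\<^bsub>D_ring\<^esub> P') \<odot>\<^bsub>N\<^esub> x = P \<odot>\<^bsub>N\<^esub> (P' \<odot>\<^bsub>N\<^esub> x)"
      unfolding D_ring_simps using op_comp[OF Q2(1) Q'(1) x(1)] by simp
  next
    fix y assume y': "y \<in> carrier N"
    obtain m1 m' L1 where *: "m1 \<in> carrier M" "m' \<in> carrier M" "x = fr m1 L1" "y = fr m' L1"
      using loc_cases3[OF x' y' x'] by metis
    obtain Q K where Q: "Q \<in> D_ops" "\<And>f. Q (s ^ L1 * f) = s ^ K * P f" using ore_exists[OF P] by blast
    show "P \<odot>\<^bsub>N\<^esub> (x \<oplus>\<^bsub>N\<^esub> y) = P \<odot>\<^bsub>N\<^esub> x \<oplus>\<^bsub>N\<^esub> P \<odot>\<^bsub>N\<^esub> y"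
      unfolding * using * Q by (simp add: loc_add_same loc_op[OF P Q] smult_r_distr smult_closed)
  }
qed (fact ring_D_ring)

lemma D_module_loc: "D_module N"
  by (rule D_moduleI[OF left_module_loc])

lemma loc_rmul: "m \<in> carrier M \<Longrightarrow> (*) r \<odot>\<^bsub>N\<^esub> fr m L = fr ((*) r \<odot> m) L"
  by (rule loc_op) (auto simp: D_ops_mult mult_ac)

lemma loc_op_commuting:
  assumes "P \<in> D_ops" "\<And>f. P (s * f) = s * P f" "m \<in> carrier M"
  shows "P \<odot>\<^bsub>N\<^esub> fr m L = fr (P \<odot> m) L"
proof -
  have "P (s ^ L * f) = s ^ L * P f" for f by (induction L arbitrary: f) (auto simp: assms(2) mult.assoc)
  then show ?thesis using loc_op[OF assms(1,1) _ assms(3)] by blast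
qed

lemma fr_zero: "fr \<zero> L = \<zero>\<^bsub>N\<^esub>"
  unfolding loc_zero by (subst fr_eq_iff) (auto simp: D_ops_mult)

lemma fr_eq_zero_iff: "m \<in> carrier M \<Longrightarrow> fr m L = \<zero>\<^bsub>N\<^esub> \<longleftrightarrow> (\<exists>K. (*) (s ^ K) \<odot> m = \<zero>)"
  unfolding loc_zero by (subst fr_eq_iff) (auto simp: D_ops_mult)

lemma loc_unit: "m \<in> carrier M \<Longrightarrow> (*) (s ^ L) \<odot>\<^bsub>N\<^esub> fr m L = fr m 0"
  by (simp add: loc_rmul) (metis add_0 fr_expand)

lemma loc_inj:
  assumes "x \<in> carrier N" "(*) (s ^ K) \<odot>\<^bsub>N\<^esub> x = \<zero>\<^bsub>N\<^esub>" shows "x = \<zero>\<^bsub>N\<^esub>"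
proof -
  obtain m L where x: "m \<in> carrier M" "x = fr m L" using loc_cases[OF assms(1)] .
  then obtain J where "(*) (s ^ J) \<odot> ((*) (s ^ K) \<odot> m) = \<zero>" using assms(2) by (auto simp: loc_rmul fr_eq_zero_iff)
  then show ?thesis using x by (auto simp: fr_eq_zero_iff rmul_rmul power_add[symmetric])
qed

lemma loc_hom: "(\<lambda>m. fr m 0) \<in> mod_hom D_ring M N"
proof (rule mod_homI)
  fix P :: "('k, 'n) poly_op" and m assume "P \<in> D_ops" "m \<in> carrier M"
  then show "fr (P \<odot> m) 0 = P \<odot>\<^bsub>N\<^esub> fr m 0" using loc_op[of P P 0 0 m] by simp
qed (auto simp: loc_add_same)

end

lemma nzd_mono: "mono_poly a * f = (0 :: ('k::field, 'n::{finite,linorder}) mpoly) \<Longrightarrow> f = 0"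
  by (metis lookup_single_eq lookup_zero mult_eq_0_iff zero_neq_one)

definition vexp :: "'n::finite set \<Rightarrow> nat \<Rightarrow> 'n expo" where
  "vexp \<beta> L = Abs_poly_mapping (\<lambda>i. if i \<in> \<beta> then L else 0)"

lemma lookup_vexp: "lk (vexp \<beta> L) i = (if i \<in> \<beta> then L else 0)"
  by (simp add: vexp_def)

lemma xmon_eq: "xmon \<beta> = mono_poly (vexp \<beta> 1)"
proof -
  have "finite \<beta>" by simp
  then show ?thesis
  proof (induction \<beta>)
    case empty
    have "vexp {} 1 = (0 :: 'a expo)" by (intro poly_mapping_eqI) (simp add: lookup_vexp)
    then show ?case by (simp add: xmon_def single_one)
  next
    case (insert i \<beta>)
    have "vexp (insert i \<beta>) 1 = vexp \<beta> 1 + unit_exp i"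
      using insert by (intro poly_mapping_eqI) (auto simp: lookup_vexp lookup_add lookup_single when_def)
    then show ?case using insert by (simp add: xmon_def single_Suc_exp)
  qed
qed

lemma xmon_power: "xmon \<beta> ^ L = mono_poly (vexp \<beta> L)"
proof (induction L)
  case 0
  have "vexp \<beta> 0 = 0" by (intro poly_mapping_eqI) (simp add: lookup_vexp)
  then show ?case by (simp add: single_one)
next
  case (Suc L)
  have "vexp \<beta> (Suc L) = vexp \<beta> 1 + vexp \<beta> L" by (intro poly_mapping_eqI) (simp add: lookup_vexp lookup_add)
  then show ?case using Suc by (simp add: xmon_eq mult_single)
qed

lemma xmon_remove: "i \<in> \<gamma> \<Longrightarrow> xmon \<gamma> = var_poly i * xmon (\<gamma> - {i})"
  unfolding xmon_def by (simp add: prod.remove)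

lemma localization_xmon: "D_module M \<Longrightarrow> localization M (xmon \<beta>)"
  unfolding localization_def localization_axioms_def xmon_eq using nzd_mono by blast

context D_module begin

lemma spec_single: "spec M {b} x \<Longrightarrow> x \<in> deg_part M b"
  using projection_weight[OF _ eu_id] spec_carrier[of M "{b}" x] by fastforce

end

subsection \<open>Weights of localizations\<close>

locale mono_localization = localization M "xmon \<beta>" for M :: "('k::field, 'n::{finite,linorder}, 'm) dmodule" (structure) and \<beta>
begin

lemma fr_spec:
  assumes "spec M B m" shows "spec N ((\<lambda>b. wsub b (vexp \<beta> L)) ` B) (fr m L)"
proof -
  interpret N: D_module N by (rule D_module_loc)
  have m: "m \<in> carrier M" using spec_carrier[OF assms] .
  show ?thesis
  proof (rule N.mono_spec_cancel[of "vexp \<beta> L"])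
    show "y = \<zero>\<^bsub>N\<^esub>" if "y \<in> carrier N" "(*) (mono_poly (vexp \<beta> L)) \<odot>\<^bsub>N\<^esub> y = \<zero>\<^bsub>N\<^esub>" for y
      using loc_inj[OF that(1)] that(2) by (simp add: xmon_power)
    have "(\<lambda>b. wadd b (vexp \<beta> L)) ` (\<lambda>b. wsub b (vexp \<beta> L)) ` B = B" by (simp add: image_image)
    then show "spec N ((\<lambda>b. wadd b (vexp \<beta> L)) ` (\<lambda>b. wsub b (vexp \<beta> L)) ` B) ((*) (mono_poly (vexp \<beta> L)) \<odot>\<^bsub>N\<^esub> fr m L)"
      using mod_hom_spec[OF left_module_loc loc_hom assms] loc_unit[OF m] by (simp add: xmon_power)
  qed (use m in simp)
qed

lemma fr_weight: "m \<in> deg_part M b \<Longrightarrow> fr m L \<in> deg_part N (wsub b (vexp \<beta> L))"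
  using D_module.spec_single[OF D_module_loc] fr_spec[OF spec_weight] by fastforce

lemma weight_module_loc:
  assumes "weight_module M" shows "weight_module N"
  unfolding weight_module_def
proof (intro conjI ballI left_module_loc)
  fix x assume "x \<in> carrier N"
  then obtain m L where x: "m \<in> carrier M" "x = fr m L" by (rule loc_cases)
  then obtain B where "finite B" "spec M B m" using assms by (auto simp: weight_module_def)
  then show "\<exists>B. finite B \<and> spec N B x" using fr_spec x by blast
qed

lemma loc_weight_lift:
  assumes W: "weight_module M" and x: "x \<in> deg_part N b"
  shows "\<exists>m L. m \<in> deg_part M (wadd b (vexp \<beta> L)) \<and> x = fr m L"
proof -
  interpret N: D_module N by (rule D_module_loc)
  obtain m L where m: "m \<in> carrier M" "x = fr m L" using loc_cases[OF deg_part_carrier[OF x]] .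
  have "(*) (mono_poly (vexp \<beta> L)) \<odot>\<^bsub>N\<^esub> x \<in> deg_part N (wadd b (vexp \<beta> L))" using N.mono_weight[OF x] .
  then have "fr m 0 \<in> deg_part N (wadd b (vexp \<beta> L))" using m by (simp add: loc_unit xmon_power[symmetric])
  from weight_lift[OF W D_module_loc loc_hom m(1) this]
  obtain m' where m': "m' \<in> deg_part M (wadd b (vexp \<beta> L))" "fr m' 0 = fr m 0" by blast
  have c: "m' \<in> carrier M" using deg_part_carrier[OF m'(1)] .
  have "(*) (xmon \<beta> ^ L) \<odot>\<^bsub>N\<^esub> (fr m' L \<ominus>\<^bsub>N\<^esub> fr m L) = \<zero>\<^bsub>N\<^esub>"
    using c m m'(2) by (simp add: N.smult_diff D_ops_mult loc_unit N.M.diff_eq_zero_iff)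
  then have "fr m' L \<ominus>\<^bsub>N\<^esub> fr m L = \<zero>\<^bsub>N\<^esub>" using loc_inj[of "fr m' L \<ominus>\<^bsub>N\<^esub> fr m L" L] c m(1) N.M.minus_closed[OF fr_carrier fr_carrier, of m' m L L] by blast
  then show ?thesis using m' m c by (auto simp: N.M.diff_eq_zero_iff)
qed

end

lemma mono_localizationI: "D_module M \<Longrightarrow> mono_localization M \<beta>"
  by (simp add: mono_localization_def localization_xmon)

subsection \<open>Maps between localizations\<close>

context D_module begin

context
  fixes s r :: "('k, 'n) mpoly"
  assumes s: "\<And>f. s * f = 0 \<Longrightarrow> f = 0" and rs: "\<And>f. (r * s) * f = 0 \<Longrightarrow> f = 0"
begin

interpretation S: localization M s by unfold_locales (rule s)
interpretation T: localization M "r * s" by unfold_locales (rule rs)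

lemma loc_map_fr:
  assumes m: "m \<in> carrier M"
  shows "loc_map M (powers s) (powers (r * s)) (S.fr m L) = T.fr ((*) (r ^ L) \<odot> m) L"
  unfolding loc_map_def
proof (rule Union_const_eq)
  show "T.fr ((*) (r ^ L) \<odot> m) L \<in> {Defs.frac M (powers (r * s)) ((*) w \<odot> m') (w * t) |w m' t. (m', t) \<in> S.fr m L \<and> w * t \<in> powers (r * s)}"
    unfolding T.fr_def using S.fr_self[OF m, of L]
    by (intro CollectI exI[of _ "r ^ L"] exI[of _ m] exI[of _ "s ^ L"]) (auto simp: T.powers_iff power_mult_distrib)
next
  fix y assume "y \<in> {Defs.frac M (powers (r * s)) ((*) w \<odot> m') (w * t) |w m' t. (m', t) \<in> S.fr m L \<and> w * t \<in> powers (r * s)}"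
  then obtain w m' L' K where y: "y = T.fr ((*) w \<odot> m') K" "w * s ^ L' = (r * s) ^ K" "m' \<in> carrier M" "S.fr m' L' = S.fr m L"
    by (auto simp: S.fr_mem[OF m] T.powers_iff T.fr_def)
  then obtain J where J: "(*) (s ^ (J + L)) \<odot> m' = (*) (s ^ (J + L')) \<odot> m" using S.fr_eq_iff[OF y(3) m] by blast
  have "(*) ((r * s) ^ (J + L)) \<odot> ((*) w \<odot> m') = (*) (r ^ (J + L) * w) \<odot> ((*) (s ^ (J + L)) \<odot> m')"
    using y(3) by (simp add: rmul_rmul power_mult_distrib mult_ac)
  also have "\<dots> = (*) (r ^ (J + L) * s ^ J * (w * s ^ L')) \<odot> m"
    unfolding J using m by (simp add: rmul_rmul power_add mult_ac)
  also have "\<dots> = (*) ((r * s) ^ (J + K)) \<odot> ((*) (r ^ L) \<odot> m)"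
    unfolding y(2) using m by (simp add: rmul_rmul power_mult_distrib power_add mult_ac)
  finally show "y = T.fr ((*) (r ^ L) \<odot> m) L" unfolding y(1) using y(3) m by (subst T.fr_eq_iff) auto
qed

lemma loc_map_hom: "loc_map M (powers s) (powers (r * s)) \<in> mod_hom D_ring S.N T.N"
proof (rule mod_homI)
  fix x assume "x \<in> carrier S.N"
  then obtain m L where "m \<in> carrier M" "x = S.fr m L" by (rule S.loc_cases)
  then show "loc_map M (powers s) (powers (r * s)) x \<in> carrier T.N" by (simp add: loc_map_fr)
next
  fix x y assume xy: "x \<in> carrier S.N" "y \<in> carrier S.N"
  obtain m m' L where "m \<in> carrier M" "m' \<in> carrier M" "x = S.fr m L" "y = S.fr m' L"
    using S.loc_cases3[OF xy xy(1)] by metis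
  then show "loc_map M (powers s) (powers (r * s)) (x \<oplus>\<^bsub>S.N\<^esub> y) =
      loc_map M (powers s) (powers (r * s)) x \<oplus>\<^bsub>T.N\<^esub> loc_map M (powers s) (powers (r * s)) y"
    by (simp add: S.loc_add_same T.loc_add_same loc_map_fr smult_r_distr D_ops_mult)
next
  fix P :: "('k, 'n) poly_op" and x assume P: "P \<in> D_ops" and "x \<in> carrier S.N"
  then obtain m L where x: "m \<in> carrier M" "x = S.fr m L" using S.loc_cases by blast
  obtain Q K where Q: "Q \<in> D_ops" "\<And>f. Q (s ^ L * f) = s ^ K * P f" using S.ore_exists[OF P] by blast
  obtain Q' K' where Q': "Q' \<in> D_ops" "\<And>f. Q' ((r * s) ^ L * f) = (r * s) ^ K' * P f" using T.ore_exists[OF P] by blast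
  have "(\<lambda>f. ((r * s) ^ K' * r ^ K) * Q f) = (\<lambda>f. (r * s) ^ K * Q' (r ^ L * f))"
  proof (rule D_ops_right_cancel_eq[where r = "s ^ L"])
    fix f
    have "((r * s) ^ K' * r ^ K) * Q (s ^ L * f) = (r * s) ^ K * ((r * s) ^ K' * P f)"
      unfolding Q(2) by (simp add: power_mult_distrib mult_ac)
    also have "\<dots> = (r * s) ^ K * Q' (r ^ L * (s ^ L * f))"
      unfolding Q'(2)[symmetric] by (simp add: power_mult_distrib mult_ac)
    finally show "((r * s) ^ K' * r ^ K) * Q (s ^ L * f) = (r * s) ^ K * Q' (r ^ L * (s ^ L * f))" .
  qed (use Q Q' D_ops_lmult[OF D_ops_rmult] D_ops_lmult S.nzd_pow in blast)+
  then have "(\<lambda>f. ((r * s) ^ K' * r ^ K) * Q f) \<odot> m = (\<lambda>f. (r * s) ^ K * Q' (r ^ L * f)) \<odot> m" by simp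
  then have "(*) ((r * s) ^ K') \<odot> ((*) (r ^ K) \<odot> (Q \<odot> m)) = (*) ((r * s) ^ K) \<odot> (Q' \<odot> ((*) (r ^ L) \<odot> m))"
    using x Q(1) Q'(1) smult_closed op_comp[OF D_ops_mult Q(1) x(1), of "(r * s) ^ K' * r ^ K"]
      op_comp[OF Q'(1) D_ops_mult x(1), of "r ^ L"] op_comp[OF D_ops_mult D_ops_rmult[OF Q'(1)] x(1), of "(r * s) ^ K" "r ^ L"]
    by (simp add: rmul_rmul)
  then have "T.fr ((*) (r ^ K) \<odot> (Q \<odot> m)) K = T.fr (Q' \<odot> ((*) (r ^ L) \<odot> m)) K'"
    using x Q(1) Q'(1) smult_closed by (subst T.fr_eq_iff) (auto intro!: exI[of _ 0])
  then show "loc_map M (powers s) (powers (r * s)) (P \<odot>\<^bsub>S.N\<^esub> x) = P \<odot>\<^bsub>T.N\<^esub> loc_map M (powers s) (powers (r * s)) x"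
    using x P Q Q' smult_closed by (simp add: S.loc_op[OF P Q] T.loc_op[OF P Q'] loc_map_fr)
qed

end

end

section \<open>The Cech complex\<close>

subsection \<open>Sums of homomorphisms\<close>

lemma finsum_hom:
  assumes M: "left_module A M" and N: "left_module A N" and "finite I"
    and g: "\<And>i. i \<in> I \<Longrightarrow> g i \<in> mod_hom A M N"
  shows "(\<lambda>x. finsum N (\<lambda>i. g i x) I) \<in> mod_hom A M N"
proof -
  interpret N: left_module A N by fact
  have c: "x \<in> carrier M \<Longrightarrow> i \<in> I \<Longrightarrow> g i x \<in> carrier N" for i x using mod_homD(1)[OF g] .
  show ?thesis
  proof (rule mod_homI)
    fix x y assume xy: "x \<in> carrier M" "y \<in> carrier M"
    then have "finsum N (\<lambda>i. g i (x \<oplus>\<^bsub>M\<^esub> y)) I = finsum N (\<lambda>i. g i x \<oplus>\<^bsub>N\<^esub> g i y) I"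
      by (intro N.M.finsum_cong' refl) (auto simp: mod_homD(2)[OF g] c)
    also have "\<dots> = finsum N (\<lambda>i. g i x) I \<oplus>\<^bsub>N\<^esub> finsum N (\<lambda>i. g i y) I"
      by (rule N.M.finsum_addf) (use xy c in auto)
    finally show "finsum N (\<lambda>i. g i (x \<oplus>\<^bsub>M\<^esub> y)) I = finsum N (\<lambda>i. g i x) I \<oplus>\<^bsub>N\<^esub> finsum N (\<lambda>i. g i y) I" .
  next
    fix a x assume ax: "a \<in> carrier A" "x \<in> carrier M"
    then have "finsum N (\<lambda>i. g i (a \<odot>\<^bsub>M\<^esub> x)) I = finsum N (\<lambda>i. a \<odot>\<^bsub>N\<^esub> g i x) I"
      by (intro N.M.finsum_cong' refl) (auto simp: mod_homD(3)[OF g] c N.smult_closed)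
    also have "\<dots> = a \<odot>\<^bsub>N\<^esub> finsum N (\<lambda>i. g i x) I"
      by (rule N.smult_finsum[symmetric]) (use ax c assms in auto)
    finally show "finsum N (\<lambda>i. g i (a \<odot>\<^bsub>M\<^esub> x)) I = a \<odot>\<^bsub>N\<^esub> finsum N (\<lambda>i. g i x) I" .
  qed (use c in \<open>auto intro!: N.M.finsum_closed\<close>)
qed

lemma dsum_hom:
  assumes "\<And>i. i \<in> I \<Longrightarrow> g i \<in> mod_hom A M (N i)"
  shows "(\<lambda>x. \<lambda>i\<in>I. g i x) \<in> mod_hom A M (dsum I N)"
  by (rule mod_homI) (auto simp: dsum_simps mod_homD[OF assms] intro!: restrict_ext)

text \<open>
  Every unordered pair of indices contributes two terms that cancel.
\<close>

lemma (in abelian_group) finsum_antisymmetric: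
  assumes "finite D" and "\<And>i j. i \<in> D \<Longrightarrow> j \<in> D \<Longrightarrow> i \<noteq> j \<Longrightarrow> a i j \<in> carrier G"
    and "\<And>i j. i \<in> D \<Longrightarrow> j \<in> D \<Longrightarrow> i \<noteq> j \<Longrightarrow> a i j \<oplus> a j i = \<zero>"
  shows "(\<Oplus>i\<in>D. \<Oplus>j\<in>D - {i}. a i j) = \<zero>"
  using assms
proof (induction D)
  case (insert k D)
  have c: "i \<in> insert k D \<Longrightarrow> j \<in> insert k D \<Longrightarrow> i \<noteq> j \<Longrightarrow> a i j \<in> carrier G" for i j using insert.prems by blast
  have inner: "(\<Oplus>j\<in>insert k D - {i}. a i j) = a i k \<oplus> (\<Oplus>j\<in>D - {i}. a i j)" if "i \<in> D" for i
  proof -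
    have "insert k D - {i} = insert k (D - {i})" using that insert by auto
    moreover have "(\<Oplus>j\<in>insert k (D - {i}). a i j) = a i k \<oplus> (\<Oplus>j\<in>D - {i}. a i j)"
      by (rule finsum_insert) (use that insert c in auto)
    ultimately show ?thesis by simp
  qed
  have s1: "(\<Oplus>j\<in>D. a k j) \<in> carrier G" "(\<Oplus>i\<in>D. a i k) \<in> carrier G"
    using insert c by (auto intro!: finsum_closed)
  have "(\<Oplus>i\<in>insert k D. \<Oplus>j\<in>insert k D - {i}. a i j) = (\<Oplus>j\<in>insert k D - {k}. a k j) \<oplus> (\<Oplus>i\<in>D. \<Oplus>j\<in>insert k D - {i}. a i j)"
    by (rule finsum_insert) (use insert c in \<open>auto intro!: finsum_closed\<close>)
  also have "insert k D - {k} = D" using insert by auto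
  also have "(\<Oplus>i\<in>D. \<Oplus>j\<in>insert k D - {i}. a i j) = (\<Oplus>i\<in>D. a i k \<oplus> (\<Oplus>j\<in>D - {i}. a i j))"
    by (intro finsum_cong' refl) (use insert c in \<open>auto simp: inner intro!: finsum_closed a_closed\<close>)
  also have "\<dots> = (\<Oplus>i\<in>D. a i k) \<oplus> (\<Oplus>i\<in>D. \<Oplus>j\<in>D - {i}. a i j)"
    by (rule finsum_addf) (use insert c in \<open>auto intro!: finsum_closed\<close>)
  also have "(\<Oplus>i\<in>D. \<Oplus>j\<in>D - {i}. a i j) = \<zero>" using insert by simp
  also have "(\<Oplus>j\<in>D. a k j) \<oplus> ((\<Oplus>i\<in>D. a i k) \<oplus> \<zero>) = (\<Oplus>j\<in>D. a k j) \<oplus> (\<Oplus>j\<in>D. a j k)"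
    using s1 by simp
  also have "\<dots> = (\<Oplus>j\<in>D. a k j \<oplus> a j k)"
    by (rule finsum_addf[symmetric]) (use insert c in auto)
  also have "\<dots> = (\<Oplus>j\<in>D. \<zero>)" by (intro finsum_cong' refl) (use insert in auto)
  finally show ?case by simp
qed simp

subsection \<open>Vanishing of the variation maps\<close>

text \<open>
  In characteristic zero this is the property that gives modules with variation zero their name:
  \<open>\<partial>\<^sub>i\<close> kills the weight spaces with \<open>b\<^sub>i = 0\<close>, from which \<open>x\<^sub>i\<close> cannot lead back.
\<close>

definition var_zero :: "('k::field, 'n::{finite,linorder}, 'm) dmodule \<Rightarrow> bool" where
  "var_zero M \<longleftrightarrow> (\<forall>i b m. m \<in> deg_part M b \<longrightarrow> b i = 0 \<longrightarrow> partial i \<odot>\<^bsub>M\<^esub> m = \<zero>\<^bsub>M\<^esub>)"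

lemma var_zero_image:
  assumes M: "weight_module M" "var_zero M" and N: "D_module N" and f: "f \<in> mod_hom D_ring M N"
    and s: "f ` carrier M = carrier N"
  shows "var_zero N"
  unfolding var_zero_def
proof (intro allI impI)
  fix i b n assume n: "n \<in> deg_part N b" and b: "b i = 0"
  interpret M: D_module M using M by (simp add: weight_moduleD)
  interpret N: D_module N by fact
  obtain x where x: "x \<in> carrier M" "n = f x" using s deg_part_carrier[OF n] by blast
  then obtain m where m: "m \<in> deg_part M b" "f m = n" using weight_lift[OF M(1) N f] n by blast
  have "partial i \<odot>\<^bsub>N\<^esub> n = f (partial i \<odot>\<^bsub>M\<^esub> m)"
    using mod_homD(3)[OF f partial_D deg_part_carrier[OF m(1)]] m by simp
  then show "partial i \<odot>\<^bsub>N\<^esub> n = \<zero>\<^bsub>N\<^esub>"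
    using M(2) m(1) b mod_hom_zero[OF M.left_module_axioms N.left_module_axioms f] by (auto simp: var_zero_def)
qed

lemma var_zero_submodule: "submodule A D_ring M \<Longrightarrow> var_zero M \<Longrightarrow> var_zero (M\<lparr>carrier := A\<rparr>)"
  by (auto simp: var_zero_def deg_part_restrict[OF submodule_subset])

lemma var_zero_dsum: "(\<And>i. i \<in> I \<Longrightarrow> var_zero (M i)) \<Longrightarrow> var_zero (dsum I M)"
  unfolding var_zero_def deg_part_dsum by (auto simp: dsum_simps intro!: restrict_ext)

lemma partial_xmon: "i \<notin> \<beta> \<Longrightarrow> partial i (xmon \<beta> * f) = xmon \<beta> * partial i f"
proof -
  assume "i \<notin> \<beta>"
  have "finite \<beta>" by simp
  from this \<open>i \<notin> \<beta>\<close> show ?thesis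
    by (induction \<beta> arbitrary: f) (auto simp: xmon_def partial_other_var mult.assoc)
qed

context mono_localization begin

lemma loc_var_inj:
  assumes "i \<in> \<beta>" "x \<in> carrier N" "(*) (var_poly i) \<odot>\<^bsub>N\<^esub> x = \<zero>\<^bsub>N\<^esub>"
  shows "x = \<zero>\<^bsub>N\<^esub>"
proof -
  interpret N: D_module N by (rule D_module_loc)
  have "(*) (xmon \<beta> ^ 1) \<odot>\<^bsub>N\<^esub> x = (*) (xmon (\<beta> - {i})) \<odot>\<^bsub>N\<^esub> ((*) (var_poly i) \<odot>\<^bsub>N\<^esub> x)"
    using assms(2) by (simp add: N.rmul_rmul xmon_remove[OF assms(1), symmetric] mult.commute[of _ "var_poly i"])
  also have "\<dots> = \<zero>\<^bsub>N\<^esub>" unfolding assms(3) by (simp add: D_ops_mult)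
  finally show ?thesis using loc_inj assms(2) by blast
qed

text \<open>
  If \<open>x\<^sub>i\<close> is inverted, then \<open>x\<^sub>i \<partial>\<^sub>i n = 0\<close> by the weight of \<open>n\<close>, and \<open>x\<^sub>i\<close> can be cancelled. Otherwise \<open>\<partial>\<^sub>i\<close>
  commutes with the denominators and acts on numerators, whose weight agrees with that of \<open>n\<close> in
  the direction \<open>i\<close>.
\<close>

lemma var_zero_loc:
  assumes "weight_module M" "var_zero M" shows "var_zero N"
  unfolding var_zero_def
proof (intro allI impI)
  fix i b n assume n: "n \<in> deg_part N b" and b: "b i = 0"
  interpret N: D_module N by (rule D_module_loc)
  show "partial i \<odot>\<^bsub>N\<^esub> n = \<zero>\<^bsub>N\<^esub>"
  proof (cases "i \<in> \<beta>")
    case True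
    have nc: "n \<in> carrier N" by (rule deg_part_carrier[OF n])
    have "(\<lambda>f :: ('k, 'n) mpoly. var_poly i * partial i f) = euler_op i 1" using var_partial by blast
    then have "(*) (var_poly i) \<odot>\<^bsub>N\<^esub> (partial i \<odot>\<^bsub>N\<^esub> n) = euler_op i 1 \<odot>\<^bsub>N\<^esub> n"
      using N.op_comp[OF D_ops_mult partial_D nc, of "var_poly i" i] by simp
    also have "\<dots> = \<zero>\<^bsub>N\<^esub>" using n b nc by (simp add: deg_part_def const_poly_simps)
    finally show ?thesis using loc_var_inj[OF True] nc N.smult_closed partial_D by blast
  next
    case False
    from loc_weight_lift[OF assms(1) n] obtain m L where m: "m \<in> deg_part M (wadd b (vexp \<beta> L))" "n = fr m L" by blast
    have "partial i \<odot> m = \<zero>" using assms(2) m(1) b False by (auto simp: var_zero_def wadd_def lookup_vexp)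
    then show ?thesis unfolding m(2)
      using loc_op_commuting[OF partial_D partial_xmon[OF False] deg_part_carrier[OF m(1)]] fr_zero by simp
  qed
qed

end

subsection \<open>The differential\<close>

lemma loc_atI:
  assumes "D_module M"
  shows D_module_loc_at: "D_module (loc_at M \<beta>)" and left_module_loc_at: "left_module D_ring (loc_at M \<beta>)"
proof -
  interpret mono_localization M \<beta> using assms by (rule mono_localizationI)
  show "D_module (loc_at M \<beta>)" "left_module D_ring (loc_at M \<beta>)"
    using D_module_loc left_module_loc by (simp_all add: loc_at_def)
qed

abbreviation "lfr M \<beta> \<equiv> localization.fr M (xmon \<beta>)"
abbreviation "res M \<gamma> i \<equiv> loc_map M (powers (xmon (\<gamma> - {i}))) (powers (xmon \<gamma>))"

lemma
  fixes M :: "('k::field, 'n::{finite,linorder}, 'm) dmodule"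
  assumes M: "D_module M" and i: "i \<in> \<gamma>"
  shows res_hom: "res M \<gamma> i \<in> mod_hom D_ring (loc_at M (\<gamma> - {i})) (loc_at M \<gamma>)"
    and res_fr: "m \<in> carrier M \<Longrightarrow> res M \<gamma> i (lfr M (\<gamma> - {i}) m L) = lfr M \<gamma> ((*) (var_poly i ^ L) \<odot>\<^bsub>M\<^esub> m) L"
proof -
  interpret D_module M by fact
  have nz: "xmon \<beta> * f = 0 \<Longrightarrow> f = 0" for \<beta> :: "'n set" and f :: "('k, 'n) mpoly"
    using nzd_mono unfolding xmon_eq .
  show "res M \<gamma> i \<in> mod_hom D_ring (loc_at M (\<gamma> - {i})) (loc_at M \<gamma>)"
    using loc_map_hom[of "xmon (\<gamma> - {i})" "var_poly i"] nz xmon_remove[OF i] unfolding loc_at_def by metis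
  show "m \<in> carrier M \<Longrightarrow> res M \<gamma> i (lfr M (\<gamma> - {i}) m L) = lfr M \<gamma> ((*) (var_poly i ^ L) \<odot>\<^bsub>M\<^esub> m) L"
    using loc_map_fr[of "xmon (\<gamma> - {i})" "var_poly i"] nz xmon_remove[OF i] by metis
qed

lemma res_res_commute:
  assumes M: "D_module M" and ij: "i \<in> \<gamma>" "j \<in> \<gamma>" "i \<noteq> j" and x: "x \<in> carrier (loc_at M (\<gamma> - {i} - {j}))"
  shows "res M \<gamma> i (res M (\<gamma> - {i}) j x) = res M \<gamma> j (res M (\<gamma> - {j}) i x)"
proof -
  interpret M: D_module M by fact
  interpret L: mono_localization M "\<gamma> - {i} - {j}" by (rule mono_localizationI[OF M])
  obtain m L where m: "m \<in> carrier M" "x = L.fr m L" using x L.loc_cases unfolding loc_at_def by blast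
  have e: "\<gamma> - {i} - {j} = \<gamma> - {j} - {i}" by auto
  have "res M \<gamma> i (res M (\<gamma> - {i}) j x) = lfr M \<gamma> ((*) (var_poly i ^ L) \<odot>\<^bsub>M\<^esub> ((*) (var_poly j ^ L) \<odot>\<^bsub>M\<^esub> m)) L"
    unfolding m(2) using ij m(1) by (simp add: res_fr[OF M])
  also have "\<dots> = lfr M \<gamma> ((*) (var_poly j ^ L) \<odot>\<^bsub>M\<^esub> ((*) (var_poly i ^ L) \<odot>\<^bsub>M\<^esub> m)) L"
    using M.rmul_commute[OF m(1)] by simp
  also have "\<dots> = res M \<gamma> j (res M (\<gamma> - {j}) i x)"
    unfolding m(2) e using ij m(1) by (simp add: res_fr[OF M])
  finally show ?thesis .
qed

lemma cube_sign_const: "(cube_sign i \<gamma> :: ('k::field, 'n::{finite,linorder}) mpoly) = const_poly (cube_sign i \<gamma>)"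
proof -
  have "(- 1) ^ n = (const_poly ((- 1) ^ n) :: ('k, 'n) mpoly)" for n
    by (induction n) (simp_all add: const_poly_simps)
  then show ?thesis by (simp add: cube_sign_def)
qed

text \<open>
  Removing the smaller of two indices lowers the position of the larger one by one, but not conversely.
\<close>

lemma cube_sign_swap:
  assumes "i \<in> \<gamma>" "j \<in> \<gamma>" "i \<noteq> j"
  shows "cube_sign i \<gamma> * cube_sign j (\<gamma> - {i}) = - (cube_sign j \<gamma> * cube_sign i (\<gamma> - {j}) :: 'a::comm_ring_1)"
proof -
  have *: "cube_sign i \<gamma> * cube_sign j (\<gamma> - {i}) = - (cube_sign j \<gamma> * cube_sign i (\<gamma> - {j}) :: 'a)"
    if "i < j" "i \<in> \<gamma>" "j \<in> \<gamma>" for i j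
  proof -
    have 1: "{l \<in> \<gamma> - {j}. l < i} = {l \<in> \<gamma>. l < i}" using that by auto
    have "{l \<in> \<gamma>. l < j} = insert i {l \<in> \<gamma> - {i}. l < j}" using that by auto
    then have "card {l \<in> \<gamma>. l < j} = Suc (card {l \<in> \<gamma> - {i}. l < j})" by simp
    with 1 show ?thesis by (simp add: cube_sign_def)
  qed
  show ?thesis
  proof (cases "i < j")
    case True
    then show ?thesis using * assms by blast
  next
    case False
    then have "cube_sign j \<gamma> * cube_sign i (\<gamma> - {j}) = - (cube_sign i \<gamma> * cube_sign j (\<gamma> - {i}) :: 'a)" using *[of j i] assms by auto
    then show ?thesis by simp
  qed
qed

lemma cech_idx_remove: "\<gamma> \<in> cech_idx \<alpha> (Suc p) \<Longrightarrow> i \<in> \<gamma> \<Longrightarrow> \<gamma> - {i} \<in> cech_idx \<alpha> p"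
  by (auto simp: cech_idx_def)

lemma finite_cech_idx [simp]: "finite (cech_idx (\<alpha> :: 'n::{finite,linorder} set) p)"
  by simp

lemma left_module_cech: "D_module M \<Longrightarrow> left_module D_ring (cech_mod M \<alpha> p)"
  unfolding cech_mod_def by (rule left_module_dsum[OF ring_D_ring]) (rule left_module_loc_at)

lemma (in D_module) const_hom: "(\<lambda>x. (*) (const_poly c) \<odot> x) \<in> mod_hom D_ring M M"
  by (rule mod_homI) (auto simp: smult_r_distr D_ops_mult op_const)

lemma cech_diff_hom:
  assumes M: "D_module M"
  shows "cech_diff M \<alpha> p \<in> mod_hom D_ring (cech_mod M \<alpha> p) (cech_mod M \<alpha> (Suc p))"
proof -
  have "(\<lambda>f. \<Oplus>\<^bsub>loc_at M \<gamma>\<^esub>i\<in>\<gamma>. (*) (cube_sign i \<gamma>) \<odot>\<^bsub>loc_at M \<gamma>\<^esub> res M \<gamma> i (f (\<gamma> - {i}))) \<in> mod_hom D_ring (cech_mod M \<alpha> p) (loc_at M \<gamma>)"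
    if \<gamma>: "\<gamma> \<in> cech_idx \<alpha> (Suc p)" for \<gamma>
  proof (rule finsum_hom[OF left_module_cech[OF M] left_module_loc_at[OF M]])
    interpret L: D_module "loc_at M \<gamma>" by (rule D_module_loc_at[OF M])
    fix i assume i: "i \<in> \<gamma>"
    have "(\<lambda>f. f (\<gamma> - {i})) \<in> mod_hom D_ring (cech_mod M \<alpha> p) (loc_at M (\<gamma> - {i}))"
      unfolding cech_mod_def by (rule dsum_component_hom) (rule cech_idx_remove[OF \<gamma> i])
    from mod_hom_compose[OF mod_hom_compose[OF this res_hom[OF M i]] L.const_hom]
    show "(\<lambda>f. (*) (cube_sign i \<gamma>) \<odot>\<^bsub>loc_at M \<gamma>\<^esub> res M \<gamma> i (f (\<gamma> - {i}))) \<in> mod_hom D_ring (cech_mod M \<alpha> p) (loc_at M \<gamma>)"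
      unfolding cube_sign_const .
  qed simp
  from dsum_hom[OF this] show ?thesis by (simp add: cech_mod_def cech_diff_def[abs_def])
qed

text \<open>
  Two indices \<open>i\<close> and \<open>j\<close> are removed in both orders; the localization maps commute and the signs are opposite.
\<close>

lemma cech_diff_diff:
  fixes M :: "('k::field, 'n::{finite,linorder}, 'm) dmodule"
  assumes M: "D_module M" and f: "f \<in> carrier (cech_mod M \<alpha> p)"
  shows "cech_diff M \<alpha> (Suc p) (cech_diff M \<alpha> p f) = \<zero>\<^bsub>cech_mod M \<alpha> (Suc (Suc p))\<^esub>"
proof -
  have fc: "f \<beta> \<in> carrier (loc_at M \<beta>)" if "\<beta> \<in> cech_idx \<alpha> p" for \<beta> using f that by (auto simp: cech_mod_def dsum_simps)
  have "(\<Oplus>\<^bsub>loc_at M \<delta>\<^esub>i\<in>\<delta>. (*) (cube_sign i \<delta>) \<odot>\<^bsub>loc_at M \<delta>\<^esub> res M \<delta> i (cech_diff M \<alpha> p f (\<delta> - {i}))) = \<zero>\<^bsub>loc_at M \<delta>\<^esub>"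
    if \<delta>: "\<delta> \<in> cech_idx \<alpha> (Suc (Suc p))" for \<delta>
  proof -
    interpret L: D_module "loc_at M \<delta>" by (rule D_module_loc_at[OF M])
    define y where "y i j = res M \<delta> i (res M (\<delta> - {i}) j (f (\<delta> - {i} - {j})))" for i j
    define a where "a i j = (*) (const_poly (cube_sign i \<delta> * cube_sign j (\<delta> - {i}))) \<odot>\<^bsub>loc_at M \<delta>\<^esub> y i j" for i j
    have fij: "f (\<delta> - {i} - {j}) \<in> carrier (loc_at M (\<delta> - {i} - {j}))" if "i \<in> \<delta>" "j \<in> \<delta>" "i \<noteq> j" for i j
      using fc cech_idx_remove[OF cech_idx_remove[OF \<delta>]] that by blast
    have swap: "\<delta> - {i} - {j} = \<delta> - {j} - {i}" for i j by auto
    have y1: "res M (\<delta> - {i}) j (f (\<delta> - {i} - {j})) \<in> carrier (loc_at M (\<delta> - {i}))" if "i \<in> \<delta>" "j \<in> \<delta>" "i \<noteq> j" for i j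
      using mod_homD(1)[OF res_hom[OF M, of j "\<delta> - {i}"] fij[OF that]] that by simp
    have y: "y i j \<in> carrier (loc_at M \<delta>)" if "i \<in> \<delta>" "j \<in> \<delta>" "i \<noteq> j" for i j
      unfolding y_def using mod_homD(1)[OF res_hom[OF M, of i \<delta>] y1[OF that]] that by simp
    have ys: "y i j = y j i" if "i \<in> \<delta>" "j \<in> \<delta>" "i \<noteq> j" for i j
      unfolding y_def using res_res_commute[OF M that fij[OF that]] swap[of i j] by simp
    have inner: "(*) (cube_sign i \<delta>) \<odot>\<^bsub>loc_at M \<delta>\<^esub> res M \<delta> i (cech_diff M \<alpha> p f (\<delta> - {i})) = (\<Oplus>\<^bsub>loc_at M \<delta>\<^esub>j\<in>\<delta> - {i}. a i j)"
      if i: "i \<in> \<delta>" for i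
    proof -
      interpret L': D_module "loc_at M (\<delta> - {i})" by (rule D_module_loc_at[OF M])
      let ?g = "\<lambda>j. (*) (const_poly (cube_sign j (\<delta> - {i}))) \<odot>\<^bsub>loc_at M (\<delta> - {i})\<^esub> res M (\<delta> - {i}) j (f (\<delta> - {i} - {j}))"
      have hom: "(\<lambda>x. (*) (const_poly (cube_sign i \<delta>)) \<odot>\<^bsub>loc_at M \<delta>\<^esub> res M \<delta> i x) \<in> mod_hom D_ring (loc_at M (\<delta> - {i})) (loc_at M \<delta>)"
        by (rule mod_hom_compose[OF res_hom[OF M i] L.const_hom])
      have gc: "?g \<in> \<delta> - {i} \<rightarrow> carrier (loc_at M (\<delta> - {i}))" by (intro Pi_I L'.rmul_closed y1[OF i]) auto
      have "cech_diff M \<alpha> p f (\<delta> - {i}) = (\<Oplus>\<^bsub>loc_at M (\<delta> - {i})\<^esub>j\<in>\<delta> - {i}. ?g j)"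
        using cech_idx_remove[OF \<delta> i] by (simp add: cech_diff_def cube_sign_const)
      then have "(*) (cube_sign i \<delta>) \<odot>\<^bsub>loc_at M \<delta>\<^esub> res M \<delta> i (cech_diff M \<alpha> p f (\<delta> - {i})) =
          (\<Oplus>\<^bsub>loc_at M \<delta>\<^esub>j\<in>\<delta> - {i}. (*) (const_poly (cube_sign i \<delta>)) \<odot>\<^bsub>loc_at M \<delta>\<^esub> res M \<delta> i (?g j))"
        using mod_hom_finsum[OF left_module_loc_at[OF M] left_module_loc_at[OF M] hom _ gc] by (simp add: cube_sign_const)
      also have "\<dots> = (\<Oplus>\<^bsub>loc_at M \<delta>\<^esub>j\<in>\<delta> - {i}. a i j)"
      proof (intro L.M.finsum_cong' refl)
        show "a i \<in> \<delta> - {i} \<rightarrow> carrier (loc_at M \<delta>)" using y[OF i] by (force simp: a_def)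
        fix j assume j: "j \<in> \<delta> - {i}"
        have "res M \<delta> i (?g j) = (*) (const_poly (cube_sign j (\<delta> - {i}))) \<odot>\<^bsub>loc_at M \<delta>\<^esub> y i j"
          unfolding y_def using mod_homD(3)[OF res_hom[OF M i] D_ops_mult] y1[OF i] j by auto
        then show "(*) (const_poly (cube_sign i \<delta>)) \<odot>\<^bsub>loc_at M \<delta>\<^esub> res M \<delta> i (?g j) = a i j"
          using y[OF i] j by (auto simp: a_def L.rmul_rmul const_poly_simps)
      qed
      finally show ?thesis .
    qed
    have "(\<Oplus>\<^bsub>loc_at M \<delta>\<^esub>i\<in>\<delta>. (*) (cube_sign i \<delta>) \<odot>\<^bsub>loc_at M \<delta>\<^esub> res M \<delta> i (cech_diff M \<alpha> p f (\<delta> - {i}))) =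
        (\<Oplus>\<^bsub>loc_at M \<delta>\<^esub>i\<in>\<delta>. \<Oplus>\<^bsub>loc_at M \<delta>\<^esub>j\<in>\<delta> - {i}. a i j)"
      by (intro L.M.finsum_cong' refl inner) (force intro!: L.M.finsum_closed L.rmul_closed y simp: a_def)
    also have "\<dots> = \<zero>\<^bsub>loc_at M \<delta>\<^esub>"
    proof (rule L.M.finsum_antisymmetric)
      fix i j assume ij: "i \<in> \<delta>" "j \<in> \<delta>" "i \<noteq> j"
      show "a i j \<in> carrier (loc_at M \<delta>)" using y[OF ij] by (simp add: a_def)
      have "a i j \<oplus>\<^bsub>loc_at M \<delta>\<^esub> a j i = (*) (const_poly (cube_sign i \<delta> * cube_sign j (\<delta> - {i}) + cube_sign j \<delta> * cube_sign i (\<delta> - {j}))) \<odot>\<^bsub>loc_at M \<delta>\<^esub> y i j"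
        using y[OF ij] ys[OF ij] by (simp add: a_def L.rmul_add const_poly_simps(3))
      then show "a i j \<oplus>\<^bsub>loc_at M \<delta>\<^esub> a j i = \<zero>\<^bsub>loc_at M \<delta>\<^esub>"
        using cube_sign_swap[OF ij, where 'a = 'k] y[OF ij] by (simp add: const_poly_simps(1))
    qed simp
    finally show ?thesis .
  qed
  then show ?thesis unfolding cech_diff_def[of M \<alpha> "Suc p"] by (auto simp: cech_mod_def dsum_simps intro!: restrict_ext)
qed

subsection \<open>Cocycles, coboundaries and local cohomology\<close>

definition cocycles where "cocycles M \<alpha> p = {f \<in> carrier (cech_mod M \<alpha> p). cech_diff M \<alpha> p f = \<zero>\<^bsub>cech_mod M \<alpha> (Suc p)\<^esub>}"

definition coboundaries where "coboundaries M \<alpha> p =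
  (case p of 0 \<Rightarrow> {\<zero>\<^bsub>cech_mod M \<alpha> 0\<^esub>} | Suc q \<Rightarrow> cech_diff M \<alpha> q ` carrier (cech_mod M \<alpha> q))"

lemma local_coh_eq:
  "local_coh M \<alpha> p = quot_mod ((cech_mod M \<alpha> p)\<lparr>carrier := cocycles M \<alpha> p\<rparr>) (coboundaries M \<alpha> p)"
  by (simp add: local_coh_def cohomology_mod_def cocycles_def coboundaries_def a_kernel_def')

lemma submodule_restrict:
  assumes "left_module A M" "submodule B A M" "submodule Z A M" "B \<subseteq> Z"
  shows "submodule B A (M\<lparr>carrier := Z\<rparr>)"
proof -
  interpret left_module A "M\<lparr>carrier := Z\<rparr>" using assms left_module.left_module_submodule by blast
  show ?thesis by (rule submodule_by_closure) (use assms submodule_closure[OF assms(2)] in auto)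
qed

context
  fixes M :: "('k::field, 'n::{finite,linorder}, 'm) dmodule" and \<alpha> :: "'n set" and p :: nat
  assumes M: "D_module M"
begin

lemma submodule_cocycles: "submodule (cocycles M \<alpha> p) D_ring (cech_mod M \<alpha> p)"
  unfolding cocycles_def
  by (rule mod_hom_kernel_submodule[OF left_module_cech[OF M] left_module_cech[OF M] cech_diff_hom[OF M]])

lemma submodule_coboundaries: "submodule (coboundaries M \<alpha> p) D_ring (cech_mod M \<alpha> p)"
proof (cases p)
  case 0
  interpret C: left_module D_ring "cech_mod M \<alpha> 0" by (rule left_module_cech[OF M])
  show ?thesis unfolding 0 coboundaries_def by (simp, rule C.submodule_by_closure) auto
next
  case (Suc q)
  then show ?thesis
    using mod_hom_image_submodule[OF left_module_cech[OF M] left_module_cech[OF M] cech_diff_hom[OF M]]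
    by (simp add: coboundaries_def)
qed

lemma coboundaries_cocycles: "coboundaries M \<alpha> p \<subseteq> cocycles M \<alpha> p"
proof (cases p)
  case 0
  interpret C: left_module D_ring "cech_mod M \<alpha> p" by (rule left_module_cech[OF M])
  show ?thesis using mod_hom_zero[OF left_module_cech[OF M] left_module_cech[OF M] cech_diff_hom[OF M], of \<alpha> p]
    C.M.zero_closed by (simp add: 0 coboundaries_def cocycles_def)
next
  case (Suc q)
  then show ?thesis using cech_diff_diff[OF M] mod_homD(1)[OF cech_diff_hom[OF M]]
    by (auto simp: coboundaries_def cocycles_def)
qed

lemma submodule_coboundaries': "submodule (coboundaries M \<alpha> p) D_ring ((cech_mod M \<alpha> p)\<lparr>carrier := cocycles M \<alpha> p\<rparr>)"
  by (rule submodule_restrict[OF left_module_cech[OF M] submodule_coboundaries submodule_cocycles coboundaries_cocycles])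

lemma left_module_cocycles: "left_module D_ring ((cech_mod M \<alpha> p)\<lparr>carrier := cocycles M \<alpha> p\<rparr>)"
  by (rule left_module.left_module_submodule[OF left_module_cech[OF M] submodule_cocycles])

lemma left_module_local_coh: "left_module D_ring (local_coh M \<alpha> p)"
  unfolding local_coh_eq by (rule left_module.left_module_quot[OF left_module_cocycles submodule_coboundaries'])

end

lemma weight_module_loc_at: "weight_module M \<Longrightarrow> weight_module (loc_at M \<beta>)"
  using mono_localization.weight_module_loc[OF mono_localizationI[OF weight_moduleD]] by (simp add: loc_at_def)

lemma var_zero_loc_at: "weight_module M \<Longrightarrow> var_zero M \<Longrightarrow> var_zero (loc_at M \<beta>)"
  using mono_localization.var_zero_loc[OF mono_localizationI[OF weight_moduleD]] by (simp add: loc_at_def)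

lemma weight_module_cech: "weight_module M \<Longrightarrow> weight_module (cech_mod M \<alpha> p)"
  unfolding cech_mod_def by (rule weight_module_dsum) (auto intro: weight_module_loc_at)

lemma var_zero_cech: "weight_module M \<Longrightarrow> var_zero M \<Longrightarrow> var_zero (cech_mod M \<alpha> p)"
  unfolding cech_mod_def by (rule var_zero_dsum) (auto intro: var_zero_loc_at)

lemma weight_module_cocycles:
  "weight_module M \<Longrightarrow> weight_module ((cech_mod M \<alpha> p)\<lparr>carrier := cocycles M \<alpha> p\<rparr>)"
  by (rule weight_module_submodule[OF weight_module_cech submodule_cocycles[OF weight_moduleD]])

lemma weight_module_local_coh: "weight_module M \<Longrightarrow> weight_module (local_coh M \<alpha> p)"
  unfolding local_coh_eq by (rule weight_module_quot[OF weight_module_cocycles submodule_coboundaries'[OF weight_moduleD]])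

lemma var_zero_local_coh:
  assumes "weight_module M" "var_zero M" shows "var_zero (local_coh M \<alpha> p)"
proof -
  note M = weight_moduleD[OF assms(1)]
  interpret Z: left_module D_ring "(cech_mod M \<alpha> p)\<lparr>carrier := cocycles M \<alpha> p\<rparr>" by (rule left_module_cocycles[OF M])
  show ?thesis unfolding local_coh_eq
    by (rule var_zero_image[OF weight_module_cocycles[OF assms(1)] var_zero_submodule[OF submodule_cocycles[OF M] var_zero_cech[OF assms]]
          D_moduleI[OF Z.left_module_quot[OF submodule_coboundaries'[OF M]]] Z.coset_hom[OF submodule_coboundaries'[OF M]]])
      (simp only: Z.quot_mod_carrier)
qed

section \<open>The modules \<open>E\<^sub>\<alpha>\<close>\<close>

subsection \<open>The polynomial ring as a module\<close>

lemma R_mod_simps [simp]: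
  "carrier R_mod = UNIV" "\<zero>\<^bsub>R_mod\<^esub> = 0" "f \<oplus>\<^bsub>R_mod\<^esub> g = f + g" "P \<odot>\<^bsub>R_mod\<^esub> f = P f"
  by (simp_all add: R_mod_def)

lemma left_module_R_mod: "left_module D_ring (R_mod :: ('k::field, 'n::{finite,linorder}, _) dmodule)"
  by (rule left_moduleI[OF ring_D_ring]) (auto simp: D_ring_simps(2-) k_linearD[OF D_ops_k_linear])

lemma D_module_R_mod: "D_module R_mod"
  by (rule D_moduleI[OF left_module_R_mod])

lemma single_const: "Poly_Mapping.single a c = const_poly c * mono_poly a"
  by (simp add: const_poly_def mult_single)

lemma R_mod_weight: "Poly_Mapping.single a c \<in> deg_part R_mod (\<lambda>i. int (lk a i))"
proof -
  have "euler_op i t (Poly_Mapping.single a c) = const_poly (of_int (int_binom (int (lk a i)) t)) * Poly_Mapping.single a c" for i t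
    by (intro poly_mapping_eqI) (auto simp: lookup_euler_op lookup_const_times int_binom_nat lookup_single when_def)
  then show ?thesis by (simp add: deg_part_def)
qed

lemma R_mod_weight_lookup:
  assumes f: "f \<in> deg_part (R_mod :: ('k::field, 'n::{finite,linorder}, _) dmodule) b" "lk f a \<noteq> 0"
  shows "b = (\<lambda>i. int (lk a i))"
proof (rule ccontr)
  assume "b \<noteq> (\<lambda>i. int (lk a i))"
  then obtain i where "b i \<noteq> int (lk a i)" by auto
  then obtain t where t: "of_int (int_binom (b i) t) \<noteq> (of_int (int_binom (int (lk a i)) t) :: 'k)"
    using int_binom_separates by blast
  have "lk (euler_op i t f) a = lk (const_poly (of_int (int_binom (b i) t)) * f) a"
    using f(1) by (simp add: deg_part_def)
  then show False using t f(2) by (simp add: lookup_euler_op lookup_const_times int_binom_nat)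
qed

lemma weight_module_R_mod: "weight_module R_mod"
  unfolding weight_module_def
proof (intro conjI ballI left_module_R_mod)
  interpret D_module R_mod by (rule D_module_R_mod)
  fix f :: "('b, 'a) mpoly"
  show "\<exists>B. finite B \<and> spec R_mod B f"
  proof (induction f rule: mpoly_induct)
    case (single a c)
    show ?case using spec_weight[OF R_mod_weight] by blast
  next
    case (add f g)
    then show ?case using spec_add by (metis R_mod_simps(3) finite_UnI)
  qed
qed

subsection \<open>Coefficients of Laurent polynomials\<close>

definition nexp :: "('n::finite \<Rightarrow> int) \<Rightarrow> 'n expo" where "nexp b = Abs_poly_mapping (\<lambda>i. nat (b i))"

lemma lookup_nexp: "lk (nexp b) i = nat (b i)"
  by (simp add: nexp_def)

text \<open>
  Exponents are integers, with coefficient \<open>0\<close> outside the orthant, so that multiplication by a monomial is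
  a translation without side conditions.
\<close>

definition pcoeff :: "('k::field, 'n::{finite,linorder}) mpoly \<Rightarrow> ('n \<Rightarrow> int) \<Rightarrow> 'k" where
  "pcoeff f b = (if \<forall>i. 0 \<le> b i then lk f (nexp b) else 0)"

lemma pcoeff_add: "pcoeff (f + g) b = pcoeff f b + pcoeff g b"
  by (simp add: pcoeff_def lookup_add)

lemma pcoeff_const: "pcoeff (const_poly c * f) b = c * pcoeff f b"
  by (simp add: pcoeff_def lookup_const_times)

lemma pcoeff_mono: "pcoeff (mono_poly a * f) b = pcoeff f (wsub b a)"
proof (cases "\<forall>i. 0 \<le> wsub b a i")
  case True
  then have le: "int (lk a i) \<le> b i" for i by (simp add: wsub_def)
  then have "0 \<le> b i" for i by (metis le of_nat_0_le_iff order_trans)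
  moreover have "nexp b - a = nexp (wsub b a)"
    by (intro poly_mapping_eqI) (simp add: lookup_minus lookup_nexp wsub_def nat_diff_distrib')
  moreover have "lk a i \<le> lk (nexp b) i" for i using le[of i] by (simp add: lookup_nexp)
  ultimately show ?thesis using True by (simp add: pcoeff_def lookup_single_times)
next
  case False
  then obtain i where "b i < int (lk a i)" by (auto simp: wsub_def not_le)
  then have "\<not> ((\<forall>i. 0 \<le> b i) \<and> (\<forall>i. lk a i \<le> lk (nexp b) i))" by (auto simp: lookup_nexp) (metis le_nat_iff not_le)
  then show ?thesis using False by (auto simp: pcoeff_def lookup_single_times)
qed

lemma pcoeff_nat: "pcoeff f (\<lambda>i. int (lk a i)) = lk f a"
proof -
  have "nexp (\<lambda>i. int (lk a i)) = a" by (intro poly_mapping_eqI) (simp add: lookup_nexp)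
  then show ?thesis by (simp add: pcoeff_def)
qed

lemma pcoeff_eqI: "pcoeff f = pcoeff g \<Longrightarrow> f = g"
  by (intro poly_mapping_eqI) (metis pcoeff_nat)

lemma pcoeff_single: "pcoeff (Poly_Mapping.single a c) b = (if b = (\<lambda>i. int (lk a i)) then c else 0)"
proof (cases "b = (\<lambda>i. int (lk a i))")
  case True
  then show ?thesis by (simp add: pcoeff_nat)
next
  case False
  then have "(\<forall>i. 0 \<le> b i) \<Longrightarrow> nexp b \<noteq> a" by (auto simp: fun_eq_iff lookup_nexp)
  then show ?thesis using False by (auto simp: pcoeff_def lookup_single when_def)
qed

lemma pcoeff_finite: "finite {b. pcoeff f b \<noteq> 0}"
proof (induction f rule: mpoly_induct)
  case (single a c)
  then show ?case by (rule finite_subset[of _ "{\<lambda>i. int (lk a i)}"]) (auto simp: pcoeff_single split: if_splits)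
next
  case (add f g)
  then show ?case by (rule_tac finite_subset[of _ "{b. pcoeff f b \<noteq> 0} \<union> {b. pcoeff g b \<noteq> 0}"]) (auto simp: pcoeff_add)
qed

abbreviation "Lau \<equiv> loc_at R_mod UNIV"

interpretation L: mono_localization "R_mod :: ('k::field, 'n::{finite,linorder}, _) dmodule" UNIV
  rewrites "loc_mod (R_mod :: ('k::field, 'n::{finite,linorder}, _) dmodule) (powers (xmon UNIV)) \<equiv> Lau"
  by (rule mono_localizationI[OF D_module_R_mod]) (simp add: loc_at_def)

interpretation LM: D_module Lau
  by (rule L.D_module_loc)

definition lcoeff :: "('k::field, 'n::{finite,linorder}) laurent \<Rightarrow> ('n \<Rightarrow> int) \<Rightarrow> 'k" where
  "lcoeff l b = (let (f, N) = (SOME (f, N). l = L.fr f N) in pcoeff f (wadd b (vexp UNIV N)))"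

lemma lcoeff_fr: "lcoeff (L.fr f N) b = pcoeff f (wadd b (vexp UNIV N))"
proof -
  define z where "z = (SOME (f', N'). L.fr f N = L.fr f' N')"
  have "case z of (f', N') \<Rightarrow> L.fr f N = L.fr f' N'" unfolding z_def by (rule someI[of _ "(f, N)"]) simp
  then obtain f' N' where z: "z = (f', N')" "L.fr f N = L.fr f' N'" by (cases z) auto
  obtain K where "xmon UNIV ^ (K + N') * f = xmon UNIV ^ (K + N) * f'" using z(2) by (auto simp: L.fr_eq_iff)
  then have "pcoeff (mono_poly (vexp UNIV (K + N')) * f) (wadd b (vexp UNIV (K + N + N'))) =
      pcoeff (mono_poly (vexp UNIV (K + N)) * f') (wadd b (vexp UNIV (K + N + N')))"
    by (simp add: xmon_power)
  moreover have "wsub (wadd b (vexp UNIV (K + N + N'))) (vexp UNIV (K + N')) = wadd b (vexp UNIV N)"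
    "wsub (wadd b (vexp UNIV (K + N + N'))) (vexp UNIV (K + N)) = wadd b (vexp UNIV N')"
    by (auto simp: wsub_def wadd_def lookup_vexp)
  ultimately show ?thesis using z(1) by (simp add: lcoeff_def z_def[symmetric] pcoeff_mono)
qed

lemma lcoeff_add: "l \<in> carrier Lau \<Longrightarrow> l' \<in> carrier Lau \<Longrightarrow> lcoeff (l \<oplus>\<^bsub>Lau\<^esub> l') b = lcoeff l b + lcoeff l' b"
proof -
  assume l: "l \<in> carrier Lau" and l': "l' \<in> carrier Lau"
  obtain f f' N where "l = L.fr f N" "l' = L.fr f' N" using L.loc_cases3[OF l l' l'] by metis
  then show ?thesis by (simp add: L.loc_add_same lcoeff_fr pcoeff_add)
qed

lemma lcoeff_rmul:
  assumes "l \<in> carrier Lau"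
  shows lcoeff_const: "lcoeff ((*) (const_poly c) \<odot>\<^bsub>Lau\<^esub> l) b = c * lcoeff l b"
    and lcoeff_mono: "lcoeff ((*) (mono_poly a) \<odot>\<^bsub>Lau\<^esub> l) b = lcoeff l (wsub b a)"
proof -
  obtain f N where l: "l = L.fr f N" using L.loc_cases[OF assms] by metis
  have "wsub (wadd b v) a = wadd (wsub b a) v" for v by (simp add: wsub_def wadd_def algebra_simps)
  then show "lcoeff ((*) (const_poly c) \<odot>\<^bsub>Lau\<^esub> l) b = c * lcoeff l b"
    "lcoeff ((*) (mono_poly a) \<odot>\<^bsub>Lau\<^esub> l) b = lcoeff l (wsub b a)"
    by (simp_all add: l L.loc_rmul lcoeff_fr pcoeff_const pcoeff_mono)
qed

lemma lcoeff_zero: "lcoeff \<zero>\<^bsub>Lau\<^esub> b = 0"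
  using lcoeff_const[of "\<zero>\<^bsub>Lau\<^esub>" 0 b] by (simp add: const_poly_simps)

lemma lcoeff_eqI:
  assumes l: "l \<in> carrier Lau" and l': "l' \<in> carrier Lau" and e: "\<And>b. lcoeff l b = lcoeff l' b"
  shows "l = l'"
proof -
  obtain f f' N where f: "l = L.fr f N" "l' = L.fr f' N" using L.loc_cases3[OF l l' l'] by metis
  have "pcoeff f b = pcoeff f' b" for b using e[of "wsub b (vexp UNIV N)"] by (simp add: f lcoeff_fr)
  then have "f = f'" by (intro pcoeff_eqI ext)
  then show ?thesis using f by simp
qed

lemma lcoeff_finite: "l \<in> carrier Lau \<Longrightarrow> finite {b. lcoeff l b \<noteq> 0}"
proof -
  assume "l \<in> carrier Lau"
  then obtain f N where l: "l = L.fr f N" using L.loc_cases by metis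
  have "{b. lcoeff l b \<noteq> 0} \<subseteq> (\<lambda>b. wsub b (vexp UNIV N)) ` {b. pcoeff f b \<noteq> 0}"
    by (auto simp: l lcoeff_fr image_iff intro!: exI[of _ "wadd _ (vexp UNIV N)"])
  then show ?thesis using pcoeff_finite finite_subset by blast
qed

text \<open>
  The Laurent monomial \<open>c x\<^sup>b\<close>. Any \<open>N\<close> that clears the denominators would do.
\<close>

definition lmono :: "('n::{finite,linorder} \<Rightarrow> int) \<Rightarrow> 'k::field \<Rightarrow> ('k, 'n) laurent" where
  "lmono b c = (let N = \<Sum>i\<in>UNIV. nat \<bar>b i\<bar> in L.fr (Poly_Mapping.single (nexp (wadd b (vexp UNIV N))) c) N)"

lemma abs_le_sum: "\<bar>b i\<bar> \<le> int (\<Sum>i\<in>UNIV. nat \<bar>b i\<bar>)" for b :: "'n::finite \<Rightarrow> int"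
  using member_le_sum[of i UNIV "\<lambda>i. nat \<bar>b i\<bar>"] by (simp del: of_nat_sum)

lemma lmono_carrier [simp]: "lmono b c \<in> carrier Lau"
  by (simp add: lmono_def Let_def)

lemma lcoeff_lmono: "lcoeff (lmono b c) b' = (if b' = b then c else 0)"
proof -
  define N where "N = (\<Sum>i\<in>UNIV. nat \<bar>b i\<bar>)"
  have "0 \<le> b i + int N" for i using abs_le_sum[of b i] by (simp add: N_def[symmetric] del: of_nat_sum)
  then have "(\<lambda>i. int (lk (nexp (wadd b (vexp UNIV N))) i)) = wadd b (vexp UNIV N)"
    by (auto simp: lookup_nexp wadd_def lookup_vexp)
  moreover have "wadd b' (vexp UNIV N) = wadd b (vexp UNIV N) \<longleftrightarrow> b' = b" by (metis wadd_wsub(2))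
  ultimately show ?thesis by (simp add: lmono_def N_def[symmetric] Let_def lcoeff_fr pcoeff_single)
qed

lemma laurent_induct [consumes 1, case_names zero mono add]:
  assumes "l \<in> carrier Lau" and z: "Pr \<zero>\<^bsub>Lau\<^esub>" and m: "\<And>b c. lcoeff l b \<noteq> 0 \<Longrightarrow> Pr (lmono b c)"
    and a: "\<And>x y. x \<in> carrier Lau \<Longrightarrow> y \<in> carrier Lau \<Longrightarrow> Pr x \<Longrightarrow> Pr y \<Longrightarrow> Pr (x \<oplus>\<^bsub>Lau\<^esub> y)"
  shows "Pr l"
proof -
  have "Pr l'" if "finite B" "l' \<in> carrier Lau" "{b. lcoeff l' b \<noteq> 0} \<subseteq> B" "B \<subseteq> {b. lcoeff l b \<noteq> 0}" for l' B
    using that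
  proof (induction B arbitrary: l')
    case empty
    then have "l' = \<zero>\<^bsub>Lau\<^esub>" by (intro lcoeff_eqI) (auto simp: lcoeff_zero)
    then show ?case using z by simp
  next
    case (insert b B)
    define l2 where "l2 = l' \<oplus>\<^bsub>Lau\<^esub> lmono b (- lcoeff l' b)"
    have l2: "l2 \<in> carrier Lau" "lcoeff l2 b' = (if b' = b then 0 else lcoeff l' b')" for b'
      using insert by (auto simp: l2_def lcoeff_add lcoeff_lmono)
    have "Pr l2" by (rule insert.IH) (use insert l2 in \<open>auto split: if_splits\<close>)
    moreover have "Pr (lmono b (lcoeff l' b))" using insert m by blast
    ultimately have "Pr (l2 \<oplus>\<^bsub>Lau\<^esub> lmono b (lcoeff l' b))" using a l2 by simp
    moreover have "l2 \<oplus>\<^bsub>Lau\<^esub> lmono b (lcoeff l' b) = l'"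
      by (rule lcoeff_eqI) (use insert l2 in \<open>auto simp: lcoeff_add lcoeff_lmono\<close>)
    ultimately show ?case by simp
  qed
  from this[OF lcoeff_finite[OF assms(1)] assms(1)] show ?thesis by blast
qed

lemma laurent_exists:
  fixes \<phi> :: "('n::{finite,linorder} \<Rightarrow> int) \<Rightarrow> 'k::field"
  assumes "finite {b. \<phi> b \<noteq> 0}" shows "\<exists>l\<in>carrier Lau. \<forall>b. lcoeff l b = \<phi> b"
proof -
  have "\<exists>l\<in>carrier Lau. \<forall>b. lcoeff l b = (if b \<in> B then \<phi> b else 0)" if "finite B" for B
    using that
  proof (induction B)
    case empty
    show ?case by (intro bexI[of _ "\<zero>\<^bsub>Lau\<^esub>"]) (auto simp: lcoeff_zero)
  next
    case (insert b B)
    then obtain l where l: "l \<in> carrier Lau" "\<forall>b. lcoeff l b = (if b \<in> B then \<phi> b else 0)" by blast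
    then show ?case using insert
      by (intro bexI[of _ "l \<oplus>\<^bsub>Lau\<^esub> lmono b (\<phi> b)"]) (auto simp: lcoeff_add lcoeff_lmono)
  qed
  from this[OF assms] obtain l where l: "l \<in> carrier Lau" "\<forall>b. lcoeff l b = (if b \<in> {b. \<phi> b \<noteq> 0} then \<phi> b else 0)" by blast
  then have "lcoeff l b = \<phi> b" for b by (cases "\<phi> b = 0") auto
  then show ?thesis using l(1) by blast
qed

lemma lcoeff_euler:
  assumes "l \<in> carrier Lau"
  shows "lcoeff (euler_op i t \<odot>\<^bsub>Lau\<^esub> l) b = of_int (int_binom (b i) t) * lcoeff l b"
proof -
  obtain f N where l: "l = L.fr f N" using L.loc_cases[OF assms] by metis
  obtain B where B: "finite B" "spec Lau B l"
    using weight_module_loc_at[OF weight_module_R_mod] assms unfolding weight_module_def by metis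
  have wt: "lcoeff m b = 0" if m: "m \<in> deg_part Lau w" and bw: "b \<noteq> w" for m w b
  proof -
    obtain f N where f: "f \<in> deg_part R_mod (wadd w (vexp UNIV N))" "m = L.fr f N"
      using L.loc_weight_lift[OF weight_module_R_mod m] by blast
    have "pcoeff f (wadd b (vexp UNIV N)) = 0"
    proof (rule ccontr)
      assume ne: "pcoeff f (wadd b (vexp UNIV N)) \<noteq> 0"
      then have nn: "\<forall>i. 0 \<le> wadd b (vexp UNIV N) i" and "lk f (nexp (wadd b (vexp UNIV N))) \<noteq> 0"
        by (auto simp: pcoeff_def split: if_splits)
      from R_mod_weight_lookup[OF f(1) this(2)] nn have "wadd w (vexp UNIV N) = wadd b (vexp UNIV N)"
        by (auto simp: lookup_nexp fun_eq_iff)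
      then show False using bw by (metis wadd_wsub(2))
    qed
    then show ?thesis using f by (simp add: lcoeff_fr)
  qed
  show ?thesis using B
  proof (induction rule: LM.spec_induct)
    case zero
    show ?case by (simp add: lcoeff_zero euler_op_D)
  next
    case (weight w m)
    have mc: "m \<in> carrier Lau" by (rule deg_part_carrier[OF weight(2)])
    have "euler_op i t \<odot>\<^bsub>Lau\<^esub> m = (*) (const_poly (of_int (int_binom (w i) t))) \<odot>\<^bsub>Lau\<^esub> m"
      using weight(2) by (simp add: deg_part_def)
    then show ?case using wt[OF weight(2), of b] by (cases "b = w") (auto simp: lcoeff_const[OF mc])
  next
    case (add y z)
    then show ?case by (simp add: LM.smult_r_distr euler_op_D lcoeff_add LM.smult_closed distrib_left)
  qed
qed

subsection \<open>The submodules \<open>E_sub\<close>\<close>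

lemma (in left_module) sum_of_submodules:
  assumes "finite I" and U: "\<And>i. i \<in> I \<Longrightarrow> submodule (U i) R M"
  shows "submodule {finsum M g I | g. \<forall>i\<in>I. g i \<in> U i} R M"
    and "i \<in> I \<Longrightarrow> U i \<subseteq> {finsum M g I | g. \<forall>i\<in>I. g i \<in> U i}"
proof -
  have c: "g \<in> I \<rightarrow> carrier M" if "\<forall>i\<in>I. g i \<in> U i" for g using that submodule_subset[OF U] by blast
  show "submodule {finsum M g I | g. \<forall>i\<in>I. g i \<in> U i} R M"
  proof (rule submodule_by_closure)
    show "{finsum M g I | g. \<forall>i\<in>I. g i \<in> U i} \<subseteq> carrier M" using c by (auto intro!: M.finsum_closed)
    have "finsum M (\<lambda>_. \<zero>) I = \<zero>" by simp
    then show "\<zero> \<in> {finsum M g I | g. \<forall>i\<in>I. g i \<in> U i}"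
      using submodule_zero[OF U] by (intro CollectI exI[of _ "\<lambda>_. \<zero>"]) simp
  next
    fix x y assume "x \<in> {finsum M g I | g. \<forall>i\<in>I. g i \<in> U i}" "y \<in> {finsum M g I | g. \<forall>i\<in>I. g i \<in> U i}"
    then obtain g h where g: "x = finsum M g I" "\<forall>i\<in>I. g i \<in> U i" and h: "y = finsum M h I" "\<forall>i\<in>I. h i \<in> U i" by blast
    have "x \<oplus> y = finsum M (\<lambda>i. g i \<oplus> h i) I" using M.finsum_addf[OF c[OF g(2)] c[OF h(2)]] g h by simp
    moreover have "\<forall>i\<in>I. g i \<oplus> h i \<in> U i" using g h submodule_add[OF U] by blast
    ultimately show "x \<oplus> y \<in> {finsum M g I | g. \<forall>i\<in>I. g i \<in> U i}" by blast
  next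
    fix a x assume a: "a \<in> carrier R" and "x \<in> {finsum M g I | g. \<forall>i\<in>I. g i \<in> U i}"
    then obtain g where g: "x = finsum M g I" "\<forall>i\<in>I. g i \<in> U i" by blast
    have "a \<odot> x = finsum M (\<lambda>i. a \<odot> g i) I" using smult_finsum[OF a assms(1) c[OF g(2)]] g by simp
    moreover have "\<forall>i\<in>I. a \<odot> g i \<in> U i" using g submodule_smult[OF U] a by blast
    ultimately show "a \<odot> x \<in> {finsum M g I | g. \<forall>i\<in>I. g i \<in> U i}" by blast
  qed
  assume i: "i \<in> I"
  show "U i \<subseteq> {finsum M g I | g. \<forall>i\<in>I. g i \<in> U i}"
  proof
    fix x assume x: "x \<in> U i"
    have xc: "x \<in> carrier M" using x submodule_subset[OF U[OF i]] by blast
    have "finsum M (\<lambda>j. if i = j then x else \<zero>) I = x"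
      using M.finsum_singleton[OF i assms(1), of "\<lambda>_. x"] xc by simp
    moreover have "\<forall>j\<in>I. (if i = j then x else \<zero>) \<in> U j" using x submodule_zero[OF U] by auto
    ultimately show "x \<in> {finsum M g I | g. \<forall>i\<in>I. g i \<in> U i}" by (intro CollectI exI[of _ "\<lambda>j. if i = j then x else \<zero>"]) simp
  qed
qed

definition nonneg_part :: "'n::{finite,linorder} \<Rightarrow> ('k::field, 'n) laurent set" where
  "nonneg_part i = res R_mod UNIV i ` carrier (loc_at R_mod (UNIV - {i}))"

lemma submodule_nonneg_part: "submodule (nonneg_part i) D_ring Lau"
  unfolding nonneg_part_def
  by (rule mod_hom_image_submodule[OF left_module_loc_at[OF D_module_R_mod] left_module_loc_at[OF D_module_R_mod] res_hom[OF D_module_R_mod]]) simp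

lemma E_sub_eq: "E_sub \<alpha> = {finsum Lau g \<alpha> | g. \<forall>i\<in>\<alpha>. g i \<in> nonneg_part i}"
  by (simp add: E_sub_def nonneg_part_def)

lemma submodule_E_sub: "submodule (E_sub \<alpha>) D_ring Lau"
  unfolding E_sub_eq by (rule LM.sum_of_submodules(1)) (auto intro: submodule_nonneg_part)

lemma lcoeff_nonneg_part:
  assumes "l \<in> nonneg_part i" "b i < 0" shows "lcoeff l b = 0"
proof -
  interpret Q: mono_localization R_mod "UNIV - {i}" by (rule mono_localizationI[OF D_module_R_mod])
  obtain x where x: "x \<in> carrier (loc_at R_mod (UNIV - {i}))" "l = res R_mod UNIV i x"
    using assms(1) by (auto simp: nonneg_part_def)
  then obtain f N where f: "x = Q.fr f N" using Q.loc_cases unfolding loc_at_def by metis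
  have vp: "var_poly i ^ N = mono_poly (vexp {i} N)" using xmon_power[of "{i}" N] by (simp add: xmon_def)
  have "l = L.fr (var_poly i ^ N * f) N" unfolding x f using res_fr[OF D_module_R_mod, of i UNIV f N] by simp
  then have "lcoeff l b = pcoeff f (wsub (wadd b (vexp UNIV N)) (vexp {i} N))"
    by (simp add: lcoeff_fr vp pcoeff_mono)
  also have "\<dots> = 0" using assms(2) by (auto simp: pcoeff_def wsub_def wadd_def lookup_vexp intro!: exI[of _ i])
  finally show ?thesis .
qed

lemma lmono_nonneg_part:
  assumes "0 \<le> b i" shows "lmono b c \<in> nonneg_part i"
proof -
  interpret Q: mono_localization R_mod "UNIV - {i}" by (rule mono_localizationI[OF D_module_R_mod])
  define N where "N = (\<Sum>i\<in>UNIV. nat \<bar>b i\<bar>)"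
  have N: "0 \<le> b i + int N" for i using abs_le_sum[of b i] by (simp add: N_def[symmetric] del: of_nat_sum)
  have vp: "var_poly i ^ N = mono_poly (vexp {i} N)" using xmon_power[of "{i}" N] by (simp add: xmon_def)
  define f where "f = Poly_Mapping.single (nexp (wadd b (vexp (UNIV - {i}) N))) c"
  have "vexp {i} N + nexp (wadd b (vexp (UNIV - {i}) N)) = nexp (wadd b (vexp UNIV N))"
    using N assms by (intro poly_mapping_eqI) (auto simp: lookup_add lookup_nexp lookup_vexp wadd_def nat_add_distrib)
  then have "var_poly i ^ N * f = Poly_Mapping.single (nexp (wadd b (vexp UNIV N))) c"
    by (simp add: vp f_def mult_single)
  then have "lmono b c = res R_mod UNIV i (Q.fr f N)"
    using res_fr[OF D_module_R_mod, of i UNIV f N] by (simp add: lmono_def N_def[symmetric] Let_def)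
  moreover have "Q.fr f N \<in> carrier (loc_at R_mod (UNIV - {i}))" unfolding loc_at_def by simp
  ultimately show ?thesis by (auto simp: nonneg_part_def)
qed

text \<open>
  The exponents of the Laurent monomials that survive in \<open>E\<^sub>\<alpha>\<close>.
\<close>

definition ncone :: "'n set \<Rightarrow> ('n \<Rightarrow> int) set" where "ncone \<alpha> = {b. \<forall>i\<in>\<alpha>. b i < 0}"

lemma ncone_mono: "\<alpha> \<subseteq> \<beta> \<Longrightarrow> ncone \<beta> \<subseteq> ncone \<alpha>"
  by (auto simp: ncone_def)

lemma ncone_wsub: "b \<in> ncone \<alpha> \<Longrightarrow> wsub b a \<in> ncone \<alpha>"
  by (auto simp: ncone_def wsub_def)

text \<open>
  A monomial outside the cone has a nonnegative exponent at some \<open>i \<in> \<alpha>\<close> and therefore comes from the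
  localization in which \<open>x\<^sub>i\<close> is not inverted. Elements of these localizations have no monomials in the cone.
\<close>

lemma E_sub_iff: "l \<in> E_sub \<alpha> \<longleftrightarrow> l \<in> carrier Lau \<and> (\<forall>b\<in>ncone \<alpha>. lcoeff l b = 0)"
proof
  assume "l \<in> E_sub \<alpha>"
  then obtain g where g: "l = finsum Lau g \<alpha>" "\<forall>i\<in>\<alpha>. g i \<in> nonneg_part i" by (auto simp: E_sub_eq)
  have c: "g \<in> \<alpha> \<rightarrow> carrier Lau" using g submodule_subset[OF submodule_nonneg_part] by blast
  have "lcoeff l b = 0" if "b \<in> ncone \<alpha>" for b
  proof -
    have "lcoeff l b = (\<Sum>i\<in>\<alpha>. lcoeff (g i) b)"
      unfolding g(1) by (rule LM.M.additive_finsum[OF lcoeff_add _ c]) auto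
    moreover have "lcoeff (g i) b = 0" if "i \<in> \<alpha>" for i
      using lcoeff_nonneg_part[of "g i" i b] g(2) \<open>b \<in> ncone \<alpha>\<close> that by (auto simp: ncone_def)
    ultimately show ?thesis by simp
  qed
  then show "l \<in> carrier Lau \<and> (\<forall>b\<in>ncone \<alpha>. lcoeff l b = 0)"
    using \<open>l \<in> E_sub \<alpha>\<close> submodule_subset[OF submodule_E_sub] by blast
next
  assume l: "l \<in> carrier Lau \<and> (\<forall>b\<in>ncone \<alpha>. lcoeff l b = 0)"
  then have "l \<in> carrier Lau" by simp
  then show "l \<in> E_sub \<alpha>"
  proof (induction rule: laurent_induct)
    case (mono b c)
    then have "b \<notin> ncone \<alpha>" using l by blast
    then obtain i where i: "i \<in> \<alpha>" "0 \<le> b i" by (auto simp: ncone_def not_less)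
    have "nonneg_part i \<subseteq> E_sub \<alpha>"
      unfolding E_sub_eq by (rule LM.sum_of_submodules(2)) (auto intro: submodule_nonneg_part i)
    then show ?case using lmono_nonneg_part[where b = b and i = i, OF i(2)] by blast
  qed (auto intro: submodule_zero[OF submodule_E_sub] submodule_add[OF submodule_E_sub])
qed

subsection \<open>Coefficients of elements of \<open>E\<^sub>\<alpha>\<close>\<close>

abbreviation "ecls \<alpha> l \<equiv> E_sub \<alpha> +>\<^bsub>Lau\<^esub> l"

lemma left_module_E: "left_module D_ring (E_mod \<alpha>)"
  unfolding E_mod_def by (rule LM.left_module_quot[OF submodule_E_sub])

lemma D_module_E: "D_module (E_mod \<alpha>)"
  by (rule D_moduleI[OF left_module_E])

interpretation EM: D_module "E_mod \<alpha>"
  by (rule D_module_E)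

lemma E_carrier: "carrier (E_mod \<alpha>) = ecls \<alpha> ` carrier Lau"
  by (simp add: E_mod_def LM.quot_mod_carrier)

text \<open>
  The value \<open>0\<close> outside the cone is a convention.
\<close>

definition ecoeff :: "'n::{finite,linorder} set \<Rightarrow> ('k::field, 'n) laurent set \<Rightarrow> ('n \<Rightarrow> int) \<Rightarrow> 'k" where
  "ecoeff \<alpha> C b = (if b \<in> ncone \<alpha> then lcoeff (SOME l. l \<in> carrier Lau \<and> C = ecls \<alpha> l) b else 0)"

lemma lcoeff_diff_E: 
  assumes "l \<in> carrier Lau" "l' \<in> carrier Lau" "ecls \<alpha> l = ecls \<alpha> l'" "b \<in> ncone \<alpha>"
  shows "lcoeff l b = lcoeff l' b"
proof -
  have "l \<ominus>\<^bsub>Lau\<^esub> l' \<in> E_sub \<alpha>" using LM.coset_eq_iff[OF submodule_E_sub assms(1,2)] assms(3) by blast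
  then have "lcoeff (l \<ominus>\<^bsub>Lau\<^esub> l') b = 0" using assms(4) E_sub_iff by blast
  moreover have "l = (l \<ominus>\<^bsub>Lau\<^esub> l') \<oplus>\<^bsub>Lau\<^esub> l'"
    using assms by (simp add: LM.M.minus_eq LM.M.a_assoc LM.M.l_neg)
  then have "lcoeff l b = lcoeff (l \<ominus>\<^bsub>Lau\<^esub> l') b + lcoeff l' b"
    using lcoeff_add assms by (metis LM.M.minus_closed)
  ultimately show ?thesis by simp
qed

lemma ecoeff_cls: "l \<in> carrier Lau \<Longrightarrow> ecoeff \<alpha> (ecls \<alpha> l) b = (if b \<in> ncone \<alpha> then lcoeff l b else 0)"
proof -
  assume l: "l \<in> carrier Lau"
  define l' where "l' = (SOME l'. l' \<in> carrier Lau \<and> ecls \<alpha> l = ecls \<alpha> l')"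
  have "l' \<in> carrier Lau \<and> ecls \<alpha> l = ecls \<alpha> l'" unfolding l'_def by (rule someI[of _ l]) (use l in simp)
  moreover have "ecoeff \<alpha> (ecls \<alpha> l) b = (if b \<in> ncone \<alpha> then lcoeff l' b else 0)"
    unfolding ecoeff_def l'_def ..
  ultimately show ?thesis using lcoeff_diff_E[of l l' \<alpha> b] l by simp
qed

lemma E_cases:
  assumes "C \<in> carrier (E_mod \<alpha>)" obtains l where "l \<in> carrier Lau" "C = ecls \<alpha> l"
  using assms by (auto simp: E_carrier)

lemma ecls_carrier: "l \<in> carrier Lau \<Longrightarrow> ecls \<alpha> l \<in> carrier (E_mod \<alpha>)"
  by (auto simp: E_carrier)

lemma ecoeff_outside: "b \<notin> ncone \<alpha> \<Longrightarrow> ecoeff \<alpha> C b = 0"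
  by (simp add: ecoeff_def)

lemma ecoeff_add:
  "C \<in> carrier (E_mod \<alpha>) \<Longrightarrow> C' \<in> carrier (E_mod \<alpha>) \<Longrightarrow> ecoeff \<alpha> (C \<oplus>\<^bsub>E_mod \<alpha>\<^esub> C') b = ecoeff \<alpha> C b + ecoeff \<alpha> C' b"
  by (elim E_cases) (simp add: E_mod_def LM.quot_mod_add[OF submodule_E_sub] ecoeff_cls lcoeff_add)

lemma
  assumes "C \<in> carrier (E_mod \<alpha>)"
  shows ecoeff_const: "ecoeff \<alpha> ((*) (const_poly c) \<odot>\<^bsub>E_mod \<alpha>\<^esub> C) b = c * ecoeff \<alpha> C b"
    and ecoeff_mono: "b \<in> ncone \<alpha> \<Longrightarrow> ecoeff \<alpha> ((*) (mono_poly a) \<odot>\<^bsub>E_mod \<alpha>\<^esub> C) b = ecoeff \<alpha> C (wsub b a)"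
    and ecoeff_euler: "ecoeff \<alpha> (euler_op i t \<odot>\<^bsub>E_mod \<alpha>\<^esub> C) b = of_int (int_binom (b i) t) * ecoeff \<alpha> C b"
proof -
  obtain l where l: "l \<in> carrier Lau" "C = ecls \<alpha> l" using E_cases[OF assms] .
  show "ecoeff \<alpha> ((*) (const_poly c) \<odot>\<^bsub>E_mod \<alpha>\<^esub> C) b = c * ecoeff \<alpha> C b"
    "b \<in> ncone \<alpha> \<Longrightarrow> ecoeff \<alpha> ((*) (mono_poly a) \<odot>\<^bsub>E_mod \<alpha>\<^esub> C) b = ecoeff \<alpha> C (wsub b a)"
    "ecoeff \<alpha> (euler_op i t \<odot>\<^bsub>E_mod \<alpha>\<^esub> C) b = of_int (int_binom (b i) t) * ecoeff \<alpha> C b"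
    using l(1) ncone_wsub[of b \<alpha> a] unfolding l(2) E_mod_def
    by (simp_all add: LM.quot_mod_smult[OF submodule_E_sub] D_ops_mult euler_op_D
        ecoeff_cls lcoeff_const lcoeff_mono lcoeff_euler LM.smult_closed)
qed

lemma ecoeff_zero: "ecoeff \<alpha> \<zero>\<^bsub>E_mod \<alpha>\<^esub> b = 0"
  using ecoeff_const[OF EM.M.zero_closed, of \<alpha> 0 b] by (simp add: const_poly_simps)

lemma ecoeff_eqI:
  assumes C: "C \<in> carrier (E_mod \<alpha>)" and C': "C' \<in> carrier (E_mod \<alpha>)"
    and e: "\<And>b. b \<in> ncone \<alpha> \<Longrightarrow> ecoeff \<alpha> C b = ecoeff \<alpha> C' b"
  shows "C = C'"
proof -
  obtain l where l: "l \<in> carrier Lau" "C = ecls \<alpha> l" using E_cases[OF C] .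
  obtain l' where l': "l' \<in> carrier Lau" "C' = ecls \<alpha> l'" using E_cases[OF C'] .
  have "l \<ominus>\<^bsub>Lau\<^esub> l' \<in> carrier Lau" using l l' by simp
  moreover have "lcoeff (l \<ominus>\<^bsub>Lau\<^esub> l') b = 0" if "b \<in> ncone \<alpha>" for b
  proof -
    have "l = (l \<ominus>\<^bsub>Lau\<^esub> l') \<oplus>\<^bsub>Lau\<^esub> l'"
      using l l' by (simp add: LM.M.minus_eq LM.M.a_assoc LM.M.l_neg)
    then have "lcoeff l b = lcoeff (l \<ominus>\<^bsub>Lau\<^esub> l') b + lcoeff l' b"
      using lcoeff_add l l' by (metis LM.M.minus_closed)
    moreover have "lcoeff l b = lcoeff l' b" using e[OF that] l l' that by (simp add: ecoeff_cls)
    ultimately show ?thesis by simp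
  qed
  ultimately show ?thesis using l l' LM.coset_eq_iff[OF submodule_E_sub] E_sub_iff by blast
qed

text \<open>
  The element with prescribed coefficients, for finitely supported \<open>\<phi>\<close>.
\<close>

definition mkE :: "'n::{finite,linorder} set \<Rightarrow> (('n \<Rightarrow> int) \<Rightarrow> 'k::field) \<Rightarrow> ('k, 'n) laurent set" where
  "mkE \<alpha> \<phi> = (SOME C. C \<in> carrier (E_mod \<alpha>) \<and> (\<forall>b\<in>ncone \<alpha>. ecoeff \<alpha> C b = \<phi> b))"

lemma mkE:
  fixes \<phi> :: "('n::{finite,linorder} \<Rightarrow> int) \<Rightarrow> 'k::field"
  assumes "finite {b \<in> ncone \<alpha>. \<phi> b \<noteq> 0}"
  shows mkE_carrier: "mkE \<alpha> \<phi> \<in> carrier (E_mod \<alpha>)"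
    and ecoeff_mkE: "b \<in> ncone \<alpha> \<Longrightarrow> ecoeff \<alpha> (mkE \<alpha> \<phi>) b = \<phi> b"
proof -
  have "{b. (if b \<in> ncone \<alpha> then \<phi> b else 0) \<noteq> 0} = {b \<in> ncone \<alpha>. \<phi> b \<noteq> 0}" by auto
  then obtain l where l: "l \<in> carrier Lau" "\<forall>b. lcoeff l b = (if b \<in> ncone \<alpha> then \<phi> b else 0)"
    using laurent_exists[of "\<lambda>b. if b \<in> ncone \<alpha> then \<phi> b else 0"] assms by auto
  have "mkE \<alpha> \<phi> \<in> carrier (E_mod \<alpha>) \<and> (\<forall>b\<in>ncone \<alpha>. ecoeff \<alpha> (mkE \<alpha> \<phi>) b = \<phi> b)"
    unfolding mkE_def by (rule someI[of _ "ecls \<alpha> l"]) (use l in \<open>simp add: ecls_carrier ecoeff_cls\<close>)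
  then show "mkE \<alpha> \<phi> \<in> carrier (E_mod \<alpha>)" "b \<in> ncone \<alpha> \<Longrightarrow> ecoeff \<alpha> (mkE \<alpha> \<phi>) b = \<phi> b" by auto
qed

lemma E_weight_iff:
  fixes C :: "('k::field, 'n::{finite,linorder}) laurent set"
  shows "C \<in> deg_part (E_mod \<alpha>) b \<longleftrightarrow> C \<in> carrier (E_mod \<alpha>) \<and> (\<forall>c. c \<noteq> b \<longrightarrow> ecoeff \<alpha> C c = 0)"
proof (intro iffI conjI allI impI)
  assume C: "C \<in> deg_part (E_mod \<alpha>) b"
  show Cc: "C \<in> carrier (E_mod \<alpha>)" by (rule deg_part_carrier[OF C])
  fix c assume "c \<noteq> b"
  then obtain i where "c i \<noteq> b i" by (auto simp: fun_eq_iff)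
  then obtain t where t: "of_int (int_binom (c i) t) \<noteq> (of_int (int_binom (b i) t) :: 'k)"
    using int_binom_separates by blast
  have "euler_op i t \<odot>\<^bsub>E_mod \<alpha>\<^esub> C = (*) (const_poly (of_int (int_binom (b i) t))) \<odot>\<^bsub>E_mod \<alpha>\<^esub> C"
    using C by (simp add: deg_part_def)
  from arg_cong[OF this, of "\<lambda>C. ecoeff \<alpha> C c"] show "ecoeff \<alpha> C c = 0"
    using t by (simp add: ecoeff_euler[OF Cc] ecoeff_const[OF Cc])
next
  assume C: "C \<in> carrier (E_mod \<alpha>) \<and> (\<forall>c. c \<noteq> b \<longrightarrow> ecoeff \<alpha> C c = 0)"
  have "euler_op i t \<odot>\<^bsub>E_mod \<alpha>\<^esub> C = (*) (const_poly (of_int (int_binom (b i) t))) \<odot>\<^bsub>E_mod \<alpha>\<^esub> C" for i t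
  proof (rule ecoeff_eqI)
    fix c show "ecoeff \<alpha> (euler_op i t \<odot>\<^bsub>E_mod \<alpha>\<^esub> C) c = ecoeff \<alpha> ((*) (const_poly (of_int (int_binom (b i) t))) \<odot>\<^bsub>E_mod \<alpha>\<^esub> C) c"
      using C by (cases "c = b") (auto simp: ecoeff_euler ecoeff_const)
  qed (use C in \<open>auto intro: EM.smult_closed euler_op_D D_ops_mult\<close>)
  then show "C \<in> deg_part (E_mod \<alpha>) b" using C by (simp add: deg_part_def)
qed

lemma
  assumes "\<alpha> \<subseteq> \<beta>" "C \<in> carrier (E_mod \<alpha>)"
  shows E_epi_carrier: "E_epi \<beta> C \<in> carrier (E_mod \<beta>)"
    and ecoeff_epi: "b \<in> ncone \<beta> \<Longrightarrow> ecoeff \<beta> (E_epi \<beta> C) b = ecoeff \<alpha> C b"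
proof -
  obtain l where l: "l \<in> carrier Lau" "C = ecls \<alpha> l" using E_cases[OF assms(2)] .
  have sub: "E_sub \<alpha> \<subseteq> E_sub \<beta>" using ncone_mono[OF assms(1)] unfolding E_sub_iff subset_iff by blast
  have c: "x \<in> E_sub \<beta> \<Longrightarrow> x \<in> carrier Lau" for x using submodule_subset[OF submodule_E_sub] by blast
  have e: "E_epi \<beta> C = ecls \<beta> l"
  proof
    show "E_epi \<beta> C \<subseteq> ecls \<beta> l"
    proof
      fix z assume "z \<in> E_epi \<beta> C"
      then obtain x u where "x \<in> E_sub \<beta>" "u \<in> E_sub \<alpha>" "z = x \<oplus>\<^bsub>Lau\<^esub> (u \<oplus>\<^bsub>Lau\<^esub> l)"
        by (auto simp: E_epi_def l set_add_def' a_r_coset_def')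
      moreover have "x \<oplus>\<^bsub>Lau\<^esub> u \<in> E_sub \<beta>" using calculation sub submodule_add[OF submodule_E_sub] by blast
      moreover have "x \<oplus>\<^bsub>Lau\<^esub> (u \<oplus>\<^bsub>Lau\<^esub> l) = (x \<oplus>\<^bsub>Lau\<^esub> u) \<oplus>\<^bsub>Lau\<^esub> l"
        using calculation c sub l(1) by (intro LM.M.a_assoc[symmetric]) auto
      ultimately have "z = (x \<oplus>\<^bsub>Lau\<^esub> u) \<oplus>\<^bsub>Lau\<^esub> l" "x \<oplus>\<^bsub>Lau\<^esub> u \<in> E_sub \<beta>" by simp_all
      then show "z \<in> ecls \<beta> l" by (auto simp: a_r_coset_def')
    qed
    show "ecls \<beta> l \<subseteq> E_epi \<beta> C"
    proof
      fix z assume "z \<in> ecls \<beta> l"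
      then obtain x where "x \<in> E_sub \<beta>" "z = x \<oplus>\<^bsub>Lau\<^esub> l" by (auto simp: a_r_coset_def')
      then have "z = x \<oplus>\<^bsub>Lau\<^esub> (\<zero>\<^bsub>Lau\<^esub> \<oplus>\<^bsub>Lau\<^esub> l)" "x \<in> E_sub \<beta>" using l by simp_all
      then show "z \<in> E_epi \<beta> C" using submodule_zero[OF submodule_E_sub, of \<alpha>]
        unfolding E_epi_def l set_add_def' a_r_coset_def' by blast
    qed
  qed
  show "E_epi \<beta> C \<in> carrier (E_mod \<beta>)" unfolding e by (rule ecls_carrier[OF l(1)])
  show "b \<in> ncone \<beta> \<Longrightarrow> ecoeff \<beta> (E_epi \<beta> C) b = ecoeff \<alpha> C b"
    using ncone_mono[OF assms(1)] ecoeff_cls[OF l(1), of \<alpha> b] ecoeff_cls[OF l(1), of \<beta> b]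
    unfolding e unfolding l(2) by auto
qed

section \<open>Homomorphisms into \<open>E\<^sub>\<alpha>\<close>\<close>

lemma ring_of_type_algebra_simps [simp]:
  "carrier ring_of_type_algebra = UNIV" "x \<oplus>\<^bsub>ring_of_type_algebra\<^esub> y = x + y"
  "x \<otimes>\<^bsub>ring_of_type_algebra\<^esub> y = x * y" "\<one>\<^bsub>ring_of_type_algebra\<^esub> = 1" "\<zero>\<^bsub>ring_of_type_algebra\<^esub> = 0"
  by (simp_all add: ring_of_type_algebra_def)

lemma graded_R_homI:
  assumes "\<And>x. x \<in> carrier M \<Longrightarrow> f x \<in> carrier N"
    and "\<And>x y. x \<in> carrier M \<Longrightarrow> y \<in> carrier M \<Longrightarrow> f (x \<oplus>\<^bsub>M\<^esub> y) = f x \<oplus>\<^bsub>N\<^esub> f y"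
    and "\<And>r x. x \<in> carrier M \<Longrightarrow> f ((*) r \<odot>\<^bsub>M\<^esub> x) = (*) r \<odot>\<^bsub>N\<^esub> f x"
    and "\<And>b m. m \<in> deg_part M b \<Longrightarrow> f m \<in> deg_part N b"
  shows "f \<in> graded_R_hom M N"
  using assms by (auto simp: graded_R_hom_def mod_hom_def as_R_mod_def restrict_scalars_def)

lemma graded_R_homD:
  assumes "f \<in> graded_R_hom M N"
  shows "x \<in> carrier M \<Longrightarrow> f x \<in> carrier N"
    and "x \<in> carrier M \<Longrightarrow> y \<in> carrier M \<Longrightarrow> f (x \<oplus>\<^bsub>M\<^esub> y) = f x \<oplus>\<^bsub>N\<^esub> f y"
    and "x \<in> carrier M \<Longrightarrow> f ((*) r \<odot>\<^bsub>M\<^esub> x) = (*) r \<odot>\<^bsub>N\<^esub> f x"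
    and "m \<in> deg_part M b \<Longrightarrow> f m \<in> deg_part N b"
  using assms by (auto simp: graded_R_hom_def mod_hom_def as_R_mod_def restrict_scalars_def image_subset_iff)

lemma mod_hom_graded:
  assumes "D_module M" "f \<in> mod_hom D_ring M N" shows "f \<in> graded_R_hom M N"
  by (rule graded_R_homI) (auto simp: mod_homD[OF assms(2)] D_ops_mult D_module.mod_hom_weight[OF assms])

lemma graded_R_hom_compose:
  "f \<in> graded_R_hom M N \<Longrightarrow> g \<in> graded_R_hom N K \<Longrightarrow> (\<lambda>x. g (f x)) \<in> graded_R_hom M K"
  by (rule graded_R_homI) (simp_all add: graded_R_homD)

lemma graded_R_hom_zero:
  assumes "D_module M" "D_module N" "f \<in> graded_R_hom M N" shows "f \<zero>\<^bsub>M\<^esub> = \<zero>\<^bsub>N\<^esub>"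
proof -
  interpret M: D_module M by fact
  interpret N: D_module N by fact
  have "f ((*) 0 \<odot>\<^bsub>M\<^esub> \<zero>\<^bsub>M\<^esub>) = (*) 0 \<odot>\<^bsub>N\<^esub> f \<zero>\<^bsub>M\<^esub>" by (rule graded_R_homD(3)[OF assms(3)]) simp
  then show ?thesis using graded_R_homD(1)[OF assms(3), of "\<zero>\<^bsub>M\<^esub>"] by simp
qed

text \<open>
  Both sides of \<open>f(\<partial>\<^sub>i m) = \<partial>\<^sub>i f(m)\<close> have the same image under \<open>x\<^sub>i\<close>, an Euler operator. Multiplication
  by \<open>x\<^sub>i\<close> is injective on the relevant part of \<open>E\<^sub>\<alpha>\<close>, unless it leaves the cone of \<open>\<alpha>\<close>; in that case
  \<open>f(m) = 0\<close>, and \<open>\<partial>\<^sub>i m = 0\<close> because \<open>M\<close> has vanishing variation maps.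
\<close>

lemma graded_R_hom_D_linear:
  fixes M :: "('k::field, 'n::{finite,linorder}, 'm) dmodule"
  assumes W: "weight_module M" and V: "var_zero M" and ch: "CHAR('k) = 0"
    and f: "f \<in> graded_R_hom M (E_mod \<alpha>)"
  shows "f \<in> mod_hom D_ring M (E_mod \<alpha>)"
proof -
  interpret M: D_module M using W by (rule weight_moduleD)
  have Mp: "partial i \<odot>\<^bsub>M\<^esub> x \<in> carrier M" if "x \<in> carrier M" for i x using M.smult_closed partial_D that by blast
  have Ep: "partial i \<odot>\<^bsub>E_mod \<alpha>\<^esub> C \<in> carrier (E_mod \<alpha>)" if "C \<in> carrier (E_mod \<alpha>)" for i and C :: "('k, 'n) laurent set"
    using EM.smult_closed partial_D that by blast
  have xd: "(*) (var_poly i) \<odot>\<^bsub>K\<^esub> (partial i \<odot>\<^bsub>K\<^esub> x) = euler_op i 1 \<odot>\<^bsub>K\<^esub> x" if "D_module K" "x \<in> carrier K"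
    for K :: "('k, 'n, 'z) dmodule" and i x
  proof -
    interpret K: D_module K by fact
    have "(\<lambda>f :: ('k, 'n) mpoly. var_poly i * partial i f) = euler_op i 1" using var_partial by blast
    then show ?thesis using K.op_comp[OF D_ops_mult partial_D that(2), of "var_poly i" i] by simp
  qed
  have pw: "f (partial i \<odot>\<^bsub>M\<^esub> m) = partial i \<odot>\<^bsub>E_mod \<alpha>\<^esub> f m" if m: "m \<in> deg_part M b" for i m b
  proof (rule ecoeff_eqI)
    have mc: "m \<in> carrier M" by (rule deg_part_carrier[OF m])
    have fm: "f m \<in> carrier (E_mod \<alpha>)" by (rule graded_R_homD(1)[OF f mc])
    show "f (partial i \<odot>\<^bsub>M\<^esub> m) \<in> carrier (E_mod \<alpha>)" by (rule graded_R_homD(1)[OF f Mp[OF mc]])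
    show "partial i \<odot>\<^bsub>E_mod \<alpha>\<^esub> f m \<in> carrier (E_mod \<alpha>)" by (rule Ep[OF fm])
    fix c assume c: "c \<in> ncone \<alpha>"
    have w: "f (partial i \<odot>\<^bsub>M\<^esub> m) \<in> deg_part (E_mod \<alpha>) (wsub b (unit_exp i))"
      "partial i \<odot>\<^bsub>E_mod \<alpha>\<^esub> f m \<in> deg_part (E_mod \<alpha>) (wsub b (unit_exp i))"
      using graded_R_homD(4)[OF f] M.partial_weight[OF m] EM.partial_weight m by blast+
    show "ecoeff \<alpha> (f (partial i \<odot>\<^bsub>M\<^esub> m)) c = ecoeff \<alpha> (partial i \<odot>\<^bsub>E_mod \<alpha>\<^esub> f m) c"
    proof (cases "c = wsub b (unit_exp i)")
      case False
      then show ?thesis using w unfolding E_weight_iff by metis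
    next
      case cb: True
      show ?thesis
      proof (cases "i \<in> \<alpha> \<and> b i = 0")
        case True
        then have "b \<notin> ncone \<alpha>" by (auto simp: ncone_def intro!: bexI[of _ i])
        then have "ecoeff \<alpha> (f m) v = 0" for v
          using graded_R_homD(4)[OF f m] ecoeff_outside[of v \<alpha>] unfolding E_weight_iff by (cases "v = b") auto
        then have "f m = \<zero>\<^bsub>E_mod \<alpha>\<^esub>" by (intro ecoeff_eqI[OF fm]) (auto simp: ecoeff_zero)
        moreover have "partial i \<odot>\<^bsub>M\<^esub> m = \<zero>\<^bsub>M\<^esub>" using V m True by (auto simp: var_zero_def)
        ultimately show ?thesis using graded_R_hom_zero[OF M.D_module_axioms D_module_E f] EM.smult_zero partial_D by metis
      next
        case False
        have bc: "b \<in> ncone \<alpha>"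
        proof -
          have "b j < 0" if "j \<in> \<alpha>" for j
            using c that False by (cases "j = i") (auto simp: cb ncone_def wsub_def lookup_single when_def dest!: bspec[of _ _ j])
          then show ?thesis by (auto simp: ncone_def)
        qed
        have x: "ecoeff \<alpha> C c = ecoeff \<alpha> ((*) (var_poly i) \<odot>\<^bsub>E_mod \<alpha>\<^esub> C) b" if "C \<in> carrier (E_mod \<alpha>)" for C
          using ecoeff_mono[OF that bc, of "unit_exp i"] by (simp add: cb var_poly_def)
        have "(*) (var_poly i) \<odot>\<^bsub>E_mod \<alpha>\<^esub> f (partial i \<odot>\<^bsub>M\<^esub> m) = f (euler_op i 1 \<odot>\<^bsub>M\<^esub> m)"
          using graded_R_homD(3)[OF f Mp[OF mc]] xd[OF M.D_module_axioms mc] by metis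
        also have "\<dots> = (*) (const_poly (of_int (int_binom (b i) 1))) \<odot>\<^bsub>E_mod \<alpha>\<^esub> f m"
          using m graded_R_homD(3)[OF f mc] by (simp add: deg_part_def)
        also have "\<dots> = (*) (var_poly i) \<odot>\<^bsub>E_mod \<alpha>\<^esub> (partial i \<odot>\<^bsub>E_mod \<alpha>\<^esub> f m)"
          using graded_R_homD(4)[OF f m] xd[OF D_module_E fm] by (simp add: deg_part_def)
        finally show ?thesis using x[OF graded_R_homD(1)[OF f Mp[OF mc]]] x[OF Ep[OF fm]] by simp
      qed
    qed
  qed
  have p: "f (partial i \<odot>\<^bsub>M\<^esub> x) = partial i \<odot>\<^bsub>E_mod \<alpha>\<^esub> f x" if x: "x \<in> carrier M" for i x
  proof -
    obtain B where "finite B" "spec M B x" using W x by (auto simp: weight_module_def)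
    then show ?thesis
    proof (induction rule: M.spec_induct)
      case zero
      show ?case using graded_R_hom_zero[OF M.D_module_axioms D_module_E f] M.smult_zero EM.smult_zero partial_D by metis
    next
      case (add y z)
      then show ?case using graded_R_homD[OF f] Mp by (simp add: M.smult_r_distr EM.smult_r_distr partial_D)
    next
      case (weight b m)
      then show ?case using pw by blast
    qed
  qed
  show ?thesis
  proof (rule mod_homI)
    fix P :: "('k, 'n) poly_op" and x assume P: "P \<in> D_ops" and "x \<in> carrier M"
    from ch P have "\<forall>x\<in>carrier M. f (P \<odot>\<^bsub>M\<^esub> x) = P \<odot>\<^bsub>E_mod \<alpha>\<^esub> f x"
    proof (induction P rule: D_ops_induct_char_0)
      case (mult r)
      show ?case using graded_R_homD(3)[OF f] by blast
    next
      case (partial i)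
      show ?case using p by blast
    next
      case (add P Q)
      then show ?case using graded_R_homD(1,2)[OF f] by (simp add: M.op_add EM.op_add M.smult_closed)
    next
      case (comp P Q)
      then show ?case using graded_R_homD(1)[OF f] by (simp add: M.op_comp EM.op_comp M.smult_closed)
    qed
    then show "f (P \<odot>\<^bsub>M\<^esub> x) = P \<odot>\<^bsub>E_mod \<alpha>\<^esub> f x" using \<open>x \<in> carrier M\<close> by blast
  qed (auto simp: graded_R_homD[OF f])
qed

text \<open>The modules for which \<open>[M]\<^sub>\<alpha>\<close> can be computed from the weight spaces.\<close>

definition straight_type :: "('k::field, 'n::{finite,linorder}, 'm) dmodule \<Rightarrow> bool" where
  "straight_type M \<longleftrightarrow> weight_module M \<and> (CHAR('k) = 0 \<longrightarrow> var_zero M)"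

lemma straight_typeD: "straight_type M \<Longrightarrow> weight_module M" "straight_type M \<Longrightarrow> D_module M"
  by (auto simp: straight_type_def intro: weight_moduleD)

lemma cube_vs_carrier:
  assumes "straight_type M"
  shows "carrier (cube_vs M \<alpha>) = extensional (carrier M) \<inter> graded_R_hom M (E_mod \<alpha>)"
  using assms graded_R_hom_D_linear mod_hom_graded[OF straight_typeD(2)[OF assms]]
  by (auto simp: cube_vs_def straight_type_def)

subsection \<open>Compatible families of functionals\<close>

text \<open>
  The weight \<open>-\<one> + L\<beta>\<close>: a vector \<open>m\<close> has this weight if the fraction \<open>m / x\<^sup>L\<^sup>\<beta>\<close> has weight \<open>-\<one>\<close>.
\<close>

definition wvec :: "'n set \<Rightarrow> nat \<Rightarrow> 'n \<Rightarrow> int" where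
  "wvec \<beta> L = (\<lambda>i. if i \<in> \<beta> then int L - 1 else - 1)"

lemma wvec_ncone: "wvec \<beta> L \<in> ncone (- \<beta>)"
  by (simp add: wvec_def ncone_def)

lemma wvec_shift: "wsub (wvec \<beta> (L + K)) (vexp \<beta> K) = wvec \<beta> L" "wadd (wvec \<beta> L) (vexp \<beta> K) = wvec \<beta> (L + K)"
  by (auto simp: wvec_def wsub_def wadd_def lookup_vexp)

lemma wvec_reach:
  fixes b :: "'n::finite \<Rightarrow> int"
  assumes "b \<in> ncone (- \<beta>)" shows "\<exists>L c. wadd b c = wvec \<beta> L"
proof -
  define L where "L = Suc (\<Sum>i\<in>UNIV. nat \<bar>b i\<bar>)"
  have le: "b i \<le> int L - 1" for i using abs_le_sum[of b i] by (simp add: L_def del: of_nat_sum)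
  have "b i \<le> wvec \<beta> L i" for i using le[of i] assms by (cases "i \<in> \<beta>") (force simp: wvec_def ncone_def)+
  then have "wadd b (nexp (\<lambda>i. wvec \<beta> L i - b i)) = wvec \<beta> L"
    by (intro ext) (simp add: wadd_def lookup_nexp)
  then show ?thesis by blast
qed

text \<open>
  A graded homomorphism \<open>f : M \<rightarrow> E\<^sub>\<alpha>\<close>, \<open>\<alpha>\<close> the complement of \<open>\<beta>\<close>, is the same as the family of
  functionals that take the coefficient of \<open>f(m)\<close> at \<open>-\<one> + L\<beta>\<close>: every exponent in the cone
  of \<open>\<alpha>\<close> lies below one of these.
\<close>

definition compatible :: "('k::field, 'n::{finite,linorder}, 'm) dmodule \<Rightarrow> 'n set \<Rightarrow> (nat \<Rightarrow> 'm \<Rightarrow> 'k) \<Rightarrow> bool" where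
  "compatible M \<beta> \<tau> \<longleftrightarrow> (\<forall>L.
     (\<forall>x\<in>carrier M. \<forall>y\<in>carrier M. \<tau> L (x \<oplus>\<^bsub>M\<^esub> y) = \<tau> L x + \<tau> L y) \<and>
     (\<forall>c. \<forall>x\<in>carrier M. \<tau> L ((*) (const_poly c) \<odot>\<^bsub>M\<^esub> x) = c * \<tau> L x) \<and>
     (\<forall>K. \<forall>x\<in>carrier M. \<tau> (L + K) ((*) (mono_poly (vexp \<beta> K)) \<odot>\<^bsub>M\<^esub> x) = \<tau> L x) \<and>
     (\<forall>b m. m \<in> deg_part M b \<longrightarrow> b \<noteq> wvec \<beta> L \<longrightarrow> \<tau> L m = 0))"

lemma graded_compatible:
  assumes f: "f \<in> graded_R_hom M (E_mod (- \<beta>))"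
  shows "compatible M \<beta> (\<lambda>L m. ecoeff (- \<beta>) (f m) (wvec \<beta> L))"
  unfolding compatible_def
proof (intro allI conjI ballI impI)
  fix L b m assume "m \<in> deg_part M b" "b \<noteq> wvec \<beta> L"
  then show "ecoeff (- \<beta>) (f m) (wvec \<beta> L) = 0" using graded_R_homD(4)[OF f] unfolding E_weight_iff by metis
qed (simp_all add: graded_R_homD[OF f] ecoeff_add ecoeff_const ecoeff_mono wvec_ncone wvec_shift)

lemma graded_determined:
  assumes M: "D_module M" and f: "f \<in> graded_R_hom M (E_mod (- \<beta>))" and g: "g \<in> graded_R_hom M (E_mod (- \<beta>))"
    and eq: "\<And>L m. m \<in> carrier M \<Longrightarrow> ecoeff (- \<beta>) (f m) (wvec \<beta> L) = ecoeff (- \<beta>) (g m) (wvec \<beta> L)"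
    and m: "m \<in> carrier M"
  shows "f m = g m"
proof (rule ecoeff_eqI)
  interpret M: D_module M by fact
  show "f m \<in> carrier (E_mod (- \<beta>))" by (rule graded_R_homD(1)[OF f m])
  show "g m \<in> carrier (E_mod (- \<beta>))" by (rule graded_R_homD(1)[OF g m])
  fix b assume "b \<in> ncone (- \<beta>)"
  then obtain L c where c: "wadd b c = wvec \<beta> L" using wvec_reach by blast
  then have b: "b = wsub (wvec \<beta> L) c" by (metis wadd_wsub(2))
  have "ecoeff (- \<beta>) (h m) b = ecoeff (- \<beta>) (h ((*) (mono_poly c) \<odot>\<^bsub>M\<^esub> m)) (wvec \<beta> L)"
    if h: "h \<in> graded_R_hom M (E_mod (- \<beta>))" for h
    using ecoeff_mono[OF graded_R_homD(1)[OF h m] wvec_ncone, of c] b graded_R_homD(3)[OF h m] by simp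
  then show "ecoeff (- \<beta>) (f m) b = ecoeff (- \<beta>) (g m) b" using eq f g M.rmul_closed[OF m] by metis
qed

text \<open>
  The coefficient of \<open>f(m)\<close> at \<open>b\<close> has to be \<open>\<tau>\<^sub>L(x\<^sup>c m)\<close> whenever \<open>b + c = -\<one> + L\<beta>\<close>. Such \<open>L\<close> and \<open>c\<close> exist
  for all \<open>b\<close> in the cone, compatibility makes the value independent of them, and only finitely
  many values are nonzero because \<open>m\<close> has finite spectrum.
\<close>

lemma compatible_graded:
  fixes M :: "('k::field, 'n::{finite,linorder}, 'm) dmodule"
  assumes W: "weight_module M" and \<tau>: "compatible M \<beta> \<tau>"
  shows "\<exists>f\<in>extensional (carrier M) \<inter> graded_R_hom M (E_mod (- \<beta>)).
           \<forall>m\<in>carrier M. \<forall>L. ecoeff (- \<beta>) (f m) (wvec \<beta> L) = \<tau> L m"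
proof -
  interpret M: D_module M using W by (rule weight_moduleD)
  have add: "\<tau> L (x \<oplus>\<^bsub>M\<^esub> y) = \<tau> L x + \<tau> L y" if "x \<in> carrier M" "y \<in> carrier M" for L x y
    using \<tau> that by (auto simp: compatible_def)
  have const: "\<tau> L ((*) (const_poly c) \<odot>\<^bsub>M\<^esub> x) = c * \<tau> L x" if "x \<in> carrier M" for L c x
    using \<tau> that by (auto simp: compatible_def)
  have shift: "\<tau> (L + K) ((*) (mono_poly (vexp \<beta> K)) \<odot>\<^bsub>M\<^esub> x) = \<tau> L x" if "x \<in> carrier M" for L K x
    using \<tau> that by (auto simp: compatible_def)
  have kill: "\<tau> L m = 0" if "m \<in> deg_part M b" "b \<noteq> wvec \<beta> L" for L m b
    using \<tau> that by (auto simp: compatible_def)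
  have z: "\<tau> L \<zero>\<^bsub>M\<^esub> = 0" for L using const[of "\<zero>\<^bsub>M\<^esub>" L 0] by (simp add: const_poly_simps)
  have coh: "\<tau> L ((*) (mono_poly c) \<odot>\<^bsub>M\<^esub> x) = \<tau> L' ((*) (mono_poly c') \<odot>\<^bsub>M\<^esub> x)"
    if "wadd b c = wvec \<beta> L" "wadd b c' = wvec \<beta> L'" and x: "x \<in> carrier M" for b c c' L L' x
  proof -
    have "int (lk c i) + int (if i \<in> \<beta> then L' else 0) = int (lk c' i) + int (if i \<in> \<beta> then L else 0)" for i
      using fun_cong[OF that(1), of i] fun_cong[OF that(2), of i] by (auto simp: wadd_def wvec_def)
    then have "lk c i + (if i \<in> \<beta> then L' else 0) = lk c' i + (if i \<in> \<beta> then L else 0)" for i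
      by (metis of_nat_add of_nat_eq_iff)
    then have e: "vexp \<beta> L' + c = vexp \<beta> L + c'"
      by (intro poly_mapping_eqI) (simp add: lookup_add lookup_vexp add.commute)
    have "\<tau> L ((*) (mono_poly c) \<odot>\<^bsub>M\<^esub> x) = \<tau> (L + L') ((*) (mono_poly (vexp \<beta> L' + c)) \<odot>\<^bsub>M\<^esub> x)"
      using shift[of "(*) (mono_poly c) \<odot>\<^bsub>M\<^esub> x" L L'] x by (simp add: M.rmul_rmul mult_single)
    also have "\<dots> = \<tau> L' ((*) (mono_poly c') \<odot>\<^bsub>M\<^esub> x)"
      unfolding e using shift[of "(*) (mono_poly c') \<odot>\<^bsub>M\<^esub> x" L' L] x by (simp add: M.rmul_rmul mult_single add.commute)
    finally show ?thesis .
  qed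
  \<comment> \<open>An arbitrary choice of \<open>L\<close> and \<open>c\<close> for each exponent.\<close>
  define Lc where "Lc b = (SOME Lc. wadd b (snd Lc) = wvec \<beta> (fst Lc))" for b
  have Lc: "wadd b (snd (Lc b)) = wvec \<beta> (fst (Lc b))" if "b \<in> ncone (- \<beta>)" for b
    using wvec_reach[OF that] unfolding Lc_def by (metis (mono_tags, lifting) fst_conv snd_conv someI_ex)
  define \<phi> where "\<phi> m b = \<tau> (fst (Lc b)) ((*) (mono_poly (snd (Lc b))) \<odot>\<^bsub>M\<^esub> m)" for m b
  have \<phi>: "\<phi> m b = \<tau> L ((*) (mono_poly c) \<odot>\<^bsub>M\<^esub> m)" if "b \<in> ncone (- \<beta>)" "wadd b c = wvec \<beta> L" "m \<in> carrier M" for m b c L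
    unfolding \<phi>_def by (rule coh[OF Lc[OF that(1)] that(2,3)])
  have \<phi>add: "\<phi> (x \<oplus>\<^bsub>M\<^esub> y) b = \<phi> x b + \<phi> y b" if "x \<in> carrier M" "y \<in> carrier M" for x y b
    using that by (simp add: \<phi>_def M.smult_r_distr D_ops_mult add)
  have \<phi>w: "b = w" if "m \<in> deg_part M w" "b \<in> ncone (- \<beta>)" "\<phi> m b \<noteq> 0" for m w b
  proof -
    have "wadd w (snd (Lc b)) = wvec \<beta> (fst (Lc b))"
      using kill[OF M.mono_weight[OF that(1)]] that(3) unfolding \<phi>_def by metis
    then show "b = w" using Lc[OF that(2)] by (metis wadd_wsub(2))
  qed
  have fin: "finite {b \<in> ncone (- \<beta>). \<phi> m b \<noteq> 0}" if m: "m \<in> carrier M" for m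
  proof -
    obtain B where "finite B" "spec M B m" using W m by (auto simp: weight_module_def)
    then show ?thesis
    proof (induction rule: M.spec_induct)
      case zero
      show ?case by (simp add: \<phi>_def D_ops_mult z)
    next
      case (weight w m)
      have "{b \<in> ncone (- \<beta>). \<phi> m b \<noteq> 0} \<subseteq> {w}" using \<phi>w[OF weight(2)] by blast
      then show ?case by (rule finite_subset) simp
    next
      case (add y z)
      then show ?case
        by (rule_tac finite_subset[of _ "{b \<in> ncone (- \<beta>). \<phi> y b \<noteq> 0} \<union> {b \<in> ncone (- \<beta>). \<phi> z b \<noteq> 0}"]) (auto simp: \<phi>add)
    qed
  qed
  define f where "f = (\<lambda>m\<in>carrier M. mkE (- \<beta>) (\<phi> m))"
  have fc: "f m \<in> carrier (E_mod (- \<beta>))" if "m \<in> carrier M" for m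
    using that mkE_carrier[OF fin] by (simp add: f_def)
  have fco: "ecoeff (- \<beta>) (f m) b = \<phi> m b" if "m \<in> carrier M" "b \<in> ncone (- \<beta>)" for m b
    using that ecoeff_mkE[OF fin] by (simp add: f_def)
  have fa: "f (x \<oplus>\<^bsub>M\<^esub> y) = f x \<oplus>\<^bsub>E_mod (- \<beta>)\<^esub> f y" if "x \<in> carrier M" "y \<in> carrier M" for x y
    by (rule ecoeff_eqI[where \<alpha> = "- \<beta>"]) (use that in \<open>simp_all add: fc fco \<phi>add ecoeff_add\<close>)
  have fr: "f ((*) r \<odot>\<^bsub>M\<^esub> x) = (*) r \<odot>\<^bsub>E_mod (- \<beta>)\<^esub> f x" if x: "x \<in> carrier M" for r x
  proof (induction r rule: mpoly_induct)
    case (single a c)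
    have "f ((*) (const_poly c) \<odot>\<^bsub>M\<^esub> y) = (*) (const_poly c) \<odot>\<^bsub>E_mod (- \<beta>)\<^esub> f y" if "y \<in> carrier M" for y
    proof (rule ecoeff_eqI)
      fix b assume b: "b \<in> ncone (- \<beta>)"
      have "\<phi> ((*) (const_poly c) \<odot>\<^bsub>M\<^esub> y) b = c * \<phi> y b"
        unfolding \<phi>_def using that M.rmul_commute[OF that] const M.rmul_closed by metis
      then show "ecoeff (- \<beta>) (f ((*) (const_poly c) \<odot>\<^bsub>M\<^esub> y)) b = ecoeff (- \<beta>) ((*) (const_poly c) \<odot>\<^bsub>E_mod (- \<beta>)\<^esub> f y) b"
        using that b by (simp add: fco fc ecoeff_const)
    qed (use that in \<open>simp_all add: fc\<close>)
    moreover have "f ((*) (mono_poly a) \<odot>\<^bsub>M\<^esub> x) = (*) (mono_poly a) \<odot>\<^bsub>E_mod (- \<beta>)\<^esub> f x"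
    proof (rule ecoeff_eqI)
      fix b assume b: "b \<in> ncone (- \<beta>)"
      obtain L c where c: "wadd b c = wvec \<beta> L" using wvec_reach[OF b] by blast
      have "wadd (wsub b a) (c + a) = wadd b c" by (simp add: wadd_def wsub_def lookup_add)
      then have "\<phi> x (wsub b a) = \<tau> L ((*) (mono_poly (c + a)) \<odot>\<^bsub>M\<^esub> x)"
        using \<phi>[OF ncone_wsub[OF b] _ x] c by simp
      also have "\<dots> = \<phi> ((*) (mono_poly a) \<odot>\<^bsub>M\<^esub> x) b"
        using \<phi>[OF b c, of "(*) (mono_poly a) \<odot>\<^bsub>M\<^esub> x"] x by (simp add: M.rmul_rmul mult_single)
      finally show "ecoeff (- \<beta>) (f ((*) (mono_poly a) \<odot>\<^bsub>M\<^esub> x)) b = ecoeff (- \<beta>) ((*) (mono_poly a) \<odot>\<^bsub>E_mod (- \<beta>)\<^esub> f x) b"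
        using x b ncone_wsub[OF b] by (simp add: fco fc ecoeff_mono)
    qed (use x in \<open>simp_all add: fc\<close>)
    ultimately show ?case
      using x fc[OF x] M.rmul_rmul[OF x, of "const_poly c" "mono_poly a"] EM.rmul_rmul[OF fc[OF x], of "const_poly c" "mono_poly a"]
      by (metis single_const M.rmul_closed)
  next
    case (add r s)
    then show ?case using x by (simp add: M.rmul_add EM.rmul_add fa fc)
  qed
  have fw: "f m \<in> deg_part (E_mod (- \<beta>)) w" if m: "m \<in> deg_part M w" for m w
    unfolding E_weight_iff
  proof (intro conjI allI impI)
    have mc: "m \<in> carrier M" by (rule deg_part_carrier[OF m])
    show "f m \<in> carrier (E_mod (- \<beta>))" by (rule fc[OF mc])
    fix b assume "b \<noteq> w"
    then show "ecoeff (- \<beta>) (f m) b = 0" using \<phi>w[OF m] fco[OF mc] ecoeff_outside by metis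
  qed
  have "f \<in> graded_R_hom M (E_mod (- \<beta>))" by (rule graded_R_homI) (auto simp: fc fa fr fw)
  moreover have "ecoeff (- \<beta>) (f m) (wvec \<beta> L) = \<tau> L m" if "m \<in> carrier M" for m L
    using fco[OF that wvec_ncone, of L] \<phi>[where b = "wvec \<beta> L" and c = 0 and L = L and m = m, OF wvec_ncone _ that] that by (simp add: single_one)
  ultimately show ?thesis by (intro bexI[of _ f]) (auto simp: f_def)
qed

subsection \<open>Residues\<close>

text \<open>
  The linear functionals on the part of weight \<open>-\<one>\<close>, extended by zero to the other weights.
\<close>

definition functional :: "('k::field, 'n::{finite,linorder}, 'm) dmodule \<Rightarrow> ('m \<Rightarrow> 'k) \<Rightarrow> bool" where
  "functional M \<mu> \<longleftrightarrow>
     (\<forall>x\<in>carrier M. \<forall>y\<in>carrier M. \<mu> (x \<oplus>\<^bsub>M\<^esub> y) = \<mu> x + \<mu> y) \<and>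
     (\<forall>c. \<forall>x\<in>carrier M. \<mu> ((*) (const_poly c) \<odot>\<^bsub>M\<^esub> x) = c * \<mu> x) \<and>
     (\<forall>b m. m \<in> deg_part M b \<longrightarrow> b \<noteq> (\<lambda>_. - 1) \<longrightarrow> \<mu> m = 0)"

definition residue :: "('k::field, 'n::{finite,linorder}) laurent set \<Rightarrow> 'k" where
  "residue C = ecoeff UNIV C (\<lambda>_. - 1)"

lemma wvec_empty: "wvec {} L = (\<lambda>_. - 1)"
  by (simp add: wvec_def)

lemma functional_compatible:
  assumes "D_module M" shows "compatible M {} (\<lambda>L. \<mu>) \<longleftrightarrow> functional M \<mu>"
proof -
  interpret D_module M by fact
  have "vexp {} K = (0 :: 'b expo)" for K by (intro poly_mapping_eqI) (simp add: lookup_vexp)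
  then show ?thesis by (auto simp: compatible_def functional_def wvec_empty single_one)
qed

lemma residue_functional:
  assumes "D_module M" "g \<in> graded_R_hom M (E_mod UNIV)"
  shows "functional M (\<lambda>x. residue (g x))"
  using graded_compatible[of g M "{}"] assms functional_compatible[OF assms(1)] by (simp add: wvec_empty residue_def)

lemma residue_determined:
  assumes "D_module M" "f \<in> graded_R_hom M (E_mod UNIV)" "g \<in> graded_R_hom M (E_mod UNIV)"
    and "\<And>m. m \<in> carrier M \<Longrightarrow> residue (f m) = residue (g m)" "m \<in> carrier M"
  shows "f m = g m"
  using graded_determined[of M f "{}" g] assms by (simp add: wvec_empty residue_def)

text \<open>
  The case of the empty \<open>\<beta>\<close>, in which \<open>-\<one> + L\<beta>\<close> does not depend on \<open>L\<close>: every functional is the residue of a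
  homomorphism into \<open>E\<^sub>\<one>\<close>.
\<close>

lemma residue_exists:
  assumes "weight_module M" "functional M \<mu>"
  shows "\<exists>g\<in>extensional (carrier M) \<inter> graded_R_hom M (E_mod UNIV). \<forall>m\<in>carrier M. residue (g m) = \<mu> m"
  using compatible_graded[OF assms(1), of "{}" "\<lambda>L. \<mu>"] assms(2) functional_compatible[OF weight_moduleD[OF assms(1)]]
  by (simp add: wvec_empty residue_def)

subsection \<open>Extension of functionals\<close>

context D_module begin

text \<open>
  The graph of a linear functional on a subspace, the form in which Zorn's lemma is applied.
\<close>

definition linear_relation :: "('m \<times> 'k) set \<Rightarrow> bool" where
  "linear_relation G \<longleftrightarrow> G \<subseteq> carrier M \<times> UNIV \<and> (\<zero>, 0) \<in> G \<and>
     (\<forall>x c y d. (x, c) \<in> G \<longrightarrow> (y, d) \<in> G \<longrightarrow> (x \<oplus> y, c + d) \<in> G) \<and>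
     (\<forall>a x c. (x, c) \<in> G \<longrightarrow> ((*) (const_poly a) \<odot> x, a * c) \<in> G) \<and>
     (\<forall>c. (\<zero>, c) \<in> G \<longrightarrow> c = 0)"

lemma const_mult_mult: "x \<in> carrier M \<Longrightarrow> (*) (const_poly a) \<odot> ((*) (const_poly b) \<odot> x) = (*) (const_poly (a * b)) \<odot> x"
  by (simp add: rmul_rmul const_poly_simps)

lemma const_plus: "x \<in> carrier M \<Longrightarrow> (*) (const_poly a) \<odot> x \<oplus> (*) (const_poly b) \<odot> x = (*) (const_poly (a + b)) \<odot> x"
  by (simp add: rmul_add const_poly_simps)

lemma const_minus_cancel: "x \<in> carrier M \<Longrightarrow> x \<oplus> (*) (const_poly (- 1)) \<odot> x = \<zero>"
  using const_plus[of x 1 "- 1"] by (simp add: const_poly_simps)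

lemma linear_relationD:
  assumes "linear_relation G"
  shows "(x, c) \<in> G \<Longrightarrow> x \<in> carrier M" "(\<zero>, 0) \<in> G"
    "(x, c) \<in> G \<Longrightarrow> (y, d) \<in> G \<Longrightarrow> (x \<oplus> y, c + d) \<in> G"
    "(x, c) \<in> G \<Longrightarrow> ((*) (const_poly a) \<odot> x, a * c) \<in> G"
    "(\<zero>, c) \<in> G \<Longrightarrow> c = 0"
  using assms unfolding linear_relation_def by auto

lemma linear_relation_extend:
  assumes G: "linear_relation G" and x: "x \<in> carrier M" "\<And>c. (x, c) \<notin> G"
  shows "linear_relation {(y \<oplus> (*) (const_poly a) \<odot> x, c) | y a c. (y, c) \<in> G}"
proof -
  note Gc = linear_relationD(1)[OF G]
  let ?H = "{(y \<oplus> (*) (const_poly a) \<odot> x, c) | y a c. (y, c) \<in> G}"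
  have "?H \<subseteq> carrier M \<times> UNIV" using Gc x(1) by auto
  moreover have "(\<zero>, 0) \<in> ?H" using linear_relationD(2)[OF G] x(1)
    by (intro CollectI exI[of _ \<zero>] exI[of _ 0]) (auto simp: const_poly_simps)
  moreover have "(u \<oplus> v, c + d) \<in> ?H" if "(u, c) \<in> ?H" "(v, d) \<in> ?H" for u c v d
  proof -
    obtain y a z b where *: "u = y \<oplus> (*) (const_poly a) \<odot> x" "v = z \<oplus> (*) (const_poly b) \<odot> x" "(y, c) \<in> G" "(z, d) \<in> G"
      using \<open>(u, c) \<in> ?H\<close> \<open>(v, d) \<in> ?H\<close> by blast
    have "u \<oplus> v = (y \<oplus> z) \<oplus> ((*) (const_poly a) \<odot> x \<oplus> (*) (const_poly b) \<odot> x)"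
      unfolding * using Gc[OF *(3)] Gc[OF *(4)] x(1) by (simp add: M.a_ac)
    also have "\<dots> = (y \<oplus> z) \<oplus> (*) (const_poly (a + b)) \<odot> x" by (simp add: const_plus x(1))
    finally show ?thesis using linear_relationD(3)[OF G *(3,4)] by (intro CollectI exI conjI) auto
  qed
  moreover have "((*) (const_poly b) \<odot> u, b * c) \<in> ?H" if "(u, c) \<in> ?H" for b u c
  proof -
    obtain y a where *: "u = y \<oplus> (*) (const_poly a) \<odot> x" "(y, c) \<in> G" using \<open>(u, c) \<in> ?H\<close> by blast
    have "(*) (const_poly b) \<odot> u = (*) (const_poly b) \<odot> y \<oplus> (*) (const_poly (b * a)) \<odot> x"
      unfolding * using Gc[OF *(2)] x(1) by (simp add: smult_r_distr D_ops_mult const_mult_mult)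
    then show ?thesis using linear_relationD(4)[OF G *(2)] by (intro CollectI exI conjI) auto
  qed
  moreover have "c = 0" if "(\<zero>, c) \<in> ?H" for c
  proof -
    obtain y a where *: "\<zero> = y \<oplus> (*) (const_poly a) \<odot> x" "(y, c) \<in> G" using \<open>(\<zero>, c) \<in> ?H\<close> by blast
    have yc: "y \<in> carrier M" by (rule Gc[OF *(2)])
    show ?thesis
    proof (cases "a = 0")
      case True
      then have "y = \<zero>" using * yc x(1) by (simp add: const_poly_simps)
      then show ?thesis using *(2) linear_relationD(5)[OF G] by blast
    next
      case False
      have "(*) (const_poly a) \<odot> x = (*) (const_poly (- 1)) \<odot> y"
        using *(1) const_minus_cancel[OF yc] yc x(1) by (metis M.add.l_cancel rmul_closed)
      then have "(*) (const_poly (inverse a)) \<odot> ((*) (const_poly a) \<odot> x) = (*) (const_poly (inverse a * - 1)) \<odot> y"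
        using yc by (simp only: const_mult_mult)
      then have "x = (*) (const_poly (inverse a * - 1)) \<odot> y"
        using False x(1) by (simp add: const_mult_mult) (simp add: const_poly_simps(2))
      then show ?thesis using x(2) linear_relationD(4)[OF G *(2), of "inverse a * - 1"] by simp
    qed
  qed
  ultimately show ?thesis unfolding linear_relation_def[of ?H] by (intro conjI allI impI)
qed

lemma linear_relation_total:
  assumes "linear_relation G"
  shows "\<exists>\<mu>. (\<forall>x\<in>carrier M. \<forall>y\<in>carrier M. \<mu> (x \<oplus> y) = \<mu> x + \<mu> y) \<and>
    (\<forall>c. \<forall>x\<in>carrier M. \<mu> ((*) (const_poly c) \<odot> x) = c * \<mu> x) \<and> (\<forall>(x, c)\<in>G. \<mu> x = c)"
proof -
  define A where "A = {H. linear_relation H \<and> G \<subseteq> H}"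
  have "\<exists>H\<in>A. \<forall>K\<in>A. H \<subseteq> K \<longrightarrow> K = H"
  proof (rule subset_Zorn_nonempty)
    show "A \<noteq> {}" using assms by (auto simp: A_def)
    fix \<C> assume ne: "\<C> \<noteq> {}" and ch: "subset.chain A \<C>"
    then have lin: "linear_relation H" "G \<subseteq> H" if "H \<in> \<C>" for H using that by (auto simp: subset.chain_def A_def)
    have dir: "\<exists>H\<in>\<C>. p \<in> H \<and> q \<in> H" if pq: "p \<in> \<Union>\<C>" "q \<in> \<Union>\<C>" for p q
    proof -
      obtain H1 H2 where "H1 \<in> \<C>" "H2 \<in> \<C>" "p \<in> H1" "q \<in> H2" using pq by blast
      moreover then have "H1 \<subseteq> H2 \<or> H2 \<subseteq> H1" using ch by (simp add: subset_chain_def)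
      ultimately show ?thesis by blast
    qed
    have "linear_relation (\<Union>\<C>)"
      unfolding linear_relation_def
    proof (intro conjI allI impI)
      show "\<Union>\<C> \<subseteq> carrier M \<times> UNIV" using linear_relationD(1)[OF lin(1)] by auto
      obtain H where "H \<in> \<C>" using ne by blast
      then show "(\<zero>, 0) \<in> \<Union>\<C>" using linear_relationD(2)[OF lin(1)] by blast
      fix x c y d assume "(x, c) \<in> \<Union>\<C>" "(y, d) \<in> \<Union>\<C>"
      then obtain H where "H \<in> \<C>" "(x, c) \<in> H" "(y, d) \<in> H" using dir by metis
      then show "(x \<oplus> y, c + d) \<in> \<Union>\<C>" using linear_relationD(3)[OF lin(1)] by blast
    next
      fix a x c assume "(x, c) \<in> \<Union>\<C>"
      then obtain H where "H \<in> \<C>" "(x, c) \<in> H" by blast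
      then show "((*) (const_poly a) \<odot> x, a * c) \<in> \<Union>\<C>" using linear_relationD(4)[OF lin(1)] by blast
    next
      fix c assume "(\<zero>, c) \<in> \<Union>\<C>"
      then obtain H where "H \<in> \<C>" "(\<zero>, c) \<in> H" by blast
      then show "c = 0" using linear_relationD(5)[OF lin(1)] by blast
    qed
    moreover have "G \<subseteq> \<Union>\<C>" using lin(2) ne by blast
    ultimately show "\<Union>\<C> \<in> A" by (simp add: A_def)
  qed
  then obtain H where H0: "H \<in> A" "\<And>K. K \<in> A \<Longrightarrow> H \<subseteq> K \<Longrightarrow> K = H" by blast
  then have H: "linear_relation H" "G \<subseteq> H" by (auto simp: A_def)
  have Hmax: "K = H" if "linear_relation K" "H \<subseteq> K" for K
    using H0(2)[of K] that H(2) by (auto simp: A_def)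
  have total: "\<exists>c. (x, c) \<in> H" if x: "x \<in> carrier M" for x
  proof (rule ccontr)
    assume "\<not> ?thesis"
    then have n: "(x, c) \<notin> H" for c by blast
    let ?K = "{(y \<oplus> (*) (const_poly a) \<odot> x, c) | y a c. (y, c) \<in> H}"
    have "H \<subseteq> ?K"
    proof
      fix p assume p: "p \<in> H"
      obtain y c where yc: "p = (y, c)" by (cases p)
      have "y \<in> carrier M" using p yc linear_relationD(1)[OF H(1)] by blast
      then show "p \<in> ?K" using p yc x by (intro CollectI exI[of _ y] exI[of _ 0] exI[of _ c]) (simp add: const_poly_simps)
    qed
    then have "?K = H" using Hmax[OF linear_relation_extend[OF H(1) x n]] by simp
    moreover have "(x, 0) \<in> ?K" using linear_relationD(2)[OF H(1)] x
      by (intro CollectI exI[of _ \<zero>] exI[of _ 1] exI[of _ 0]) (simp add: const_poly_simps)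
    ultimately show False using n by simp
  qed
  have single: "c = d" if "(x, c) \<in> H" "(x, d) \<in> H" for x c d
  proof -
    have "x \<in> carrier M" using that linear_relationD(1)[OF H(1)] by blast
    moreover have "(x \<oplus> (*) (const_poly (- 1)) \<odot> x, c + - 1 * d) \<in> H"
      using linear_relationD(3)[OF H(1) that(1) linear_relationD(4)[OF H(1) that(2)]] .
    ultimately have "(\<zero>, c - d) \<in> H" by (simp add: const_minus_cancel)
    then show ?thesis using linear_relationD(5)[OF H(1), of "c - d"] by simp
  qed
  define \<mu> where "\<mu> x = (THE c. (x, c) \<in> H)" for x
  have \<mu>: "\<mu> x = c" if "(x, c) \<in> H" for x c unfolding \<mu>_def using single that by blast
  show ?thesis
  proof (intro exI[of _ \<mu>] conjI ballI allI)
    fix x y assume "x \<in> carrier M" "y \<in> carrier M"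
    then obtain c d where "(x, c) \<in> H" "(y, d) \<in> H" using total by blast
    moreover have "(x \<oplus> y, c + d) \<in> H" using calculation linear_relationD(3)[OF H(1)] by blast
    ultimately show "\<mu> (x \<oplus> y) = \<mu> x + \<mu> y" using \<mu> by simp
  next
    fix a x assume "x \<in> carrier M"
    then obtain c where "(x, c) \<in> H" using total by blast
    moreover have "((*) (const_poly a) \<odot> x, a * c) \<in> H" using calculation linear_relationD(4)[OF H(1)] by blast
    ultimately show "\<mu> ((*) (const_poly a) \<odot> x) = a * \<mu> x" using \<mu> by simp
  qed (use \<mu> H(2) in auto)
qed

end

text \<open>
  This is the injectivity of \<open>E\<^sub>\<one>\<close>, expressed through residues. The functional is first extended by zero
  to the elements of \<open>M\<close> without component of weight \<open>-\<one>\<close>, which is consistent because a submodule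
  contains the weight components of its elements, and then to all of \<open>M\<close> as a linear functional.
\<close>

lemma functional_extend:
  fixes M :: "('k::field, 'n::{finite,linorder}, 'm) dmodule"
  assumes W: "weight_module M" and A: "submodule A D_ring M" and \<kappa>: "functional (M\<lparr>carrier := A\<rparr>) \<kappa>"
  shows "\<exists>\<mu>. functional M \<mu> \<and> (\<forall>a\<in>A. \<mu> a = \<kappa> a)"
proof -
  interpret M: D_module M using W by (rule weight_moduleD)
  let ?A = "M\<lparr>carrier := A\<rparr>"
  have WA: "weight_module ?A" by (rule weight_module_submodule[OF W A])
  interpret A: D_module ?A using WA by (rule weight_moduleD)
  note Asub = submodule_subset[OF A]
  have \<kappa>a: "\<kappa> (x \<oplus>\<^bsub>M\<^esub> y) = \<kappa> x + \<kappa> y" if "x \<in> A" "y \<in> A" for x y using \<kappa> that by (auto simp: functional_def)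
  have \<kappa>c: "\<kappa> ((*) (const_poly c) \<odot>\<^bsub>M\<^esub> x) = c * \<kappa> x" if "x \<in> A" for x c using \<kappa> that by (auto simp: functional_def)
  have \<kappa>0: "\<kappa> \<zero>\<^bsub>M\<^esub> = 0" using \<kappa>c[OF submodule_zero[OF A], of 0] by (simp add: const_poly_simps)
  \<comment> \<open>The elements without component of weight \<open>-\<one>\<close>.\<close>
  define N where "N = {w. \<exists>B. finite B \<and> spec M B w \<and> (\<lambda>_. - 1) \<notin> B}"
  have Nc: "w \<in> carrier M" if "w \<in> N" for w using that unfolding N_def spec_def by blast
  have N0: "\<zero>\<^bsub>M\<^esub> \<in> N" using M.spec_zero by (auto simp: N_def)
  have Na: "x \<oplus>\<^bsub>M\<^esub> y \<in> N" if xy: "x \<in> N" "y \<in> N" for x y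
  proof -
    obtain B B' where "finite B" "spec M B x" "(\<lambda>_. - 1) \<notin> B" "finite B'" "spec M B' y" "(\<lambda>_. - 1) \<notin> B'"
      using xy by (auto simp: N_def)
    then show ?thesis unfolding N_def using M.spec_add[of B x B' y] by (intro CollectI exI[of _ "B \<union> B'"]) simp
  qed
  have Nm: "(*) (const_poly c) \<odot>\<^bsub>M\<^esub> x \<in> N" if "x \<in> N" for x c
    using that M.mod_hom_spec[OF M.left_module_axioms M.const_hom] unfolding N_def by blast
  have AN: "\<kappa> x = 0" if x: "x \<in> A" "x \<in> N" for x
  proof -
    obtain B where B: "finite B" "spec M B x" "(\<lambda>_. - 1) \<notin> B" using x by (auto simp: N_def)
    then have "spec ?A B x" using x Asub by (simp add: spec_restrict)
    with B(1) show ?thesis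
    proof (induction rule: A.spec_induct)
      case (weight b m)
      then show ?case using \<kappa> B(3) unfolding functional_def by metis
    qed (simp_all add: \<kappa>0 \<kappa>a)
  qed
  define G where "G = {(a \<oplus>\<^bsub>M\<^esub> w, \<kappa> a) | a w. a \<in> A \<and> w \<in> N}"
  have "M.linear_relation G"
    unfolding M.linear_relation_def
  proof (intro conjI allI impI)
    show "G \<subseteq> carrier M \<times> UNIV" using Asub Nc by (auto simp: G_def)
    show "(\<zero>\<^bsub>M\<^esub>, 0) \<in> G" unfolding G_def
      by (intro CollectI exI[of _ "\<zero>\<^bsub>M\<^esub>"]) (auto simp: N0 \<kappa>0 submodule_zero[OF A])
  next
    fix x c y d assume "(x, c) \<in> G" "(y, d) \<in> G"
    then obtain a w a' w' where *: "a \<in> A" "w \<in> N" "a' \<in> A" "w' \<in> N" "x = a \<oplus>\<^bsub>M\<^esub> w" "y = a' \<oplus>\<^bsub>M\<^esub> w'" "c = \<kappa> a" "d = \<kappa> a'"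
      by (auto simp: G_def)
    then have "x \<oplus>\<^bsub>M\<^esub> y = (a \<oplus>\<^bsub>M\<^esub> a') \<oplus>\<^bsub>M\<^esub> (w \<oplus>\<^bsub>M\<^esub> w')"
      using Asub Nc by (simp add: subset_iff M.M.a_ac)
    moreover have "c + d = \<kappa> (a \<oplus>\<^bsub>M\<^esub> a')" using * by (simp add: \<kappa>a)
    ultimately show "(x \<oplus>\<^bsub>M\<^esub> y, c + d) \<in> G"
      using Na[OF *(2,4)] submodule_add[OF A *(1,3)] unfolding G_def by (intro CollectI exI conjI) auto
  next
    fix e x c assume "(x, c) \<in> G"
    then obtain a w where *: "a \<in> A" "w \<in> N" "x = a \<oplus>\<^bsub>M\<^esub> w" "c = \<kappa> a" by (auto simp: G_def)
    then have "(*) (const_poly e) \<odot>\<^bsub>M\<^esub> x = (*) (const_poly e) \<odot>\<^bsub>M\<^esub> a \<oplus>\<^bsub>M\<^esub> (*) (const_poly e) \<odot>\<^bsub>M\<^esub> w"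
      using Asub Nc by (auto simp: M.smult_r_distr D_ops_mult)
    then show "((*) (const_poly e) \<odot>\<^bsub>M\<^esub> x, e * c) \<in> G"
      using * Nm[OF *(2)] submodule_smult[OF A D_ops_mult *(1)] \<kappa>c[OF *(1)] unfolding G_def
      by (intro CollectI exI[of _ "(*) (const_poly e) \<odot>\<^bsub>M\<^esub> a"] exI[of _ "(*) (const_poly e) \<odot>\<^bsub>M\<^esub> w"]) auto
  next
    fix c assume "(\<zero>\<^bsub>M\<^esub>, c) \<in> G"
    then obtain a w where *: "a \<in> A" "w \<in> N" "\<zero>\<^bsub>M\<^esub> = a \<oplus>\<^bsub>M\<^esub> w" "c = \<kappa> a" by (auto simp: G_def)
    have c: "a \<in> carrier M" "w \<in> carrier M" using * Asub Nc by auto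
    then have "a = (*) (const_poly (- 1)) \<odot>\<^bsub>M\<^esub> w"
      using *(3) M.const_minus_cancel[OF c(2)] by (metis M.M.a_comm M.M.add.l_cancel M.rmul_closed)
    then have "a \<in> N" using Nm *(2) by simp
    then show "c = 0" using AN * by simp
  qed
  from M.linear_relation_total[OF this] obtain \<mu> where
    \<mu>: "\<forall>x\<in>carrier M. \<forall>y\<in>carrier M. \<mu> (x \<oplus>\<^bsub>M\<^esub> y) = \<mu> x + \<mu> y"
       "\<forall>c. \<forall>x\<in>carrier M. \<mu> ((*) (const_poly c) \<odot>\<^bsub>M\<^esub> x) = c * \<mu> x"
    and \<mu>G: "\<forall>(x, c)\<in>G. \<mu> x = c" by (elim exE conjE) (rule that)
  have \<mu>3: "\<mu> x = c" if "(x, c) \<in> G" for x c using bspec[OF \<mu>G that] by simp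
  have "\<mu> m = 0" if "m \<in> deg_part M b" "b \<noteq> (\<lambda>_. - 1)" for m b
  proof -
    have "m \<in> N" unfolding N_def using M.spec_weight[OF that(1)] that(2) by (intro CollectI exI[of _ "{b}"]) auto
    then have "(\<zero>\<^bsub>M\<^esub> \<oplus>\<^bsub>M\<^esub> m, \<kappa> \<zero>\<^bsub>M\<^esub>) \<in> G" unfolding G_def using submodule_zero[OF A] by blast
    then show ?thesis using \<mu>3 \<kappa>0 deg_part_carrier[OF that(1)] by fastforce
  qed
  moreover have "\<mu> a = \<kappa> a" if "a \<in> A" for a
  proof -
    have "(a \<oplus>\<^bsub>M\<^esub> \<zero>\<^bsub>M\<^esub>, \<kappa> a) \<in> G" unfolding G_def using that N0 by blast
    then show ?thesis using \<mu>3 that Asub by fastforce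
  qed
  ultimately show ?thesis using \<mu>(1,2) unfolding functional_def by blast
qed

section \<open>Modules with variation zero\<close>

definition negs :: "('n \<Rightarrow> int) \<Rightarrow> 'n set" where "negs b = {i. b i < 0}"

text \<open>
  For a module with variation zero, multiplication by \<open>x\<^sub>i\<close> is bijective between adjacent weight spaces, except at
  the step from \<open>b\<^sub>i = -1\<close> to \<open>b\<^sub>i = 0\<close>. Of this, the induction along the filtration uses the injectivity for \<open>b\<^sub>i \<ge> 0\<close>.
\<close>

definition var_injective :: "('k::field, 'n::{finite,linorder}, 'm) dmodule \<Rightarrow> bool" where
  "var_injective M \<longleftrightarrow> (\<forall>i b m. m \<in> deg_part M b \<longrightarrow> 0 \<le> b i \<longrightarrow> (*) (var_poly i) \<odot>\<^bsub>M\<^esub> m = \<zero>\<^bsub>M\<^esub> \<longrightarrow> m = \<zero>\<^bsub>M\<^esub>)"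

definition weights_in :: "('k::field, 'n::{finite,linorder}, 'm) dmodule \<Rightarrow> 'n set set \<Rightarrow> bool" where
  "weights_in M S \<longleftrightarrow> (\<forall>b m. m \<in> deg_part M b \<longrightarrow> m \<noteq> \<zero>\<^bsub>M\<^esub> \<longrightarrow> negs b \<in> S)"

subsection \<open>The graded pieces\<close>

lemma loc_R_weight_zero:
  fixes z :: "('k::field, 'n::{finite,linorder}) laurent"
  assumes z: "z \<in> deg_part (loc_at R_mod \<beta>) b" and i: "i \<notin> \<beta>" "b i < 0"
  shows "z = \<zero>\<^bsub>loc_at R_mod \<beta>\<^esub>"
proof -
  interpret Q: mono_localization "R_mod :: ('k, 'n, _) dmodule" \<beta> by (rule mono_localizationI[OF D_module_R_mod])
  obtain f L where f: "f \<in> deg_part R_mod (wadd b (vexp \<beta> L))" "z = Q.fr f L"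
    using Q.loc_weight_lift[OF weight_module_R_mod] z unfolding loc_at_def by blast
  have "lk f a = 0" for a
  proof (rule ccontr)
    assume "lk f a \<noteq> 0"
    from fun_cong[OF R_mod_weight_lookup[OF f(1) this], of i] show False
      using i by (simp add: wadd_def lookup_vexp)
  qed
  then have "f = \<zero>\<^bsub>R_mod\<^esub>" by (simp add: poly_mapping_eqI)
  then show ?thesis using f(2) Q.fr_zero by (simp add: loc_at_def)
qed

lemma loc_R_var_inj:
  fixes z :: "('k::field, 'n::{finite,linorder}) laurent"
  assumes z: "z \<in> carrier (loc_at R_mod \<beta>)" "(*) (var_poly i) \<odot>\<^bsub>loc_at R_mod \<beta>\<^esub> z = \<zero>\<^bsub>loc_at R_mod \<beta>\<^esub>"
  shows "z = \<zero>\<^bsub>loc_at R_mod \<beta>\<^esub>"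
proof -
  interpret Q: mono_localization "R_mod :: ('k, 'n, _) dmodule" \<beta> by (rule mono_localizationI[OF D_module_R_mod])
  obtain f L where f: "z = Q.fr f L" using z(1) Q.loc_cases unfolding loc_at_def by blast
  then have "Q.fr (var_poly i * f) L = \<zero>\<^bsub>loc_at R_mod \<beta>\<^esub>" using z(2) Q.loc_rmul[of f "var_poly i" L] by (simp add: loc_at_def)
  then obtain K where "xmon \<beta> ^ K * (var_poly i * f) = 0" using Q.fr_eq_zero_iff[of "var_poly i * f" L] by (auto simp: loc_at_def)
  then have "var_poly i * f = 0" by (rule Q.nzd_pow)
  then have "f = \<zero>\<^bsub>R_mod\<^esub>" using nzd_mono[of "unit_exp i" f] by (simp add: var_poly_def)
  then show ?thesis using f Q.fr_zero by (simp add: loc_at_def)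
qed

lemma deg_part_R_single:
  fixes f :: "('k::field, 'n::{finite,linorder}) mpoly"
  assumes "f \<in> deg_part R_mod b" shows "f = Poly_Mapping.single (nexp b) (lk f (nexp b))"
proof (rule poly_mapping_eqI)
  fix a
  have "a = nexp b" if "lk f a \<noteq> 0"
    using R_mod_weight_lookup[OF assms that] by (intro poly_mapping_eqI) (simp add: lookup_nexp)
  then show "lk f a = lk (Poly_Mapping.single (nexp b) (lk f (nexp b))) a"
    by (auto simp: lookup_single when_def)
qed

text \<open>
  A coboundary of weight \<open>b\<close> comes from the cochains of weight \<open>b\<close>, and these live on proper subsets
  of \<open>\<alpha>\<close>; if \<open>b\<close> is negative on \<open>\<alpha>\<close> there are none.
\<close>

lemma coboundary_weight_zero:
  fixes y :: "'n::{finite,linorder} set \<Rightarrow> ('k::field, 'n) laurent"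
  assumes y: "y \<in> coboundaries R_mod \<alpha> (card \<alpha>)" "y \<in> deg_part (cech_mod R_mod \<alpha> (card \<alpha>)) b"
    and b: "\<alpha> \<subseteq> negs b"
  shows "y = \<zero>\<^bsub>cech_mod R_mod \<alpha> (card \<alpha>)\<^esub>"
proof (cases "card \<alpha>")
  case 0
  then show ?thesis using y(1) by (simp add: coboundaries_def)
next
  case (Suc q)
  note C = left_module_cech[OF D_module_R_mod]
  obtain g where g: "g \<in> carrier (cech_mod R_mod \<alpha> q)" "y = cech_diff R_mod \<alpha> q g"
    using y(1) Suc by (auto simp: coboundaries_def)
  obtain g' where g': "g' \<in> deg_part (cech_mod R_mod \<alpha> q) b" "cech_diff R_mod \<alpha> q g' = y"
    using weight_lift[OF weight_module_cech[OF weight_module_R_mod] D_moduleI[OF C] cech_diff_hom[OF D_module_R_mod] g(1)] y(2) g(2) Suc by auto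
  have "g' \<beta> = \<zero>\<^bsub>loc_at R_mod \<beta>\<^esub>" if \<beta>: "\<beta> \<in> cech_idx \<alpha> q" for \<beta>
  proof -
    have "\<beta> \<noteq> \<alpha>" "\<beta> \<subseteq> \<alpha>" using \<beta> Suc by (auto simp: cech_idx_def)
    then obtain j where j: "j \<in> \<alpha>" "j \<notin> \<beta>" by blast
    then have "b j < 0" using b by (auto simp: negs_def)
    moreover have "g' \<beta> \<in> deg_part (loc_at R_mod \<beta>) b" using g'(1) \<beta> by (auto simp: cech_mod_def deg_part_dsum)
    ultimately show ?thesis using loc_R_weight_zero j by blast
  qed
  moreover have "g' \<in> carrier (cech_mod R_mod \<alpha> q)" by (rule deg_part_carrier[OF g'(1)])
  ultimately have "g' = \<zero>\<^bsub>cech_mod R_mod \<alpha> q\<^esub>"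
    by (auto simp: cech_mod_def dsum_simps PiE_def extensional_def restrict_def fun_eq_iff)
  moreover have "cech_diff R_mod \<alpha> q \<zero>\<^bsub>cech_mod R_mod \<alpha> q\<^esub> = (\<zero>\<^bsub>cech_mod R_mod \<alpha> (Suc q)\<^esub> :: 'n set \<Rightarrow> ('k, 'n) laurent)"
    by (rule mod_hom_zero[OF C C cech_diff_hom[OF D_module_R_mod]])
  ultimately show ?thesis using g'(2) Suc by simp
qed

lemma cech_idx_top: "cech_idx \<alpha> (card \<alpha>) = {\<alpha> :: 'n::{finite,linorder} set}"
  by (auto simp: cech_idx_def dest: card_subset_eq[OF finite])

text \<open>
  A class of weight \<open>b\<close> in the top cohomology is represented by a fraction of weight \<open>b\<close> with denominator a power of
  \<open>x\<^sup>\<alpha>\<close>. This forces \<open>b\<^sub>i \<ge> 0\<close> for \<open>i \<notin> \<alpha>\<close>. If \<open>b\<^sub>i \<ge> 0\<close> for some \<open>i \<in> \<alpha>\<close>, then \<open>x\<^sub>i\<close> can be cancelled from the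
  denominator and the fraction is a coboundary. So the weights that occur are negative exactly on \<open>\<alpha>\<close>. If \<open>x\<^sub>i\<close> kills such a
  class and \<open>b\<^sub>i \<ge> 0\<close>, then it kills the representing fraction, as there are no coboundaries of
  the weight in question, and that fraction is zero since \<open>R\<close> is a domain.
\<close>

lemma local_coh_top:
  fixes \<alpha> :: "'n::{finite,linorder} set"
  defines "H \<equiv> local_coh (R_mod :: ('k::field, 'n, _) dmodule) \<alpha> (card \<alpha>)"
  shows "weights_in H {\<alpha>}" "var_injective H"
proof -
  let ?R = "R_mod :: ('k, 'n, _) dmodule"
  let ?C = "cech_mod ?R \<alpha> (card \<alpha>)"
  let ?B = "coboundaries ?R \<alpha> (card \<alpha>)"
  let ?Z = "?C\<lparr>carrier := cocycles ?R \<alpha> (card \<alpha>)\<rparr>"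
  note M = D_module_R_mod and W = weight_module_R_mod
  interpret C: D_module ?C by (rule D_moduleI[OF left_module_cech[OF M]])
  interpret Z: left_module D_ring ?Z by (rule left_module_cocycles[OF M])
  interpret H: D_module H unfolding H_def by (rule D_moduleI[OF left_module_local_coh[OF M]])
  note B = submodule_coboundaries'[OF M]
  have Zsub: "cocycles ?R \<alpha> (card \<alpha>) \<subseteq> carrier ?C" by (rule submodule_subset[OF submodule_cocycles[OF M]])
  have Heq: "H = quot_mod ?Z ?B" by (simp add: H_def local_coh_eq)
  have comp0: "n = \<zero>\<^bsub>?C\<^esub>" if "n \<in> carrier ?C" "n \<alpha> = \<zero>\<^bsub>loc_at ?R \<alpha>\<^esub>" for n
    using that by (auto simp: cech_mod_def dsum_simps cech_idx_top PiE_def extensional_def restrict_def fun_eq_iff)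
  have lift: "\<exists>n. n \<in> cocycles ?R \<alpha> (card \<alpha>) \<and> n \<in> deg_part ?C b \<and> h = ?B +>\<^bsub>?Z\<^esub> n" if h: "h \<in> deg_part H b" for h b
  proof -
    obtain z where z: "z \<in> carrier ?Z" "h = ?B +>\<^bsub>?Z\<^esub> z"
      using deg_part_carrier[OF h] unfolding Heq Z.quot_mod_carrier by blast
    have "?B +>\<^bsub>?Z\<^esub> z \<in> deg_part (quot_mod ?Z ?B) b" using h z(2) by (simp add: Heq)
    then obtain n where "n \<in> deg_part ?Z b" "?B +>\<^bsub>?Z\<^esub> n = h"
      using weight_lift[OF weight_module_cocycles[OF W] D_moduleI[OF Z.left_module_quot[OF B]] Z.coset_hom[OF B] z(1)] z(2) by blast
    then show ?thesis using deg_part_restrict[OF Zsub] by blast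
  qed
  have Hz: "?B +>\<^bsub>?Z\<^esub> n = \<zero>\<^bsub>H\<^esub> \<longleftrightarrow> n \<in> ?B" if "n \<in> cocycles ?R \<alpha> (card \<alpha>)" for n
    using Z.coset_zero_iff[OF B, of n] that by (simp add: Heq)
  have nl: "n \<alpha> \<in> deg_part (loc_at ?R \<alpha>) b" if "n \<in> deg_part ?C b" for n b
    using that by (simp add: cech_mod_def deg_part_dsum cech_idx_top)
  show win: "weights_in H {\<alpha>}"
    unfolding weights_in_def
  proof (intro allI impI)
    fix b h assume h: "h \<in> deg_part H b" and ne: "h \<noteq> \<zero>\<^bsub>H\<^esub>"
    obtain n where n: "n \<in> cocycles ?R \<alpha> (card \<alpha>)" "n \<in> deg_part ?C b" "h = ?B +>\<^bsub>?Z\<^esub> n" using lift[OF h] by blast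
    have nB: "n \<notin> ?B" using ne n Hz by simp
    then have n0: "n \<noteq> \<zero>\<^bsub>?C\<^esub>" using submodule_zero[OF submodule_coboundaries[OF M]] by metis
    have "i \<in> \<alpha>" if "b i < 0" for i
      using loc_R_weight_zero[OF nl[OF n(2)] _ that] comp0[OF deg_part_carrier[OF n(2)]] n0 by blast
    moreover have "b i < 0" if i: "i \<in> \<alpha>" for i
    proof (rule ccontr)
      assume bi: "\<not> b i < 0"
      interpret Q: mono_localization ?R \<alpha> by (rule mono_localizationI[OF M])
      interpret P: mono_localization ?R "\<alpha> - {i}" by (rule mono_localizationI[OF M])
      interpret PN: D_module "loc_at ?R (\<alpha> - {i})" by (rule D_module_loc_at[OF M])
      interpret QN: D_module "loc_at ?R \<alpha>" by (rule D_module_loc_at[OF M])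
      obtain q where q: "card \<alpha> = Suc q" using i by (metis card_Suc_Diff1 finite)
      obtain f L where f: "f \<in> deg_part ?R (wadd b (vexp \<alpha> L))" "n \<alpha> = Q.fr f L"
        using Q.loc_weight_lift[OF W] nl[OF n(2)] unfolding loc_at_def by blast
      define w where "w = wadd b (vexp \<alpha> L)"
      \<comment> \<open>The numerator is a multiple of \<open>x\<^sub>i\<^sup>L\<close>; the quotient is \<open>f'\<close>.\<close>
      define f' where "f' = Poly_Mapping.single (nexp w - vexp {i} L) (lk f (nexp w))"
      have vp: "var_poly i ^ L = mono_poly (vexp {i} L)" using xmon_power[of "{i}" L] by (simp add: xmon_def)
      have "vexp {i} L + (nexp w - vexp {i} L) = nexp w"
        using bi i by (intro poly_mapping_eqI) (auto simp: lookup_add lookup_minus lookup_vexp lookup_nexp w_def wadd_def)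
      then have ff': "var_poly i ^ L * f' = f"
        using deg_part_R_single[OF f(1)] by (simp add: f'_def vp mult_single w_def)
      let ?s = "const_poly (cube_sign i \<alpha>) :: ('k, 'n) mpoly"
      define g where "g = (\<lambda>\<beta>\<in>cech_idx \<alpha> q. if \<beta> = \<alpha> - {i} then (*) ?s \<odot>\<^bsub>loc_at ?R \<beta>\<^esub> P.fr f' L else \<zero>\<^bsub>loc_at ?R \<beta>\<^esub>)"
      have idx: "\<alpha> - {k} \<in> cech_idx \<alpha> q" if "k \<in> \<alpha>" for k using that q by (simp add: cech_idx_def)
      have frc: "P.fr f' L \<in> carrier (loc_at ?R (\<alpha> - {i}))" unfolding loc_at_def by simp
      have lz: "\<zero>\<^bsub>loc_at ?R \<beta>\<^esub> \<in> carrier (loc_at ?R \<beta>)" for \<beta>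
        using D_module_loc_at[OF M, of \<beta>] by (meson D_module.axioms abelian_monoid.zero_closed abelian_group.axioms(1) left_module.axioms(2))
      have gc: "g \<in> carrier (cech_mod ?R \<alpha> q)"
        using frc lz by (auto simp: g_def cech_mod_def dsum_simps)
      have summand: "(*) (cube_sign k \<alpha>) \<odot>\<^bsub>loc_at ?R \<alpha>\<^esub> res ?R \<alpha> k (g (\<alpha> - {k})) = (if i = k then n \<alpha> else \<zero>\<^bsub>loc_at ?R \<alpha>\<^esub>)" if k: "k \<in> \<alpha>" for k
      proof (cases "k = i")
        case True
        have "res ?R \<alpha> i (g (\<alpha> - {i})) = (*) ?s \<odot>\<^bsub>loc_at ?R \<alpha>\<^esub> Q.fr f L"
          using idx[OF i] mod_homD(3)[OF res_hom[OF M i] D_ops_mult frc] res_fr[OF M i, of f' L] ff'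
          by (simp add: g_def)
        moreover have "cube_sign i \<alpha> * cube_sign i \<alpha> = (1 :: 'k)" by (simp add: cube_sign_def flip: power_add)
        moreover have "Q.fr f L \<in> carrier (loc_at ?R \<alpha>)" unfolding loc_at_def by simp
        ultimately show ?thesis using True f(2)
          by (simp add: cube_sign_const QN.rmul_rmul const_poly_simps(2) flip: const_poly_simps(4))
      next
        case False
        then have "g (\<alpha> - {k}) = \<zero>\<^bsub>loc_at ?R (\<alpha> - {k})\<^esub>" using idx[OF k] k i by (auto simp: g_def)
        moreover have "res ?R \<alpha> k \<zero>\<^bsub>loc_at ?R (\<alpha> - {k})\<^esub> = \<zero>\<^bsub>loc_at ?R \<alpha>\<^esub>"
          by (rule mod_hom_zero[OF left_module_loc_at[OF M] left_module_loc_at[OF M] res_hom[OF M k]])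
        moreover have "(*) (cube_sign k \<alpha>) \<odot>\<^bsub>loc_at ?R \<alpha>\<^esub> \<zero>\<^bsub>loc_at ?R \<alpha>\<^esub> = \<zero>\<^bsub>loc_at ?R \<alpha>\<^esub>"
          by (rule QN.smult_zero[OF D_ops_mult])
        ultimately show ?thesis using False by simp
      qed
      have "cech_diff ?R \<alpha> q g \<alpha> = n \<alpha>"
      proof -
        have "cech_diff ?R \<alpha> q g \<alpha> = (\<Oplus>\<^bsub>loc_at ?R \<alpha>\<^esub>k\<in>\<alpha>. (*) (cube_sign k \<alpha>) \<odot>\<^bsub>loc_at ?R \<alpha>\<^esub> res ?R \<alpha> k (g (\<alpha> - {k})))"
          using cech_idx_top[of \<alpha>] q by (simp add: cech_diff_def)
        also have "\<dots> = (\<Oplus>\<^bsub>loc_at ?R \<alpha>\<^esub>k\<in>\<alpha>. if i = k then n \<alpha> else \<zero>\<^bsub>loc_at ?R \<alpha>\<^esub>)"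
          by (intro QN.M.finsum_cong' refl summand) (use deg_part_carrier[OF nl[OF n(2)]] in auto)
        also have "\<dots> = n \<alpha>"
          using QN.M.finsum_singleton[OF i, of "\<lambda>_. n \<alpha>"] deg_part_carrier[OF nl[OF n(2)]] by simp
        finally show ?thesis .
      qed
      moreover have "cech_diff ?R \<alpha> q g \<in> carrier ?C" using mod_homD(1)[OF cech_diff_hom[OF M] gc] q by simp
      ultimately have "cech_diff ?R \<alpha> q g = n"
        using deg_part_carrier[OF n(2)] by (auto simp: cech_mod_def dsum_simps cech_idx_top intro: PiE_ext)
      then show False using nB gc q by (auto simp: coboundaries_def)
    qed
    ultimately show "negs b \<in> {\<alpha>}" by (auto simp: negs_def)
  qed
  show "var_injective H"
    unfolding var_injective_def
  proof (intro allI impI, rule ccontr)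
    fix i b h assume h: "h \<in> deg_part H b" and bi: "0 \<le> b i" and xh: "(*) (var_poly i) \<odot>\<^bsub>H\<^esub> h = \<zero>\<^bsub>H\<^esub>" and ne: "h \<noteq> \<zero>\<^bsub>H\<^esub>"
    obtain n where n: "n \<in> cocycles ?R \<alpha> (card \<alpha>)" "n \<in> deg_part ?C b" "h = ?B +>\<^bsub>?Z\<^esub> n" using lift[OF h] by blast
    have \<alpha>: "\<alpha> = negs b" using win h ne by (auto simp: weights_in_def)
    let ?y = "(*) (var_poly i) \<odot>\<^bsub>?C\<^esub> n"
    have "?B +>\<^bsub>?Z\<^esub> ?y = \<zero>\<^bsub>H\<^esub>"
      using xh n(1,3) Z.quot_mod_smult[OF B D_ops_mult, of n "var_poly i"] by (simp add: Heq)
    then have yB: "?y \<in> ?B" using Hz submodule_smult[OF submodule_cocycles[OF M] D_ops_mult n(1)] by blast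
    have "?y \<in> deg_part ?C (wadd b (unit_exp i))" by (rule C.var_weight[OF n(2)])
    moreover have "\<alpha> \<subseteq> negs (wadd b (unit_exp i))" using \<alpha> bi by (auto simp: negs_def wadd_def lookup_single when_def)
    ultimately have "?y = \<zero>\<^bsub>?C\<^esub>" using coboundary_weight_zero[OF yB] by blast
    from fun_cong[OF this, of \<alpha>] have "(*) (var_poly i) \<odot>\<^bsub>loc_at ?R \<alpha>\<^esub> n \<alpha> = \<zero>\<^bsub>loc_at ?R \<alpha>\<^esub>"
      by (simp add: cech_mod_def dsum_simps cech_idx_top)
    then have "n \<alpha> = \<zero>\<^bsub>loc_at ?R \<alpha>\<^esub>" using loc_R_var_inj deg_part_carrier[OF nl[OF n(2)]] by blast
    then have "n = \<zero>\<^bsub>?C\<^esub>" using comp0 deg_part_carrier[OF n(2)] by blast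
    then have "n \<in> ?B" using submodule_zero[OF submodule_coboundaries[OF M]] by simp
    then show False using Hz n ne by blast
  qed
qed

lemma weights_in_dsum:
  assumes "\<And>i. i \<in> I \<Longrightarrow> weights_in (M i) S" shows "weights_in (dsum I M) S"
  unfolding weights_in_def
proof (intro allI impI)
  fix b f assume f: "f \<in> deg_part (dsum I M) b" "f \<noteq> \<zero>\<^bsub>dsum I M\<^esub>"
  have "\<exists>i\<in>I. f i \<noteq> \<zero>\<^bsub>M i\<^esub>"
  proof (rule ccontr)
    assume "\<not> ?thesis"
    then have "f = \<zero>\<^bsub>dsum I M\<^esub>" using deg_part_carrier[OF f(1)] by (auto simp: dsum_simps PiE_def extensional_def restrict_def fun_eq_iff)
    then show False using f(2) by simp
  qed
  then show "negs b \<in> S" using f(1) assms by (auto simp: deg_part_dsum weights_in_def)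
qed

lemma var_injective_dsum:
  assumes "\<And>i. i \<in> I \<Longrightarrow> var_injective (M i)" shows "var_injective (dsum I M)"
  unfolding var_injective_def
proof (intro allI impI)
  fix i b f assume f: "f \<in> deg_part (dsum I M) b" "0 \<le> b i" "(*) (var_poly i) \<odot>\<^bsub>dsum I M\<^esub> f = \<zero>\<^bsub>dsum I M\<^esub>"
  have "f j = \<zero>\<^bsub>M j\<^esub>" if "j \<in> I" for j
    using f(1,2) fun_cong[OF f(3), of j] assms[OF that] that by (auto simp: dsum_simps deg_part_dsum var_injective_def)
  then show "f = \<zero>\<^bsub>dsum I M\<^esub>"
    using deg_part_carrier[OF f(1)] by (auto simp: dsum_simps PiE_def extensional_def restrict_def fun_eq_iff)
qed

subsection \<open>Extensions\<close>

context D_module begin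

text \<open>
  A nonzero element with finite spectrum has a nonzero weight component.
\<close>

lemma spec_zeroI:
  assumes "finite B" "spec M B y"
    and z: "\<And>e \<phi> w. eu e \<phi> \<Longrightarrow> e \<odot> y \<in> deg_part M w \<Longrightarrow> e \<odot> y = \<zero>"
  shows "y = \<zero>"
  using assms(1,2)
proof (induction B)
  case empty
  then show ?case by (rule_tac spec_empty)
next
  case (insert b B)
  obtain e and \<phi> :: "_ \<Rightarrow> 'k" where e: "eu e \<phi>" "\<phi> b = 1" "\<forall>w\<in>B. w \<noteq> b \<longrightarrow> \<phi> w = 0"
    using eu_projection[OF insert(1)] by blast
  have y: "y \<in> carrier M" by (rule spec_carrier[OF insert.prems])
  have "e \<odot> y \<in> deg_part M b" using projection_weight[OF insert.prems e(1)] e(3) by blast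
  then have ez: "e \<odot> y = \<zero>" using z[OF e(1)] by blast
  have e': "eu (\<lambda>f. f - e f) (\<lambda>v. 1 - \<phi> v)" by (rule eu_diff[OF eu_id e(1)])
  have "e \<odot> y \<oplus> (\<lambda>f. f - e f) \<odot> y = y" using op_add[OF eu_D[OF e(1)] eu_D[OF e'] y] y by simp
  then have ye: "(\<lambda>f. f - e f) \<odot> y = y" using ez eu_closed[OF e' y] by simp
  have "spec M B y"
    unfolding spec_def
  proof (intro conjI allI impI y)
    fix P and \<psi> :: "('n \<Rightarrow> int) \<Rightarrow> 'k" assume P: "eu P \<psi> \<and> (\<forall>b\<in>B. \<psi> b = 0)"
    have "(\<lambda>f. P (f - e f)) \<odot> y = \<zero>"
      by (rule specD[OF insert.prems eu.comp[OF _ e', of P \<psi>]]) (use P e in auto)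
    then show "P \<odot> y = \<zero>" using op_comp[OF _ eu_D[OF e'] y, of P] P eu_D[of P \<psi>] ye by simp
  qed
  then show ?case by (rule insert.IH)
qed

lemma var_power_inj:
  assumes "var_injective M" "0 \<le> w i"
  shows "z \<in> deg_part M w \<Longrightarrow> (*) (mono_poly (vexp {i} K)) \<odot> z = \<zero> \<Longrightarrow> z = \<zero>"
  using assms(2)
proof (induction K arbitrary: z w)
  case 0
  have "vexp {i} 0 = 0" by (intro poly_mapping_eqI) (simp add: lookup_vexp)
  then show ?case using 0 deg_part_carrier[OF 0(1)] by (simp add: single_one)
next
  case (Suc K)
  have zc: "z \<in> carrier M" by (rule deg_part_carrier[OF Suc.prems(1)])
  have "vexp {i} (Suc K) = vexp {i} K + unit_exp i"
    by (intro poly_mapping_eqI) (auto simp: lookup_vexp lookup_add lookup_single when_def)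
  then have "(*) (mono_poly (vexp {i} K)) \<odot> ((*) (var_poly i) \<odot> z) = \<zero>"
    using Suc.prems(2) zc by (simp add: rmul_rmul single_Suc_exp mult.commute[of "mono_poly (vexp {i} K)" "var_poly i"])
  then have "(*) (var_poly i) \<odot> z = \<zero>"
    by (rule Suc.IH[OF var_weight[OF Suc.prems(1)]]) (use Suc.prems(3) in \<open>simp add: wadd_def lookup_single\<close>)
  then show ?case using assms(1) Suc.prems unfolding var_injective_def by blast
qed

end

text \<open>
  What is carried along the filtration: besides the two properties that are wanted in the end, bounds on the
  weights and injectivity of variables, by which finite spectra are lifted from a quotient.
\<close>

definition level :: "('k::field, 'n::{finite,linorder}, 'm) dmodule \<Rightarrow> int \<Rightarrow> bool" where
  "level M j \<longleftrightarrow> weight_module M \<and> var_injective M \<and> var_zero M \<and> weights_in M {S. int (card S) \<le> j}"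

text \<open>
  The main point is that elements of \<open>M\<close> have finite spectrum. Let \<open>m\<close> lift a vector of weight \<open>b\<close> in
  the quotient. For \<open>i\<close> in the negative support of \<open>b\<close> the element \<open>x\<^sub>i\<^sup>K m\<close>, \<open>K = -b\<^sub>i\<close>, lies in the submodule
  \<open>A\<close>, because the quotient has no weights with smaller negative support; the finite set \<open>B\<close> consists
  of \<open>b\<close> and the weights of these elements, shifted back. If the symbol of an operator \<open>P\<close> of the Euler algebra
  vanishes on \<open>B\<close>, then \<open>P m\<close> lies in \<open>A\<close> and is killed by these powers. But a weight of \<open>A\<close> has
  fewer negative entries than \<open>b\<close>, so one of these \<open>x\<^sub>i\<close> is injective on its weight space; hence \<open>P m = 0\<close>.

  The vanishing of \<open>\<partial>\<^sub>i\<close> on the weights with \<open>b\<^sub>i = 0\<close> follows from the bound on weights: a vector that is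
  not in \<open>A\<close> has \<open>j\<close> negative entries in its weight, and \<open>\<partial>\<^sub>i\<close> would add one more.
\<close>

lemma level_extension:
  fixes M :: "('k::field, 'n::{finite,linorder}, 'm) dmodule" and Y :: "('k, 'n, 'x) dmodule"
  assumes M: "D_module M" and q: "q \<in> mod_hom D_ring M Y" "q ` carrier M = carrier Y"
    and Y: "weight_module Y" "var_injective Y" "weights_in Y {S. int (card S) = j}"
    and A: "A = {x \<in> carrier M. q x = \<zero>\<^bsub>Y\<^esub>}" "level (M\<lparr>carrier := A\<rparr>) (j - 1)"
  shows "level M j"
proof -
  interpret M: D_module M by fact
  interpret Y: D_module Y using Y(1) by (rule weight_moduleD)
  let ?A = "M\<lparr>carrier := A\<rparr>"
  have subA: "submodule A D_ring M"
    unfolding A(1) by (rule mod_hom_kernel_submodule[OF M.left_module_axioms Y.left_module_axioms q(1)])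
  note Ac = submodule_subset[OF subA]
  have WA: "weight_module ?A" and IA: "var_injective ?A" and VA: "var_zero ?A" and BA: "weights_in ?A {S. int (card S) \<le> j - 1}"
    using A(2) by (auto simp: level_def)
  interpret A: D_module ?A using WA by (rule weight_moduleD)
  have Adeg: "m \<in> deg_part ?A b \<longleftrightarrow> m \<in> A \<and> m \<in> deg_part M b" for m b using deg_part_restrict[OF Ac] by blast
  have qa: "q x \<in> carrier Y" if "x \<in> carrier M" for x using mod_homD(1)[OF q(1) that] .
  have fromA: "\<exists>B. finite B \<and> spec M B m" if "m \<in> A" for m
    using WA that by (auto simp: weight_module_def spec_restrict[OF Ac])
  have weights: "negs b \<in> {S. int (card S) \<le> j}" if m: "m \<in> deg_part M b" "m \<noteq> \<zero>\<^bsub>M\<^esub>" for m b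
  proof (cases "q m = \<zero>\<^bsub>Y\<^esub>")
    case True
    then have "m \<in> deg_part ?A b" using m(1) deg_part_carrier[OF m(1)] by (subst Adeg) (simp add: A(1))
    then show ?thesis using BA m(2) by (force simp: weights_in_def)
  next
    case False
    then show ?thesis using M.mod_hom_weight[OF q(1) m(1)] Y(3) by (auto simp: weights_in_def)
  qed
  have inj: "m = \<zero>\<^bsub>M\<^esub>" if m: "m \<in> deg_part M b" "0 \<le> b i" "(*) (var_poly i) \<odot>\<^bsub>M\<^esub> m = \<zero>\<^bsub>M\<^esub>" for i b m
  proof -
    have mc: "m \<in> carrier M" by (rule deg_part_carrier[OF m(1)])
    have "(*) (var_poly i) \<odot>\<^bsub>Y\<^esub> q m = \<zero>\<^bsub>Y\<^esub>"
      using mod_homD(3)[OF q(1) D_ops_mult mc, of "var_poly i"] m(3) mod_hom_zero[OF M.left_module_axioms Y.left_module_axioms q(1)] by simp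
    then have "q m = \<zero>\<^bsub>Y\<^esub>" using Y(2) M.mod_hom_weight[OF q(1) m(1)] m(2) by (auto simp: var_injective_def)
    then have "m \<in> deg_part ?A b" using m(1) mc by (subst Adeg) (simp add: A(1))
    then show ?thesis using IA m by (auto simp: var_injective_def)
  qed
  have var: "partial i \<odot>\<^bsub>M\<^esub> m = \<zero>\<^bsub>M\<^esub>" if m: "m \<in> deg_part M b" "b i = 0" for i b m
  proof (cases "q m = \<zero>\<^bsub>Y\<^esub>")
    case True
    then have "m \<in> deg_part ?A b" using m(1) deg_part_carrier[OF m(1)] by (subst Adeg) (simp add: A(1))
    then show ?thesis using VA m by (auto simp: var_zero_def)
  next
    case False
    then have "int (card (negs b)) = j" using M.mod_hom_weight[OF q(1) m(1)] Y(3) by (auto simp: weights_in_def)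
    moreover have "negs (wsub b (unit_exp i)) = insert i (negs b)"
      using m(2) by (auto simp: negs_def wsub_def lookup_single when_def split: if_splits)
    moreover have "i \<notin> negs b" using m(2) by (simp add: negs_def)
    ultimately have "int (card (negs (wsub b (unit_exp i)))) = j + 1" by simp
    then show ?thesis using weights[OF M.partial_weight[OF m(1), of i]] by force
  qed
  have lift: "\<exists>B. finite B \<and> spec M B m"
    if v: "v \<in> deg_part Y b" and m: "m \<in> carrier M" "q m = v" for v b m
  proof (cases "v = \<zero>\<^bsub>Y\<^esub>")
    case True
    then show ?thesis using fromA m by (simp add: A(1))
  next
    case False
    then have cb: "int (card (negs b)) = j" using Y(3) v by (auto simp: weights_in_def)
    \<comment> \<open>The exponent that lifts the entry \<open>b\<^sub>i\<close> to \<open>0\<close>.\<close>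
    define a where "a i = vexp {i} (nat (- b i))" for i
    define g where "g i = (*) (mono_poly (a i)) \<odot>\<^bsub>M\<^esub> m" for i
    have gA: "g i \<in> A" if i: "i \<in> negs b" for i
    proof -
      have "(*) (mono_poly (a i)) \<odot>\<^bsub>Y\<^esub> v \<in> deg_part Y (wadd b (a i))" by (rule Y.mono_weight[OF v])
      moreover have "negs (wadd b (a i)) = negs b - {i}"
        using i by (auto simp: negs_def wadd_def a_def lookup_vexp split: if_splits)
      then have "int (card (negs (wadd b (a i)))) < j" using cb i card_Diff1_less[of "negs b" i] by simp
      ultimately have "(*) (mono_poly (a i)) \<odot>\<^bsub>Y\<^esub> v = \<zero>\<^bsub>Y\<^esub>" using Y(3) by (force simp: weights_in_def)
      then show ?thesis using mod_homD(3)[OF q(1) D_ops_mult m(1)] m by (simp add: g_def A(1))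
    qed
    then have "\<forall>i\<in>negs b. \<exists>B. finite B \<and> spec M B (g i)" using fromA by blast
    then obtain C where C: "\<And>i. i \<in> negs b \<Longrightarrow> finite (C i) \<and> spec M (C i) (g i)" by metis
    define B where "B = insert b (\<Union>i\<in>negs b. (\<lambda>w. wsub w (a i)) ` C i)"
    have "spec M B m"
      unfolding spec_def
    proof (intro conjI allI impI m(1))
      fix P and \<phi> :: "('n \<Rightarrow> int) \<Rightarrow> 'k" assume P: "eu P \<phi> \<and> (\<forall>b\<in>B. \<phi> b = 0)"
      define y where "y = P \<odot>\<^bsub>M\<^esub> m"
      have yc: "y \<in> carrier M" using M.eu_closed P m(1) unfolding y_def by blast
      have "q y = P \<odot>\<^bsub>Y\<^esub> v" unfolding y_def using mod_homD(3)[OF q(1) eu_D m(1)] P m(2) by blast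
      also have "\<dots> = \<zero>\<^bsub>Y\<^esub>" using Y.eu_weight[OF v, of P \<phi>] P qa[OF m(1)] m(2) by (simp add: B_def const_poly_simps)
      finally have yA: "y \<in> A" using yc by (simp add: A(1))
      have xy: "(*) (mono_poly (a i)) \<odot>\<^bsub>M\<^esub> y = \<zero>\<^bsub>M\<^esub>" if i: "i \<in> negs b" for i
      proof -
        obtain P' where P': "eu P' (\<lambda>b. \<phi> (wsub b (a i)))" "\<And>f. mono_poly (a i) * P f = P' (mono_poly (a i) * f)"
          using eu_shift P by blast
        have "(*) (mono_poly (a i)) \<odot>\<^bsub>M\<^esub> y = P' \<odot>\<^bsub>M\<^esub> g i"
          unfolding y_def g_def by (rule M.op_comm) (use P P' m in \<open>auto intro: eu_D D_ops_mult\<close>)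
        also have "\<dots> = \<zero>\<^bsub>M\<^esub>"
          by (rule specD[OF conjunct2[OF C[OF i]] P'(1)]) (use P i in \<open>auto simp: B_def\<close>)
        finally show ?thesis .
      qed
      obtain D where D: "finite D" "spec ?A D y" using WA yA by (auto simp: weight_module_def)
      \<comment> \<open>Every weight component \<open>e y\<close> of \<open>y\<close> is killed by a power of a variable that is injective on it.\<close>
      have "y = \<zero>\<^bsub>?A\<^esub>"
      proof (rule A.spec_zeroI[OF D])
        fix e and \<psi> :: "('n \<Rightarrow> int) \<Rightarrow> 'k" and w assume e: "eu e \<psi>" and ew: "e \<odot>\<^bsub>?A\<^esub> y \<in> deg_part ?A w"
        show "e \<odot>\<^bsub>?A\<^esub> y = \<zero>\<^bsub>?A\<^esub>"
        proof (rule ccontr)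
          assume ne: "e \<odot>\<^bsub>?A\<^esub> y \<noteq> \<zero>\<^bsub>?A\<^esub>"
          then have "int (card (negs w)) < int (card (negs b))" using BA ew cb by (force simp: weights_in_def)
          then have "\<not> negs b \<subseteq> negs w" using card_mono[of "negs w" "negs b"] by auto
          then obtain i where "i \<in> negs b" "i \<notin> negs w" by blast
          then have i: "i \<in> negs b" "0 \<le> w i" by (auto simp: negs_def)
          obtain e' where e': "eu e' (\<lambda>b. \<psi> (wsub b (a i)))" "\<And>f. mono_poly (a i) * e f = e' (mono_poly (a i) * f)"
            using eu_shift[OF e] by blast
          have "(*) (mono_poly (a i)) \<odot>\<^bsub>M\<^esub> (e \<odot>\<^bsub>M\<^esub> y) = e' \<odot>\<^bsub>M\<^esub> ((*) (mono_poly (a i)) \<odot>\<^bsub>M\<^esub> y)"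
            by (rule M.op_comm) (use e e' yc in \<open>auto intro: eu_D D_ops_mult\<close>)
          then have "(*) (mono_poly (a i)) \<odot>\<^bsub>?A\<^esub> (e \<odot>\<^bsub>?A\<^esub> y) = \<zero>\<^bsub>?A\<^esub>"
            using xy[OF i(1)] M.smult_zero[OF eu_D[OF e'(1)]] by simp
          then show False using A.var_power_inj[OF IA i(2) ew, of "nat (- b i)"] ne by (simp add: a_def)
        qed
      qed
      then show "P \<odot>\<^bsub>M\<^esub> m = \<zero>\<^bsub>M\<^esub>" by (simp add: y_def)
    qed
    moreover have "finite B" using C by (auto simp: B_def)
    ultimately show ?thesis by blast
  qed
  have "\<exists>B. finite B \<and> spec M B m" if m: "m \<in> carrier M" for m
  proof -
    obtain B where "finite B" "spec Y B (q m)" using Y(1) qa[OF m] by (auto simp: weight_module_def)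
    note B = this
    have "\<forall>m'\<in>carrier M. q m' = q m \<longrightarrow> (\<exists>B. finite B \<and> spec M B m')"
      using B
    proof (induction rule: Y.spec_induct)
      case zero
      show ?case using fromA by (auto simp: A(1))
    next
      case (weight b v)
      then show ?case using lift by blast
    next
      case (add v v')
      show ?case
      proof (intro ballI impI)
        fix m' assume m': "m' \<in> carrier M" "q m' = v \<oplus>\<^bsub>Y\<^esub> v'"
        have "v \<in> q ` carrier M" using q(2) add(1) by simp
        then obtain m1 where m1: "m1 \<in> carrier M" "q m1 = v" by auto
        have "q (m' \<ominus>\<^bsub>M\<^esub> m1) = (v \<oplus>\<^bsub>Y\<^esub> v') \<ominus>\<^bsub>Y\<^esub> v"
          using mod_hom_diff[OF M.left_module_axioms Y.left_module_axioms q(1) m'(1) m1(1)] m'(2) m1(2) by simp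
        also have "\<dots> = v'" using add(1,2) by (simp add: Y.M.minus_eq Y.M.a_ac Y.M.r_neg)
        finally have "\<exists>B. finite B \<and> spec M B (m' \<ominus>\<^bsub>M\<^esub> m1)"
          using bspec[OF add(4) M.M.minus_closed[OF m'(1) m1(1)]] by simp
        moreover have "\<exists>B. finite B \<and> spec M B m1" using bspec[OF add(3) m1(1)] m1(2) by simp
        ultimately obtain B1 B2 where "finite B1" "spec M B1 m1" "finite B2" "spec M B2 (m' \<ominus>\<^bsub>M\<^esub> m1)" by auto
        moreover have "m1 \<oplus>\<^bsub>M\<^esub> (m' \<ominus>\<^bsub>M\<^esub> m1) = m'" using m1 m' by (simp add: M.M.minus_eq M.M.a_ac M.M.r_neg)
        ultimately show "\<exists>B. finite B \<and> spec M B m'" using M.spec_add by (metis finite_UnI)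
      qed
    qed
    then show ?thesis using m by blast
  qed
  then show ?thesis
    using M.left_module_axioms weights inj var
    by (simp add: level_def weight_module_def var_injective_def var_zero_def weights_in_def)
qed

lemma level_zero:
  assumes "left_module D_ring M" shows "level (M\<lparr>carrier := {\<zero>\<^bsub>M\<^esub>}\<rparr>) (- 1)"
proof -
  interpret left_module D_ring M by fact
  have s: "submodule {\<zero>\<^bsub>M\<^esub>} D_ring M" by (rule submodule_by_closure) auto
  interpret Z: D_module "M\<lparr>carrier := {\<zero>\<^bsub>M\<^esub>}\<rparr>" by (rule D_moduleI[OF left_module_submodule[OF s]])
  have "weight_module (M\<lparr>carrier := {\<zero>\<^bsub>M\<^esub>}\<rparr>)"
    unfolding weight_module_def using Z.left_module_axioms Z.spec_zero by auto
  then show ?thesis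
    by (auto simp: level_def var_injective_def var_zero_def weights_in_def partial_D dest: deg_part_carrier)
qed

lemma variation_zero_straight_type:
  fixes M :: "('k::field, 'n::{finite,linorder}, 'm) dmodule"
  assumes "variation_zero M" shows "straight_type M"
proof -
  obtain F :: "int \<Rightarrow> 'm set" and mu :: "'n set \<Rightarrow> nat" where
    M: "left_module D_ring M" and F0: "F (- 1) = {\<zero>\<^bsub>M\<^esub>}" and Fn: "F (int CARD('n)) = carrier M"
    and F: "\<And>j. j \<in> {0..int CARD('n)} \<Longrightarrow> submodule (F j) D_ring M \<and> F (j - 1) \<subseteq> F j \<and>
           isomorphic_mod D_ring (quot_mod (M\<lparr>carrier := F j\<rparr>) (F (j - 1)))
             (dsum {(\<alpha>, t). int (card \<alpha>) = j \<and> t < mu \<alpha>}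
                (\<lambda>(\<alpha>, t). local_coh (R_mod :: ('k, 'n, ('k, 'n) mpoly) dmodule) \<alpha> (card \<alpha>)))"
    using assms unfolding variation_zero_def by blast
  interpret M: left_module D_ring M by fact
  \<comment> \<open>The induction is over \<open>k = j + 1\<close>, so that it starts at \<open>F\<^sub>-\<^sub>1\<close>.\<close>
  have lev: "int k \<le> int CARD('n) + 1 \<Longrightarrow> submodule (F (int k - 1)) D_ring M \<and> level (M\<lparr>carrier := F (int k - 1)\<rparr>) (int k - 1)" for k
  proof (induction k)
    case 0
    have "submodule {\<zero>\<^bsub>M\<^esub>} D_ring M" by (rule M.submodule_by_closure) auto
    then show ?case using level_zero[OF M] F0 by simp
  next
    case (Suc k)
    define j where "j = int k"
    let ?I = "{(\<alpha> :: 'n set, t). int (card \<alpha>) = j \<and> t < mu \<alpha>}"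
    let ?Y = "dsum ?I (\<lambda>(\<alpha>, t). local_coh (R_mod :: ('k, 'n, ('k, 'n) mpoly) dmodule) \<alpha> (card \<alpha>))"
    have jr: "j \<in> {0..int CARD('n)}" using Suc by (simp add: j_def)
    have sub: "submodule (F j) D_ring M" "F (j - 1) \<subseteq> F j" using F[OF jr] by auto
    have prev: "submodule (F (j - 1)) D_ring M" "level (M\<lparr>carrier := F (j - 1)\<rparr>) (j - 1)" using Suc by (auto simp: j_def)
    let ?M = "M\<lparr>carrier := F j\<rparr>"
    interpret Fj: left_module D_ring ?M by (rule M.left_module_submodule[OF sub(1)])
    have s': "submodule (F (j - 1)) D_ring ?M" by (rule submodule_restrict[OF M prev(1) sub])
    obtain \<psi> where \<psi>: "\<psi> \<in> mod_hom D_ring (quot_mod ?M (F (j - 1))) ?Y" "bij_betw \<psi> (carrier (quot_mod ?M (F (j - 1)))) (carrier ?Y)"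
      using F[OF jr] by (auto simp: isomorphic_mod_def mod_iso_def)
    have "finite ?I"
      by (rule finite_subset[of _ "SIGMA \<alpha>:UNIV. {..<mu \<alpha>}"]) auto
    then have Y: "weight_module ?Y"
      by (rule weight_module_dsum) (auto intro: weight_module_local_coh[OF weight_module_R_mod])
    define q where "q x = \<psi> (F (j - 1) +>\<^bsub>?M\<^esub> x)" for x
    have q: "q \<in> mod_hom D_ring ?M ?Y" unfolding q_def by (rule mod_hom_compose[OF Fj.coset_hom[OF s'] \<psi>(1)])
    have "level ?M j"
    proof (rule level_extension[OF D_moduleI[OF Fj.left_module_axioms] q _ Y])
      show "q ` carrier ?M = carrier ?Y"
        using \<psi>(2) unfolding q_def bij_betw_def Fj.quot_mod_carrier by (simp add: image_image)
      show "var_injective ?Y"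
        by (rule var_injective_dsum) (auto intro: local_coh_top)
      show "weights_in ?Y {S. int (card S) = j}"
        by (rule weights_in_dsum) (use local_coh_top(1) in \<open>fastforce simp: weights_in_def\<close>)
      have "x \<in> F (j - 1) \<longleftrightarrow> q x = \<zero>\<^bsub>?Y\<^esub>" if x: "x \<in> F j" for x
      proof -
        interpret Q: left_module D_ring "quot_mod ?M (F (j - 1))" by (rule Fj.left_module_quot[OF s'])
        have z: "\<psi> \<zero>\<^bsub>quot_mod ?M (F (j - 1))\<^esub> = \<zero>\<^bsub>?Y\<^esub>"
          by (rule mod_hom_zero[OF Q.left_module_axioms _ \<psi>(1)]) (use Y in \<open>simp add: weight_module_def\<close>)
        have "q x = \<zero>\<^bsub>?Y\<^esub> \<longleftrightarrow> F (j - 1) +>\<^bsub>?M\<^esub> x = \<zero>\<^bsub>quot_mod ?M (F (j - 1))\<^esub>"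
          unfolding q_def z[symmetric]
          by (rule inj_on_eq_iff[OF bij_betw_imp_inj_on[OF \<psi>(2)]]) (use x submodule_zero[OF sub(1)] in \<open>auto simp: Fj.quot_mod_carrier Fj.quot_mod_zero[OF s']\<close>)
        then show ?thesis using Fj.coset_zero_iff[OF s'] x by simp
      qed
      then show "F (j - 1) = {x \<in> carrier ?M. q x = \<zero>\<^bsub>?Y\<^esub>}" using sub(2) by auto
      show "level (?M\<lparr>carrier := F (j - 1)\<rparr>) (j - 1)" using prev(2) by simp
    qed
    then show ?case using sub(1) by (simp add: j_def)
  qed
  from lev[of "Suc CARD('n)"] have "level (M\<lparr>carrier := carrier M\<rparr>) (int CARD('n))" by (simp add: Fn)
  then show ?thesis by (auto simp: level_def straight_type_def)
qed

section \<open>The vector spaces of the hypercube\<close>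

lemma cube_vs_simps:
  "\<zero>\<^bsub>cube_vs M \<alpha>\<^esub> = (\<lambda>m\<in>carrier M. \<zero>\<^bsub>E_mod \<alpha>\<^esub>)"
  "f \<oplus>\<^bsub>cube_vs M \<alpha>\<^esub> g = (\<lambda>m\<in>carrier M. f m \<oplus>\<^bsub>E_mod \<alpha>\<^esub> g m)"
  "c \<odot>\<^bsub>cube_vs M \<alpha>\<^esub> f = (\<lambda>m\<in>carrier M. (*) (const_poly c) \<odot>\<^bsub>E_mod \<alpha>\<^esub> f m)"
  by (simp_all add: cube_vs_def)

lemma (in D_module) graded_R_hom_restrict:
  assumes f: "f \<in> graded_R_hom M N" shows "restrict f (carrier M) \<in> graded_R_hom M N"
  by (rule graded_R_homI)
     (use graded_R_homD[OF f] deg_part_carrier[of _ M] in auto)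

lemma graded_R_hom_add:
  assumes N: "D_module N" and f: "f \<in> graded_R_hom M N" and g: "g \<in> graded_R_hom M N"
  shows "(\<lambda>m. f m \<oplus>\<^bsub>N\<^esub> g m) \<in> graded_R_hom M N"
proof -
  interpret N: D_module N by (rule N)
  note fD = graded_R_homD[OF f] and gD = graded_R_homD[OF g]
  show ?thesis
    by (rule graded_R_homI)
       (simp_all add: fD gD N.M.a_ac N.smult_r_distr D_ops_mult N.deg_part_add)
qed

lemma left_module_cube_vs:
  fixes M :: "('k::field, 'n::{finite,linorder}, 'm) dmodule"
  assumes S: "straight_type M"
  shows "left_module (ring_of_type_algebra :: 'k ring) (cube_vs M \<alpha>)"
proof -
  interpret M: D_module M by (rule straight_typeD(2)[OF S])
  note C = cube_vs_carrier[OF S, of \<alpha>]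
  have fc [simp]: "f m \<in> carrier (E_mod \<alpha>)" if "f \<in> carrier (cube_vs M \<alpha>)" "m \<in> carrier M" for f m
    using that graded_R_homD(1)[of f] by (auto simp: C)
  have gr: "f \<in> graded_R_hom M (E_mod \<alpha>)" if "f \<in> carrier (cube_vs M \<alpha>)" for f
    using that by (simp add: C)
  have ex: "f \<in> extensional (carrier M)" if "f \<in> carrier (cube_vs M \<alpha>)" for f
    using that by (simp add: C)
  have mk: "restrict f (carrier M) \<in> carrier (cube_vs M \<alpha>)" if "f \<in> graded_R_hom M (E_mod \<alpha>)" for f
    using M.graded_R_hom_restrict[OF that] by (simp add: C)
  show ?thesis
  proof (rule left_moduleI)
    show "ring (ring_of_type_algebra :: 'k ring)" by blast
  next
    fix f g assume "f \<in> carrier (cube_vs M \<alpha>)" "g \<in> carrier (cube_vs M \<alpha>)"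
    then show "f \<oplus>\<^bsub>cube_vs M \<alpha>\<^esub> g \<in> carrier (cube_vs M \<alpha>)"
      unfolding cube_vs_simps by (intro mk graded_R_hom_add D_module_E gr)
  next
    have "(\<lambda>_. \<zero>\<^bsub>E_mod \<alpha>\<^esub>) \<in> graded_R_hom M (E_mod \<alpha> :: ('k, 'n, _) dmodule)"
      by (rule graded_R_homI) (simp_all add: EM.deg_part_zero D_ops_mult)
    then show "\<zero>\<^bsub>cube_vs M \<alpha>\<^esub> \<in> carrier (cube_vs M \<alpha>)"
      unfolding cube_vs_simps by (rule mk)
  next
    fix f assume f: "f \<in> carrier (cube_vs M \<alpha>)"
    show "\<zero>\<^bsub>cube_vs M \<alpha>\<^esub> \<oplus>\<^bsub>cube_vs M \<alpha>\<^esub> f = f"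
      by (rule extensionalityI[of _ "carrier M"]) (use f ex in \<open>auto simp: cube_vs_simps\<close>)
    show "\<zero>\<^bsub>ring_of_type_algebra\<^esub> \<odot>\<^bsub>cube_vs M \<alpha>\<^esub> f = \<zero>\<^bsub>cube_vs M \<alpha>\<^esub>"
      unfolding cube_vs_simps by (rule restrict_ext) (use f in \<open>simp add: const_poly_simps\<close>)
    show "\<one>\<^bsub>ring_of_type_algebra\<^esub> \<odot>\<^bsub>cube_vs M \<alpha>\<^esub> f = f"
      by (rule extensionalityI[of _ "carrier M"]) (use f ex in \<open>auto simp: cube_vs_simps const_poly_simps\<close>)
  next
    fix f and c :: 'k assume f: "f \<in> carrier (cube_vs M \<alpha>)"
    show "c \<odot>\<^bsub>cube_vs M \<alpha>\<^esub> f \<in> carrier (cube_vs M \<alpha>)"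
      unfolding cube_vs_simps
      by (rule mk) (rule graded_R_hom_compose[OF gr[OF f] mod_hom_graded[OF D_module_E EM.const_hom]])
  qed (simp_all add: cube_vs_simps EM.M.a_ac EM.const_plus EM.const_mult_mult EM.smult_r_distr D_ops_mult cong: restrict_cong)
qed

lemma straight_type_cech: "straight_type M \<Longrightarrow> straight_type (cech_mod M \<alpha> p)"
  by (simp add: straight_type_def weight_module_cech var_zero_cech)

lemma straight_type_local_coh: "straight_type M \<Longrightarrow> straight_type (local_coh M \<alpha> p)"
  by (simp add: straight_type_def weight_module_local_coh var_zero_local_coh)

lemma residue_add: "C \<in> carrier (E_mod UNIV) \<Longrightarrow> C' \<in> carrier (E_mod UNIV) \<Longrightarrow>
    residue (C \<oplus>\<^bsub>E_mod UNIV\<^esub> C') = residue C + residue C'"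
  by (simp add: residue_def ecoeff_add)

lemma residue_const: "C \<in> carrier (E_mod UNIV) \<Longrightarrow> residue ((*) (const_poly c) \<odot>\<^bsub>E_mod UNIV\<^esub> C) = c * residue C"
  by (simp add: residue_def ecoeff_const)

lemma cube_vs_residue_eqI:
  assumes S: "straight_type N" and "g \<in> carrier (cube_vs N UNIV)" "h \<in> carrier (cube_vs N UNIV)"
    and "\<And>n. n \<in> carrier N \<Longrightarrow> residue (g n) = residue (h n)"
  shows "g = h"
  by (rule extensionalityI[of _ "carrier N"])
     (use assms residue_determined[OF straight_typeD(2)[OF S], of g h] in \<open>auto simp: cube_vs_carrier[OF S]\<close>)

lemma cube_vs_residue_exists:
  assumes S: "straight_type N" and "functional N \<mu>"
  shows "\<exists>g\<in>carrier (cube_vs N UNIV). \<forall>n\<in>carrier N. residue (g n) = \<mu> n"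
  using residue_exists[OF straight_typeD(1)[OF S] assms(2)] by (simp add: cube_vs_carrier[OF S])

lemma cube_vs_app: "straight_type N \<Longrightarrow> g \<in> carrier (cube_vs N \<alpha>) \<Longrightarrow> n \<in> carrier N \<Longrightarrow> g n \<in> carrier (E_mod \<alpha>)"
  using graded_R_homD(1)[of g] by (auto simp: cube_vs_carrier)

lemma cube_vs_zero_app:
  "straight_type N \<Longrightarrow> g \<in> carrier (cube_vs N \<alpha>) \<Longrightarrow> g \<zero>\<^bsub>N\<^esub> = \<zero>\<^bsub>E_mod \<alpha>\<^esub>"
  using graded_R_hom_zero[OF straight_typeD(2) D_module_E, of N g] by (auto simp: cube_vs_carrier)

lemma functionalD:
  assumes "functional M \<mu>"
  shows "x \<in> carrier M \<Longrightarrow> y \<in> carrier M \<Longrightarrow> \<mu> (x \<oplus>\<^bsub>M\<^esub> y) = \<mu> x + \<mu> y"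
    and "x \<in> carrier M \<Longrightarrow> \<mu> ((*) (const_poly c) \<odot>\<^bsub>M\<^esub> x) = c * \<mu> x"
    and "m \<in> deg_part M b \<Longrightarrow> b \<noteq> (\<lambda>_. - 1) \<Longrightarrow> \<mu> m = 0"
  using assms unfolding functional_def by auto

lemma functionalI:
  assumes "\<And>x y. x \<in> carrier M \<Longrightarrow> y \<in> carrier M \<Longrightarrow> \<mu> (x \<oplus>\<^bsub>M\<^esub> y) = \<mu> x + \<mu> y"
    and "\<And>c x. x \<in> carrier M \<Longrightarrow> \<mu> ((*) (const_poly c) \<odot>\<^bsub>M\<^esub> x) = c * \<mu> x"
    and "\<And>b m. m \<in> deg_part M b \<Longrightarrow> b \<noteq> (\<lambda>_. - 1) \<Longrightarrow> \<mu> m = 0"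
  shows "functional M \<mu>"
  using assms unfolding functional_def by auto

lemma (in D_module) functional_zero: "functional M \<mu> \<Longrightarrow> \<mu> \<zero> = 0"
  using functionalD(2)[of M \<mu> \<zero> 0] by (simp add: const_poly_simps)

lemma functional_compose:
  assumes M: "D_module M" and f: "f \<in> mod_hom D_ring M N" and \<mu>: "functional N \<mu>"
  shows "functional M (\<lambda>x. \<mu> (f x))"
proof -
  interpret M: D_module M by (rule M)
  show ?thesis
    by (rule functionalI)
       (simp_all add: mod_homD[OF f] functionalD[OF \<mu>] D_ops_mult functionalD(3)[OF \<mu> M.mod_hom_weight[OF f]])
qed

text \<open>
  Weight vectors lift to weight vectors, so the induced functional still vanishes on the weights other than \<open>-\<one>\<close>.
\<close>

lemma functional_factor:
  assumes W: "weight_module N" and N': "D_module N'" and f: "f \<in> mod_hom D_ring N N'"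
    and s: "f ` carrier N = carrier N'" and \<kappa>: "functional N \<kappa>"
    and k: "\<And>x. x \<in> carrier N \<Longrightarrow> f x = \<zero>\<^bsub>N'\<^esub> \<Longrightarrow> \<kappa> x = 0"
  shows "\<exists>\<mu>. functional N' \<mu> \<and> (\<forall>x\<in>carrier N. \<mu> (f x) = \<kappa> x)"
proof -
  interpret N: D_module N by (rule weight_moduleD[OF W])
  interpret N': D_module N' by (rule N')
  note fD = mod_homD[OF f] and kD = functionalD[OF \<kappa>]
  define \<mu> where "\<mu> y = \<kappa> (SOME x. x \<in> carrier N \<and> f x = y)" for y
  have \<mu>: "\<mu> (f x) = \<kappa> x" if x: "x \<in> carrier N" for x
  proof -
    define z where "z = (SOME z. z \<in> carrier N \<and> f z = f x)"
    have z: "z \<in> carrier N" "f z = f x" unfolding z_def using x by (metis (mono_tags, lifting) someI_ex)+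
    have "f (z \<ominus>\<^bsub>N\<^esub> x) = \<zero>\<^bsub>N'\<^esub>"
      using mod_hom_diff[OF N.left_module_axioms N'.left_module_axioms f z(1) x] z(2) fD(1)[OF x]
      by (simp add: N'.M.diff_eq_zero_iff)
    then have "\<kappa> (z \<ominus>\<^bsub>N\<^esub> x) = 0" using k z(1) x by simp
    moreover have "z = (z \<ominus>\<^bsub>N\<^esub> x) \<oplus>\<^bsub>N\<^esub> x" using z(1) x by (simp add: N.M.minus_eq N.M.a_assoc N.M.l_neg)
    ultimately have "\<kappa> z = \<kappa> x" using kD(1)[of "z \<ominus>\<^bsub>N\<^esub> x" x] z(1) x by simp
    then show ?thesis by (simp add: \<mu>_def z_def)
  qed
  have "functional N' \<mu>"
  proof (rule functionalI)
    fix y y' assume "y \<in> carrier N'" "y' \<in> carrier N'"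
    then obtain x x' where "x \<in> carrier N" "x' \<in> carrier N" "y = f x" "y' = f x'" using s by blast
    then show "\<mu> (y \<oplus>\<^bsub>N'\<^esub> y') = \<mu> y + \<mu> y'" using \<mu> fD(2) kD(1) by (metis N.M.a_closed)
  next
    fix c y assume "y \<in> carrier N'"
    then obtain x where "x \<in> carrier N" "y = f x" using s by blast
    then show "\<mu> ((*) (const_poly c) \<odot>\<^bsub>N'\<^esub> y) = c * \<mu> y"
      using \<mu> fD(3)[OF D_ops_mult] kD(2) by (metis N.rmul_closed)
  next
    fix b y assume y: "y \<in> deg_part N' b" and b: "b \<noteq> (\<lambda>_. - 1)"
    obtain x where x: "x \<in> carrier N" "y = f x" using s deg_part_carrier[OF y] by blast
    then obtain m where "m \<in> deg_part N b" "f m = y" using weight_lift[OF W N' f x(1)] y by blast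
    then show "\<mu> y = 0" using \<mu> kD(3)[OF _ b] deg_part_carrier by metis
  qed
  with \<mu> show ?thesis by blast
qed

section \<open>Duality for localizations\<close>

text \<open>
  The pairing of \<open>[M]\<close> at the complement of \<open>\<beta>\<close> with \<open>M[1/x\<^sup>\<beta>]\<close>: the fraction \<open>m / x\<^sup>L\<^sup>\<beta>\<close> is
  paired with \<open>f\<close> to the coefficient of \<open>f m\<close> in the degree of \<open>x\<^sup>L\<^sup>\<beta> / x\<^sup>\<one>\<close>, the residue of
  \<open>f m / x\<^sup>L\<^sup>\<beta>\<close> so to speak.
\<close>

definition pairing :: "('k::field, 'n::{finite,linorder}, 'm) dmodule \<Rightarrow> 'n set \<Rightarrow>
    ('m \<Rightarrow> ('k, 'n) laurent set) \<Rightarrow> ('m \<times> ('k, 'n) mpoly) set \<Rightarrow> 'k" where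
  "pairing M \<beta> f x = (THE c. \<exists>m L. m \<in> carrier M \<and> x = lfr M \<beta> m L \<and> c = ecoeff (- \<beta>) (f m) (wvec \<beta> L))"

lemma wvec_eq: "wvec \<beta> L = wadd (\<lambda>_. - 1) (vexp \<beta> L)"
  by (auto simp: wvec_def wadd_def lookup_vexp)

lemma compatible_fr:
  assumes M: "D_module M" and \<tau>: "compatible M \<beta> \<tau>"
    and m: "m \<in> carrier M" "m' \<in> carrier M" "lfr M \<beta> m L = lfr M \<beta> m' L'"
  shows "\<tau> L m = \<tau> L' m'"
proof -
  interpret Q: mono_localization M \<beta> by (rule mono_localizationI[OF M])
  obtain K where K: "(*) (xmon \<beta> ^ (K + L')) \<odot>\<^bsub>M\<^esub> m = (*) (xmon \<beta> ^ (K + L)) \<odot>\<^bsub>M\<^esub> m'"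
    using m Q.fr_eq_iff by blast
  have sh: "\<tau> (A + B) ((*) (xmon \<beta> ^ B) \<odot>\<^bsub>M\<^esub> x) = \<tau> A x" if "x \<in> carrier M" for A B x
    using \<tau> that unfolding compatible_def xmon_power by blast
  have "\<tau> L m = \<tau> (L + (K + L')) ((*) (xmon \<beta> ^ (K + L')) \<odot>\<^bsub>M\<^esub> m)" using sh[OF m(1)] by simp
  also have "\<dots> = \<tau> (L' + (K + L)) ((*) (xmon \<beta> ^ (K + L)) \<odot>\<^bsub>M\<^esub> m')" using K by (simp add: ac_simps)
  also have "\<dots> = \<tau> L' m'" by (rule sh[OF m(2)])
  finally show ?thesis .
qed

lemma pairing_fr:
  assumes M: "D_module M" and f: "f \<in> graded_R_hom M (E_mod (- \<beta>))" and m: "m \<in> carrier M"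
  shows "pairing M \<beta> f (lfr M \<beta> m L) = ecoeff (- \<beta>) (f m) (wvec \<beta> L)"
  unfolding pairing_def
  by (rule the_equality) (use m compatible_fr[OF M graded_compatible[OF f]] in blast)+

text \<open>
  The fraction \<open>m / x\<^sup>L\<^sup>\<beta>\<close> has weight \<open>-\<one>\<close> exactly if \<open>m\<close> has the weight at which the coefficient of \<open>f(m)\<close> is taken.
\<close>

lemma pairing_functional:
  assumes W: "weight_module M" and f: "f \<in> graded_R_hom M (E_mod (- \<beta>))"
  shows "functional (loc_at M \<beta>) (pairing M \<beta> f)"
proof -
  have M: "D_module M" by (rule weight_moduleD[OF W])
  interpret Q: mono_localization M \<beta> by (rule mono_localizationI[OF M])
  note p = pairing_fr[OF M f] and fD = graded_R_homD[OF f]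
  show ?thesis
    unfolding loc_at_def
  proof (rule functionalI)
    fix x y assume "x \<in> carrier Q.N" "y \<in> carrier Q.N"
    then obtain m m' L where "m \<in> carrier M" "m' \<in> carrier M" "x = Q.fr m L" "y = Q.fr m' L"
      using Q.loc_cases3[of x y y] by metis
    then show "pairing M \<beta> f (x \<oplus>\<^bsub>Q.N\<^esub> y) = pairing M \<beta> f x + pairing M \<beta> f y"
      by (simp add: Q.loc_add_same p fD ecoeff_add)
  next
    fix c x assume "x \<in> carrier Q.N"
    then obtain m L where "m \<in> carrier M" "x = Q.fr m L" using Q.loc_cases by metis
    then show "pairing M \<beta> f ((*) (const_poly c) \<odot>\<^bsub>Q.N\<^esub> x) = c * pairing M \<beta> f x"
      by (simp add: Q.loc_rmul p fD ecoeff_const)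
  next
    fix b x assume x: "x \<in> deg_part Q.N b" and b: "b \<noteq> (\<lambda>_. - 1)"
    obtain m L where m: "m \<in> deg_part M (wadd b (vexp \<beta> L))" "x = Q.fr m L"
      using Q.loc_weight_lift[OF W x] by blast
    have "wadd b (vexp \<beta> L) \<noteq> wvec \<beta> L" unfolding wvec_eq using b by (metis wadd_wsub(2))
    then show "pairing M \<beta> f x = 0"
      using m fD(4)[OF m(1)] p[OF deg_part_carrier[OF m(1)]] by (simp add: E_weight_iff)
  qed
qed

lemma functional_localization_compatible:
  assumes M: "D_module M" and \<mu>: "functional (loc_at M \<beta>) \<mu>"
  shows "compatible M \<beta> (\<lambda>L m. \<mu> (lfr M \<beta> m L))"
proof -
  interpret Q: mono_localization M \<beta> by (rule mono_localizationI[OF M])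
  note \<mu>D = functionalD[OF \<mu>[unfolded loc_at_def]]
  show ?thesis
    unfolding compatible_def
  proof (intro allI conjI ballI impI)
    fix L x y assume "x \<in> carrier M" "y \<in> carrier M"
    then show "\<mu> (Q.fr (x \<oplus>\<^bsub>M\<^esub> y) L) = \<mu> (Q.fr x L) + \<mu> (Q.fr y L)"
      by (simp add: \<mu>D flip: Q.loc_add_same)
  next
    fix L c x assume "x \<in> carrier M"
    then show "\<mu> (Q.fr ((*) (const_poly c) \<odot>\<^bsub>M\<^esub> x) L) = c * \<mu> (Q.fr x L)"
      by (simp add: \<mu>D flip: Q.loc_rmul)
  next
    fix L K x assume "x \<in> carrier M"
    then show "\<mu> (Q.fr ((*) (mono_poly (vexp \<beta> K)) \<odot>\<^bsub>M\<^esub> x) (L + K)) = \<mu> (Q.fr x L)"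
      unfolding xmon_power[symmetric] by (simp add: Q.fr_expand)
  next
    fix L b m assume m: "m \<in> deg_part M b" and b: "b \<noteq> wvec \<beta> L"
    have "wsub b (vexp \<beta> L) \<noteq> (\<lambda>_. - 1)" using b unfolding wvec_eq by (metis wadd_wsub(1))
    then show "\<mu> (Q.fr m L) = 0" using \<mu>D(3)[OF Q.fr_weight[OF m]] by blast
  qed
qed

lemma E_epi_graded:
  assumes "\<alpha> \<subseteq> \<beta>"
  shows "E_epi \<beta> \<in> graded_R_hom (E_mod \<alpha>) (E_mod \<beta> :: ('k::field, 'n::{finite,linorder}, _) dmodule)"
proof (rule graded_R_homI)
  note c = E_epi_carrier[OF assms] and co = ecoeff_epi[OF assms]
  have sub: "b \<in> ncone \<alpha>" if "b \<in> ncone \<beta>" for b using that ncone_mono[OF assms] by blast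
  show "E_epi \<beta> C \<in> carrier (E_mod \<beta>)" if "C \<in> carrier (E_mod \<alpha> :: ('k, 'n, _) dmodule)" for C
    by (rule c[OF that])
  show add: "E_epi \<beta> (C \<oplus>\<^bsub>E_mod \<alpha>\<^esub> C') = E_epi \<beta> C \<oplus>\<^bsub>E_mod \<beta>\<^esub> E_epi \<beta> C'"
    if "C \<in> carrier (E_mod \<alpha> :: ('k, 'n, _) dmodule)" "C' \<in> carrier (E_mod \<alpha>)" for C C'
    by (rule ecoeff_eqI[of _ \<beta>]) (use that in \<open>simp_all add: c co ecoeff_add\<close>)
  show "E_epi \<beta> ((*) r \<odot>\<^bsub>E_mod \<alpha>\<^esub> C) = (*) r \<odot>\<^bsub>E_mod \<beta>\<^esub> E_epi \<beta> C"
    if "C \<in> carrier (E_mod \<alpha> :: ('k, 'n, _) dmodule)" for C and r :: "('k, 'n) mpoly"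
    using that
  proof (induction r arbitrary: C rule: mpoly_ring_induct)
    case (const a)
    show ?case by (rule ecoeff_eqI[of _ \<beta>]) (use const in \<open>simp_all add: c co ecoeff_const\<close>)
  next
    case (var i)
    have vp: "var_poly i = (mono_poly (vexp {i} 1) :: ('k, 'n) mpoly)"
      using xmon_eq[of "{i}"] by (simp add: xmon_def)
    show ?case
      by (rule ecoeff_eqI[of _ \<beta>])
         (use var in \<open>simp_all add: vp c co ecoeff_mono sub ncone_wsub\<close>)
  next
    case (add f g)
    then show ?case by (simp add: EM.rmul_add \<open>\<And>C C'. _ \<Longrightarrow> _ \<Longrightarrow> E_epi \<beta> (C \<oplus>\<^bsub>E_mod \<alpha>\<^esub> C') = _\<close> c)
  next
    case (mult f g)
    have "E_epi \<beta> ((*) (f * g) \<odot>\<^bsub>E_mod \<alpha>\<^esub> C) = E_epi \<beta> ((*) f \<odot>\<^bsub>E_mod \<alpha>\<^esub> ((*) g \<odot>\<^bsub>E_mod \<alpha>\<^esub> C))"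
      using mult.prems by (simp only: EM.rmul_rmul)
    also have "\<dots> = (*) f \<odot>\<^bsub>E_mod \<beta>\<^esub> ((*) g \<odot>\<^bsub>E_mod \<beta>\<^esub> E_epi \<beta> C)"
      using mult.prems by (simp add: mult.IH)
    also have "\<dots> = (*) (f * g) \<odot>\<^bsub>E_mod \<beta>\<^esub> E_epi \<beta> C"
      using c[OF mult.prems] by (simp only: EM.rmul_rmul)
    finally show ?case .
  qed
  show "E_epi \<beta> C \<in> deg_part (E_mod \<beta>) b" if "C \<in> deg_part (E_mod \<alpha> :: ('k, 'n, _) dmodule) b" for C b
    unfolding E_weight_iff
  proof (intro conjI allI impI)
    have C: "C \<in> carrier (E_mod \<alpha>)" by (rule deg_part_carrier[OF that])
    show "E_epi \<beta> C \<in> carrier (E_mod \<beta>)" by (rule c[OF C])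
    fix w assume "w \<noteq> b"
    then show "ecoeff \<beta> (E_epi \<beta> C) w = 0"
      using that co[OF C] by (cases "w \<in> ncone \<beta>") (auto simp: E_weight_iff ecoeff_outside)
  qed
qed

lemma cube_map_carrier:
  assumes S: "straight_type M" and f: "f \<in> carrier (cube_vs M \<alpha>)"
  shows "cube_map M \<alpha> i f \<in> carrier (cube_vs M (insert i \<alpha>))"
proof -
  interpret M: D_module M by (rule straight_typeD(2)[OF S])
  have "(\<lambda>x. E_epi (insert i \<alpha>) (f x)) \<in> graded_R_hom M (E_mod (insert i \<alpha>))"
    using f by (intro graded_R_hom_compose[OF _ E_epi_graded]) (auto simp: cube_vs_carrier[OF S])
  from M.graded_R_hom_restrict[OF this] show ?thesis
    by (simp add: cube_map_def compose_def cube_vs_carrier[OF S])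
qed

context
  fixes M :: "('k::field, 'n::{finite,linorder}, 'm) dmodule"
  assumes S: "straight_type M"
begin

interpretation M: D_module M by (rule straight_typeD(2)[OF S])

lemma cube_vs_graded: "f \<in> carrier (cube_vs M \<alpha>) \<Longrightarrow> f \<in> graded_R_hom M (E_mod \<alpha>)"
  by (simp add: cube_vs_carrier[OF S])

lemma loc_at_cases:
  assumes "x \<in> carrier (loc_at M \<beta>)" obtains m L where "m \<in> carrier M" "x = lfr M \<beta> m L"
proof -
  interpret Q: mono_localization M \<beta> by (rule mono_localizationI[OF M.D_module_axioms])
  from assms show thesis unfolding loc_at_def by (rule Q.loc_cases) (rule that)
qed

lemma pairing_simps:
  assumes "f \<in> carrier (cube_vs M (- \<beta>))" "g \<in> carrier (cube_vs M (- \<beta>))" "x \<in> carrier (loc_at M \<beta>)"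
  shows pairing_add: "pairing M \<beta> (f \<oplus>\<^bsub>cube_vs M (- \<beta>)\<^esub> g) x = pairing M \<beta> f x + pairing M \<beta> g x"
    and pairing_const: "pairing M \<beta> (c \<odot>\<^bsub>cube_vs M (- \<beta>)\<^esub> f) x = c * pairing M \<beta> f x"
proof -
  interpret V: left_module "ring_of_type_algebra :: 'k ring" "cube_vs M (- \<beta>)" by (rule left_module_cube_vs[OF S])
  obtain m L where x: "m \<in> carrier M" "x = lfr M \<beta> m L" using loc_at_cases[OF assms(3)] .
  note p = pairing_fr[OF M.D_module_axioms cube_vs_graded x(1)]
  have "f \<oplus>\<^bsub>cube_vs M (- \<beta>)\<^esub> g \<in> carrier (cube_vs M (- \<beta>))" "c \<odot>\<^bsub>cube_vs M (- \<beta>)\<^esub> f \<in> carrier (cube_vs M (- \<beta>))"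
    using assms V.smult_closed by simp_all
  then show "pairing M \<beta> (f \<oplus>\<^bsub>cube_vs M (- \<beta>)\<^esub> g) x = pairing M \<beta> f x + pairing M \<beta> g x"
      "pairing M \<beta> (c \<odot>\<^bsub>cube_vs M (- \<beta>)\<^esub> f) x = c * pairing M \<beta> f x"
    using assms x by (simp_all add: p) (simp_all add: cube_vs_simps ecoeff_add ecoeff_const cube_vs_app[OF S])
qed

lemma pairing_determined:
  assumes f: "f \<in> carrier (cube_vs M (- \<beta>))" and g: "g \<in> carrier (cube_vs M (- \<beta>))"
    and eq: "\<And>x. x \<in> carrier (loc_at M \<beta>) \<Longrightarrow> pairing M \<beta> f x = pairing M \<beta> g x"
  shows "f = g"
proof (rule extensionalityI[of _ "carrier M"])
  interpret Q: mono_localization M \<beta> by (rule mono_localizationI[OF M.D_module_axioms])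
  have "ecoeff (- \<beta>) (f m) (wvec \<beta> L) = ecoeff (- \<beta>) (g m) (wvec \<beta> L)" if m: "m \<in> carrier M" for L m
    using eq[of "Q.fr m L"] m pairing_fr[OF M.D_module_axioms cube_vs_graded[OF f] m] pairing_fr[OF M.D_module_axioms cube_vs_graded[OF g] m]
    by (simp add: loc_at_def)
  then show "f m = g m" if "m \<in> carrier M" for m
    using graded_determined[OF M.D_module_axioms cube_vs_graded[OF f] cube_vs_graded[OF g] _ that] by blast
qed (use f g in \<open>auto simp: cube_vs_carrier[OF S]\<close>)

lemma pairing_exists:
  assumes "functional (loc_at M \<beta>) \<mu>"
  shows "\<exists>f\<in>carrier (cube_vs M (- \<beta>)). \<forall>x\<in>carrier (loc_at M \<beta>). pairing M \<beta> f x = \<mu> x"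
proof -
  obtain f where f: "f \<in> carrier (cube_vs M (- \<beta>))"
      "\<And>m L. m \<in> carrier M \<Longrightarrow> ecoeff (- \<beta>) (f m) (wvec \<beta> L) = \<mu> (lfr M \<beta> m L)"
    using compatible_graded[OF straight_typeD(1)[OF S] functional_localization_compatible[OF M.D_module_axioms assms]]
    by (auto simp: cube_vs_carrier[OF S])
  have "pairing M \<beta> f x = \<mu> x" if "x \<in> carrier (loc_at M \<beta>)" for x
    using that by (rule loc_at_cases) (simp add: pairing_fr[OF M.D_module_axioms cube_vs_graded[OF f(1)]] f(2))
  with f(1) show ?thesis by blast
qed

text \<open>
  The maps of the hypercube are dual to the localization maps: if \<open>m / x\<^sup>L\<close> is rewritten with one
  more variable \<open>x\<^sub>i\<close> in the denominator, then \<open>m\<close> is multiplied by \<open>x\<^sub>i\<^sup>L\<close>, which moves the degree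
  in which \<open>f m\<close> is evaluated back to the previous one.
\<close>

lemma pairing_res:
  assumes i: "i \<in> \<delta>" and f: "f \<in> carrier (cube_vs M (- \<delta>))" and x: "x \<in> carrier (loc_at M (\<delta> - {i}))"
  shows "pairing M \<delta> f (res M \<delta> i x) = pairing M (\<delta> - {i}) (cube_map M (- \<delta>) i f) x"
proof -
  obtain m L where m: "m \<in> carrier M" "x = lfr M (\<delta> - {i}) m L" using loc_at_cases[OF x] .
  have vp: "var_poly i ^ L = mono_poly (vexp {i} L)" using xmon_power[of "{i}" L] by (simp add: xmon_def)
  have cm: "- (\<delta> - {i}) = insert i (- \<delta>)" using i by auto
  have w: "wsub (wvec \<delta> L) (vexp {i} L) = wvec (\<delta> - {i}) L"
    using i by (auto simp: wsub_def wvec_def lookup_vexp)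
  have fm: "f m \<in> carrier (E_mod (- \<delta>))" by (rule cube_vs_app[OF S f m(1)])
  have "pairing M \<delta> f (res M \<delta> i x) = ecoeff (- \<delta>) (f ((*) (var_poly i ^ L) \<odot>\<^bsub>M\<^esub> m)) (wvec \<delta> L)"
    using res_fr[OF M.D_module_axioms i m(1)] m pairing_fr[OF M.D_module_axioms cube_vs_graded[OF f]] by simp
  also have "\<dots> = ecoeff (- \<delta>) (f m) (wvec (\<delta> - {i}) L)"
    using graded_R_homD(3)[OF cube_vs_graded[OF f] m(1)] ecoeff_mono[OF fm wvec_ncone] by (simp add: vp w)
  also have "\<dots> = ecoeff (- (\<delta> - {i})) (cube_map M (- \<delta>) i f m) (wvec (\<delta> - {i}) L)"
    using ecoeff_epi[OF _ fm, of "insert i (- \<delta>)"] wvec_ncone[of "\<delta> - {i}" L] m(1)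
    by (simp add: cm cube_map_def compose_def subset_insertI)
  also have "\<dots> = pairing M (\<delta> - {i}) (cube_map M (- \<delta>) i f) x"
    using pairing_fr[OF M.D_module_axioms, of "cube_map M (- \<delta>) i f" "\<delta> - {i}"] m
      cube_vs_graded[OF cube_map_carrier[OF S f, of i]] by (simp add: cm)
  finally show ?thesis .
qed

end

subsection \<open>The sign twist\<close>

text \<open>
  The factor relating the pairings in the two complexes. The hypercube counts the predecessors of
  \<open>i\<close> outside \<open>\<beta>\<close>, the Cech complex those inside; together they are all elements below \<open>i\<close>,
  which is the number that the twist records.
\<close>

definition twist :: "'n::{finite,linorder} set \<Rightarrow> 'a::comm_ring_1" where
  "twist \<beta> = (\<Prod>i\<in>\<beta>. (- 1) ^ card {j. j < i})"

lemma twist_twist: "twist \<beta> * twist \<beta> = (1 :: 'a::comm_ring_1)"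
  by (simp add: twist_def flip: prod.distrib power_mult_distrib)

lemma twist_remove:
  fixes \<delta> :: "'n::{finite,linorder} set"
  assumes i: "i \<in> \<delta>"
  shows "twist (\<delta> - {i}) * cube_sign i (- (\<delta> - {i})) = (twist \<delta> * cube_sign i \<delta> :: 'a::comm_ring_1)"
proof -
  have "{j. j < i} = {j \<in> \<delta>. j < i} \<union> {j \<in> - (\<delta> - {i}). j < i}" by auto
  then have "card {j. j < i} = card ({j \<in> \<delta>. j < i} \<union> {j \<in> - (\<delta> - {i}). j < i})" by (rule arg_cong)
  also have "\<dots> = card {j \<in> \<delta>. j < i} + card {j \<in> - (\<delta> - {i}). j < i}"
    by (rule card_Un_disjoint) auto
  finally have "card {j. j < i} = card {j \<in> \<delta>. j < i} + card {j \<in> - (\<delta> - {i}). j < i}" .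
  moreover have "twist \<delta> = (- 1) ^ card {j. j < i} * (twist (\<delta> - {i}) :: 'a)"
    unfolding twist_def by (rule prod.remove[OF _ i]) simp
  moreover have "(- 1 :: 'a) ^ a * (- 1) ^ a = 1" for a by (simp flip: power_mult_distrib)
  ultimately show ?thesis by (simp add: cube_sign_def power_add ac_simps)
qed

section \<open>The two complexes as functionals on the Cech complex\<close>

lemma dsum_inclusion_hom:
  assumes M: "\<And>j. j \<in> I \<Longrightarrow> left_module A (M j)" and i: "i \<in> I"
  shows "(\<lambda>x. \<lambda>j\<in>I. if j = i then x else \<zero>\<^bsub>M j\<^esub>) \<in> mod_hom A (M i) (dsum I M)"
proof -
  have z: "\<zero>\<^bsub>M j\<^esub> \<in> carrier (M j)" "\<zero>\<^bsub>M j\<^esub> \<oplus>\<^bsub>M j\<^esub> \<zero>\<^bsub>M j\<^esub> = \<zero>\<^bsub>M j\<^esub>" if "j \<in> I" for j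
  proof -
    interpret left_module A "M j" by (rule M[OF that])
    show "\<zero>\<^bsub>M j\<^esub> \<in> carrier (M j)" "\<zero>\<^bsub>M j\<^esub> \<oplus>\<^bsub>M j\<^esub> \<zero>\<^bsub>M j\<^esub> = \<zero>\<^bsub>M j\<^esub>" by simp_all
  qed
  show ?thesis
    by (rule mod_homI)
       (auto simp: dsum_simps z left_module.smult_zero[OF M] intro!: restrict_ext)
qed

lemma compl_cube_idx: "\<beta> \<in> cech_idx UNIV p \<longleftrightarrow> - \<beta> \<in> cube_idx p"
  for \<beta> :: "'n::{finite,linorder} set"
proof -
  have "card \<beta> + card (- \<beta>) = CARD('n)"
    using card_Un_disjoint[of \<beta> "- \<beta>"] by (simp add: Compl_partition)
  then show ?thesis by (auto simp: cech_idx_def cube_idx_def)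
qed

lemma cube_idx_remove: "\<gamma> \<in> cube_idx p \<Longrightarrow> i \<in> \<gamma> \<Longrightarrow> \<gamma> - {i} \<in> cube_idx (Suc p)"
  for \<gamma> :: "'n::{finite,linorder} set"
  using card_Suc_Diff1[of \<gamma> i] by (simp add: cube_idx_def)

text \<open>
  Since \<open>[M]\<^sub>\<alpha>\<close> is dual to the localization at the complement of \<open>\<alpha>\<close>, a term of the hypercube complex is a
  functional on the corresponding term of the Cech complex.
\<close>

definition total_pairing :: "('k::field, 'n::{finite,linorder}, 'm) dmodule \<Rightarrow> nat \<Rightarrow>
    ('n set \<Rightarrow> 'm \<Rightarrow> ('k, 'n) laurent set) \<Rightarrow> ('n set \<Rightarrow> ('m \<times> ('k, 'n) mpoly) set) \<Rightarrow> 'k" where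
  "total_pairing M p F n = (\<Sum>\<beta>\<in>cech_idx UNIV p. twist \<beta> * pairing M \<beta> (F (- \<beta>)) (n \<beta>))"

context
  fixes M :: "('k::field, 'n::{finite,linorder}, 'm) dmodule"
  assumes S: "straight_type M"
begin

interpretation M: D_module M by (rule straight_typeD(2)[OF S])


lemma D_module_cech: "D_module (cech_mod M UNIV p)"
  by (rule D_moduleI[OF left_module_cech[OF M.D_module_axioms]])

lemma cech_app: "n \<in> carrier (cech_mod M UNIV p) \<Longrightarrow> \<beta> \<in> cech_idx UNIV p \<Longrightarrow> n \<beta> \<in> carrier (loc_at M \<beta>)"
  by (auto simp: cech_mod_def dsum_simps)

lemma cube_app: "F \<in> carrier (cube_cplx M p) \<Longrightarrow> \<beta> \<in> cech_idx UNIV p \<Longrightarrow> F (- \<beta>) \<in> carrier (cube_vs M (- \<beta>))"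
  by (auto simp: cube_cplx_def dsum_simps compl_cube_idx)

lemma left_module_cube_cplx: "left_module ring_of_type_algebra (cube_cplx M p)"
  unfolding cube_cplx_def by (rule left_module_dsum) (use left_module_cube_vs[OF S] in blast)+

lemma total_pairing_functional:
  assumes F: "F \<in> carrier (cube_cplx M p)" shows "functional (cech_mod M UNIV p) (total_pairing M p F)"
proof (rule functionalI)
  have P: "functional (loc_at M \<beta>) (pairing M \<beta> (F (- \<beta>)))" if "\<beta> \<in> cech_idx UNIV p" for \<beta>
    by (rule pairing_functional[OF straight_typeD(1)[OF S] cube_vs_graded[OF S cube_app[OF F that]]])
  show "total_pairing M p F (x \<oplus>\<^bsub>cech_mod M UNIV p\<^esub> y) = total_pairing M p F x + total_pairing M p F y"
    if "x \<in> carrier (cech_mod M UNIV p)" "y \<in> carrier (cech_mod M UNIV p)" for x y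
    unfolding total_pairing_def sum.distrib[symmetric]
    by (rule sum.cong) (use that in \<open>simp_all add: functionalD(1)[OF P] cech_app cech_mod_def[of M] dsum_simps distrib_left PiE_iff\<close>)
  show "total_pairing M p F ((*) (const_poly c) \<odot>\<^bsub>cech_mod M UNIV p\<^esub> x) = c * total_pairing M p F x"
    if "x \<in> carrier (cech_mod M UNIV p)" for c x
    unfolding total_pairing_def sum_distrib_left
    by (rule sum.cong) (use that in \<open>simp_all add: functionalD(2)[OF P] cech_mod_def[of M] dsum_simps PiE_iff\<close>)
  show "total_pairing M p F m = 0" if "m \<in> deg_part (cech_mod M UNIV p) b" "b \<noteq> (\<lambda>_. - 1)" for m b
    unfolding total_pairing_def
    by (rule sum.neutral) (use that functionalD(3)[OF P] in \<open>auto simp: cech_mod_def deg_part_dsum\<close>)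
qed

lemma total_pairing_linear:
  assumes F: "F \<in> carrier (cube_cplx M p)" and G: "G \<in> carrier (cube_cplx M p)" and n: "n \<in> carrier (cech_mod M UNIV p)"
  shows "total_pairing M p (F \<oplus>\<^bsub>cube_cplx M p\<^esub> G) n = total_pairing M p F n + total_pairing M p G n"
    and "total_pairing M p (c \<odot>\<^bsub>cube_cplx M p\<^esub> F) n = c * total_pairing M p F n"
proof -
  have *: "(F \<oplus>\<^bsub>cube_cplx M p\<^esub> G) (- \<beta>) = F (- \<beta>) \<oplus>\<^bsub>cube_vs M (- \<beta>)\<^esub> G (- \<beta>)"
      "(c \<odot>\<^bsub>cube_cplx M p\<^esub> F) (- \<beta>) = c \<odot>\<^bsub>cube_vs M (- \<beta>)\<^esub> F (- \<beta>)" if "\<beta> \<in> cech_idx UNIV p" for \<beta>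
    using that by (simp_all add: cube_cplx_def dsum_simps compl_cube_idx)
  show "total_pairing M p (F \<oplus>\<^bsub>cube_cplx M p\<^esub> G) n = total_pairing M p F n + total_pairing M p G n"
    unfolding total_pairing_def sum.distrib[symmetric]
    by (rule sum.cong) (simp_all add: * pairing_add[OF S cube_app[OF F] cube_app[OF G] cech_app[OF n]] distrib_left)
  show "total_pairing M p (c \<odot>\<^bsub>cube_cplx M p\<^esub> F) n = c * total_pairing M p F n"
    unfolding total_pairing_def sum_distrib_left
    by (rule sum.cong) (simp_all add: * pairing_const[OF S cube_app[OF F] cube_app[OF F] cech_app[OF n]])
qed

lemma inclusion_hom:
  "\<beta> \<in> cech_idx UNIV p \<Longrightarrow>
     (\<lambda>x. \<lambda>\<gamma>\<in>cech_idx UNIV p. if \<gamma> = \<beta> then x else \<zero>\<^bsub>loc_at M \<gamma>\<^esub>) \<in> mod_hom D_ring (loc_at M \<beta>) (cech_mod M UNIV p)"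
  unfolding cech_mod_def by (rule dsum_inclusion_hom) (rule left_module_loc_at[OF M.D_module_axioms])

lemma total_pairing_determined:
  assumes F: "F \<in> carrier (cube_cplx M p)" and G: "G \<in> carrier (cube_cplx M p)"
    and eq: "\<And>n. n \<in> carrier (cech_mod M UNIV p) \<Longrightarrow> total_pairing M p F n = total_pairing M p G n"
  shows "F = G"
proof -
  have val: "total_pairing M p H (\<lambda>\<gamma>\<in>cech_idx UNIV p. if \<gamma> = \<beta> then x else \<zero>\<^bsub>loc_at M \<gamma>\<^esub>) = twist \<beta> * pairing M \<beta> (H (- \<beta>)) x"
    if H: "H \<in> carrier (cube_cplx M p)" and \<beta>: "\<beta> \<in> cech_idx UNIV p" for H \<beta> x
  proof -
    have "pairing M \<gamma> (H (- \<gamma>)) \<zero>\<^bsub>loc_at M \<gamma>\<^esub> = 0" if "\<gamma> \<in> cech_idx UNIV p" for \<gamma>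
      by (rule D_module.functional_zero[OF D_module_loc_at[OF M.D_module_axioms]
            pairing_functional[OF straight_typeD(1)[OF S] cube_vs_graded[OF S cube_app[OF H that]]]])
    then have "total_pairing M p H (\<lambda>\<gamma>\<in>cech_idx UNIV p. if \<gamma> = \<beta> then x else \<zero>\<^bsub>loc_at M \<gamma>\<^esub>)
        = (\<Sum>\<gamma>\<in>cech_idx UNIV p. if \<gamma> = \<beta> then twist \<beta> * pairing M \<beta> (H (- \<beta>)) x else 0)"
      unfolding total_pairing_def by (intro sum.cong refl) auto
    then show ?thesis using \<beta> by simp
  qed
  have c: "F (- \<beta>) = G (- \<beta>)" if \<beta>: "\<beta> \<in> cech_idx UNIV p" for \<beta>
  proof (rule pairing_determined[OF S cube_app[OF F \<beta>] cube_app[OF G \<beta>]])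
    fix x assume "x \<in> carrier (loc_at M \<beta>)"
    then have t: "twist \<beta> * pairing M \<beta> (F (- \<beta>)) x = twist \<beta> * pairing M \<beta> (G (- \<beta>)) x"
      using eq[OF mod_homD(1)[OF inclusion_hom[OF \<beta>]]] val[OF F \<beta>] val[OF G \<beta>] by simp
    show "pairing M \<beta> (F (- \<beta>)) x = pairing M \<beta> (G (- \<beta>)) x"
      using arg_cong[OF t, of "\<lambda>c. twist \<beta> * c"] by (simp only: mult.assoc[symmetric] twist_twist mult_1)
  qed
  have "F \<gamma> = G \<gamma>" if "\<gamma> \<in> cube_idx p" for \<gamma>
    using c[of "- \<gamma>"] that by (simp add: compl_cube_idx)
  then show ?thesis
    using F G unfolding cube_cplx_def dsum_simps by (intro PiE_ext) auto
qed

text \<open>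
  The components of \<open>F\<close> represent the restrictions of \<open>\<mu>\<close> to the summands of the Cech complex.
\<close>

lemma total_pairing_exists:
  assumes \<mu>: "functional (cech_mod M UNIV p) \<mu>"
  shows "\<exists>F\<in>carrier (cube_cplx M p). \<forall>n\<in>carrier (cech_mod M UNIV p). total_pairing M p F n = \<mu> n"
proof -
  interpret C: D_module "cech_mod M UNIV p" by (rule D_module_cech)
  let ?\<iota> = "\<lambda>\<beta> x. \<lambda>\<gamma>\<in>cech_idx UNIV p. if \<gamma> = \<beta> then x else \<zero>\<^bsub>loc_at M \<gamma>\<^esub>"
  have ex: "\<exists>f\<in>carrier (cube_vs M (- \<beta>)). \<forall>x\<in>carrier (loc_at M \<beta>). pairing M \<beta> f x = twist \<beta> * \<mu> (?\<iota> \<beta> x)"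
    if \<beta>: "\<beta> \<in> cech_idx UNIV p" for \<beta>
  proof (rule pairing_exists[OF S])
    have "functional (loc_at M \<beta>) (\<lambda>x. \<mu> (?\<iota> \<beta> x))"
      by (rule functional_compose[OF D_module_loc_at[OF M.D_module_axioms] inclusion_hom[OF \<beta>] \<mu>])
    then show "functional (loc_at M \<beta>) (\<lambda>x. twist \<beta> * \<mu> (?\<iota> \<beta> x))"
      by (simp add: functional_def distrib_left mult.left_commute)
  qed
  define f where "f \<beta> = (SOME g. g \<in> carrier (cube_vs M (- \<beta>)) \<and>
      (\<forall>x\<in>carrier (loc_at M \<beta>). pairing M \<beta> g x = twist \<beta> * \<mu> (?\<iota> \<beta> x)))" for \<beta>
  have f: "f \<beta> \<in> carrier (cube_vs M (- \<beta>))"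
      "\<And>x. x \<in> carrier (loc_at M \<beta>) \<Longrightarrow> pairing M \<beta> (f \<beta>) x = twist \<beta> * \<mu> (?\<iota> \<beta> x)"
    if "\<beta> \<in> cech_idx UNIV p" for \<beta>
    using someI_ex[OF ex[OF that, unfolded Bex_def]] unfolding f_def by blast+
  define F where "F = (\<lambda>\<alpha>\<in>cube_idx p. f (- \<alpha>))"
  have Fc: "F \<in> carrier (cube_cplx M p)"
    unfolding cube_cplx_def dsum_simps
  proof (rule PiE_I)
    fix \<alpha> :: "'n set" assume "\<alpha> \<in> cube_idx p"
    then show "F \<alpha> \<in> carrier (cube_vs M \<alpha>)" using f(1)[of "- \<alpha>"] by (simp add: F_def compl_cube_idx)
  qed (simp add: F_def)
  have "total_pairing M p F n = \<mu> n" if n: "n \<in> carrier (cech_mod M UNIV p)" for n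
  proof -
    have "\<mu> (\<lambda>\<gamma>\<in>cech_idx UNIV p. if \<gamma> \<in> J then n \<gamma> else \<zero>\<^bsub>loc_at M \<gamma>\<^esub>) = (\<Sum>\<beta>\<in>J. \<mu> (?\<iota> \<beta> (n \<beta>)))"
      if "finite J" "J \<subseteq> cech_idx UNIV p" for J
      using that
    proof (induction J)
      case empty
      have "(\<lambda>\<gamma>\<in>cech_idx UNIV p. \<zero>\<^bsub>loc_at M \<gamma>\<^esub>) = \<zero>\<^bsub>cech_mod M UNIV p\<^esub>" by (simp add: cech_mod_def dsum_simps)
      then show ?case using C.functional_zero[OF \<mu>] by simp
    next
      case (insert \<beta> J)
      let ?n = "\<lambda>\<gamma>\<in>cech_idx UNIV p. if \<gamma> \<in> J then n \<gamma> else \<zero>\<^bsub>loc_at M \<gamma>\<^esub>"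
      have lm: "left_module D_ring (loc_at M \<gamma>)" for \<gamma> by (rule left_module_loc_at[OF M.D_module_axioms])
      have z: "\<zero>\<^bsub>loc_at M \<gamma>\<^esub> \<in> carrier (loc_at M \<gamma>)" "\<zero>\<^bsub>loc_at M \<gamma>\<^esub> \<oplus>\<^bsub>loc_at M \<gamma>\<^esub> \<zero>\<^bsub>loc_at M \<gamma>\<^esub> = \<zero>\<^bsub>loc_at M \<gamma>\<^esub>"
        "x \<in> carrier (loc_at M \<gamma>) \<Longrightarrow> x \<oplus>\<^bsub>loc_at M \<gamma>\<^esub> \<zero>\<^bsub>loc_at M \<gamma>\<^esub> = x"
        "x \<in> carrier (loc_at M \<gamma>) \<Longrightarrow> \<zero>\<^bsub>loc_at M \<gamma>\<^esub> \<oplus>\<^bsub>loc_at M \<gamma>\<^esub> x = x" for \<gamma> x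
      proof -
        interpret L: left_module D_ring "loc_at M \<gamma>" by (rule lm)
        show "\<zero>\<^bsub>loc_at M \<gamma>\<^esub> \<in> carrier (loc_at M \<gamma>)" "\<zero>\<^bsub>loc_at M \<gamma>\<^esub> \<oplus>\<^bsub>loc_at M \<gamma>\<^esub> \<zero>\<^bsub>loc_at M \<gamma>\<^esub> = \<zero>\<^bsub>loc_at M \<gamma>\<^esub>"
          "x \<in> carrier (loc_at M \<gamma>) \<Longrightarrow> x \<oplus>\<^bsub>loc_at M \<gamma>\<^esub> \<zero>\<^bsub>loc_at M \<gamma>\<^esub> = x"
          "x \<in> carrier (loc_at M \<gamma>) \<Longrightarrow> \<zero>\<^bsub>loc_at M \<gamma>\<^esub> \<oplus>\<^bsub>loc_at M \<gamma>\<^esub> x = x" by simp_all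
      qed
      have nc: "n \<gamma> \<in> carrier (loc_at M \<gamma>)" if "\<gamma> \<in> cech_idx UNIV p" for \<gamma> using cech_app[OF n that] .
      have e: "(\<lambda>\<gamma>\<in>cech_idx UNIV p. if \<gamma> \<in> insert \<beta> J then n \<gamma> else \<zero>\<^bsub>loc_at M \<gamma>\<^esub>) = ?\<iota> \<beta> (n \<beta>) \<oplus>\<^bsub>cech_mod M UNIV p\<^esub> ?n"
        unfolding cech_mod_def dsum_simps by (rule restrict_ext) (use insert.hyps nc z in auto)
      have c: "?\<iota> \<beta> (n \<beta>) \<in> carrier (cech_mod M UNIV p)" "?n \<in> carrier (cech_mod M UNIV p)"
        using nc z insert.prems by (auto simp: cech_mod_def dsum_simps)
      have J: "J \<subseteq> cech_idx UNIV p" using insert.prems by simp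
      show ?case
        by (simp only: e functionalD(1)[OF \<mu> c] insert.IH[OF J] sum.insert[OF insert.hyps])
    qed
    from this[of "cech_idx UNIV p"] have "\<mu> (\<lambda>\<gamma>\<in>cech_idx UNIV p. n \<gamma>) = (\<Sum>\<beta>\<in>cech_idx UNIV p. \<mu> (?\<iota> \<beta> (n \<beta>)))"
      by (simp cong: restrict_cong)
    moreover have "(\<lambda>\<gamma>\<in>cech_idx UNIV p. n \<gamma>) = n"
      using n by (auto simp: cech_mod_def dsum_simps PiE_def extensional_restrict)
    moreover have "total_pairing M p F n = (\<Sum>\<beta>\<in>cech_idx UNIV p. \<mu> (?\<iota> \<beta> (n \<beta>)))"
      unfolding total_pairing_def
    proof (rule sum.cong[OF refl])
      fix \<beta> :: "'n set" assume \<beta>: "\<beta> \<in> cech_idx UNIV p"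
      then have "F (- \<beta>) = f \<beta>" by (simp add: F_def compl_cube_idx)
      then show "twist \<beta> * pairing M \<beta> (F (- \<beta>)) (n \<beta>) = \<mu> (?\<iota> \<beta> (n \<beta>))"
        using f(2)[OF \<beta> cech_app[OF n \<beta>]] by (simp only: mult.assoc[symmetric] twist_twist mult_1)
    qed
    ultimately show ?thesis by simp
  qed
  with Fc show ?thesis by blast
qed

lemma cube_diff_carrier:
  assumes F: "F \<in> carrier (cube_cplx M (Suc p))" shows "cube_diff M p F \<in> carrier (cube_cplx M p)"
  unfolding cube_cplx_def dsum_simps
proof (rule PiE_I)
  fix \<gamma> :: "'n set" assume \<gamma>: "\<gamma> \<in> cube_idx p"
  interpret V: left_module ring_of_type_algebra "cube_vs M \<gamma>" by (rule left_module_cube_vs[OF S])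
  have "cube_map M (\<gamma> - {i}) i (F (\<gamma> - {i})) \<in> carrier (cube_vs M \<gamma>)" if "i \<in> \<gamma>" for i
    using cube_map_carrier[OF S, of "F (\<gamma> - {i})" "\<gamma> - {i}" i] F cube_idx_remove[OF \<gamma> that] that
    by (auto simp: cube_cplx_def dsum_simps insert_absorb)
  then show "cube_diff M p F \<gamma> \<in> carrier (cube_vs M \<gamma>)"
    using \<gamma> V.smult_closed by (simp add: cube_diff_def)
qed (simp add: cube_diff_def)

text \<open>
  The two differentials are adjoint. On the Cech side there is a term for every \<open>\<delta>\<close> and \<open>i \<in> \<delta>\<close>, on the side of the
  hypercube one for every \<open>\<beta>\<close> and \<open>i \<notin> \<beta>\<close>; they correspond under \<open>\<beta> = \<delta> - {i}\<close>, being equal up to signs by the duality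
  of the maps of the hypercube and the localization maps, and the twist adjusts the signs.
\<close>

lemma total_pairing_diff:
  assumes F: "F \<in> carrier (cube_cplx M (Suc p))" and n: "n \<in> carrier (cech_mod M UNIV p)"
  shows "total_pairing M p (cube_diff M p F) n = total_pairing M (Suc p) F (cech_diff M UNIV p n)"
proof -
  let ?c = "\<lambda>\<delta> i. pairing M (\<delta> - {i}) (cube_map M (- \<delta>) i (F (- \<delta>))) (n (\<delta> - {i}))"
  have R: "pairing M \<delta> (F (- \<delta>)) (cech_diff M UNIV p n \<delta>) = (\<Sum>i\<in>\<delta>. cube_sign i \<delta> * ?c \<delta> i)"
    if \<delta>: "\<delta> \<in> cech_idx UNIV (Suc p)" for \<delta>
  proof -
    interpret L: D_module "loc_at M \<delta>" by (rule D_module_loc_at[OF M.D_module_axioms])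
    note P = pairing_functional[OF straight_typeD(1)[OF S] cube_vs_graded[OF S cube_app[OF F \<delta>]]]
    have nc: "n (\<delta> - {i}) \<in> carrier (loc_at M (\<delta> - {i}))" if "i \<in> \<delta>" for i
      by (rule cech_app[OF n cech_idx_remove[OF \<delta> that]])
    have rc: "res M \<delta> i (n (\<delta> - {i})) \<in> carrier (loc_at M \<delta>)" if "i \<in> \<delta>" for i
      by (rule mod_homD(1)[OF res_hom[OF M.D_module_axioms that] nc[OF that]])
    have "pairing M \<delta> (F (- \<delta>)) (cech_diff M UNIV p n \<delta>) =
        (\<Sum>i\<in>\<delta>. pairing M \<delta> (F (- \<delta>)) ((*) (cube_sign i \<delta>) \<odot>\<^bsub>loc_at M \<delta>\<^esub> res M \<delta> i (n (\<delta> - {i}))))"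
      using \<delta> unfolding cech_diff_def
      by (simp add: rc L.M.additive_finsum[OF functionalD(1)[OF P]])
    also have "\<dots> = (\<Sum>i\<in>\<delta>. cube_sign i \<delta> * ?c \<delta> i)"
      by (rule sum.cong)
         (simp_all add: cube_sign_const functionalD(2)[OF P] rc pairing_res[OF S _ cube_app[OF F \<delta>]] nc)
    finally show ?thesis .
  qed
  have Lh: "pairing M \<beta> (cube_diff M p F (- \<beta>)) (n \<beta>) = (\<Sum>i\<in>- \<beta>. cube_sign i (- \<beta>) * ?c (insert i \<beta>) i)"
    if \<beta>: "\<beta> \<in> cech_idx UNIV p" for \<beta>
  proof -
    interpret V: left_module ring_of_type_algebra "cube_vs M (- \<beta>)" by (rule left_module_cube_vs[OF S])
    have \<beta>': "- \<beta> \<in> cube_idx p" using \<beta> by (simp add: compl_cube_idx)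
    have ins: "- \<beta> - {i} = - insert i \<beta>" "insert i \<beta> - {i} = \<beta>" if "i \<in> - \<beta>" for i using that by auto
    have mc: "cube_map M (- \<beta> - {i}) i (F (- \<beta> - {i})) \<in> carrier (cube_vs M (- \<beta>))" if "i \<in> - \<beta>" for i
      using cube_map_carrier[OF S, of "F (- \<beta> - {i})" "- \<beta> - {i}" i] F cube_idx_remove[OF \<beta>' that] that
      by (auto simp: cube_cplx_def dsum_simps insert_absorb)
    have "pairing M \<beta> (cube_diff M p F (- \<beta>)) (n \<beta>) =
        (\<Sum>i\<in>- \<beta>. pairing M \<beta> (cube_sign i (- \<beta>) \<odot>\<^bsub>cube_vs M (- \<beta>)\<^esub> cube_map M (- \<beta> - {i}) i (F (- \<beta> - {i}))) (n \<beta>))"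
      using \<beta>' unfolding cube_diff_def
      by (simp add: V.M.additive_finsum[where \<phi> = "\<lambda>f. pairing M \<beta> f (n \<beta>)"] pairing_add[OF S] cech_app[OF n \<beta>] mc V.smult_closed)
    also have "\<dots> = (\<Sum>i\<in>- \<beta>. cube_sign i (- \<beta>) * ?c (insert i \<beta>) i)"
    proof (rule sum.cong[OF refl])
      fix i assume i: "i \<in> - \<beta>"
      show "pairing M \<beta> (cube_sign i (- \<beta>) \<odot>\<^bsub>cube_vs M (- \<beta>)\<^esub> cube_map M (- \<beta> - {i}) i (F (- \<beta> - {i}))) (n \<beta>) =
          cube_sign i (- \<beta>) * ?c (insert i \<beta>) i"
        using pairing_const[OF S mc[OF i] mc[OF i] cech_app[OF n \<beta>]] unfolding ins[OF i] .
    qed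
    finally show ?thesis .
  qed
  have "total_pairing M p (cube_diff M p F) n =
      (\<Sum>(\<beta>, i)\<in>Sigma (cech_idx UNIV p) (\<lambda>\<beta>. - \<beta>). twist \<beta> * cube_sign i (- \<beta>) * ?c (insert i \<beta>) i)"
    by (simp add: total_pairing_def Lh sum_distrib_left mult.assoc flip: sum.Sigma)
  also have "\<dots> = (\<Sum>(\<delta>, i)\<in>Sigma (cech_idx UNIV (Suc p)) (\<lambda>\<delta>. \<delta>). twist \<delta> * cube_sign i \<delta> * ?c \<delta> i)"
  proof (rule sum.reindex_bij_witness[of _ "\<lambda>(\<delta>, i). (\<delta> - {i}, i)" "\<lambda>(\<beta>, i). (insert i \<beta>, i)"])
    show "(case (case a of (\<beta>, i) \<Rightarrow> (insert i \<beta>, i)) of (\<delta>, i) \<Rightarrow> twist \<delta> * cube_sign i \<delta> * ?c \<delta> i) =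
          (case a of (\<beta>, i) \<Rightarrow> twist \<beta> * cube_sign i (- \<beta>) * ?c (insert i \<beta>) i)"
      if mem: "a \<in> Sigma (cech_idx UNIV p) (\<lambda>\<beta>. - \<beta>)" for a
    proof -
      obtain \<beta> i where a: "a = (\<beta>, i)" "i \<notin> \<beta>" using mem by (cases a) auto
      then have "twist \<beta> * cube_sign i (- \<beta>) = (twist (insert i \<beta>) * cube_sign i (insert i \<beta>) :: 'k)"
        using twist_remove[of i "insert i \<beta>"] by simp
      then show ?thesis by (simp add: a)
    qed
  qed (auto simp: cech_idx_def card_insert_if)
  also have "\<dots> = total_pairing M (Suc p) F (cech_diff M UNIV p n)"
    by (simp add: total_pairing_def R sum_distrib_left mult.assoc flip: sum.Sigma)
  finally show ?thesis .
qed

end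

lemma cube_functor_map_hom:
  fixes N :: "('k::field, 'n::{finite,linorder}, 'm) dmodule"
  assumes N: "straight_type N" and N': "straight_type N'" and f: "f \<in> mod_hom D_ring N N'"
  shows "cube_functor_map N f \<in> mod_hom (ring_of_type_algebra :: 'k ring) (cube_vs N' \<alpha>) (cube_vs N \<alpha>)"
proof (rule mod_homI)
  interpret N: D_module N by (rule straight_typeD(2)[OF N])
  note fD = mod_homD[OF f]
  show "cube_functor_map N f g \<in> carrier (cube_vs N \<alpha>)" if "g \<in> carrier (cube_vs N' \<alpha>)" for g
    using N.graded_R_hom_restrict[OF graded_R_hom_compose[OF mod_hom_graded[OF straight_typeD(2)[OF N] f], of g]] that
    by (simp add: cube_vs_carrier[OF N] cube_vs_carrier[OF N'] cube_functor_map_def compose_def)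
  show "cube_functor_map N f (g \<oplus>\<^bsub>cube_vs N' \<alpha>\<^esub> h) = cube_functor_map N f g \<oplus>\<^bsub>cube_vs N \<alpha>\<^esub> cube_functor_map N f h" for g h
    unfolding cube_functor_map_def compose_def cube_vs_simps by (rule restrict_ext) (simp add: fD(1))
  show "cube_functor_map N f (c \<odot>\<^bsub>cube_vs N' \<alpha>\<^esub> g) = c \<odot>\<^bsub>cube_vs N \<alpha>\<^esub> cube_functor_map N f g" for c g
    unfolding cube_functor_map_def compose_def cube_vs_simps by (rule restrict_ext) (simp add: fD(1))
qed

text \<open>
  That the maps \<open>d\<close> are linear and form a complex need not be checked: it is inherited through the injective \<open>\<phi>\<close>.
\<close>

lemma isomorphic_complexes_transport:
  assumes W: "chain_complex A W e" and V: "\<And>p. left_module A (V p)"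
    and \<phi>: "\<And>p. \<phi> p \<in> mod_iso A (V p) (W p)"
    and d: "\<And>p x. x \<in> carrier (V (Suc p)) \<Longrightarrow> d p x \<in> carrier (V p)"
    and comm: "\<And>p x. x \<in> carrier (V (Suc p)) \<Longrightarrow> \<phi> p (d p x) = e p (\<phi> (Suc p) x)"
  shows "isomorphic_complexes A V d W e"
proof -
  have hom: "\<phi> p \<in> mod_hom A (V p) (W p)" and inj: "inj_on (\<phi> p) (carrier (V p))" for p
    using \<phi>[of p] by (auto simp: mod_iso_def bij_betw_def)
  note \<phi>D = mod_homD[OF hom]
  have lW: "left_module A (W p)" and e: "e p \<in> mod_hom A (W (Suc p)) (W p)"
    and ee: "x \<in> carrier (W (Suc (Suc p))) \<Longrightarrow> e p (e (Suc p) x) = \<zero>\<^bsub>W p\<^esub>" for p x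
    using W by (auto simp: chain_complex_def)
  note eD = mod_homD[OF e]
  have "d p \<in> mod_hom A (V (Suc p)) (V p)" for p
  proof (rule mod_homI)
    interpret V: left_module A "V p" by (rule assms(2))
    interpret V': left_module A "V (Suc p)" by (rule assms(2))
    show "d p x \<in> carrier (V p)" if "x \<in> carrier (V (Suc p))" for x using d that .
    show "d p (x \<oplus>\<^bsub>V (Suc p)\<^esub> y) = d p x \<oplus>\<^bsub>V p\<^esub> d p y" if xy: "x \<in> carrier (V (Suc p))" "y \<in> carrier (V (Suc p))" for x y
      by (rule inj_onD[OF inj[of p]]) (use xy in \<open>simp_all add: d comm \<phi>D eD\<close>)
    show "d p (a \<odot>\<^bsub>V (Suc p)\<^esub> x) = a \<odot>\<^bsub>V p\<^esub> d p x" if ax: "a \<in> carrier A" "x \<in> carrier (V (Suc p))" for a x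
      by (rule inj_onD[OF inj[of p]]) (use ax in \<open>simp_all add: d comm \<phi>D eD V.smult_closed V'.smult_closed\<close>)
  qed
  moreover have "d p (d (Suc p) x) = \<zero>\<^bsub>V p\<^esub>" if x: "x \<in> carrier (V (Suc (Suc p)))" for p x
  proof -
    interpret Vp: left_module A "V p" by (rule V)
    show ?thesis
      by (rule inj_onD[OF inj[of p]]) (use x in \<open>simp_all add: d comm \<phi>D ee mod_hom_zero[OF V lW hom] mod_homD(1)[OF hom]\<close>)
  qed
  ultimately have "chain_complex A V d" using V unfolding chain_complex_def by blast
  then show ?thesis using W \<phi> comm unfolding isomorphic_complexes_def by blast
qed

text \<open>
  The terms of both complexes are the functionals on the Cech complex: those of the hypercube by the total
  pairing, the others by residues.
\<close>

definition cube_to_cech :: "('k::field, 'n::{finite,linorder}, 'm) dmodule \<Rightarrow> nat \<Rightarrow>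
    ('n set \<Rightarrow> 'm \<Rightarrow> ('k, 'n) laurent set) \<Rightarrow> ('n set \<Rightarrow> ('m \<times> ('k, 'n) mpoly) set) \<Rightarrow> ('k, 'n) laurent set" where
  "cube_to_cech M p F = (SOME g. g \<in> carrier (cech_cube_cplx M p) \<and>
     (\<forall>n\<in>carrier (cech_mod M UNIV p). residue (g n) = total_pairing M p F n))"

text \<open>
  If \<open>F\<close> vanishes on coboundaries, its restriction to cocycles descends to a functional on the cohomology, hence
  to a homomorphism into \<open>E\<^sub>\<one>\<close>.
\<close>

definition coh_class_map :: "('k::field, 'n::{finite,linorder}, 'm) dmodule \<Rightarrow> nat \<Rightarrow>
    ('n set \<Rightarrow> 'm \<Rightarrow> ('k, 'n) laurent set) \<Rightarrow> ('n set \<Rightarrow> ('m \<times> ('k, 'n) mpoly) set) set \<Rightarrow> ('k, 'n) laurent set" where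
  "coh_class_map M p F = (SOME g. g \<in> carrier (cube_vs (local_coh M UNIV p) UNIV) \<and>
     (\<forall>z\<in>cocycles M UNIV p.
        residue (g (coboundaries M UNIV p +>\<^bsub>(cech_mod M UNIV p)\<lparr>carrier := cocycles M UNIV p\<rparr>\<^esub> z)) = total_pairing M p F z))"

context
  fixes M :: "('k::field, 'n::{finite,linorder}, 'm) dmodule"
  assumes S: "straight_type M"
begin

interpretation M: D_module M by (rule straight_typeD(2)[OF S])


lemma SC: "straight_type (cech_mod M UNIV p)"
  by (rule straight_type_cech[OF S])

lemma cech_cube_diff_hom: "cech_cube_diff M p \<in> mod_hom ring_of_type_algebra (cech_cube_cplx M (Suc p)) (cech_cube_cplx M p)"
  unfolding cech_cube_cplx_def cech_cube_diff_def
  by (rule cube_functor_map_hom[OF SC SC cech_diff_hom[OF M.D_module_axioms]])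

lemma chain_complex_cech_cube: "chain_complex ring_of_type_algebra (cech_cube_cplx M) (cech_cube_diff M)"
  unfolding chain_complex_def
proof (intro allI conjI ballI)
  fix p
  show "left_module ring_of_type_algebra (cech_cube_cplx M p)"
    unfolding cech_cube_cplx_def by (rule left_module_cube_vs[OF SC])
  show "cech_cube_diff M p \<in> mod_hom ring_of_type_algebra (cech_cube_cplx M (Suc p)) (cech_cube_cplx M p)"
    by (rule cech_cube_diff_hom)
  fix g assume g: "g \<in> carrier (cech_cube_cplx M (Suc (Suc p)))"
  show "cech_cube_diff M p (cech_cube_diff M (Suc p) g) = \<zero>\<^bsub>cech_cube_cplx M p\<^esub>"
    unfolding cech_cube_cplx_def cech_cube_diff_def cube_functor_map_def compose_def cube_vs_simps
    by (rule restrict_ext)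
       (use g cube_vs_zero_app[OF SC] in \<open>simp add: cech_cube_cplx_def cech_diff_diff[OF M.D_module_axioms]
          mod_homD(1)[OF cech_diff_hom[OF M.D_module_axioms]]\<close>)
qed

lemma cube_to_cech:
  assumes "F \<in> carrier (cube_cplx M p)"
  shows cube_to_cech_carrier: "cube_to_cech M p F \<in> carrier (cech_cube_cplx M p)"
    and residue_cube_to_cech: "n \<in> carrier (cech_mod M UNIV p) \<Longrightarrow> residue (cube_to_cech M p F n) = total_pairing M p F n"
proof -
  have "\<exists>g. g \<in> carrier (cech_cube_cplx M p) \<and> (\<forall>n\<in>carrier (cech_mod M UNIV p). residue (g n) = total_pairing M p F n)"
    using cube_vs_residue_exists[OF SC total_pairing_functional[OF S assms]] unfolding cech_cube_cplx_def by blast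
  from someI_ex[OF this] show "cube_to_cech M p F \<in> carrier (cech_cube_cplx M p)"
    "n \<in> carrier (cech_mod M UNIV p) \<Longrightarrow> residue (cube_to_cech M p F n) = total_pairing M p F n"
    unfolding cube_to_cech_def by blast+
qed

lemma cech_cube_eqI:
  "g \<in> carrier (cech_cube_cplx M p) \<Longrightarrow> h \<in> carrier (cech_cube_cplx M p) \<Longrightarrow>
     (\<And>n. n \<in> carrier (cech_mod M UNIV p) \<Longrightarrow> residue (g n) = residue (h n)) \<Longrightarrow> g = h"
  unfolding cech_cube_cplx_def by (rule cube_vs_residue_eqI[OF SC])

lemma cube_vs_residue:
  assumes N: "straight_type N" and g: "g \<in> carrier (cube_vs N UNIV)" and h: "h \<in> carrier (cube_vs N UNIV)" and n: "n \<in> carrier N"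
  shows "residue ((g \<oplus>\<^bsub>cube_vs N UNIV\<^esub> h) n) = residue (g n) + residue (h n)"
    and "residue ((c \<odot>\<^bsub>cube_vs N UNIV\<^esub> g) n) = c * residue (g n)"
  using cube_vs_app[OF N g n] cube_vs_app[OF N h n] n by (simp_all add: cube_vs_simps residue_add residue_const)

lemma cube_to_cech_iso: "cube_to_cech M p \<in> mod_iso ring_of_type_algebra (cube_cplx M p) (cech_cube_cplx M p)"
proof -
  interpret V: left_module ring_of_type_algebra "cube_cplx M p" by (rule left_module_cube_cplx[OF S])
  interpret W: left_module ring_of_type_algebra "cech_cube_cplx M p"
    using chain_complex_cech_cube unfolding chain_complex_def by blast
  note res = cube_vs_residue[OF SC[of p], folded cech_cube_cplx_def]
  have "cube_to_cech M p \<in> mod_hom ring_of_type_algebra (cube_cplx M p) (cech_cube_cplx M p)"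
  proof (rule mod_homI)
    fix F G assume "F \<in> carrier (cube_cplx M p)" "G \<in> carrier (cube_cplx M p)"
    then show "cube_to_cech M p (F \<oplus>\<^bsub>cube_cplx M p\<^esub> G) = cube_to_cech M p F \<oplus>\<^bsub>cech_cube_cplx M p\<^esub> cube_to_cech M p G"
      by (intro cech_cube_eqI[of _ p])
         (simp_all add: res cube_to_cech_carrier residue_cube_to_cech total_pairing_linear(1)[OF S])
  next
    fix c :: 'k and F assume F: "F \<in> carrier (cube_cplx M p)"
    show "cube_to_cech M p (c \<odot>\<^bsub>cube_cplx M p\<^esub> F) = c \<odot>\<^bsub>cech_cube_cplx M p\<^esub> cube_to_cech M p F"
      by (rule cech_cube_eqI[of _ p])
         (use F in \<open>simp_all add: V.smult_closed W.smult_closed res(2)[OF cube_to_cech_carrier cube_to_cech_carrier]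
            cube_to_cech_carrier residue_cube_to_cech total_pairing_linear(2)[OF S F F]\<close>)
  qed (erule cube_to_cech_carrier)
  moreover have "inj_on (cube_to_cech M p) (carrier (cube_cplx M p))"
    by (rule inj_onI) (rule total_pairing_determined[OF S], assumption+, metis residue_cube_to_cech)
  moreover have "g \<in> cube_to_cech M p ` carrier (cube_cplx M p)" if g: "g \<in> carrier (cech_cube_cplx M p)" for g
  proof -
    have "functional (cech_mod M UNIV p) (\<lambda>n. residue (g n))"
      by (rule residue_functional[OF D_module_cech[OF S] cube_vs_graded[OF SC]]) (use g in \<open>simp add: cech_cube_cplx_def\<close>)
    from total_pairing_exists[OF S this] obtain F where
      F: "F \<in> carrier (cube_cplx M p)" "\<And>n. n \<in> carrier (cech_mod M UNIV p) \<Longrightarrow> total_pairing M p F n = residue (g n)" by blast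
    have "g = cube_to_cech M p F"
      by (rule cech_cube_eqI[of _ p]) (simp_all add: g F(2) cube_to_cech_carrier[OF F(1)] residue_cube_to_cech[OF F(1)])
    then show ?thesis using F(1) by blast
  qed
  ultimately show ?thesis
    unfolding mod_iso_def bij_betw_def using cube_to_cech_carrier by (intro CollectI conjI equalityI subsetI) auto
qed

lemma cube_to_cech_diff:
  assumes F: "F \<in> carrier (cube_cplx M (Suc p))"
  shows "cube_to_cech M p (cube_diff M p F) = cech_cube_diff M p (cube_to_cech M (Suc p) F)"
proof (rule cech_cube_eqI)
  show "cech_cube_diff M p (cube_to_cech M (Suc p) F) \<in> carrier (cech_cube_cplx M p)"
    by (rule mod_homD(1)[OF cech_cube_diff_hom cube_to_cech_carrier[OF F]])
  show "residue (cube_to_cech M p (cube_diff M p F) n) = residue (cech_cube_diff M p (cube_to_cech M (Suc p) F) n)"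
    if n: "n \<in> carrier (cech_mod M UNIV p)" for n
    using n mod_homD(1)[OF cech_diff_hom[OF M.D_module_axioms] n]
    by (simp add: residue_cube_to_cech[OF cube_diff_carrier[OF S F]] total_pairing_diff[OF S F] residue_cube_to_cech[OF F]
        cech_cube_diff_def cube_functor_map_def compose_def)
qed (rule cube_to_cech_carrier[OF cube_diff_carrier[OF S F]])

lemma cube_cech_isomorphic:
  "isomorphic_complexes ring_of_type_algebra (cube_cplx M) (cube_diff M) (cech_cube_cplx M) (cech_cube_diff M)"
  by (rule isomorphic_complexes_transport[where \<phi> = "cube_to_cech M"])
     (rule chain_complex_cech_cube left_module_cube_cplx[OF S] cube_to_cech_iso
        cube_diff_carrier[OF S] cube_to_cech_diff | assumption)+

subsection \<open>Homology\<close>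


definition cube_cycles where
  "cube_cycles p = {F \<in> carrier (cube_cplx M p). \<forall>z\<in>coboundaries M UNIV p. total_pairing M p F z = 0}"

lemma total_pairing_zero: "n \<in> carrier (cech_mod M UNIV p) \<Longrightarrow> total_pairing M p \<zero>\<^bsub>cube_cplx M p\<^esub> n = 0"
proof -
  interpret V: left_module ring_of_type_algebra "cube_cplx M p" by (rule left_module_cube_cplx[OF S])
  assume n: "n \<in> carrier (cech_mod M UNIV p)"
  show ?thesis
    using total_pairing_linear(2)[OF S V.M.zero_closed V.M.zero_closed n, of 0] V.zero_smult[OF V.M.zero_closed] by simp
qed

lemma total_pairing_at_zero: "F \<in> carrier (cube_cplx M p) \<Longrightarrow> total_pairing M p F \<zero>\<^bsub>cech_mod M UNIV p\<^esub> = 0"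
  using D_module.functional_zero[OF D_module_cech[OF S] total_pairing_functional[OF S]] by blast

text \<open>
  The cycles of the hypercube are the elements that vanish on the coboundaries of the Cech complex,
  the boundaries those that vanish on its cocycles.
\<close>

lemma cube_cycles_eq:
  "(case p of 0 \<Rightarrow> carrier (cube_cplx M 0) | Suc q \<Rightarrow> a_kernel (cube_cplx M p) (cube_cplx M q) (cube_diff M q)) = cube_cycles p"
proof (cases p)
  case 0
  then show ?thesis by (auto simp: cube_cycles_def coboundaries_def total_pairing_at_zero)
next
  case (Suc q)
  have "cube_diff M q F = \<zero>\<^bsub>cube_cplx M q\<^esub> \<longleftrightarrow> (\<forall>z\<in>coboundaries M UNIV p. total_pairing M p F z = 0)" if F: "F \<in> carrier (cube_cplx M (Suc q))" for F
  proof -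
    interpret V: left_module ring_of_type_algebra "cube_cplx M q" by (rule left_module_cube_cplx[OF S])
    have "cube_diff M q F = \<zero>\<^bsub>cube_cplx M q\<^esub> \<longleftrightarrow> (\<forall>n\<in>carrier (cech_mod M UNIV q). total_pairing M q (cube_diff M q F) n = 0)"
      using total_pairing_determined[OF S cube_diff_carrier[OF S F] V.M.zero_closed] total_pairing_zero[of _ q] by auto
    then show ?thesis by (simp add: total_pairing_diff[OF S F] coboundaries_def Suc)
  qed
  then show ?thesis by (auto simp: Suc cube_cycles_def a_kernel_def')
qed

text \<open>
  A functional that vanishes on cocycles factors through the differential of the Cech complex. The functional
  so defined on coboundaries is extended to all cochains, and this extension is represented by a preimage.
\<close>

lemma cube_boundaries_eq:
  "cube_diff M p ` carrier (cube_cplx M (Suc p)) =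
     {F \<in> cube_cycles p. \<forall>z\<in>cocycles M UNIV p. total_pairing M p F z = 0}"
proof (intro equalityI subsetI)
  fix F assume "F \<in> cube_diff M p ` carrier (cube_cplx M (Suc p))"
  then obtain G where G: "G \<in> carrier (cube_cplx M (Suc p))" "F = cube_diff M p G" by blast
  have F: "F \<in> carrier (cube_cplx M p)" using cube_diff_carrier[OF S G(1)] G(2) by simp
  have Fz: "total_pairing M p F z = 0" if "z \<in> cocycles M UNIV p" for z
    using that total_pairing_diff[OF S G(1)] total_pairing_at_zero[OF G(1)] by (simp add: cocycles_def G(2))
  then show "F \<in> {F \<in> cube_cycles p. \<forall>z\<in>cocycles M UNIV p. total_pairing M p F z = 0}"
    using F coboundaries_cocycles[OF M.D_module_axioms, of UNIV p] by (auto simp: cube_cycles_def)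
next
  fix F assume "F \<in> {F \<in> cube_cycles p. \<forall>z\<in>cocycles M UNIV p. total_pairing M p F z = 0}"
  then have F: "F \<in> carrier (cube_cplx M p)" "\<And>z. z \<in> cocycles M UNIV p \<Longrightarrow> total_pairing M p F z = 0"
    by (auto simp: cube_cycles_def)
  let ?d = "cech_diff M UNIV p"
  let ?I = "(cech_mod M UNIV (Suc p))\<lparr>carrier := ?d ` carrier (cech_mod M UNIV p)\<rparr>"
  have dh: "?d \<in> mod_hom D_ring (cech_mod M UNIV p) (cech_mod M UNIV (Suc p))" by (rule cech_diff_hom[OF M.D_module_axioms])
  have sub: "submodule (?d ` carrier (cech_mod M UNIV p)) D_ring (cech_mod M UNIV (Suc p))"
    by (rule mod_hom_image_submodule[OF left_module_cech[OF M.D_module_axioms] left_module_cech[OF M.D_module_axioms] dh])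
  have DI: "D_module ?I"
    by (rule D_moduleI[OF left_module.left_module_submodule[OF left_module_cech[OF M.D_module_axioms] sub]])
  have dI: "?d \<in> mod_hom D_ring (cech_mod M UNIV p) ?I" using mod_homD[OF dh] by (intro mod_homI) auto
  obtain \<kappa> where \<kappa>: "functional ?I \<kappa>" "\<And>n. n \<in> carrier (cech_mod M UNIV p) \<Longrightarrow> \<kappa> (?d n) = total_pairing M p F n"
    using functional_factor[OF straight_typeD(1)[OF SC] DI dI _ total_pairing_functional[OF S F(1)]] F(2)
    by (auto simp: cocycles_def)
  obtain \<mu> where \<mu>: "functional (cech_mod M UNIV (Suc p)) \<mu>" "\<And>x. x \<in> ?d ` carrier (cech_mod M UNIV p) \<Longrightarrow> \<mu> x = \<kappa> x"
    using functional_extend[OF straight_typeD(1)[OF SC] sub \<kappa>(1)] by blast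
  obtain G where G: "G \<in> carrier (cube_cplx M (Suc p))"
      "\<And>n. n \<in> carrier (cech_mod M UNIV (Suc p)) \<Longrightarrow> total_pairing M (Suc p) G n = \<mu> n"
    using total_pairing_exists[OF S \<mu>(1)] by blast
  have "F = cube_diff M p G"
    by (rule total_pairing_determined[OF S F(1) cube_diff_carrier[OF S G(1)]])
       (simp add: total_pairing_diff[OF S G(1)] G(2) mod_homD(1)[OF dh] \<mu>(2) \<kappa>(2))
  then show "F \<in> cube_diff M p ` carrier (cube_cplx M (Suc p))" using G(1) by blast
qed

text \<open>
  Cycles are mapped to functionals on the cohomology by restriction to cocycles. The map is onto because functionals
  on cocycles extend to cochains, and its kernel consists of the boundaries.
\<close>

lemma homology_isomorphic:
  "isomorphic_mod ring_of_type_algebra (cube_vs (local_coh M UNIV p) UNIV) (homology_mod (cube_cplx M) (cube_diff M) p)"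
proof -
  let ?C = "cech_mod M UNIV p"
  let ?Z = "?C\<lparr>carrier := cocycles M UNIV p\<rparr>"
  let ?B = "coboundaries M UNIV p"
  let ?H = "local_coh M UNIV p"
  interpret V: left_module ring_of_type_algebra "cube_cplx M p" by (rule left_module_cube_cplx[OF S])
  have SH: "straight_type ?H" by (rule straight_type_local_coh[OF S])
  interpret Z: left_module D_ring "?Z" by (rule left_module_cocycles[OF M.D_module_axioms])
  interpret HM: D_module "?H" by (rule straight_typeD(2)[OF SH])
  interpret Hk: left_module ring_of_type_algebra "cube_vs ?H UNIV" by (rule left_module_cube_vs[OF SH])
  have Bs: "submodule ?B D_ring ?Z" by (rule submodule_coboundaries'[OF M.D_module_axioms])
  have WZ: "weight_module ?Z" by (rule weight_module_cocycles[OF straight_typeD(1)[OF S]])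
  have ZC: "cocycles M UNIV p \<subseteq> carrier ?C" by (auto simp: cocycles_def)
  let ?q = "\<lambda>z. ?B +>\<^bsub>?Z\<^esub> z"
  have q: "?q \<in> mod_hom D_ring ?Z ?H"
    unfolding local_coh_eq by (rule Z.coset_hom[OF Bs])
  have qs: "?q ` carrier ?Z = carrier ?H" unfolding local_coh_eq Z.quot_mod_carrier ..
  have qz: "?q z = \<zero>\<^bsub>?H\<^esub> \<longleftrightarrow> z \<in> ?B" if "z \<in> carrier ?Z" for z
    unfolding local_coh_eq by (rule Z.coset_zero_iff[OF Bs that])
  have tZ: "functional ?Z (total_pairing M p F)" if "F \<in> carrier (cube_cplx M p)" for F
  proof (rule functional_compose[OF weight_moduleD[OF WZ] _ total_pairing_functional[OF S that]])
    show "(\<lambda>z. z) \<in> mod_hom D_ring ?Z ?C" using ZC by (intro mod_homI) auto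
  qed
  let ?\<chi> = "coh_class_map M p"
  have \<chi>: "?\<chi> F \<in> carrier (cube_vs ?H UNIV)" "\<And>z. z \<in> carrier ?Z \<Longrightarrow> residue (?\<chi> F (?q z)) = total_pairing M p F z"
    if F: "F \<in> cube_cycles p" for F
  proof -
    have Fc: "F \<in> carrier (cube_cplx M p)" using F by (simp add: cube_cycles_def)
    obtain \<mu> where \<mu>: "functional ?H \<mu>" "\<And>z. z \<in> carrier ?Z \<Longrightarrow> \<mu> (?q z) = total_pairing M p F z"
      using functional_factor[OF WZ HM.D_module_axioms q qs tZ[OF Fc]] F qz by (auto simp: cube_cycles_def)
    obtain g where g: "g \<in> carrier (cube_vs ?H UNIV)" "\<And>n. n \<in> carrier ?H \<Longrightarrow> residue (g n) = \<mu> n"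
      using cube_vs_residue_exists[OF SH \<mu>(1)] by blast
    have "\<exists>g. g \<in> carrier (cube_vs ?H UNIV) \<and> (\<forall>z\<in>cocycles M UNIV p. residue (g (?q z)) = total_pairing M p F z)"
      by (rule exI[of _ g]) (use g \<mu>(2) mod_homD(1)[OF q] in simp)
    from someI_ex[OF this] show "?\<chi> F \<in> carrier (cube_vs ?H UNIV)"
      "\<And>z. z \<in> carrier ?Z \<Longrightarrow> residue (?\<chi> F (?q z)) = total_pairing M p F z"
      unfolding coh_class_map_def by simp_all
  qed
  have eqI: "g = h" if gh: "g \<in> carrier (cube_vs ?H UNIV)" "h \<in> carrier (cube_vs ?H UNIV)"
    and eq: "\<And>z. z \<in> carrier ?Z \<Longrightarrow> residue (g (?q z)) = residue (h (?q z))" for g h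
  proof (rule cube_vs_residue_eqI[OF SH gh])
    fix n assume "n \<in> carrier ?H"
    then obtain z where "z \<in> carrier ?Z" "n = ?q z" using qs by blast
    then show "residue (g n) = residue (h n)" using eq by simp
  qed
  have cyc: "submodule (cube_cycles p) ring_of_type_algebra (cube_cplx M p)"
  proof (rule V.submodule_by_closure)
    have Bc: "z \<in> carrier ?C" if "z \<in> ?B" for z
      using that submodule_subset[OF submodule_coboundaries[OF M.D_module_axioms]] by blast
    show "\<zero>\<^bsub>cube_cplx M p\<^esub> \<in> cube_cycles p" by (simp add: cube_cycles_def total_pairing_zero Bc)
    show "F \<oplus>\<^bsub>cube_cplx M p\<^esub> G \<in> cube_cycles p" if "F \<in> cube_cycles p" "G \<in> cube_cycles p" for F G
      using that by (simp add: cube_cycles_def total_pairing_linear(1)[OF S] Bc)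
    show "c \<odot>\<^bsub>cube_cplx M p\<^esub> F \<in> cube_cycles p" if F: "F \<in> cube_cycles p" for c F
    proof -
      have Fc: "F \<in> carrier (cube_cplx M p)" using F by (simp add: cube_cycles_def)
      then show ?thesis
        using F V.smult_closed by (simp add: cube_cycles_def total_pairing_linear(2)[OF S Fc Fc] Bc)
    qed
  qed (auto simp: cube_cycles_def)
  let ?V = "(cube_cplx M p)\<lparr>carrier := cube_cycles p\<rparr>"
  have qc: "?q z \<in> carrier ?H" if "z \<in> carrier ?Z" for z by (rule mod_homD(1)[OF q that])
  have lV: "left_module ring_of_type_algebra ?V" by (rule V.left_module_submodule[OF cyc])
  interpret V': left_module ring_of_type_algebra ?V by (rule lV)
  have hom: "?\<chi> \<in> mod_hom ring_of_type_algebra ?V (cube_vs ?H UNIV)"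
  proof (rule mod_homI)
    fix F G assume FG: "F \<in> carrier ?V" "G \<in> carrier ?V"
    then have Fc: "F \<in> cube_cycles p" "G \<in> cube_cycles p" "F \<in> carrier (cube_cplx M p)" "G \<in> carrier (cube_cplx M p)"
      by (simp_all add: cube_cycles_def)
    have sm: "F \<oplus>\<^bsub>cube_cplx M p\<^esub> G \<in> cube_cycles p" by (rule submodule_add[OF cyc Fc(1,2)])
    have "?\<chi> (F \<oplus>\<^bsub>cube_cplx M p\<^esub> G) = ?\<chi> F \<oplus>\<^bsub>cube_vs ?H UNIV\<^esub> ?\<chi> G"
    proof (rule eqI[OF \<chi>(1)[OF sm]])
      show "?\<chi> F \<oplus>\<^bsub>cube_vs ?H UNIV\<^esub> ?\<chi> G \<in> carrier (cube_vs ?H UNIV)" using \<chi>(1) Fc by simp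
      fix z assume z: "z \<in> carrier ?Z"
      then have "z \<in> carrier ?C" using ZC by auto
      then show "residue (?\<chi> (F \<oplus>\<^bsub>cube_cplx M p\<^esub> G) (?q z)) = residue ((?\<chi> F \<oplus>\<^bsub>cube_vs ?H UNIV\<^esub> ?\<chi> G) (?q z))"
        using \<chi>(2)[OF sm z] \<chi>(2)[OF Fc(1) z] \<chi>(2)[OF Fc(2) z]
          cube_vs_residue(1)[OF SH \<chi>(1)[OF Fc(1)] \<chi>(1)[OF Fc(2)] qc[OF z]] total_pairing_linear(1)[OF S Fc(3,4)] by simp
    qed
    then show "?\<chi> (F \<oplus>\<^bsub>?V\<^esub> G) = ?\<chi> F \<oplus>\<^bsub>cube_vs ?H UNIV\<^esub> ?\<chi> G" by simp
  next
    fix c F assume F: "F \<in> carrier ?V"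
    then have Fc: "F \<in> cube_cycles p" "F \<in> carrier (cube_cplx M p)" by (simp_all add: cube_cycles_def)
    have sm: "c \<odot>\<^bsub>cube_cplx M p\<^esub> F \<in> cube_cycles p" by (rule submodule_smult[OF cyc _ Fc(1)]) simp
    have "?\<chi> (c \<odot>\<^bsub>cube_cplx M p\<^esub> F) = c \<odot>\<^bsub>cube_vs ?H UNIV\<^esub> ?\<chi> F"
    proof (rule eqI[OF \<chi>(1)[OF sm]])
      show "c \<odot>\<^bsub>cube_vs ?H UNIV\<^esub> ?\<chi> F \<in> carrier (cube_vs ?H UNIV)" using Hk.smult_closed \<chi>(1)[OF Fc(1)] by simp
      fix z assume z: "z \<in> carrier ?Z"
      then have "z \<in> carrier ?C" using ZC by auto
      then show "residue (?\<chi> (c \<odot>\<^bsub>cube_cplx M p\<^esub> F) (?q z)) = residue ((c \<odot>\<^bsub>cube_vs ?H UNIV\<^esub> ?\<chi> F) (?q z))"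
        using \<chi>(2)[OF sm z] \<chi>(2)[OF Fc(1) z]
          cube_vs_residue(2)[OF SH \<chi>(1)[OF Fc(1)] \<chi>(1)[OF Fc(1)] qc[OF z]] total_pairing_linear(2)[OF S Fc(2,2)] by simp
    qed
    then show "?\<chi> (c \<odot>\<^bsub>?V\<^esub> F) = c \<odot>\<^bsub>cube_vs ?H UNIV\<^esub> ?\<chi> F" by simp
  qed (simp add: \<chi>(1))
  have "h \<in> ?\<chi> ` cube_cycles p" if h: "h \<in> carrier (cube_vs ?H UNIV)" for h
  proof -
    have fh: "functional ?H (\<lambda>n. residue (h n))"
      by (rule residue_functional[OF HM.D_module_axioms cube_vs_graded[OF SH h]])
    have \<kappa>: "functional ?Z (\<lambda>z. residue (h (?q z)))"
      by (rule functional_compose[OF weight_moduleD[OF WZ] q fh])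
    obtain \<mu> where \<mu>: "functional ?C \<mu>" "\<And>z. z \<in> cocycles M UNIV p \<Longrightarrow> \<mu> z = residue (h (?q z))"
      using functional_extend[OF straight_typeD(1)[OF SC] submodule_cocycles[OF M.D_module_axioms] \<kappa>] by blast
    obtain F where F: "F \<in> carrier (cube_cplx M p)" "\<And>n. n \<in> carrier ?C \<Longrightarrow> total_pairing M p F n = \<mu> n"
      using total_pairing_exists[OF S \<mu>(1)] by blast
    have Fz: "total_pairing M p F z = residue (h (?q z))" if "z \<in> carrier ?Z" for z
      using that F(2)[of z] \<mu>(2)[of z] ZC by auto
    have "total_pairing M p F z = 0" if z: "z \<in> ?B" for z
    proof -
      have zZ: "z \<in> carrier ?Z" using z submodule_subset[OF Bs] by blast
      then show ?thesis using Fz[OF zZ] qz[OF zZ] z HM.functional_zero[OF fh] by simp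
    qed
    then have Fc: "F \<in> cube_cycles p" using F(1) by (simp add: cube_cycles_def)
    have "h = ?\<chi> F" by (rule eqI[OF h \<chi>(1)[OF Fc]]) (simp add: \<chi>(2)[OF Fc] Fz)
    then show ?thesis using Fc by blast
  qed
  then have surj: "?\<chi> ` carrier ?V = carrier (cube_vs ?H UNIV)" using \<chi>(1) by auto
  have res0: "residue (\<zero>\<^bsub>cube_vs ?H UNIV\<^esub> (?q z)) = 0" if "z \<in> carrier ?Z" for z
    using qc[OF that] by (simp add: cube_vs_simps residue_def ecoeff_zero)
  have "?\<chi> F = \<zero>\<^bsub>cube_vs ?H UNIV\<^esub> \<longleftrightarrow> (\<forall>z\<in>cocycles M UNIV p. total_pairing M p F z = 0)" if F: "F \<in> cube_cycles p" for F
  proof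
    assume "?\<chi> F = \<zero>\<^bsub>cube_vs ?H UNIV\<^esub>"
    then show "\<forall>z\<in>cocycles M UNIV p. total_pairing M p F z = 0" using \<chi>(2)[OF F] res0 by simp
  next
    assume "\<forall>z\<in>cocycles M UNIV p. total_pairing M p F z = 0"
    then show "?\<chi> F = \<zero>\<^bsub>cube_vs ?H UNIV\<^esub>"
      using eqI[OF \<chi>(1)[OF F] Hk.M.zero_closed] \<chi>(2)[OF F] res0 by simp
  qed
  then have "{F \<in> carrier ?V. ?\<chi> F = \<zero>\<^bsub>cube_vs ?H UNIV\<^esub>} = cube_diff M p ` carrier (cube_cplx M (Suc p))"
    unfolding cube_boundaries_eq by auto
  with first_isomorphism[OF lV Hk.left_module_axioms hom surj] show ?thesis
    unfolding homology_mod_def cube_cycles_eq by simp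
qed

end

theorem proposition3p3:
  fixes M :: "('k::field, 'n::{finite,linorder}, 'm) dmodule"
  assumes "variation_zero M"
  shows "isomorphic_complexes (ring_of_type_algebra :: 'k ring)
           (cube_cplx M) (cube_diff M) (cech_cube_cplx M) (cech_cube_diff M) \<and>
         (\<forall>p. isomorphic_mod (ring_of_type_algebra :: 'k ring)
           (cube_vs (local_coh M UNIV p) UNIV)
           (homology_mod (cube_cplx M) (cube_diff M) p))"
  using cube_cech_isomorphic[OF variation_zero_straight_type[OF assms]]
    homology_isomorphic[OF variation_zero_straight_type[OF assms]] by blast

end
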